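(* Let $T>0$, $0<s<\frac23$, and for $0\le t<T$, $x\in\mathbb{R}^3$ let $$u(t,x)=\mathbb{P}\Big\{\frac{1}{\sqrt{T-t}}\Big|\frac{x}{\sqrt{T-t}}\Big|^{\sqrt{T-t}}\Big(-\ln\Big|\frac{x}{\sqrt{T-t}}\Big|\Big)^s\phi\Big(\frac{x}{\sqrt{T-t}}\Big)\Big\},$$ where $\mathbb{P}$ is the Leray projection and $\phi=(\phi_1,\phi_2,\phi_3)$, each component $\phi_j$ being a radial cut-off function which equals $1$ in $B_{1/2}$ and vanishes outside of $B_{3/4}$. Then there are constants $C,c>0$ independent of $t$ such that $$\|u(t)\|_{L^2}^2\sim\sqrt{T-t},\qquad \|\nabla u(t)\|_{L^2}^2\sim\frac{1}{\sqrt{T-t}},$$ $$\|u(t)\|_{L^\infty}\ge\frac{c}{(T-t)^{1+\frac s2}},\qquad \|u(t)\|_{BMO}\le\frac{C}{\sqrt{T-t}}.$$ In particular, $$\lim_{t\to T}\sqrt{T-t}\,\|u(t)\|_{BMO(\mathbb{R}^3)}<\infty\quad\text{and}\quad\lim_{t\to T}\sqrt{T-t}\,\|u(t)\|_{L^\infty}=\infty.$$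
   Context: $B_R(x_0)=\{x\in\mathbb{R}^3:|x-x_0|<R\}$ and $B_R=B_R(0)$. All norms are over $\mathbb{R}^3$. A cut-off function is smooth with values in $[0,1]$. The Leray projection is $(\mathbb{P}v)_i=v_i-\mathbb{R}_i\mathbb{R}_jv_j$ (sum over $j$), with $\mathbb{R}_i$ the Riesz transforms, i.e. the projection onto divergence-free vector fields. $\|f\|_{BMO(\mathbb{R}^3)}=\sup_{R>0,x_0\in\mathbb{R}^3}\frac{1}{|B_R(x_0)|}\int_{B_R(x_0)}|f-[f]_{B_R(x_0)}|dx$, where $[f]_{B_R(x_0)}$ is the average of $f$ over $B_R(x_0)$. $a(t)\sim b(t)$ means that $a(t)/b(t)$ is bounded above and below by positive constants independent of $t$.
   Formalization: The L^∞ lower bound is proved as c/(T-t)^{(1+s)/2} instead of c/(T-t)^{1+s/2}; the printed exponent is false for every T, s, φ, since ‖u(t)‖_{L^∞} ≤ C(T-t)^{-(1+s)/2}. *)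

theory Defs
  imports "HOL-Analysis.Analysis" "HOL-Probability.Essential_Supremum"
begin

primrec Ck :: "nat \<Rightarrow> (real^3 \<Rightarrow> real) \<Rightarrow> bool" where
  "Ck 0 f \<longleftrightarrow> continuous_on UNIV f"
| "Ck (Suc k) f \<longleftrightarrow> (\<forall>x. f differentiable (at x)) \<and>
     (\<forall>j. Ck k (\<lambda>x. frechet_derivative f (at x) (axis j 1)))"

definition smooth :: "(real^3 \<Rightarrow> real) \<Rightarrow> bool" where
  "smooth f \<longleftrightarrow> (\<forall>k. Ck k f)"

definition cutoff :: "(real^3 \<Rightarrow> real) \<Rightarrow> bool" where
  "cutoff f \<longleftrightarrow> smooth f \<and> (\<forall>x. 0 \<le> f x \<and> f x \<le> 1)"

definition radial :: "(real^3 \<Rightarrow> real) \<Rightarrow> bool" where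
  "radial f \<longleftrightarrow> (\<forall>x y. norm x = norm y \<longrightarrow> f x = f y)"

text \<open>
  Sign convention. The formula \<open>(P v)_i = v_i - R_i R_j v_j\<close> gives the projection onto
  divergence-free fields exactly when \<open>R_i R_j\<close> has the Fourier symbol
  \<open>\<xi>_i \<xi>_j / |\<xi>|^2\<close>, so \<open>R_j\<close> must have the symbol \<open>\<xi>_j / |\<xi>|\<close>. The singular integral
  with kernel \<open>(x_j - y_j) / (\<pi>^2 |x - y|^4)\<close> has the symbol \<open>- \<i> \<xi>_j / |\<xi>|\<close>; this is why
  it is multiplied by \<open>\<i>\<close> below and acts on complex functions. The composition
  \<open>R_i R_j\<close> maps real functions to real functions.
\<close>

definition riesz :: "3 \<Rightarrow> (real^3 \<Rightarrow> complex) \<Rightarrow> real^3 \<Rightarrow> complex" where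
  "riesz j f x = (\<i> / of_real (pi\<^sup>2)) *
     Lim (at_right 0) (\<lambda>\<epsilon>::real.
       LINT y:{y. \<epsilon> < norm (x - y)}|lborel.
         of_real ((x $ j - y $ j) / norm (x - y) ^ 4) * f y)"

definition leray :: "(real^3 \<Rightarrow> real^3) \<Rightarrow> real^3 \<Rightarrow> real^3" where
  "leray v x = (\<chi> i. Re (of_real (v x $ i) -
     (\<Sum>j\<in>UNIV. riesz i (riesz j (\<lambda>y. of_real (v y $ j))) x)))"

definition L2_norm_sq :: "(real^3 \<Rightarrow> 'b::real_normed_vector) \<Rightarrow> ennreal" where
  "L2_norm_sq f = (\<integral>\<^sup>+ x. ennreal ((norm (f x))\<^sup>2) \<partial>lborel)"

definition Linf_norm :: "(real^3 \<Rightarrow> real^3) \<Rightarrow> ennreal" where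
  "Linf_norm f = esssup lborel (\<lambda>x. ennreal (norm (f x)))"

definition ball_avg :: "(real^3 \<Rightarrow> real^3) \<Rightarrow> real^3 \<Rightarrow> real \<Rightarrow> real^3" where
  "ball_avg f x0 R = (1 / measure lborel (ball x0 R)) *\<^sub>R (LINT x:ball x0 R|lborel. f x)"

definition BMO_norm :: "(real^3 \<Rightarrow> real^3) \<Rightarrow> ennreal" where
  "BMO_norm f = (SUP (x0, R) \<in> UNIV \<times> {0<..}.
     (\<integral>\<^sup>+ x \<in> ball x0 R. ennreal (norm (f x - ball_avg f x0 R)) \<partial>lborel)
       / emeasure lborel (ball x0 R))"

definition locally_integrable :: "(real^3 \<Rightarrow> 'b::{banach, second_countable_topology}) \<Rightarrow> bool" where
  "locally_integrable f \<longleftrightarrow> (\<forall>K. compact K \<longrightarrow> set_integrable lborel K f)"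

definition test_function :: "(real^3 \<Rightarrow> real) \<Rightarrow> bool" where
  "test_function \<psi> \<longleftrightarrow> smooth \<psi> \<and> compact (closure {x. \<psi> x \<noteq> 0})"

text \<open>\<open>G x $ i $ j\<close> stands for \<open>\<partial>_j u_i (x)\<close>; the norm of \<^typ>\<open>real^3^3\<close> is the Frobenius norm.\<close>

definition weak_gradient :: "(real^3 \<Rightarrow> real^3) \<Rightarrow> (real^3 \<Rightarrow> real^3^3) \<Rightarrow> bool" where
  "weak_gradient u G \<longleftrightarrow> locally_integrable u \<and> locally_integrable G \<and>
     (\<forall>\<psi> i j. test_function \<psi> \<longrightarrow>
        (LINT x|lborel. u x $ i * frechet_derivative \<psi> (at x) (axis j 1))
          = - (LINT x|lborel. G x $ i $ j * \<psi> x))"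

text \<open>
  A weak gradient is unique up to null sets, so the infimum ranges over at most one value;
  it is \<open>\<infinity>\<close> if there is no weak gradient.
\<close>

definition grad_L2_norm_sq :: "(real^3 \<Rightarrow> real^3) \<Rightarrow> ennreal" where
  "grad_L2_norm_sq u = (INF G \<in> {G. weak_gradient u G}. L2_norm_sq G)"

definition comparable_on :: "real set \<Rightarrow> (real \<Rightarrow> ennreal) \<Rightarrow> (real \<Rightarrow> real) \<Rightarrow> bool" where
  "comparable_on I a b \<longleftrightarrow> (\<exists>c>0. \<exists>C>0. \<forall>t\<in>I.
     ennreal (c * b t) \<le> a t \<and> a t \<le> ennreal (C * b t))"

end

theory Submission
  imports Defs "HOL-Real_Asymp.Real_Asymp"
begin

text \<open>With \<open>\<nu> = sqrt (T - t)\<close> the field at time \<open>t\<close> is \<open>\<nu>\<^sup>-\<^sup>1 V (x / \<nu>)\<close>, where \<open>V\<close> is the Leray projection of the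
  field whose components are the radial functions \<open>q (|y|) = |y|\<^sup>\<nu> (- ln |y|)\<^sup>s \<phi>\<^sub>j (y)\<close>. All the powers of
  \<open>T - t\<close> in the first, second and fourth claim come from this scaling, once the norms of \<open>V\<close> are bounded
  above, and where required below, uniformly in \<open>\<nu> \<in> (0, sqrt T]\<close>.

  The contrast between the maximum norm and the mean oscillation lies in the profile. Since \<open>|y|\<^sup>\<nu>\<close> is of
  order one down to the radius \<open>exp (- 1 / \<nu>)\<close>, where the logarithm has reached \<open>1 / \<nu>\<close>, the profile rises to the
  height \<open>\<nu>\<^sup>-\<^sup>s\<close> (\<open>log_profile_peak\<close>). Its logarithmic derivative \<open>r q'\<close>, however, is bounded uniformly in \<open>\<nu>\<close>
  (\<open>log_profile_slope\<close>), and the mean oscillation of a function of \<open>ln |y|\<close> depends only on that derivative,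
  because \<open>ln |y|\<close> has bounded mean oscillation.

  To see this behaviour through the Leray projection, the projection is computed explicitly. If
  \<open>\<Delta> w = q (|x|)\<close> with \<open>w\<close> radial, then \<open>R\<^sub>i R\<^sub>j q\<close> is a multiple \<open>\<kappa>\<close> of \<open>\<partial>\<^sub>i \<partial>\<^sub>j w\<close>, which is
  \<open>\<delta>\<^sub>i\<^sub>j m / 3 + x\<^sub>i x\<^sub>j (q - m) / |x|\<^sup>2\<close> with \<open>m\<close> the average of \<open>q\<close> over the ball of radius \<open>|x|\<close>
  (\<open>riesz_riesz_radial\<close>, \<open>leray_radial\<close>). For the proof, each Riesz transform of a function with one singular
  point is rewritten as a potential with kernel \<open>|x - y|\<^sup>-\<^sup>2\<close> of a derivative (\<open>riesz_of_by_parts\<close>); two of them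
  compose to a Newtonian potential (\<open>Ipot_Ipot\<close>, \<open>riesz_riesz\<close>), which inverts the Laplacian (\<open>Npot_hessian\<close>).
  The constant \<open>\<kappa>\<close> is \<open>riesz_mass 2 / \<pi>\<^sup>3\<close>, and \<open>0 < \<kappa> < 3\<close>.

  As \<open>q - m\<close> is controlled by \<open>r q'\<close> (\<open>mean_close\<close>), the projected field is \<open>(1 - \<kappa> / 3) q\<close> plus a bounded
  function. This gives the lower bound for the maximum norm near the peak (\<open>radial_leray_Linf_core\<close>) and
  the upper bound for the mean oscillation (\<open>BMO_radial_leray\<close>). The latter is also continuous in \<open>r q'\<close>, and
  \<open>r q'\<close> differs from its value for \<open>\<nu> = 0\<close> by \<open>O(\<nu>\<^sup>1\<^sup>-\<^sup>s)\<close> (\<open>log_profile_slope_diff\<close>); hence the limit as \<open>t \<rightarrow> T\<close>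
  exists. The upper bounds for the two \<open>L\<^sup>2\<close> norms are crude power bounds. The lower bounds are read
  off outside the support of \<open>\<phi>\<close>, where the projected field is that of a dipole whose moment stays away
  from zero; for the gradient, which is defined weakly, a test function placed there is used
  (\<open>weak_gradient_lower\<close>).\<close>

section \<open>Integration in polar coordinates and affine changes of variable\<close>

type_synonym space = "real^3"

lemma emeasure_ball3: "0 \<le> r \<Longrightarrow> emeasure lborel (ball (x::space) r) = ennreal (4 / 3 * pi * r ^ 3)"
  by (simp add: emeasure_ball unit_ball_vol_odd[of 1, simplified] fact_numeral) 

text \<open>The image of Lebesgue measure under the norm has the density \<open>4 \<pi> r\<^sup>2\<close>, because both measures give
  \<open>{..a}\<close> the volume of the ball of radius \<open>a\<close>.\<close>

lemma nn_integral_radial: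
  fixes f :: "real \<Rightarrow> ennreal"
  assumes [measurable]: "f \<in> borel_measurable borel"
  shows "(\<integral>\<^sup>+ (x::space). f (norm x) \<partial>lborel)
       = (\<integral>\<^sup>+ r. ennreal (4 * pi * r\<^sup>2) * f r * indicator {0..} r \<partial>lborel)"
proof -
  let ?M = "distr lborel borel (norm :: space \<Rightarrow> real)"
  let ?N = "density lborel (\<lambda>r. ennreal (4 * pi * r\<^sup>2) * indicator {0..} r)"
  have "?M = ?N"
  proof (rule measure_eqI_generator_eq[where E = "range atMost" and \<Omega> = UNIV and A = "\<lambda>i. {..real i}"])
    show "Int_stable (range (atMost :: real \<Rightarrow> _))"
      by (auto simp: Int_stable_def)
    show "emeasure ?M X = emeasure ?N X" if X': "X \<in> range atMost" for X
    proof -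
      obtain a where X: "X = {..a}" using X' by auto
      have "emeasure ?M X = emeasure lborel (cball (0::space) a)"
        unfolding X by (subst emeasure_distr) (auto intro!: arg_cong[where f = "emeasure lborel"])
      also have "\<dots> = emeasure ?N X"
      proof (cases "0 \<le> a")
        case False
        then show ?thesis unfolding X by (subst emeasure_density) (auto simp: indicator_def nn_integral_0_iff_AE not_le)
      next
        case True
        have "emeasure ?N X = (\<integral>\<^sup>+ r. ennreal (4 * pi * r\<^sup>2) * indicator {0..a} r \<partial>lborel)"
          unfolding X by (subst emeasure_density) (auto intro!: nn_integral_cong simp: indicator_def)
        also have "\<dots> = ennreal (4 / 3 * pi * a ^ 3 - 4 / 3 * pi * 0 ^ 3)"
          using True by (intro nn_integral_FTC_Icc) (auto intro!: derivative_eq_intros)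
        finally show ?thesis using True
          by (simp add: emeasure_cball unit_ball_vol_odd[of 1, simplified] fact_numeral)
      qed
      finally show ?thesis .
    qed
    show "sets ?M = sigma_sets UNIV (range atMost)" "sets ?N = sigma_sets UNIV (range atMost)"
      by (simp_all add: borel_eq_atMost)
    show "emeasure ?M {..real i} \<noteq> \<infinity>" for i
    proof -
      have "norm -` {..real i} = cball (0::space) (real i)" by auto
      then show ?thesis by (simp add: emeasure_distr emeasure_cball)
    qed
  qed (auto intro: real_arch_simple)
  then have "(\<integral>\<^sup>+ (x::space). f (norm x) \<partial>lborel) = integral\<^sup>N ?N f"
    by (subst (asm) eq_commute) (simp add: nn_integral_distr)
  also have "\<dots> = (\<integral>\<^sup>+ r. ennreal (4 * pi * r\<^sup>2) * f r * indicator {0..} r \<partial>lborel)"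
    by (subst nn_integral_density) (auto intro!: nn_integral_cong simp: indicator_def)
  finally show ?thesis .
qed

lemma nn_integral_affine:
  fixes f :: "space \<Rightarrow> ennreal"
  assumes [measurable]: "f \<in> borel_measurable borel" and "c \<noteq> 0"
  shows "(\<integral>\<^sup>+ x. f x \<partial>lborel) = ennreal (\<bar>c\<bar> ^ 3) * (\<integral>\<^sup>+ x. f (t + c *\<^sub>R x) \<partial>lborel)"
  by (subst lborel_affine[OF assms(2), of t])
     (simp add: nn_integral_density nn_integral_distr nn_integral_cmult)

lemma integrable_affine:
  fixes f :: "space \<Rightarrow> 'b::{banach, second_countable_topology}"
  assumes "c \<noteq> 0"
  shows "integrable lborel (\<lambda>x. f (t + c *\<^sub>R x)) \<longleftrightarrow> integrable lborel f"
proof -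
  have *: "integrable lborel (\<lambda>x. f (t + c *\<^sub>R x))" if "integrable lborel f" "c \<noteq> 0" for f :: "space \<Rightarrow> 'b" and c t
  proof -
    have [measurable]: "f \<in> borel_measurable borel" using that by auto
    have "(\<integral>\<^sup>+ x. ennreal (norm (f x)) \<partial>lborel) < \<infinity>"
      using that(1) by (simp add: integrable_iff_bounded)
    then have "(\<integral>\<^sup>+ x. ennreal (norm (f (t + c *\<^sub>R x))) \<partial>lborel) < \<infinity>"
      by (subst (asm) nn_integral_affine[where c = c and t = t])
         (use that(2) in \<open>auto simp: ennreal_mult_less_top ennreal_mult_eq_top_iff less_top\<close>)
    then show ?thesis by (simp add: integrable_iff_bounded)
  qed
  show ?thesis
  proof
    assume "integrable lborel (\<lambda>x. f (t + c *\<^sub>R x))"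
    from *[OF this, of "inverse c" "- inverse c *\<^sub>R t"] assms show "integrable lborel f"
      by (simp add: algebra_simps)
  qed (use * assms in auto)
qed

lemma integral_affine:
  fixes f :: "space \<Rightarrow> 'b::{banach, second_countable_topology}"
  assumes "c \<noteq> 0"
  shows "(LINT x|lborel. f x) = \<bar>c\<bar> ^ 3 *\<^sub>R (LINT x|lborel. f (t + c *\<^sub>R x))"
proof (cases "integrable lborel f")
  case True
  then have [measurable]: "f \<in> borel_measurable borel" by auto
  show ?thesis
    by (subst lborel_affine[OF assms, of t]) (simp add: integral_density integral_distr)
next
  case False
  with integrable_affine[OF assms, of f t] show ?thesis
    by (simp add: not_integrable_integral_eq)
qed

text \<open>The substitution \<open>y \<mapsto> x - y\<close> passes between the two forms of a convolution.\<close>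

lemma integral_reflect:
  fixes f :: "space \<Rightarrow> 'b::{banach, second_countable_topology}"
  shows "(LINT y|lborel. f (x - y)) = (LINT y|lborel. f y)"
  using integral_affine[of "-1" f x] by simp

lemma integrable_reflect:
  fixes f :: "space \<Rightarrow> 'b::{banach, second_countable_topology}"
  shows "integrable lborel (\<lambda>y. f (x - y)) \<longleftrightarrow> integrable lborel f"
  using integrable_affine[of "-1" f x] by simp

lemma nn_integral_reflect:
  fixes f :: "space \<Rightarrow> ennreal"
  assumes "f \<in> borel_measurable borel"
  shows "(\<integral>\<^sup>+ y. f (x - y) \<partial>lborel) = (\<integral>\<^sup>+ y. f y \<partial>lborel)"
  using nn_integral_affine[OF assms, of "-1" x] by simp

lemma integral_translate:
  fixes f :: "space \<Rightarrow> 'b::{banach, second_countable_topology}"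
  shows "(LINT y|lborel. f (y + x)) = (LINT y|lborel. f y)"
  using integral_affine[of "1" f x] by (simp add: add.commute)

lemma integrable_translate:
  fixes f :: "space \<Rightarrow> 'b::{banach, second_countable_topology}"
  shows "integrable lborel (\<lambda>y. f (y + x)) \<longleftrightarrow> integrable lborel f"
  using integrable_affine[of "1" f x] by (simp add: add.commute)

lemma lborel_distr_orthogonal:
  fixes f :: "space \<Rightarrow> space"
  assumes f: "orthogonal_transformation f"
  shows "distr lborel borel f = lborel"
proof (rule sym, rule lborel_eqI)
  have lin: "linear f" using f by (rule orthogonal_transformation_linear)
  then have [measurable]: "f \<in> borel_measurable borel"
    by (intro borel_measurable_continuous_onI linear_continuous_on linear_conv_bounded_linear[THEN iffD1])
  fix l u :: space assume le: "\<And>b. b \<in> Basis \<Longrightarrow> l \<bullet> b \<le> u \<bullet> b"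
  obtain g where g: "orthogonal_transformation g" "g \<circ> f = id" "f \<circ> g = id"
    using orthogonal_transformation_bij[OF f] orthogonal_transformation_inv[OF f]
    by (metis bij_betw_def inv_o_cancel surj_iff)
  have "f -` box l u = g ` box l u"
    using g(2,3) by (auto simp: fun_eq_iff image_iff) metis+
  then have "emeasure (distr lborel borel f) (box l u) = emeasure lborel (g ` box l u)"
    by (subst emeasure_distr) auto
  also have "\<dots> = emeasure lebesgue (g ` box l u)"
  proof -
    have "f -` box l u \<in> sets borel" using measurable_sets[of f borel borel "box l u"] by simp
    then show ?thesis using \<open>f -` box l u = g ` box l u\<close> by simp
  qed
  also have "\<dots> = emeasure lebesgue (box l u)"
    using measure_orthogonal_image[OF g(1), of "box l u"] measurable_orthogonal_image[OF g(1), of "box l u"]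
      lmeasurable_box[of l u]
    by (simp only: emeasure_eq_measure2)
  also have "\<dots> = (\<Prod>b\<in>Basis. (u - l) \<bullet> b)"
    using le by (simp add: emeasure_lborel_box_eq inner_diff_left)
  finally show "emeasure (distr lborel borel f) (box l u) = (\<Prod>b\<in>Basis. (u - l) \<bullet> b)" .
qed simp

lemma nn_integral_orthogonal:
  fixes f :: "space \<Rightarrow> space" and h :: "space \<Rightarrow> ennreal"
  assumes f: "orthogonal_transformation f" and [measurable]: "h \<in> borel_measurable borel"
  shows "(\<integral>\<^sup>+ x. h (f x) \<partial>lborel) = (\<integral>\<^sup>+ x. h x \<partial>lborel)"
proof -
  have [measurable]: "f \<in> borel_measurable borel" using orthogonal_transformation_linear[OF f]
    by (intro borel_measurable_continuous_onI linear_continuous_on linear_conv_bounded_linear[THEN iffD1])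
  show ?thesis
    by (subst (2) lborel_distr_orthogonal[OF f, symmetric]) (simp add: nn_integral_distr)
qed

section \<open>Power weights\<close>

lemma nn_integral_powr_01:
  assumes "-1 < a" shows "(\<integral>\<^sup>+ r. ennreal (r powr a) * indicator {0..1} r \<partial>lborel) < \<infinity>"
proof -
  have "((\<lambda>r. r powr a * indicator {0..1} r) has_integral (1 powr (a+1) / (a+1))) UNIV"
    using has_integral_powr_from_0[OF assms, of 1]
    unfolding has_integral_restrict_UNIV[of "{0..1}", symmetric] by (simp add: indicator_def of_bool_def if_distrib[of "\<lambda>c. _ * c"] cong: if_cong)
  then have "(\<integral>\<^sup>+ r. ennreal (r powr a * indicator {0..1} r) \<partial>lborel) = ennreal (1 powr (a+1) / (a+1))"
    by (intro nn_integral_has_integral_lborel) auto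
  then show ?thesis by (simp add: ennreal_mult'' ennreal_indicator)
qed

lemma nn_integral_powr_1_inf:
  assumes "a < -1" shows "(\<integral>\<^sup>+ r. ennreal (r powr a) * indicator {1..} r \<partial>lborel) < \<infinity>"
proof -
  have "((\<lambda>r. r powr a * indicator {1..} r) has_integral (- (1 powr (a+1)) / (a+1))) UNIV"
    using has_integral_powr_to_inf[OF assms, of 1]
    unfolding has_integral_restrict_UNIV[of "{1..}", symmetric] by (simp add: indicator_def of_bool_def if_distrib[of "\<lambda>c. _ * c"] cong: if_cong)
  then have "(\<integral>\<^sup>+ r. ennreal (r powr a * indicator {1..} r) \<partial>lborel) = ennreal (- (1 powr (a+1)) / (a+1))"
    by (intro nn_integral_has_integral_lborel) auto
  then show ?thesis by (simp add: ennreal_mult'' ennreal_indicator)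
qed

lemma nn_integral_power_weight:
  assumes "a < 3" "3 < a + p" "0 \<le> p"
  shows "(\<integral>\<^sup>+ (x::space). ennreal (norm x powr (-a) * (1 + norm x) powr (-p)) \<partial>lborel) < \<infinity>"
proof -
  let ?A = "\<lambda>r. ennreal (r powr (2 - a)) * indicator {0..1} r"
  let ?B = "\<lambda>r. ennreal (r powr (2 - a - p)) * indicator {1..} r"
  have "(\<integral>\<^sup>+ (x::space). ennreal (norm x powr (-a) * (1 + norm x) powr (-p)) \<partial>lborel)
     = (\<integral>\<^sup>+ r. ennreal (4 * pi * r\<^sup>2) * ennreal (r powr (-a) * (1 + r) powr (-p)) * indicator {0..} r \<partial>lborel)"
    by (rule nn_integral_radial) measurable
  also have "\<dots> \<le> (\<integral>\<^sup>+ r. ennreal (4 * pi) * (?A r + ?B r) \<partial>lborel)"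
  proof (rule nn_integral_mono)
    fix r :: real
    show "ennreal (4 * pi * r\<^sup>2) * ennreal (r powr (-a) * (1 + r) powr (-p)) * indicator {0..} r
       \<le> ennreal (4 * pi) * (?A r + ?B r)"
    proof (cases "0 < r")
      case False then show ?thesis by (cases "r = 0") (auto simp: indicator_def)
    next
      case True
      have e: "r\<^sup>2 * r powr (-a) = r powr (2 - a)" "r powr (2 - a) * r powr (-p) = r powr (2 - a - p)"
        using True by (simp_all add: powr_diff powr_add[symmetric] powr_minus field_simps flip: powr_numeral)
      have "ennreal (4 * pi * r\<^sup>2) * ennreal (r powr (-a) * (1 + r) powr (-p))
        = ennreal (4 * pi) * ennreal (r powr (2 - a) * (1 + r) powr (-p))"
        using True by (simp add: ennreal_mult'[symmetric] e(1)[symmetric] mult_ac)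
      also have "\<dots> \<le> ennreal (4 * pi) * (?A r + ?B r)"
      proof (rule mult_left_mono)
        show "ennreal (r powr (2 - a) * (1 + r) powr (-p)) \<le> ?A r + ?B r"
        proof (cases "r \<le> 1")
          case r1: True
          have "(1 + r) powr (-p) \<le> 1" using True assms by (simp add: powr_minus inverse_le_1_iff ge_one_powr_ge_zero)
          then have "r powr (2 - a) * (1 + r) powr (-p) \<le> r powr (2 - a)"
            by (simp add: mult_left_le)
          then have "ennreal (r powr (2 - a) * (1 + r) powr (-p)) \<le> ?A r"
            using True r1 by (auto simp: indicator_def intro!: ennreal_leI)
          then show ?thesis by (rule add_increasing2[rotated]) simp
        next
          case r1: False
          have "(1 + r) powr (-p) \<le> r powr (-p)" using True assms by (intro powr_mono2') auto
          then have "r powr (2 - a) * (1 + r) powr (-p) \<le> r powr (2 - a - p)"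
            unfolding e(2)[symmetric] by (intro mult_left_mono) auto
          then show ?thesis using True r1 by (auto simp: indicator_def intro!: ennreal_leI add_increasing)
        qed
      qed auto
      finally show ?thesis using True by simp
    qed
  qed
  also have "\<dots> = ennreal (4 * pi) * ((\<integral>\<^sup>+ r. ?A r \<partial>lborel) + (\<integral>\<^sup>+ r. ?B r \<partial>lborel))"
    by (subst nn_integral_cmult) (auto simp: nn_integral_add)
  also have "\<dots> < \<infinity>"
    using nn_integral_powr_01[of "2 - a"] nn_integral_powr_1_inf[of "2 - a - p"] assms
    by (simp add: ennreal_mult_less_top)
  finally show ?thesis .
qed

section \<open>Convolution of power weights\<close>

definition riesz_mass :: "real \<Rightarrow> real" where
  "riesz_mass a = enn2real (\<integral>\<^sup>+ (y::space). ennreal (norm y powr (-a) * norm (axis 1 1 - y) powr (-2)) \<partial>lborel)"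

text \<open>By the triangle inequality the longer of the two distances \<open>|y|\<close>, \<open>|e - y|\<close> is at least a third of
  one plus the shorter. Hence the product of the two singular factors is dominated by a sum of two
  weights with a single singularity each.\<close>

lemma conv_weight_finite:
  fixes e :: space
  assumes e: "norm e = 1" and a: "1 < a" "a < 3"
  shows "(\<integral>\<^sup>+ y. ennreal (norm y powr (-a) * norm (e - y) powr (-2)) \<partial>lborel) < \<infinity>"
proof -
  let ?f = "\<lambda>y::space. norm y powr (-a) * (1 + norm y) powr (-2)"
  let ?g = "\<lambda>y::space. norm y powr (-2) * (1 + norm y) powr (-a)"
  let ?K = "9 + 3 powr a"
  have "(\<integral>\<^sup>+ y. ennreal (norm y powr (-a) * norm (e - y) powr (-2)) \<partial>lborel)
      \<le> (\<integral>\<^sup>+ y. ennreal ?K * (ennreal (?f y) + ennreal (?g (e - y))) \<partial>lborel)"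
  proof (rule nn_integral_mono)
    fix y :: space
    let ?r = "norm y" and ?s = "norm (e - y)"
    have tri: "1 \<le> ?r + ?s" using norm_triangle_ineq[of y "e - y"] e by simp
    have "?r powr (-a) * ?s powr (-2) \<le> ?K * (?f y + ?g (e - y))"
    proof (cases "?r = 0 \<or> ?s = 0")
      case False
      then have pos: "?r > 0" "?s > 0" by auto
      show ?thesis
      proof (cases "?r \<le> ?s")
        case True
        then have "1 + ?r \<le> 3 * ?s" using tri by linarith
        then have "(3 * ?s) powr (-2) \<le> (1 + ?r) powr (-2)" by (intro powr_mono2') (auto simp: add_pos_nonneg)
        then have "?s powr (-2) \<le> 9 * (1 + ?r) powr (-2)" by (simp add: powr_mult powr_minus)
        then have "?r powr (-a) * ?s powr (-2) \<le> ?r powr (-a) * (9 * (1 + ?r) powr (-2))"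
          by (intro mult_left_mono) auto
        also have "\<dots> = 9 * ?f y" by simp
        also have "\<dots> \<le> ?K * (?f y + ?g (e - y))" by (intro mult_mono) auto
        finally show ?thesis .
      next
        case False
        then have "1 + ?s \<le> 3 * ?r" using tri by linarith
        then have "(3 * ?r) powr (-a) \<le> (1 + ?s) powr (-a)" using a by (intro powr_mono2') (auto simp: add_pos_nonneg)
        then have "3 powr a * (3 * ?r) powr (-a) \<le> 3 powr a * (1 + ?s) powr (-a)"
          by (rule mult_left_mono) simp
        moreover have "?r powr (-a) = 3 powr a * (3 * ?r) powr (-a)"
          by (simp add: powr_mult powr_minus)
        ultimately have "?r powr (-a) \<le> 3 powr a * (1 + ?s) powr (-a)"
          by simp
        then have "?r powr (-a) * ?s powr (-2) \<le> (3 powr a * (1 + ?s) powr (-a)) * ?s powr (-2)"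
          by (intro mult_right_mono) auto
        also have "\<dots> = 3 powr a * ?g (e - y)" by simp
        also have "\<dots> \<le> ?K * (?f y + ?g (e - y))" by (intro mult_mono) auto
        finally show ?thesis .
      qed
    qed auto
    then have "ennreal (?r powr (-a) * ?s powr (-2)) \<le> ennreal (?K * (?f y + ?g (e - y)))"
      by (rule ennreal_leI)
    then show "ennreal (?r powr (-a) * ?s powr (-2)) \<le> ennreal ?K * (ennreal (?f y) + ennreal (?g (e - y)))"
      by (simp add: ennreal_mult)
  qed
  also have "\<dots> = ennreal ?K * ((\<integral>\<^sup>+ y. ennreal (?f y) \<partial>lborel) + (\<integral>\<^sup>+ y. ennreal (?g (e - y)) \<partial>lborel))"
    by (subst nn_integral_cmult) (auto simp: nn_integral_add)
  also have "(\<integral>\<^sup>+ y. ennreal (?g (e - y)) \<partial>lborel) = (\<integral>\<^sup>+ y. ennreal (?g y) \<partial>lborel)"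
    by (rule nn_integral_reflect) measurable
  also have "ennreal ?K * ((\<integral>\<^sup>+ y. ennreal (?f y) \<partial>lborel) + (\<integral>\<^sup>+ y. ennreal (?g y) \<partial>lborel)) < \<infinity>"
    using nn_integral_power_weight[of a 2] nn_integral_power_weight[of 2 a] a
    by (simp add: ennreal_mult_less_top)
  finally show ?thesis .
qed

text \<open>Scaling and rotation invariance leave only the constant to be determined.\<close>

lemma nn_integral_conv_weight:
  fixes x :: space
  assumes x: "x \<noteq> 0" and a: "1 < a" "a < 3"
  shows "(\<integral>\<^sup>+ y. ennreal (norm y powr (-a) * norm (x - y) powr (-2)) \<partial>lborel)
       = ennreal (riesz_mass a * norm x powr (1 - a))"
proof -
  let ?e = "axis 1 1 :: space" and ?n = "norm x"
  have n: "?n > 0" using x by simp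
  obtain f where f: "orthogonal_transformation f" "f ?e = x /\<^sub>R ?n"
    using orthogonal_transformation_exists_1[of ?e "x /\<^sub>R ?n"] n by auto
  have fin: "(\<integral>\<^sup>+ y. ennreal (norm y powr (-a) * norm (?e - y) powr (-2)) \<partial>lborel) < \<infinity>"
    using a by (intro conv_weight_finite) auto
  have nf: "norm (f y) = norm y" "norm (?e - y) = norm (x /\<^sub>R ?n - f y)" for y
    using f orthogonal_transformation_norm[OF f(1)] linear_diff[OF orthogonal_transformation_linear[OF f(1)]]
    by metis+
  have "(\<integral>\<^sup>+ y. ennreal (norm y powr (-a) * norm (x - y) powr (-2)) \<partial>lborel)
     = ennreal (?n ^ 3) * (\<integral>\<^sup>+ y. ennreal (norm (?n *\<^sub>R y) powr (-a) * norm (x - ?n *\<^sub>R y) powr (-2)) \<partial>lborel)"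
    using nn_integral_affine[of "\<lambda>y. ennreal (norm y powr (-a) * norm (x - y) powr (-2))" ?n 0] n by simp
  also have "(\<lambda>y. ennreal (norm (?n *\<^sub>R y) powr (-a) * norm (x - ?n *\<^sub>R y) powr (-2)))
     = (\<lambda>y. ennreal (?n powr (- a - 2)) * ennreal (norm y powr (-a) * norm (x /\<^sub>R ?n - y) powr (-2)))"
  proof
    fix y
    have "x - ?n *\<^sub>R y = ?n *\<^sub>R (x /\<^sub>R ?n - y)" using n by (simp add: algebra_simps)
    then have "norm (x - ?n *\<^sub>R y) = ?n * norm (x /\<^sub>R ?n - y)" by (metis abs_norm_cancel norm_scaleR)
    then show "ennreal (norm (?n *\<^sub>R y) powr (-a) * norm (x - ?n *\<^sub>R y) powr (-2))
      = ennreal (?n powr (- a - 2)) * ennreal (norm y powr (-a) * norm (x /\<^sub>R ?n - y) powr (-2))"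
      by (simp add: powr_mult ennreal_mult[symmetric] powr_diff powr_minus mult_ac field_simps)
  qed
  also have "(\<integral>\<^sup>+ y. ennreal (?n powr (- a - 2)) * ennreal (norm y powr (-a) * norm (x /\<^sub>R ?n - y) powr (-2)) \<partial>lborel)
     = ennreal (?n powr (- a - 2)) * (\<integral>\<^sup>+ y. ennreal (norm y powr (-a) * norm (x /\<^sub>R ?n - y) powr (-2)) \<partial>lborel)"
    by (rule nn_integral_cmult) measurable
  also have "(\<integral>\<^sup>+ y. ennreal (norm y powr (-a) * norm (x /\<^sub>R ?n - y) powr (-2)) \<partial>lborel)
     = (\<integral>\<^sup>+ y. ennreal (norm y powr (-a) * norm (?e - y) powr (-2)) \<partial>lborel)"
    by (subst nn_integral_orthogonal[OF f(1), symmetric]) (auto simp: nf)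
  also have "\<dots> = ennreal (riesz_mass a)"
    unfolding riesz_mass_def using fin by (simp add: ennreal_enn2real)
  also have "ennreal (?n ^ 3) * (ennreal (?n powr (- a - 2)) * ennreal (riesz_mass a))
     = ennreal (riesz_mass a * (?n ^ 3 * ?n powr (- a - 2)))"
    by (simp add: ennreal_mult[symmetric] riesz_mass_def mult_ac)
  also have "?n ^ 3 * ?n powr (- a - 2) = ?n powr (1 - a)"
    using n by (simp add: powr_add[symmetric] flip: powr_numeral)
  finally show ?thesis .
qed

lemma riesz_mass_nonneg: "0 \<le> riesz_mass a"
  by (simp add: riesz_mass_def)

lemma riesz_mass_2_pos: "0 < riesz_mass 2"
proof -
  let ?f = "\<lambda>y::space. ennreal (norm y powr (-2) * norm (axis 1 1 - y) powr (-2))"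
  have "(\<integral>\<^sup>+ y. ?f y \<partial>lborel) \<noteq> 0"
  proof
    assume "(\<integral>\<^sup>+ y. ?f y \<partial>lborel) = 0"
    then have "AE y in lborel. ?f y = 0" by (subst (asm) nn_integral_0_iff_AE) auto
    moreover have "AE y::space in lborel. y \<noteq> 0" "AE y::space in lborel. y \<noteq> axis 1 1"
      by (rule AE_lborel_singleton)+
    ultimately have "AE y::space in lborel. False"
      by eventually_elim (auto simp: ennreal_eq_0_iff mult_le_0_iff)
    then show False
      by (simp add: eventually_False ae_filter_eq_bot_iff emeasure_lborel_UNIV)
  qed
  moreover have "(\<integral>\<^sup>+ y. ?f y \<partial>lborel) < \<infinity>" by (rule conv_weight_finite) auto
  ultimately show ?thesis by (simp add: riesz_mass_def enn2real_positive_iff less_top zero_less_iff_neq_zero)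
qed

text \<open>The integral equals \<open>\<pi>\<^sup>3\<close>. An upper bound below \<open>3 \<pi>\<^sup>3\<close> keeps the projection from cancelling the
  peak of a radial field, and \<open>24 \<pi>\<close> is such a bound because \<open>\<pi>\<^sup>2 > 8\<close>. It comes from replacing the
  longer of the distances \<open>|y|\<close>, \<open>|e - y|\<close> by the larger of the shorter one and of one minus the
  shorter one; the resulting integral is radial and elementary.\<close>

lemma riesz_mass_2_le: "riesz_mass 2 \<le> 24 * pi"
proof -
  let ?e = "axis 1 1 :: space"
  define h where "h = (\<lambda>r::real. r powr (-2) * max r (1 - r) powr (-2))"
  have [measurable]: "h \<in> borel_measurable borel" unfolding h_def by measurable
  have h0: "h r \<ge> 0" for r by (simp add: h_def)
  have "(\<integral>\<^sup>+ y. ennreal (norm y powr (-2) * norm (?e - y) powr (-2)) \<partial>lborel)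
     \<le> (\<integral>\<^sup>+ y. ennreal (h (norm y)) + ennreal (h (norm (?e - y))) \<partial>lborel)"
  proof (rule nn_integral_mono)
    fix y :: space
    let ?r = "norm y" and ?s = "norm (?e - y)"
    have tri: "1 \<le> ?r + ?s" using norm_triangle_ineq[of y "?e - y"] by simp
    have *: "u powr (-2) * v powr (-2) \<le> h u" if "u \<le> v" "1 \<le> u + v" "0 \<le> u" "0 \<le> v" for u v :: real
    proof -
      have "v powr (-2) \<le> max u (1 - u) powr (-2)" using that by (intro powr_mono2') auto
      then show ?thesis unfolding h_def by (intro mult_left_mono) auto
    qed
    have "?r powr (-2) * ?s powr (-2) \<le> h ?r + h ?s"
      using *[of ?r ?s] *[of ?s ?r] tri h0[of ?r] h0[of ?s]
      by (cases "?r \<le> ?s") (auto simp: mult_ac)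
    then show "ennreal (?r powr (-2) * ?s powr (-2)) \<le> ennreal (h ?r) + ennreal (h ?s)"
      using h0 by (simp flip: ennreal_plus add: ennreal_leI)
  qed
  also have "\<dots> = (\<integral>\<^sup>+ (y::space). ennreal (h (norm y)) \<partial>lborel) + (\<integral>\<^sup>+ y. ennreal (h (norm (?e - y))) \<partial>lborel)"
    by (rule nn_integral_add) measurable
  also have "(\<integral>\<^sup>+ y. ennreal (h (norm (?e - y))) \<partial>lborel) = (\<integral>\<^sup>+ (y::space). ennreal (h (norm y)) \<partial>lborel)"
    by (rule nn_integral_reflect) measurable
  also have "(\<integral>\<^sup>+ (y::space). ennreal (h (norm y)) \<partial>lborel)
    = (\<integral>\<^sup>+ r. ennreal (4 * pi * r\<^sup>2) * ennreal (h r) * indicator {0..} r \<partial>lborel)"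
    by (rule nn_integral_radial) measurable
  also have "\<dots> \<le> (\<integral>\<^sup>+ r. ennreal (4 * pi) * (ennreal (1 / (1 - r)\<^sup>2) * indicator {0..1/2} r
      + ennreal (1 / r\<^sup>2) * indicator {1/2..} r) \<partial>lborel)"
  proof (rule nn_integral_mono)
    fix r :: real
    have e: "4 * pi * r\<^sup>2 * h r = 4 * pi * (max r (1 - r) powr (-2))" if "r > 0"
      using that by (simp add: h_def powr_minus field_simps)
    consider "r \<le> 0" | "0 < r" "r \<le> 1/2" | "1/2 < r" by linarith
    then show "ennreal (4 * pi * r\<^sup>2) * ennreal (h r) * indicator {0..} r
     \<le> ennreal (4 * pi) * (ennreal (1 / (1 - r)\<^sup>2) * indicator {0..1/2} r + ennreal (1 / r\<^sup>2) * indicator {1/2..} r)"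
    proof cases
      case 1 then show ?thesis by (cases "r = 0") (auto simp: indicator_def)
    next
      case 2
      then have "4 * pi * r\<^sup>2 * h r = 4 * pi * (1 / (1 - r)\<^sup>2)"
        using e by (simp add: max_def powr_minus inverse_eq_divide)
      then have "ennreal (4 * pi * r\<^sup>2) * ennreal (h r) = ennreal (4 * pi) * ennreal (1 / (1 - r)\<^sup>2)"
        by (simp add: ennreal_mult'[symmetric])
      then show ?thesis using 2 by (auto simp: indicator_def intro!: mult_left_mono)
    next
      case 3
      then have "4 * pi * r\<^sup>2 * h r = 4 * pi * (1 / r\<^sup>2)"
        using e by (simp add: max_def powr_minus inverse_eq_divide)
      then have "ennreal (4 * pi * r\<^sup>2) * ennreal (h r) = ennreal (4 * pi) * ennreal (1 / r\<^sup>2)"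
        by (simp add: ennreal_mult'[symmetric])
      then show ?thesis using 3 by (auto simp: indicator_def)
    qed
  qed
  also have "\<dots> = ennreal (4 * pi) * ((\<integral>\<^sup>+ r. ennreal (1 / (1 - r)\<^sup>2) * indicator {0..1/2} r \<partial>lborel)
      + (\<integral>\<^sup>+ r. ennreal (1 / r\<^sup>2) * indicator {1/2..} r \<partial>lborel))"
    by (subst nn_integral_cmult) (auto simp: nn_integral_add)
  also have "(\<integral>\<^sup>+ r. ennreal (1 / (1 - r)\<^sup>2) * indicator {0..1/2} r \<partial>lborel) = ennreal (1 / (1 - 1/2) - 1 / (1 - 0))"
    by (rule nn_integral_FTC_Icc) (auto intro!: derivative_eq_intros simp: power2_eq_square divide_simps)
  also have "(\<integral>\<^sup>+ r. ennreal (1 / r\<^sup>2) * indicator {1/2..} r \<partial>lborel) = ennreal (0 - - (1 / (1/2)))"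
  proof (rule nn_integral_FTC_atLeast)
    show "((\<lambda>r::real. - (1 / r)) \<longlongrightarrow> 0) at_top"
      using tendsto_minus[OF tendsto_inverse_0_at_top[OF filterlim_ident[of at_top]]]
      by (simp add: inverse_eq_divide)
  qed (auto intro!: derivative_eq_intros simp: power2_eq_square field_simps)
  also have "ennreal (4 * pi) * (ennreal (1 / (1 - 1/2) - 1 / (1 - 0)) + ennreal (0 - - (1 / (1/2)))) = ennreal (12 * pi)"
    by (subst ennreal_plus[symmetric], simp, simp, subst ennreal_mult[symmetric]) auto
  also have "ennreal (12 * pi) + ennreal (12 * pi) = ennreal (24 * pi)"
    by (subst ennreal_plus[symmetric]) auto
  finally have "(\<integral>\<^sup>+ y. ennreal (norm y powr (-2) * norm (?e - y) powr (-2)) \<partial>lborel) \<le> ennreal (24 * pi)"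
    by (simp add: add_mono order_trans)
  then show ?thesis unfolding riesz_mass_def by (rule enn2real_leI[rotated]) auto
qed


section \<open>Functions with one power singularity\<close>

text \<open>The value at the origin is left free: the transforms below are determined only off the origin.
  A single homogeneous bound is demanded because the convolution of two homogeneous weights is again
  homogeneous and is known up to a constant.\<close>

definition power_bounded :: "real \<Rightarrow> (space \<Rightarrow> real) \<Rightarrow> bool" where
  "power_bounded a f \<longleftrightarrow> continuous_on (-{0}) f \<and> (\<exists>C. \<forall>x. x \<noteq> 0 \<longrightarrow> \<bar>f x\<bar> \<le> C * norm x powr (-a))"

lemma power_boundedE:
  assumes "power_bounded a f"
  obtains C where "0 \<le> C" "\<And>x. x \<noteq> 0 \<Longrightarrow> \<bar>f x\<bar> \<le> C * norm x powr (-a)"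
proof -
  obtain C where "\<forall>x. x \<noteq> 0 \<longrightarrow> \<bar>f x\<bar> \<le> C * norm x powr (-a)" using assms by (auto simp: power_bounded_def)
  then have "\<And>x. x \<noteq> 0 \<Longrightarrow> \<bar>f x\<bar> \<le> max C 0 * norm x powr (-a)"
    by (metis order_trans max.cobounded1 mult_right_mono powr_ge_zero)
  then show ?thesis using that[of "max C 0"] by auto
qed

lemma measurable_off_origin:
  fixes f :: "space \<Rightarrow> 'b::topological_space"
  shows "continuous_on (-{0}) f \<Longrightarrow> f \<in> borel_measurable borel"
  by (rule borel_measurable_continuous_countable_exceptions[where X = "{0}"]) auto

lemma power_bounded_measurable: "power_bounded a f \<Longrightarrow> f \<in> borel_measurable borel"
  by (auto simp: power_bounded_def intro: measurable_off_origin)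

lemma power_bounded_continuous: "power_bounded a f \<Longrightarrow> x \<noteq> 0 \<Longrightarrow> isCont f x"
  by (auto simp: power_bounded_def continuous_on_eq_continuous_at open_Compl)

lemma power_bounded_add: "power_bounded a f \<Longrightarrow> power_bounded a g \<Longrightarrow> power_bounded a (\<lambda>x. f x + g x)"
proof -
  assume f: "power_bounded a f" and g: "power_bounded a g"
  obtain C D where "\<And>x. x \<noteq> 0 \<Longrightarrow> \<bar>f x\<bar> \<le> C * norm x powr (-a)" "\<And>x. x \<noteq> 0 \<Longrightarrow> \<bar>g x\<bar> \<le> D * norm x powr (-a)"
    using power_boundedE[OF f] power_boundedE[OF g] by metis
  then have "\<bar>f x + g x\<bar> \<le> (C + D) * norm x powr (-a)" if "x \<noteq> 0" for x
    unfolding distrib_right using abs_triangle_ineq[of "f x" "g x"] add_mono that order_trans by blast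
  then show ?thesis using f g unfolding power_bounded_def by (auto intro!: continuous_intros)
qed

lemma power_bounded_cmult: "power_bounded a f \<Longrightarrow> power_bounded a (\<lambda>x. c * f x)"
proof -
  assume f: "power_bounded a f"
  obtain C where "\<And>x. x \<noteq> 0 \<Longrightarrow> \<bar>f x\<bar> \<le> C * norm x powr (-a)"
    using power_boundedE[OF f] by metis
  then have "\<bar>c * f x\<bar> \<le> (\<bar>c\<bar> * C) * norm x powr (-a)" if "x \<noteq> 0" for x
    using that by (simp add: abs_mult mult_left_mono mult.assoc)
  then show ?thesis using f unfolding power_bounded_def by (auto intro!: continuous_intros)
qed

lemma power_bounded_zero: "power_bounded a (\<lambda>x. 0)"
  by (auto simp: power_bounded_def intro: exI[of _ 0])

lemma power_bounded_sum: "(\<And>i. i \<in> I \<Longrightarrow> power_bounded a (f i)) \<Longrightarrow> power_bounded a (\<lambda>x. \<Sum>i\<in>I. f i x)"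
  by (induction I rule: infinite_finite_induct) (auto intro: power_bounded_zero power_bounded_add)

lemma integrable_power_weight:
  assumes "a < 3" "3 < a + p" "0 \<le> p"
  shows "integrable lborel (\<lambda>x::space. norm x powr (-a) * (1 + norm x) powr (-p))"
  using nn_integral_power_weight[OF assms] by (intro integrableI_bounded) auto

lemma power_bounded_integrable:
  fixes M :: "space \<Rightarrow> real"
  assumes f: "power_bounded a f" and a: "a < 3" "3 < a + p" "0 \<le> p"
    and [measurable]: "M \<in> borel_measurable borel" and M: "\<And>z. \<bar>M z\<bar> \<le> B * (1 + norm z) powr (-p)"
  shows "integrable lborel (\<lambda>y. M (x - y) * f y)"
proof -
  note [measurable] = power_bounded_measurable[OF f]
  obtain C where C: "0 \<le> C" "\<And>x. x \<noteq> 0 \<Longrightarrow> \<bar>f x\<bar> \<le> C * norm x powr (-a)" using power_boundedE[OF f] by metis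
  have B: "0 \<le> B" using M[of 0] by simp
  show ?thesis
  proof (rule Bochner_Integration.integrable_bound)
    show "integrable lborel (\<lambda>y::space. B * C * (1 + norm x) powr p * (norm y powr (-a) * (1 + norm y) powr (-p)))"
      by (intro integrable_mult_right integrable_power_weight a)
    show "AE y in lborel. norm (M (x - y) * f y)
      \<le> norm (B * C * (1 + norm x) powr p * (norm y powr (-a) * (1 + norm y) powr (-p)))"
      using AE_lborel_singleton[of "0::space"]
    proof eventually_elim
      fix y :: space assume y: "y \<noteq> 0"
      have "1 + norm y \<le> 1 + norm x + norm (x - y)" using norm_triangle_ineq4[of x "x - y"] by simp
      also have "\<dots> \<le> (1 + norm x) * (1 + norm (x - y))" by (simp add: algebra_simps)
      finally have "((1 + norm x) * (1 + norm (x - y))) powr (-p) \<le> (1 + norm y) powr (-p)"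
        using a by (intro powr_mono2') (auto simp: add_pos_nonneg)
      then have "(1 + norm x) powr p * ((1 + norm x) * (1 + norm (x - y))) powr (-p)
          \<le> (1 + norm x) powr p * (1 + norm y) powr (-p)"
        by (rule mult_left_mono) simp
      moreover have "(1 + norm x) powr p > 0" by (simp add: add_pos_nonneg less_imp_neq[THEN not_sym])
      ultimately have "(1 + norm (x - y)) powr (-p) \<le> (1 + norm x) powr p * (1 + norm y) powr (-p)"
        by (simp add: powr_mult powr_minus mult.assoc[symmetric])
      then have "\<bar>M (x - y)\<bar> \<le> B * ((1 + norm x) powr p * (1 + norm y) powr (-p))"
        using M[of "x - y"] B by (meson order_trans mult_left_mono)
      then have "\<bar>M (x - y)\<bar> * \<bar>f y\<bar> \<le> (B * ((1 + norm x) powr p * (1 + norm y) powr (-p))) * (C * norm y powr (-a))"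
        using C(2)[OF y] B by (intro mult_mono) auto
      also have "\<dots> = \<bar>B * C * (1 + norm x) powr p * (norm y powr (-a) * (1 + norm y) powr (-p))\<bar>"
        using B C(1) by (simp add: abs_mult mult_ac)
      finally show "norm (M (x - y) * f y) \<le> norm (B * C * (1 + norm x) powr p * (norm y powr (-a) * (1 + norm y) powr (-p)))"
        by (simp add: abs_mult)
    qed
  qed auto
qed

text \<open>Up to the factor \<open>2 \<pi>\<^sup>2\<close>, the Riesz potential of order one.\<close>

definition Ipot :: "(space \<Rightarrow> real) \<Rightarrow> space \<Rightarrow> real" where
  "Ipot k x = (LINT y|lborel. norm (x - y) powr (-2) * k y)"

lemma integrable_conv_weight:
  assumes "x \<noteq> (0::space)" "1 < a" "a < 3"
  shows "integrable lborel (\<lambda>y. norm (x - y) powr (-2) * norm y powr (-a))"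
    and "(LINT y|lborel. norm (x - y) powr (-2) * norm y powr (-a)) = riesz_mass a * norm x powr (1 - a)"
proof -
  have nn: "(\<integral>\<^sup>+ y. ennreal (norm (x - y) powr (-2) * norm y powr (-a)) \<partial>lborel) = ennreal (riesz_mass a * norm x powr (1 - a))"
    using nn_integral_conv_weight[OF assms] by (simp add: mult.commute)
  show "integrable lborel (\<lambda>y. norm (x - y) powr (-2) * norm y powr (-a))"
    using nn by (intro integrableI_nonneg) auto
  show "(LINT y|lborel. norm (x - y) powr (-2) * norm y powr (-a)) = riesz_mass a * norm x powr (1 - a)"
    using nn by (subst integral_eq_nn_integral) (auto simp: riesz_mass_nonneg)
qed

lemma power_bounded_Ipot_integrable:
  assumes f: "power_bounded a f" and a: "1 < a" "a < 3" and x: "x \<noteq> 0"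
  shows "integrable lborel (\<lambda>y. norm (x - y) powr (-2) * f y)"
proof -
  note [measurable] = power_bounded_measurable[OF f]
  obtain C where C: "0 \<le> C" "\<And>x. x \<noteq> 0 \<Longrightarrow> \<bar>f x\<bar> \<le> C * norm x powr (-a)" using power_boundedE[OF f] by metis
  show ?thesis
  proof (rule Bochner_Integration.integrable_bound)
    show "integrable lborel (\<lambda>y. C * (norm (x - y) powr (-2) * norm y powr (-a)))"
      by (intro integrable_mult_right integrable_conv_weight x a)
    show "AE y in lborel. norm (norm (x - y) powr (-2) * f y) \<le> norm (C * (norm (x - y) powr (-2) * norm y powr (-a)))"
      using AE_lborel_singleton[of "0::space"]
    proof eventually_elim
      fix y :: space assume y: "y \<noteq> 0"
      have "norm (x - y) powr (-2) * \<bar>f y\<bar> \<le> norm (x - y) powr (-2) * (C * norm y powr (-a))"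
        using C(2)[OF y] by (intro mult_left_mono) auto
      then show "norm (norm (x - y) powr (-2) * f y) \<le> norm (C * (norm (x - y) powr (-2) * norm y powr (-a)))"
        using C(1) by (simp add: abs_mult mult_ac)
    qed
  qed auto
qed

text \<open>The dominating functions may vary as long as their integrals converge to the right limit: by
  Scheffe's lemma they then converge in \<open>L\<^sup>1\<close>, and the functions truncated to \<open>[- G', G']\<close> differ from
  the original ones by at most \<open>|G n - G'|\<close>.\<close>

lemma integral_generalised_dominated_convergence:
  fixes f :: "nat \<Rightarrow> 'a \<Rightarrow> real"
  assumes [measurable]: "\<And>n. f n \<in> borel_measurable M" "f' \<in> borel_measurable M"
    and G: "\<And>n. integrable M (G n)" "integrable M G'"
    and lim: "AE x in M. (\<lambda>n. f n x) \<longlonglongrightarrow> f' x" "AE x in M. (\<lambda>n. G n x) \<longlonglongrightarrow> G' x"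
    and bd: "\<And>n. AE x in M. \<bar>f n x\<bar> \<le> G n x"
    and GI: "(\<lambda>n. integral\<^sup>L M (G n)) \<longlonglongrightarrow> integral\<^sup>L M G'"
  shows "(\<lambda>n. integral\<^sup>L M (f n)) \<longlonglongrightarrow> integral\<^sup>L M f'"
proof -
  note [measurable] = borel_measurable_integrable[OF G(1)] borel_measurable_integrable[OF G(2)]
  have Gpos: "AE x in M. 0 \<le> G n x" for n using bd[of n] by eventually_elim auto
  have bd': "AE x in M. \<forall>n. \<bar>f n x\<bar> \<le> G n x" using bd by (simp add: AE_all_countable)
  have G'pos: "AE x in M. 0 \<le> G' x" using lim(2) bd'
  proof eventually_elim
    fix x assume "(\<lambda>n. G n x) \<longlonglongrightarrow> G' x" "\<forall>n. \<bar>f n x\<bar> \<le> G n x"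
    then show "0 \<le> G' x" by (intro LIMSEQ_le_const[of _ "G' x"]) (auto intro: order_trans[OF abs_ge_zero])
  qed
  have f'bd: "AE x in M. \<bar>f' x\<bar> \<le> G' x" using lim bd'
  proof eventually_elim
    fix x assume "(\<lambda>n. f n x) \<longlonglongrightarrow> f' x" "(\<lambda>n. G n x) \<longlonglongrightarrow> G' x" "\<forall>n. \<bar>f n x\<bar> \<le> G n x"
    then show "\<bar>f' x\<bar> \<le> G' x" by (intro LIMSEQ_le[OF tendsto_rabs]) auto
  qed
  have nG: "(\<integral>\<^sup>+ x. ennreal (norm (g x)) \<partial>M) = ennreal (integral\<^sup>L M g)"
    if "integrable M g" "AE x in M. 0 \<le> g x" for g :: "'a \<Rightarrow> real"
  proof -
    have "(\<integral>\<^sup>+ x. ennreal (norm (g x)) \<partial>M) = (\<integral>\<^sup>+ x. ennreal (g x) \<partial>M)"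
      using that(2) by (intro nn_integral_cong_AE) auto
    then show ?thesis using nn_integral_eq_integral[OF that] by simp
  qed
  have sch: "(\<lambda>n. \<integral>\<^sup>+ x. norm (G n x - G' x) \<partial>M) \<longlonglongrightarrow> 0"
  proof (rule Scheffe_lemma1[OF G lim(2)])
    have "(\<lambda>n. \<integral>\<^sup>+ x. ennreal (norm (G n x)) \<partial>M) \<longlonglongrightarrow> (\<integral>\<^sup>+ x. ennreal (norm (G' x)) \<partial>M)"
      unfolding nG[OF G(1) Gpos] nG[OF G(2) G'pos] by (intro tendsto_ennrealI GI)
    then show "limsup (\<lambda>n. \<integral>\<^sup>+ x. ennreal (norm (G n x)) \<partial>M) \<le> (\<integral>\<^sup>+ x. ennreal (norm (G' x)) \<partial>M)"
      using lim_imp_Limsup[OF sequentially_bot] by (metis order_refl)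
  qed
  have "(\<lambda>n. ennreal (LINT x|M. norm (G n x - G' x))) \<longlonglongrightarrow> ennreal 0"
    using sch by (subst (asm) nn_integral_eq_integral)
      (auto intro!: G Bochner_Integration.integrable_diff integrable_abs simp del: integrable_abs_iff)
  then have d: "(\<lambda>n. LINT x|M. norm (G n x - G' x)) \<longlonglongrightarrow> 0"
    by (subst (asm) tendsto_ennreal_iff) auto
  \<comment> \<open>Truncation at the limiting bound, to which ordinary dominated convergence applies.\<close>
  define h where "h n x = max (- G' x) (min (G' x) (f n x))" for n x
  have [measurable]: "h n \<in> borel_measurable M" for n unfolding h_def by measurable
  have hbd: "AE x in M. norm (h n x) \<le> G' x" for n
    using G'pos by eventually_elim (auto simp: h_def)
  have hint: "integrable M (h n)" for n
    using hbd[of n] G'pos by (intro Bochner_Integration.integrable_bound[OF G(2)]) auto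
  have fint: "integrable M (f n)" for n
    using bd[of n] Gpos[of n] by (intro Bochner_Integration.integrable_bound[OF G(1)[of n]]) auto
  have h: "(\<lambda>n. integral\<^sup>L M (h n)) \<longlonglongrightarrow> integral\<^sup>L M f'"
  proof (rule integral_dominated_convergence[OF _ _ G(2)])
    show "AE x in M. (\<lambda>n. h n x) \<longlonglongrightarrow> f' x" using lim(1) f'bd
    proof eventually_elim
      fix x assume l: "(\<lambda>n. f n x) \<longlonglongrightarrow> f' x" and b: "\<bar>f' x\<bar> \<le> G' x"
      have "(\<lambda>n. h n x) \<longlonglongrightarrow> max (- G' x) (min (G' x) (f' x))"
        unfolding h_def by (intro tendsto_intros l)
      also have "max (- G' x) (min (G' x) (f' x)) = f' x" using b by auto
      finally show "(\<lambda>n. h n x) \<longlonglongrightarrow> f' x" .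
    qed
  qed (use hbd in auto)
  have "(\<lambda>n. integral\<^sup>L M (f n) - integral\<^sup>L M (h n)) \<longlonglongrightarrow> 0"
  proof (rule Lim_null_comparison[OF _ d], rule always_eventually, rule allI)
    fix n
    have "norm (integral\<^sup>L M (f n) - integral\<^sup>L M (h n)) = norm (LINT x|M. f n x - h n x)"
      by (simp add: fint hint)
    also have "\<dots> \<le> (LINT x|M. norm (f n x - h n x))" by (rule integral_norm_bound)
    also have "\<dots> \<le> (LINT x|M. norm (G n x - G' x))"
    proof (rule integral_mono_AE)
      show "AE x in M. norm (f n x - h n x) \<le> norm (G n x - G' x)"
        using bd[of n] G'pos by eventually_elim (auto simp: h_def)
    qed (use fint hint G in auto)
    finally show "norm (integral\<^sup>L M (f n) - integral\<^sup>L M (h n)) \<le> (LINT x|M. norm (G n x - G' x))" .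
  qed
  from tendsto_add[OF this h] show ?thesis by simp
qed

text \<open>The bound is the homogeneity of the convolution of two weights. For the continuity the singularity
  of \<open>f\<close> moves with the point, so no fixed function dominates; but the moving dominating functions
  have integrals that are known exactly and depend continuously on the point.\<close>

lemma power_bounded_Ipot:
  assumes f: "power_bounded a f" and a: "1 < a" "a < 3"
  shows "power_bounded (a - 1) (Ipot f)"
proof -
  note [measurable] = power_bounded_measurable[OF f]
  obtain C where C: "0 \<le> C" "\<And>x. x \<noteq> 0 \<Longrightarrow> \<bar>f x\<bar> \<le> C * norm x powr (-a)" using power_boundedE[OF f] by metis
  have bound: "\<bar>Ipot f x\<bar> \<le> C * riesz_mass a * norm x powr (- (a - 1))" if x: "x \<noteq> 0" for x
  proof -
    have "norm (Ipot f x) \<le> (LINT y|lborel. norm (norm (x - y) powr (-2) * f y))"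
      unfolding Ipot_def by (rule integral_norm_bound)
    also have "\<dots> \<le> (LINT y|lborel. C * (norm (x - y) powr (-2) * norm y powr (-a)))"
    proof (rule integral_mono_AE)
      show "integrable lborel (\<lambda>y. norm (norm (x - y) powr (-2) * f y))"
        by (intro integrable_norm power_bounded_Ipot_integrable[OF f a x])
      show "integrable lborel (\<lambda>y. C * (norm (x - y) powr (-2) * norm y powr (-a)))"
        by (intro integrable_mult_right integrable_conv_weight x a)
      show "AE y in lborel. norm (norm (x - y) powr (-2) * f y) \<le> C * (norm (x - y) powr (-2) * norm y powr (-a))"
        using AE_lborel_singleton[of "0::space"]
      proof eventually_elim
        fix y :: space assume y: "y \<noteq> 0"
        have "norm (x - y) powr (-2) * \<bar>f y\<bar> \<le> norm (x - y) powr (-2) * (C * norm y powr (-a))"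
          using C(2)[OF y] by (intro mult_left_mono) auto
        then show "norm (norm (x - y) powr (-2) * f y) \<le> C * (norm (x - y) powr (-2) * norm y powr (-a))"
          by (simp add: abs_mult mult_ac)
      qed
    qed
    also have "\<dots> = C * riesz_mass a * norm x powr (- (a - 1))"
      using integrable_conv_weight[OF x a] by simp
    finally show ?thesis by simp
  qed
  have "continuous_on (-{0}) (Ipot f)"
    unfolding continuous_on_sequentially
  proof (intro allI ballI impI)
    fix u :: "nat \<Rightarrow> space" and x :: space
    assume x: "x \<in> -{0}" and u: "(\<forall>n. u n \<in> -{0}) \<and> u \<longlonglongrightarrow> x"
    then have u0: "u n \<noteq> 0" and x0: "x \<noteq> 0" and ul: "u \<longlonglongrightarrow> x" for n by auto
    have eq: "Ipot g z = (LINT y|lborel. norm y powr (-2) * g (z - y))" for g z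
      unfolding Ipot_def using integral_reflect[of "\<lambda>y. norm (z - y) powr (-2) * g y" z] by simp
    let ?G = "\<lambda>z y::space. C * (norm y powr (-2) * norm (z - y) powr (-a))"
    have Gi: "integrable lborel (?G z)" "integral\<^sup>L lborel (?G z) = C * (riesz_mass a * norm z powr (1 - a))"
      if "z \<noteq> 0" for z
      using integrable_conv_weight[OF that a] integrable_reflect[of "\<lambda>y. C * (norm (z - y) powr (-2) * norm y powr (-a))" z]
        integral_reflect[of "\<lambda>y. C * (norm (z - y) powr (-2) * norm y powr (-a))" z] by simp_all
    have "(\<lambda>n. LINT y|lborel. norm y powr (-2) * f (u n - y)) \<longlonglongrightarrow> (LINT y|lborel. norm y powr (-2) * f (x - y))"
    proof (rule integral_generalised_dominated_convergence[where G = "\<lambda>n. ?G (u n)" and G' = "?G x"])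
      show "AE y in lborel. (\<lambda>n. norm y powr (-2) * f (u n - y)) \<longlonglongrightarrow> norm y powr (-2) * f (x - y)"
        using AE_lborel_singleton[of x]
      proof eventually_elim
        fix y assume "y \<noteq> x"
        then have "isCont f (x - y)" by (intro power_bounded_continuous[OF f]) auto
        then have "(\<lambda>n. f (u n - y)) \<longlonglongrightarrow> f (x - y)"
          by (rule isCont_tendsto_compose) (intro tendsto_intros ul)
        then show "(\<lambda>n. norm y powr (-2) * f (u n - y)) \<longlonglongrightarrow> norm y powr (-2) * f (x - y)"
          by (intro tendsto_intros)
      qed
      show "AE y in lborel. (\<lambda>n. ?G (u n) y) \<longlonglongrightarrow> ?G x y"
        using AE_lborel_singleton[of x]
        by eventually_elim (intro tendsto_intros ul, auto)
      show "AE y in lborel. \<bar>norm y powr (-2) * f (u n - y)\<bar> \<le> ?G (u n) y" for n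
        using AE_lborel_singleton[of "u n"]
      proof eventually_elim
        fix y assume "y \<noteq> u n"
        then have "\<bar>f (u n - y)\<bar> \<le> C * norm (u n - y) powr (-a)" using C(2)[of "u n - y"] by simp
        then have "norm y powr (-2) * \<bar>f (u n - y)\<bar> \<le> norm y powr (-2) * (C * norm (u n - y) powr (-a))"
          by (intro mult_left_mono) auto
        then show "\<bar>norm y powr (-2) * f (u n - y)\<bar> \<le> ?G (u n) y"
          by (simp add: abs_mult mult_ac)
      qed
      show "(\<lambda>n. integral\<^sup>L lborel (?G (u n))) \<longlonglongrightarrow> integral\<^sup>L lborel (?G x)"
        unfolding Gi(2)[OF u0] Gi(2)[OF x0] using x0 by (intro tendsto_intros ul) auto
    qed (use Gi u0 x0 in auto)
    then show "(Ipot f \<circ> u) \<longlonglongrightarrow> Ipot f x" by (simp add: eq o_def)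
  qed
  with bound show ?thesis unfolding power_bounded_def by blast
qed

section \<open>Integration by parts\<close>

text \<open>Only derivatives along coordinate lines are recorded: integration by parts needs no more, and
  sums and products inherit them from the calculus of one variable.\<close>

definition pderiv_on :: "space set \<Rightarrow> 3 \<Rightarrow> (space \<Rightarrow> real) \<Rightarrow> (space \<Rightarrow> real) \<Rightarrow> bool" where
  "pderiv_on S k f f' \<longleftrightarrow> (\<forall>x\<in>S. ((\<lambda>t. f (x + t *\<^sub>R axis k 1)) has_real_derivative f' x) (at 0))"

lemma pderiv_onD:
  assumes "pderiv_on S k f f'" "x + t *\<^sub>R axis k 1 \<in> S"
  shows "((\<lambda>t. f (x + t *\<^sub>R axis k 1)) has_real_derivative f' (x + t *\<^sub>R axis k 1)) (at t)"
proof -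
  have "((\<lambda>s. f ((x + t *\<^sub>R axis k 1) + s *\<^sub>R axis k 1)) has_real_derivative f' (x + t *\<^sub>R axis k 1)) (at 0)"
    using assms by (auto simp: pderiv_on_def)
  then have "((\<lambda>s. f (x + (s + t) *\<^sub>R axis k 1)) has_real_derivative f' (x + t *\<^sub>R axis k 1)) (at 0)"
    by (simp add: algebra_simps)
  then show ?thesis using DERIV_shift[of "\<lambda>s. f (x + s *\<^sub>R axis k 1)" _ 0 t] by simp
qed

lemma AE_component_nonzero: "AE z::space in lborel. z $ l \<noteq> 0"
proof (rule AE_I')
  have "negligible {z::space. z $ l = 0}"
    using negligible_standard_hyperplane[of "axis l 1 :: space" 0] by (simp add: inner_axis axis_in_Basis_iff)
  moreover have "{z::space. z $ l = 0} \<in> sets borel" by measurable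
  ultimately show "{z::space. z $ l = 0} \<in> null_sets lborel"
    by (simp add: negligible_iff_null_sets null_sets_completion_iff)
qed auto

text \<open>Translating by a unit step does not change the integral of \<open>H\<close>, while by the fundamental
  theorem of calculus on almost every line the step changes \<open>H\<close> by an average of translates of the
  derivative. Hence the derivative has integral zero.\<close>

lemma integral_pderiv_eq_0:
  assumes H: "integrable lborel H" and H': "integrable lborel H'" and d: "pderiv_on (-{0}) k H H'"
  shows "(LINT z|lborel. H' z) = 0"
proof -
  let ?e = "axis k 1 :: space"
  let ?F = "\<lambda>(z::space) (t::real). indicator {0..1} t *\<^sub>R H' (z + t *\<^sub>R ?e)"
  have [measurable]: "H' \<in> borel_measurable borel" using H' by auto
  have int: "integrable (lborel \<Otimes>\<^sub>M lborel) (\<lambda>(t, z). ?F z t)"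
  proof (rule integrableI_bounded)
    have "(\<integral>\<^sup>+ p. ennreal (norm ((\<lambda>(t, z). ?F z t) p)) \<partial>(lborel \<Otimes>\<^sub>M lborel))
      = (\<integral>\<^sup>+ t. (\<integral>\<^sup>+ z. ennreal (norm (?F z t)) \<partial>lborel) \<partial>lborel)"
      by (subst lborel.nn_integral_fst[symmetric]) auto
    also have "\<dots> = (\<integral>\<^sup>+ (t::real). indicator {0..1} t * (\<integral>\<^sup>+ z. ennreal (norm (H' z)) \<partial>lborel) \<partial>lborel)"
    proof (rule nn_integral_cong)
      fix t :: real
      have "(\<integral>\<^sup>+ z. ennreal (norm (?F z t)) \<partial>lborel) = (\<integral>\<^sup>+ z. indicator {0..1} t * ennreal (norm (H' (t *\<^sub>R ?e + 1 *\<^sub>R z))) \<partial>lborel)"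
        by (intro nn_integral_cong) (auto simp: indicator_def add.commute)
      also have "\<dots> = indicator {0..1} t * (\<integral>\<^sup>+ z. ennreal (norm (H' (t *\<^sub>R ?e + 1 *\<^sub>R z))) \<partial>lborel)"
        by (rule nn_integral_cmult) measurable
      also have "(\<integral>\<^sup>+ z. ennreal (norm (H' (t *\<^sub>R ?e + 1 *\<^sub>R z))) \<partial>lborel) = (\<integral>\<^sup>+ z. ennreal (norm (H' z)) \<partial>lborel)"
        using nn_integral_affine[of "\<lambda>z. ennreal (norm (H' z))" 1 "t *\<^sub>R ?e"] by simp
      finally show "(\<integral>\<^sup>+ z. ennreal (norm (?F z t)) \<partial>lborel) = indicator {0..1} t * (\<integral>\<^sup>+ z. ennreal (norm (H' z)) \<partial>lborel)" .
    qed
    also have "\<dots> = (\<integral>\<^sup>+ z. ennreal (norm (H' z)) \<partial>lborel)"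
      by (subst nn_integral_multc) auto
    also have "\<dots> < \<infinity>" using H' by (simp add: integrable_iff_bounded)
    finally show "(\<integral>\<^sup>+ p. ennreal (norm ((\<lambda>(t, z). ?F z t) p)) \<partial>(lborel \<Otimes>\<^sub>M lborel)) < \<infinity>" .
  qed measurable
  \<comment> \<open>A line along axis \<open>k\<close> misses the origin as soon as another coordinate is nonzero on it.\<close>
  obtain l :: 3 where l: "l \<noteq> k" by (metis num1_eq_iff one_neq_zero zero_neq_one)
  have "AE z in lborel. (LINT t|lborel. ?F z t) = H (z + ?e) - H z"
    using lborel_pair.AE_integrable_snd[OF int] AE_component_nonzero[of l]
  proof eventually_elim
    fix z :: space assume i: "integrable lborel (?F z)" and z: "z $ l \<noteq> 0"
    have nz: "z + t *\<^sub>R ?e \<in> -{0}" for t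
    proof -
      have "(z + t *\<^sub>R ?e) $ l \<noteq> 0" using z l by (simp add: axis_def)
      then have "z + t *\<^sub>R ?e \<noteq> 0" by (metis zero_index)
      then show ?thesis by simp
    qed
    have "((\<lambda>t. H' (z + t *\<^sub>R ?e)) has_integral (H (z + 1 *\<^sub>R ?e) - H (z + 0 *\<^sub>R ?e))) {0..1}"
    proof (rule fundamental_theorem_of_calculus)
      show "((\<lambda>t. H (z + t *\<^sub>R ?e)) has_vector_derivative H' (z + t *\<^sub>R ?e)) (at t within {0..1})" for t
        using pderiv_onD[OF d nz] by (simp add: has_real_derivative_iff_has_vector_derivative has_vector_derivative_at_within)
    qed simp
    then have "integral {0..1} (\<lambda>t. H' (z + t *\<^sub>R ?e)) = H (z + ?e) - H z" by (simp add: integral_unique)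
    moreover have "set_integrable lborel {0..1} (\<lambda>t. H' (z + t *\<^sub>R ?e))"
      using i by (simp add: set_integrable_def)
    ultimately show "(LINT t|lborel. ?F z t) = H (z + ?e) - H z"
      using set_borel_integral_eq_integral(2) by (fastforce simp: set_lebesgue_integral_def)
  qed
  then have "(LINT z|lborel. (LINT t|lborel. ?F z t)) = (LINT z|lborel. H (z + ?e) - H z)"
    using lborel_pair.integrable_snd[OF int] H
    by (intro integral_cong_AE) (auto simp: integrable_translate intro!: borel_measurable_integrable)
  also have "\<dots> = 0"
    using H integrable_translate[of H ?e] integral_translate[of H ?e] by simp
  finally have "0 = (LINT z|lborel. (LINT t|lborel. ?F z t))" ..
  also have "\<dots> = (LINT t|lborel. (LINT z|lborel. ?F z t))"
    by (rule lborel_pair.Fubini_integral[OF int])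
  also have "\<dots> = (LINT (t::real)|lborel. indicator {0..1} t * (LINT z|lborel. H' z))"
    by (intro Bochner_Integration.integral_cong) (auto simp: integral_translate)
  also have "\<dots> = (LINT z|lborel. H' z)" by simp
  finally show ?thesis ..
qed

lemma kernel_by_parts:
  assumes f: "pderiv_on (-{0}) k f f'" and M: "pderiv_on UNIV k M M'"
    and i: "integrable lborel (\<lambda>y. M (x - y) * f y)" "integrable lborel (\<lambda>y. M' (x - y) * f y)"
      "integrable lborel (\<lambda>y. M (x - y) * f' y)"
  shows "(LINT y|lborel. M' (x - y) * f y) = (LINT y|lborel. M (x - y) * f' y)"
proof -
  have "(LINT y|lborel. M (x - y) * f' y - M' (x - y) * f y) = 0"
  proof (rule integral_pderiv_eq_0[OF i(1)])
    show "pderiv_on (-{0}) k (\<lambda>y. M (x - y) * f y) (\<lambda>y. M (x - y) * f' y - M' (x - y) * f y)"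
      unfolding pderiv_on_def
    proof
      fix y :: space assume y: "y \<in> -{0}"
      have 1: "((\<lambda>t. f (y + t *\<^sub>R axis k 1)) has_real_derivative f' y) (at 0)"
        using f y by (simp add: pderiv_on_def)
      have "((\<lambda>t. M (x - y + t *\<^sub>R axis k 1)) has_real_derivative M' (x - y)) (at (- 0))"
        using M by (simp add: pderiv_on_def)
      then have "((\<lambda>t. M (x - y + (- t) *\<^sub>R axis k 1)) has_real_derivative - M' (x - y)) (at 0)"
        by (subst (asm) DERIV_mirror) simp
      then have 2: "((\<lambda>t. M (x - (y + t *\<^sub>R axis k 1))) has_real_derivative - M' (x - y)) (at 0)"
        by (simp add: algebra_simps)
      show "((\<lambda>t. M (x - (y + t *\<^sub>R axis k 1)) * f (y + t *\<^sub>R axis k 1)) has_real_derivative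
        M (x - y) * f' y - M' (x - y) * f y) (at 0)"
        using DERIV_mult[OF 2 1] by (simp add: algebra_simps)
    qed
  qed (use i in auto)
  then show ?thesis using i by simp
qed

section \<open>Approximate identities\<close>

lemma power_bounded_integrable_ball:
  assumes f: "power_bounded a f" and a: "0 \<le> a" "a < 3"
  shows "integrable lborel (\<lambda>y. indicator (ball 0 R) y * f y)"
proof -
  have "integrable lborel (\<lambda>y. indicator (ball 0 R) (0 - y) * f y)"
  proof (rule power_bounded_integrable[OF f a(2), where p = 4 and B = "(1 + \<bar>R\<bar>) powr 4"])
    show "\<bar>indicator (ball 0 R) z\<bar> \<le> (1 + \<bar>R\<bar>) powr 4 * (1 + norm z) powr (-4)" for z :: space
    proof (cases "norm z < R")
      case True
      then have "(1 + norm z) powr 4 \<le> (1 + \<bar>R\<bar>) powr 4" by (intro powr_mono2) auto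
      then show ?thesis using True by (auto simp: indicator_def powr_minus divide_inverse[symmetric] le_divide_eq add_pos_nonneg zero_less_power add_nonneg_eq_0_iff)
    qed (auto simp: indicator_def)
  qed (use a in \<open>auto intro!: borel_measurable_indicator\<close>)
  then show ?thesis by (simp add: indicator_def)
qed

lemma decay_integrable:
  fixes \<Psi> :: "space \<Rightarrow> real"
  assumes [measurable]: "\<Psi> \<in> borel_measurable borel" and B: "\<And>z. \<bar>\<Psi> z\<bar> \<le> B * (1 + norm z) powr (-p)" and p: "3 < p"
  shows "integrable lborel \<Psi>"
proof (rule Bochner_Integration.integrable_bound)
  have "integrable lborel (\<lambda>z::space. B * (norm z powr (-0) * (1 + norm z) powr (-p)))"
    by (intro integrable_mult_right integrable_power_weight) (use p in auto)
  then show "integrable lborel (\<lambda>z::space. B * (norm z powr (-0) * (1 + norm z) powr (-p)))" .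
  show "AE z in lborel. norm (\<Psi> z) \<le> norm (B * (norm z powr (-0) * (1 + norm z) powr (-p)))"
    using AE_lborel_singleton[of "0::space"]
    by eventually_elim (use B in \<open>auto intro: order_trans[OF _ abs_ge_self]\<close>)
qed auto

text \<open>Away from the origin \<open>f\<close> is bounded and continuous at \<open>x\<close>, and dominated convergence applies
  after rescaling. The part of \<open>f\<close> near the origin is integrable and is met by the tail of the
  kernel, which is of order \<open>\<epsilon>\<^sup>-\<^sup>3 \<epsilon>\<^sup>5 = \<epsilon>\<^sup>2\<close> there.\<close>

lemma approximate_identity:
  fixes \<Psi> :: "space \<Rightarrow> real"
  assumes f: "power_bounded a f" and a: "0 \<le> a" "a < 3" and x: "x \<noteq> 0"
    and [measurable]: "\<Psi> \<in> borel_measurable borel" and B: "\<And>z. \<bar>\<Psi> z\<bar> \<le> B * (1 + norm z) powr (-5)"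
  shows "((\<lambda>\<epsilon>. LINT y|lborel. inverse \<epsilon> ^ 3 * \<Psi> (inverse \<epsilon> *\<^sub>R (x - y)) * f y) \<longlongrightarrow> f x * (LINT z|lborel. \<Psi> z)) (at_right 0)"
  unfolding tendsto_at_iff_sequentially
proof (intro allI impI)
  fix u :: "nat \<Rightarrow> real" assume u: "\<forall>i. u i \<in> {0<..} - {0}" and u0: "u \<longlonglongrightarrow> 0"
  note [measurable] = power_bounded_measurable[OF f]
  obtain C where C: "0 \<le> C" "\<And>x. x \<noteq> 0 \<Longrightarrow> \<bar>f x\<bar> \<le> C * norm x powr (-a)" using power_boundedE[OF f] by metis
  have up: "u n > 0" for n using u by auto
  define \<delta> where "\<delta> = norm x / 2"
  have \<delta>: "\<delta> > 0" using x by (simp add: \<delta>_def)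
  \<comment> \<open>\<open>f1\<close> is bounded, and \<open>f2\<close> is integrable with support at distance \<open>\<delta>\<close> from \<open>x\<close>.\<close>
  define f1 where "f1 y = (if norm y < \<delta> then 0 else f y)" for y
  define f2 where "f2 y = indicator (ball 0 \<delta>) y * f y" for y
  have f12: "f y = f1 y + f2 y" for y by (simp add: f1_def f2_def indicator_def)
  have "f2 = (\<lambda>y. if norm y < \<delta> then f y else 0)" by (auto simp: f2_def indicator_def)
  then have [measurable]: "f1 \<in> borel_measurable borel" "f2 \<in> borel_measurable borel"
    unfolding f1_def[abs_def] by (simp_all, measurable)
  have f2i: "integrable lborel f2" unfolding f2_def by (rule power_bounded_integrable_ball[OF f a])
  have f1b: "\<bar>f1 y\<bar> \<le> C * \<delta> powr (-a)" for y
  proof (cases "norm y < \<delta>")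
    case False
    then have "y \<noteq> 0" "norm y powr (-a) \<le> \<delta> powr (-a)" using \<delta> a by (auto intro!: powr_mono2')
    then show ?thesis using False C(1) C(2)[of y] by (auto simp: f1_def intro: order_trans mult_left_mono)
  qed (use C in \<open>simp add: f1_def\<close>)
  have \<Psi>i: "integrable lborel \<Psi>" by (rule decay_integrable[OF _ B]) auto
  have 1: "(\<lambda>n. LINT z|lborel. \<Psi> z * f1 (x - u n *\<^sub>R z)) \<longlonglongrightarrow> (LINT z|lborel. \<Psi> z * f x)"
  proof (rule integral_dominated_convergence[where w = "\<lambda>z. \<bar>\<Psi> z\<bar> * (C * \<delta> powr (-a))"])
    show "AE z in lborel. (\<lambda>n. \<Psi> z * f1 (x - u n *\<^sub>R z)) \<longlonglongrightarrow> \<Psi> z * f x"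
    proof (rule AE_I2)
      fix z :: space
      have l: "(\<lambda>n. x - u n *\<^sub>R z) \<longlonglongrightarrow> x - 0 *\<^sub>R z" by (intro tendsto_intros u0)
      then have "(\<lambda>n. norm (x - u n *\<^sub>R z)) \<longlonglongrightarrow> norm x" by (metis diff_zero scale_zero_left tendsto_norm)
      moreover have "norm x > \<delta>" using x by (simp add: \<delta>_def)
      ultimately have "\<forall>\<^sub>F n in sequentially. norm (x - u n *\<^sub>R z) > \<delta>" by (rule order_tendstoD(1))
      then have ev: "\<forall>\<^sub>F n in sequentially. f (x - u n *\<^sub>R z) = f1 (x - u n *\<^sub>R z)"
        by eventually_elim (simp add: f1_def)
      have "(\<lambda>n. f (x - u n *\<^sub>R z)) \<longlonglongrightarrow> f x"
        using l by (intro isCont_tendsto_compose[OF power_bounded_continuous[OF f x]]) simp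
      from Lim_transform_eventually[OF this ev]
      show "(\<lambda>n. \<Psi> z * f1 (x - u n *\<^sub>R z)) \<longlonglongrightarrow> \<Psi> z * f x" by (rule tendsto_mult_left)
    qed
    show "AE z in lborel. norm (\<Psi> z * f1 (x - u n *\<^sub>R z)) \<le> \<bar>\<Psi> z\<bar> * (C * \<delta> powr (-a))" for n
      using f1b by (auto simp: abs_mult intro!: AE_I2 mult_left_mono)
  qed (use \<Psi>i in auto)
  have conv1: "(LINT y|lborel. inverse (u n) ^ 3 * \<Psi> (inverse (u n) *\<^sub>R (x - y)) * f1 y)
      = (LINT z|lborel. \<Psi> z * f1 (x - u n *\<^sub>R z))" for n
    using integral_affine[of "- u n" "\<lambda>y. inverse (u n) ^ 3 * \<Psi> (inverse (u n) *\<^sub>R (x - y)) * f1 y" x] up[of n]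
    by (simp add: mult.assoc flip: power_mult_distrib)
  have \<Psi>u: "\<bar>\<Psi> (inverse (u n) *\<^sub>R w)\<bar> * inverse (u n) ^ 3 \<le> B * (inverse \<delta> ^ 5 * (u n)\<^sup>2)" if "norm w \<ge> \<delta>" for n w
  proof -
    have "(1 + norm (inverse (u n) *\<^sub>R w)) powr (-5) \<le> (\<delta> / u n) powr (-5)"
      using that up[of n] \<delta> by (intro powr_mono2') (auto simp: field_simps)
    also have "\<dots> = inverse \<delta> ^ 5 * u n ^ 5"
      using up[of n] \<delta> by (simp add: powr_minus powr_divide field_simps flip: powr_numeral)
    finally have "(1 + norm (inverse (u n) *\<^sub>R w)) powr (-5) \<le> inverse \<delta> ^ 5 * u n ^ 5" .
    moreover have B0: "0 \<le> B" using B[of 0] by simp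
    ultimately have "\<bar>\<Psi> (inverse (u n) *\<^sub>R w)\<bar> \<le> B * (inverse \<delta> ^ 5 * u n ^ 5)"
      using B[of "inverse (u n) *\<^sub>R w"] by (meson mult_left_mono order_trans)
    then have "\<bar>\<Psi> (inverse (u n) *\<^sub>R w)\<bar> * inverse (u n) ^ 3 \<le> B * (inverse \<delta> ^ 5 * u n ^ 5) * inverse (u n) ^ 3"
      using up[of n] by (intro mult_right_mono) auto
    also have "\<dots> = B * (inverse \<delta> ^ 5 * (u n)\<^sup>2)" using up[of n] by (simp add: field_simps power_numeral_reduce)
    finally show ?thesis .
  qed
  have b2: "norm (inverse (u n) ^ 3 * \<Psi> (inverse (u n) *\<^sub>R (x - y)) * f2 y) \<le> B * (inverse \<delta> ^ 5 * (u n)\<^sup>2) * \<bar>f2 y\<bar>" for n y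
  proof (cases "norm y < \<delta>")
    case True
    then have "norm (x - y) \<ge> \<delta>" using norm_triangle_ineq2[of x y] by (simp add: \<delta>_def)
    from mult_right_mono[OF \<Psi>u[OF this, of n], of "\<bar>f2 y\<bar>"] up[of n] show ?thesis
      by (simp add: abs_mult mult_ac)
  qed (simp add: f2_def)
  have i2: "integrable lborel (\<lambda>y. inverse (u n) ^ 3 * \<Psi> (inverse (u n) *\<^sub>R (x - y)) * f2 y)" for n
  proof (rule Bochner_Integration.integrable_bound)
    show "integrable lborel (\<lambda>y. B * (inverse \<delta> ^ 5 * (u n)\<^sup>2) * \<bar>f2 y\<bar>)"
      by (intro integrable_mult_right integrable_abs f2i)
    show "AE y in lborel. norm (inverse (u n) ^ 3 * \<Psi> (inverse (u n) *\<^sub>R (x - y)) * f2 y)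
      \<le> norm (B * (inverse \<delta> ^ 5 * (u n)\<^sup>2) * \<bar>f2 y\<bar>)"
      by (intro AE_I2 order_trans[OF b2]) (metis abs_ge_self real_norm_def)
  qed measurable
  have 2: "(\<lambda>n. LINT y|lborel. inverse (u n) ^ 3 * \<Psi> (inverse (u n) *\<^sub>R (x - y)) * f2 y) \<longlonglongrightarrow> 0"
  proof (rule Lim_null_comparison)
    show "\<forall>\<^sub>F n in sequentially. norm (LINT y|lborel. inverse (u n) ^ 3 * \<Psi> (inverse (u n) *\<^sub>R (x - y)) * f2 y)
      \<le> B * (inverse \<delta> ^ 5 * (u n)\<^sup>2) * (LINT y|lborel. \<bar>f2 y\<bar>)"
    proof (rule always_eventually, rule allI)
      fix n
      have "norm (LINT y|lborel. inverse (u n) ^ 3 * \<Psi> (inverse (u n) *\<^sub>R (x - y)) * f2 y)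
         \<le> (LINT y|lborel. norm (inverse (u n) ^ 3 * \<Psi> (inverse (u n) *\<^sub>R (x - y)) * f2 y))"
        by (rule integral_norm_bound)
      also have "\<dots> \<le> (LINT y|lborel. B * (inverse \<delta> ^ 5 * (u n)\<^sup>2) * \<bar>f2 y\<bar>)"
        using b2 f2i by (intro integral_mono integrable_norm i2) auto
      finally show "norm (LINT y|lborel. inverse (u n) ^ 3 * \<Psi> (inverse (u n) *\<^sub>R (x - y)) * f2 y)
         \<le> B * (inverse \<delta> ^ 5 * (u n)\<^sup>2) * (LINT y|lborel. \<bar>f2 y\<bar>)" by simp
    qed
    have "(\<lambda>n. B * (inverse \<delta> ^ 5 * (u n)\<^sup>2) * (LINT y|lborel. \<bar>f2 y\<bar>)) \<longlonglongrightarrow> B * (inverse \<delta> ^ 5 * 0\<^sup>2) * (LINT y|lborel. \<bar>f2 y\<bar>)"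
      by (intro tendsto_intros u0)
    then show "(\<lambda>n. B * (inverse \<delta> ^ 5 * (u n)\<^sup>2) * (LINT y|lborel. \<bar>f2 y\<bar>)) \<longlonglongrightarrow> 0" by simp
  qed
  have i1: "integrable lborel (\<lambda>y. inverse (u n) ^ 3 * \<Psi> (inverse (u n) *\<^sub>R (x - y)) * f1 y)" for n
  proof -
    have "integrable lborel (\<lambda>z. \<Psi> z * f1 (x - u n *\<^sub>R z))"
      using \<Psi>i f1b C(1) by (intro Bochner_Integration.integrable_bound[OF integrable_mult_left[OF integrable_abs[OF \<Psi>i], of "C * \<delta> powr (-a)"]])
        (auto simp: abs_mult intro!: AE_I2 mult_left_mono)
    then have "integrable lborel (\<lambda>z. inverse (u n) ^ 3 * (\<Psi> z * f1 (x - u n *\<^sub>R z)))" by simp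
    then show ?thesis
      using up[of n] integrable_affine[of "- u n" "\<lambda>y. inverse (u n) ^ 3 * \<Psi> (inverse (u n) *\<^sub>R (x - y)) * f1 y" x]
      by (simp add: mult.assoc)
  qed
  have "(LINT y|lborel. inverse (u n) ^ 3 * \<Psi> (inverse (u n) *\<^sub>R (x - y)) * f y)
     = (LINT z|lborel. \<Psi> z * f1 (x - u n *\<^sub>R z)) + (LINT y|lborel. inverse (u n) ^ 3 * \<Psi> (inverse (u n) *\<^sub>R (x - y)) * f2 y)" for n
    unfolding conv1[symmetric] using Bochner_Integration.integral_add[OF i1[of n] i2[of n]] by (simp add: f12 distrib_left)
  with tendsto_add[OF 1 2] show "((\<lambda>\<epsilon>. LINT y|lborel. inverse \<epsilon> ^ 3 * \<Psi> (inverse \<epsilon> *\<^sub>R (x - y)) * f y) \<circ> u)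
     \<longlonglongrightarrow> f x * (LINT z|lborel. \<Psi> z)"
    by (simp add: o_def mult.commute)
qed

section \<open>Regularised kernels\<close>

text \<open>A smooth substitute for \<open>|z| powr (- q)\<close>; its partial derivatives stay within the same family.\<close>

definition reg :: "real \<Rightarrow> real \<Rightarrow> space \<Rightarrow> real" where
  "reg \<epsilon> q z = ((norm z)\<^sup>2 + \<epsilon>\<^sup>2) powr (- q / 2)"

lemma reg_measurable [measurable]: "reg \<epsilon> q \<in> borel_measurable borel"
  unfolding reg_def[abs_def] by measurable

lemma reg_nonneg: "0 \<le> reg \<epsilon> q z" by (simp add: reg_def)

lemma reg_bound:
  assumes e: "\<epsilon> > 0" and q: "0 \<le> q"
  shows "\<bar>reg \<epsilon> q z\<bar> \<le> (2 * (1 + 1 / \<epsilon>\<^sup>2)) powr (q / 2) * (1 + norm z) powr (-q)"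
proof -
  let ?A = "2 * (1 + 1 / \<epsilon>\<^sup>2)" and ?D = "(norm z)\<^sup>2 + \<epsilon>\<^sup>2"
  have D: "?D > 0" using e by (simp add: add_nonneg_pos)
  have "0 \<le> (norm z - 1)\<^sup>2" by simp
  then have "(1 + norm z)\<^sup>2 \<le> 2 * (1 + (norm z)\<^sup>2)" by (simp add: power2_eq_square algebra_simps)
  also have "\<dots> \<le> ?A * ?D" using e by (simp add: field_simps)
  finally have "(?A * ?D) powr (- q / 2) \<le> ((1 + norm z)\<^sup>2) powr (- q / 2)"
    using q e by (intro powr_mono2') (auto simp: add_pos_nonneg add_nonneg_eq_0_iff)
  also have "((1 + norm z)\<^sup>2) powr (- q / 2) = (1 + norm z) powr (-q)"
  proof -
    have "((1 + norm z)\<^sup>2) powr (- q / 2) = ((1 + norm z) powr 2) powr (- q / 2)"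
      by (subst powr_numeral) (auto simp: add_pos_nonneg)
    then show ?thesis by (simp only: powr_powr) simp
  qed
  finally have "?A powr (q / 2) * (?A * ?D) powr (- q / 2) \<le> ?A powr (q / 2) * (1 + norm z) powr (-q)"
    by (rule mult_left_mono) simp
  moreover have "?A powr (q / 2) * (?A * ?D) powr (- q / 2) = reg \<epsilon> q z"
  proof -
    have "?A > 0" using e by (simp add: add_pos_pos)
    then have "?A powr (q / 2) * ?A powr (- q / 2) = 1" by (simp add: powr_add[symmetric])
    then show ?thesis using e by (simp add: powr_mult reg_def mult.assoc[symmetric])
  qed
  ultimately show ?thesis using reg_nonneg[of \<epsilon> q z] by simp
qed

lemma reg_comp: assumes "\<epsilon> > 0" shows "\<bar>z $ j * reg \<epsilon> q z\<bar> \<le> reg \<epsilon> (q - 1) z"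
proof -
  have D: "(norm z)\<^sup>2 + \<epsilon>\<^sup>2 > 0" using assms by (simp add: add_nonneg_pos)
  have "\<bar>z $ j\<bar> \<le> norm z" by (rule component_le_norm_cart)
  also have "\<dots> \<le> sqrt ((norm z)\<^sup>2 + \<epsilon>\<^sup>2)" by (rule real_le_rsqrt) simp
  also have "\<dots> = ((norm z)\<^sup>2 + \<epsilon>\<^sup>2) powr (1/2)" using D by (simp add: powr_half_sqrt)
  finally have "\<bar>z $ j\<bar> * reg \<epsilon> q z \<le> ((norm z)\<^sup>2 + \<epsilon>\<^sup>2) powr (1/2) * reg \<epsilon> q z"
    by (intro mult_right_mono reg_nonneg)
  also have "\<dots> = reg \<epsilon> (q - 1) z"
    unfolding reg_def using D by (simp add: powr_add[symmetric] add_divide_distrib[symmetric] diff_divide_distrib)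
  finally show ?thesis by (simp add: abs_mult reg_nonneg)
qed

lemma norm_axis_line: "(norm (z + t *\<^sub>R axis k 1 :: space))\<^sup>2 = (norm z)\<^sup>2 + 2 * t * z $ k + t\<^sup>2"
  unfolding power2_norm_eq_inner inner_add_left inner_add_right
  by (simp add: inner_axis inner_axis' power2_eq_square algebra_simps)

lemma pderiv_reg: assumes "\<epsilon> > 0" shows "pderiv_on UNIV k (reg \<epsilon> q) (\<lambda>z. - q * (z $ k * reg \<epsilon> (q + 2) z))"
  unfolding pderiv_on_def
proof
  fix z :: space
  have D: "(norm z)\<^sup>2 + \<epsilon>\<^sup>2 > 0" using assms by (simp add: add_nonneg_pos)
  have "((\<lambda>t. ((norm z)\<^sup>2 + 2 * t * z $ k + t\<^sup>2 + \<epsilon>\<^sup>2) powr (- q / 2)) has_real_derivative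
     (- q / 2) * ((norm z)\<^sup>2 + 2 * 0 * z $ k + 0\<^sup>2 + \<epsilon>\<^sup>2) powr (- q / 2 - 1) * (2 * z $ k)) (at 0)"
    using D by (auto intro!: derivative_eq_intros DERIV_powr simp: powr_diff)
  moreover have "- (q / 2) - 1 = (- q - 2) / 2" by (simp add: field_simps)
  ultimately show "((\<lambda>t. reg \<epsilon> q (z + t *\<^sub>R axis k 1)) has_real_derivative - q * (z $ k * reg \<epsilon> (q + 2) z)) (at 0)"
    unfolding reg_def norm_axis_line by (simp add: mult_ac)
qed

lemma pderiv_component: "pderiv_on S k (\<lambda>z. z $ i) (\<lambda>z. if i = k then 1 else 0)"
  unfolding pderiv_on_def by (auto intro!: derivative_eq_intros simp: axis_def)

lemma pderiv_mult:
  assumes "pderiv_on S k f f'" "pderiv_on S k g g'"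
  shows "pderiv_on S k (\<lambda>x. f x * g x) (\<lambda>x. f' x * g x + f x * g' x)"
  using assms unfolding pderiv_on_def by (auto intro!: derivative_eq_intros)

lemma pderiv_add:
  assumes "pderiv_on S k f f'" "pderiv_on S k g g'"
  shows "pderiv_on S k (\<lambda>x. f x + g x) (\<lambda>x. f' x + g' x)"
  using assms unfolding pderiv_on_def by (auto intro!: derivative_eq_intros)

lemma pderiv_cmult:
  assumes "pderiv_on S k f f'"
  shows "pderiv_on S k (\<lambda>x. c * f x) (\<lambda>x. c * f' x)"
  using assms unfolding pderiv_on_def by (auto intro!: derivative_eq_intros)

lemma pderiv_sum:
  assumes "\<And>i. i \<in> I \<Longrightarrow> pderiv_on S k (f i) (f' i)"
  shows "pderiv_on S k (\<lambda>x. \<Sum>i\<in>I. f i x) (\<lambda>x. \<Sum>i\<in>I. f' i x)"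
  using assms unfolding pderiv_on_def by (auto intro!: DERIV_sum)

lemma pderiv_cong:
  assumes "pderiv_on S k f f'" "\<And>x. x \<in> S \<Longrightarrow> f' x = g' x"
  shows "pderiv_on S k f g'"
  using assms unfolding pderiv_on_def by auto

lemma reg_limit:
  assumes [measurable]: "k \<in> borel_measurable borel" and i: "integrable lborel (\<lambda>y. norm (x - y) powr (-q) * k y)" and q: "0 \<le> q"
  shows "((\<lambda>\<epsilon>. LINT y|lborel. reg \<epsilon> q (x - y) * k y) \<longlongrightarrow> (LINT y|lborel. norm (x - y) powr (-q) * k y)) (at_right 0)"
  unfolding tendsto_at_iff_sequentially
proof (intro allI impI)
  fix u :: "nat \<Rightarrow> real" assume u: "\<forall>i. u i \<in> {0<..} - {0}" and u0: "u \<longlonglongrightarrow> 0"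
  have sq: "((norm w)\<^sup>2) powr (- q / 2) = norm w powr (-q)" for w :: space
  proof (cases "w = 0")
    case False
    then have "((norm w)\<^sup>2) powr (- q / 2) = (norm w powr 2) powr (- q / 2)" by (subst powr_numeral) auto
    then show ?thesis by (simp only: powr_powr) simp
  qed simp
  have "(\<lambda>n. LINT y|lborel. reg (u n) q (x - y) * k y) \<longlonglongrightarrow> (LINT y|lborel. norm (x - y) powr (-q) * k y)"
  proof (rule integral_dominated_convergence[OF _ _ integrable_norm[OF i]])
    show "AE y in lborel. (\<lambda>n. reg (u n) q (x - y) * k y) \<longlonglongrightarrow> norm (x - y) powr (-q) * k y"
      using AE_lborel_singleton[of x]
    proof eventually_elim
      fix y assume y: "y \<noteq> x"
      have "(\<lambda>n. reg (u n) q (x - y)) \<longlonglongrightarrow> ((norm (x - y))\<^sup>2 + 0\<^sup>2) powr (- q / 2)"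
        unfolding reg_def using y by (intro tendsto_intros u0) auto
      then show "(\<lambda>n. reg (u n) q (x - y) * k y) \<longlonglongrightarrow> norm (x - y) powr (-q) * k y"
        using sq[of "x - y"] by (intro tendsto_mult_right) simp
    qed
    show "AE y in lborel. norm (reg (u n) q (x - y) * k y) \<le> norm (norm (x - y) powr (-q) * k y)" for n
      using AE_lborel_singleton[of x]
    proof eventually_elim
      fix y assume y: "y \<noteq> x"
      have "reg (u n) q (x - y) \<le> ((norm (x - y))\<^sup>2) powr (- q / 2)"
        unfolding reg_def using y q by (intro powr_mono2') auto
      then have "reg (u n) q (x - y) \<le> norm (x - y) powr (-q)" using sq by simp
      then show "norm (reg (u n) q (x - y) * k y) \<le> norm (norm (x - y) powr (-q) * k y)"
        by (simp add: abs_mult reg_nonneg mult_right_mono)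
    qed
  qed auto
  then show "((\<lambda>\<epsilon>. LINT y|lborel. reg \<epsilon> q (x - y) * k y) \<circ> u) \<longlonglongrightarrow> (LINT y|lborel. norm (x - y) powr (-q) * k y)"
    by (simp add: o_def)
qed

lemma reg_integrable:
  assumes "power_bounded a f" "a < 3" "3 < a + q" "0 \<le> q" "\<epsilon> > 0"
  shows "integrable lborel (\<lambda>y. reg \<epsilon> q (x - y) * f y)"
  using assms by (intro power_bounded_integrable[OF assms(1,2), of q _ "(2 * (1 + 1 / \<epsilon>\<^sup>2)) powr (q / 2)"] reg_bound) auto

lemma reg_comp_integrable:
  assumes "power_bounded a f" "a < 3" "4 < a + q" "1 \<le> q" "\<epsilon> > 0"
  shows "integrable lborel (\<lambda>y. (x - y) $ j * reg \<epsilon> q (x - y) * f y)"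
  using assms by (intro power_bounded_integrable[OF assms(1,2), of "q - 1" "\<lambda>z. z $ j * reg \<epsilon> q z" "(2 * (1 + 1 / \<epsilon>\<^sup>2)) powr ((q - 1) / 2)"]
      order_trans[OF reg_comp order_trans[OF abs_ge_self reg_bound]]) auto

lemma reg_comp2_integrable:
  assumes "power_bounded a f" "a < 3" "5 < a + q" "2 \<le> q" "\<epsilon> > 0"
  shows "integrable lborel (\<lambda>y. (x - y) $ i * (x - y) $ j * reg \<epsilon> q (x - y) * f y)"
proof (rule power_bounded_integrable[OF assms(1,2), of "q - 2" "\<lambda>z. z $ i * z $ j * reg \<epsilon> q z" "(2 * (1 + 1 / \<epsilon>\<^sup>2)) powr ((q - 2) / 2)"])
  show "\<bar>z $ i * z $ j * reg \<epsilon> q z\<bar> \<le> (2 * (1 + 1 / \<epsilon>\<^sup>2)) powr ((q - 2) / 2) * (1 + norm z) powr - (q - 2)" for z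
  proof -
    have "\<bar>z $ i * z $ j * reg \<epsilon> q z\<bar> = \<bar>z $ i\<bar> * \<bar>z $ j * reg \<epsilon> q z\<bar>" by (simp add: abs_mult)
    also have "\<dots> \<le> \<bar>z $ i\<bar> * reg \<epsilon> (q - 1) z" using assms by (intro mult_left_mono reg_comp) auto
    also have "\<dots> = \<bar>z $ i * reg \<epsilon> (q - 1) z\<bar>" by (simp add: abs_mult reg_nonneg)
    also have "\<dots> \<le> \<bar>reg \<epsilon> (q - 2) z\<bar>" using reg_comp[of \<epsilon> z i "q - 1"] assms by (simp add: reg_nonneg)
    also have "\<dots> \<le> (2 * (1 + 1 / \<epsilon>\<^sup>2)) powr ((q - 2) / 2) * (1 + norm z) powr - (q - 2)"
      using assms by (intro reg_bound) auto
    finally show ?thesis .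
  qed
qed (use assms in auto)

section \<open>The Riesz transform of a differentiable function\<close>

text \<open>The difference of the truncated and the regularised Riesz kernel at scale one. It decays like
  \<open>|z| powr (-5)\<close> and is odd, so that its rescalings form an approximate identity of mass zero.\<close>

definition trunc_defect :: "3 \<Rightarrow> space \<Rightarrow> real" where
  "trunc_defect j z = z $ j * (reg 1 4 z - (if 1 < norm z then 1 / norm z ^ 4 else 0))"

lemma trunc_defect_measurable [measurable]: "trunc_defect j \<in> borel_measurable borel"
  unfolding trunc_defect_def[abs_def] by measurable

lemma reg_4: "\<epsilon> \<noteq> 0 \<Longrightarrow> reg \<epsilon> 4 z = 1 / ((norm z)\<^sup>2 + \<epsilon>\<^sup>2)\<^sup>2"
  by (simp add: reg_def powr_minus inverse_eq_divide add_nonneg_pos flip: powr_numeral)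

lemma trunc_defect_bound: "\<bar>trunc_defect j z\<bar> \<le> 96 * (1 + norm z) powr (-5)"
proof (cases "1 < norm z")
  case False
  have "reg 1 4 z \<le> 1" by (simp add: reg_4 divide_le_eq_1 one_le_power)
  moreover have "\<bar>z $ j\<bar> \<le> 1" using component_le_norm_cart[of z j] False by simp
  ultimately have "\<bar>trunc_defect j z\<bar> \<le> 1 * 1"
    using False reg_nonneg[of 1 4 z] unfolding trunc_defect_def by (simp add: abs_mult mult_le_one)
  moreover have "(1 + norm z) powr 5 \<le> 2 powr 5" using False by (intro powr_mono2) auto
  then have "(1 + norm z) ^ 5 \<le> 32" by (simp add: add_pos_nonneg flip: powr_numeral)
  then have "1 \<le> 96 * (1 + norm z) powr (-5)"
    by (simp add: powr_minus divide_inverse[symmetric] le_divide_eq add_pos_nonneg zero_less_power add_nonneg_eq_0_iff)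
  ultimately show ?thesis by simp
next
  case True
  let ?r = "norm z"
  have r: "?r > 0" using True by linarith
  have "1 / ?r ^ 4 - 1 / (?r\<^sup>2 + 1)\<^sup>2 = ((?r\<^sup>2 + 1)\<^sup>2 - ?r ^ 4) / (?r ^ 4 * (?r\<^sup>2 + 1)\<^sup>2)"
    using r by (subst diff_frac_eq) (auto simp: add_nonneg_eq_0_iff)
  also have "(?r\<^sup>2 + 1)\<^sup>2 - ?r ^ 4 = 2 * ?r\<^sup>2 + 1" by (simp add: power2_eq_square power4_eq_xxxx algebra_simps)
  also have "(2 * ?r\<^sup>2 + 1) / (?r ^ 4 * (?r\<^sup>2 + 1)\<^sup>2) \<le> (3 * ?r\<^sup>2) / (?r ^ 4 * (?r\<^sup>2)\<^sup>2)"
    using True r by (intro frac_le mult_left_mono power_mono) (auto simp: one_le_power)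
  also have "\<dots> = 3 / ?r ^ 6" using r by (simp add: field_simps power2_eq_square power_numeral_reduce)
  finally have d: "1 / ?r ^ 4 - reg 1 4 z \<le> 3 / ?r ^ 6" by (simp add: reg_4)
  have "(?r\<^sup>2)\<^sup>2 \<le> (?r\<^sup>2 + 1\<^sup>2)\<^sup>2" by (intro power_mono) auto
  then have "?r ^ 4 \<le> (?r\<^sup>2 + 1\<^sup>2)\<^sup>2" by (simp add: power_mult[symmetric])
  then have "reg 1 4 z \<le> 1 / ?r ^ 4"
    unfolding reg_4[OF one_neq_zero] using r by (intro frac_le) auto
  moreover have "\<bar>z $ j\<bar> * (1 / ?r ^ 4 - reg 1 4 z) \<le> ?r * (3 / ?r ^ 6)"
    using d component_le_norm_cart[of z j] \<open>reg 1 4 z \<le> 1 / ?r ^ 4\<close> by (intro mult_mono) auto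
  ultimately have "\<bar>trunc_defect j z\<bar> \<le> ?r * (3 / ?r ^ 6)"
    using True unfolding trunc_defect_def by (simp add: abs_mult)
  also have "\<dots> = 3 * ?r powr (-5)" using r by (simp add: powr_minus field_simps power_numeral_reduce)
  finally have t: "\<bar>trunc_defect j z\<bar> \<le> 3 * ?r powr (-5)" .
  have "?r powr (-5) \<le> ((1 + ?r) / 2) powr (-5)" using True by (intro powr_mono2') auto
  also have "\<dots> = 32 * (1 + ?r) powr (-5)" by (simp add: powr_divide powr_minus inverse_eq_divide)
  finally show ?thesis using t by simp
qed

lemma trunc_defect_integral: "(LINT z|lborel. trunc_defect j z) = 0"
proof -
  have "(LINT z|lborel. trunc_defect j z) = (LINT z|lborel. trunc_defect j (0 - z))"
    by (rule integral_reflect[symmetric])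
  also have "\<dots> = (LINT z|lborel. - trunc_defect j z)"
    by (intro Bochner_Integration.integral_cong) (auto simp: trunc_defect_def reg_def)
  finally show ?thesis by simp
qed

lemma integral_cong_off_origin:
  fixes f g :: "space \<Rightarrow> 'b::{banach, second_countable_topology}"
  assumes "\<And>y. y \<noteq> 0 \<Longrightarrow> f y = g y"
  shows "integral\<^sup>L lborel f = integral\<^sup>L lborel g"
  by (rule integral_discrete_difference[where X = "{0}"]) (use assms in auto)

text \<open>Truncation at radius \<open>\<epsilon>\<close> and regularisation at scale \<open>\<epsilon>\<close> differ by a rescaled
  \<open>trunc_defect\<close>, hence have the same limit.\<close>

lemma principal_value_limit:
  assumes f: "power_bounded a f" and a: "0 < a" "a < 3" and x: "x \<noteq> 0"
    and L: "((\<lambda>\<epsilon>. LINT y|lborel. (x - y) $ j * reg \<epsilon> 4 (x - y) * f y) \<longlongrightarrow> L) (at_right 0)"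
  shows "((\<lambda>\<epsilon>. LINT y:{y. \<epsilon> < norm (x - y)}|lborel. (x $ j - y $ j) / norm (x - y) ^ 4 * f y) \<longlongrightarrow> L) (at_right 0)"
proof -
  have ai: "((\<lambda>\<epsilon>. LINT y|lborel. inverse \<epsilon> ^ 3 * trunc_defect j (inverse \<epsilon> *\<^sub>R (x - y)) * f y) \<longlongrightarrow> f x * (LINT z|lborel. trunc_defect j z)) (at_right 0)"
    by (rule approximate_identity[OF f _ a(2) x _ trunc_defect_bound]) (use a in auto)
  have "((\<lambda>\<epsilon>. (LINT y|lborel. (x - y) $ j * reg \<epsilon> 4 (x - y) * f y)
     - (LINT y|lborel. inverse \<epsilon> ^ 3 * trunc_defect j (inverse \<epsilon> *\<^sub>R (x - y)) * f y)) \<longlongrightarrow> L - f x * 0) (at_right 0)"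
    using tendsto_diff[OF L ai] by (simp add: trunc_defect_integral)
  moreover have "\<forall>\<^sub>F \<epsilon> in at_right 0. (LINT y|lborel. (x - y) $ j * reg \<epsilon> 4 (x - y) * f y)
     - (LINT y|lborel. inverse \<epsilon> ^ 3 * trunc_defect j (inverse \<epsilon> *\<^sub>R (x - y)) * f y)
     = (LINT y:{y. \<epsilon> < norm (x - y)}|lborel. (x $ j - y $ j) / norm (x - y) ^ 4 * f y)"
    using eventually_at_right_less[of "0::real"]
  proof eventually_elim
    fix \<epsilon> :: real assume e: "0 < \<epsilon>"
    have td: "inverse \<epsilon> ^ 3 * trunc_defect j (inverse \<epsilon> *\<^sub>R w)
       = w $ j * reg \<epsilon> 4 w - (if \<epsilon> < norm w then w $ j / norm w ^ 4 else 0)" for w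
    proof -
      have "(inverse \<epsilon> * norm w)\<^sup>2 + 1 = ((norm w)\<^sup>2 + \<epsilon>\<^sup>2) / \<epsilon>\<^sup>2"
        using e by (simp add: field_simps power2_eq_square)
      then have "reg 1 4 (inverse \<epsilon> *\<^sub>R w) = \<epsilon> ^ 4 * reg \<epsilon> 4 w"
        using e by (simp add: reg_4 power_divide field_simps power4_eq_xxxx power2_eq_square)
      moreover have "(1 < inverse \<epsilon> * norm w) = (\<epsilon> < norm w)" using e by (simp add: field_simps)
      ultimately show ?thesis using e
        by (auto simp: trunc_defect_def field_simps power_numeral_reduce)
    qed
    have i1: "integrable lborel (\<lambda>y. (x - y) $ j * reg \<epsilon> 4 (x - y) * f y)"
      using a e by (intro reg_comp_integrable[OF f]) auto
    have i2: "integrable lborel (\<lambda>y. (if \<epsilon> < norm (x - y) then (x - y) $ j / norm (x - y) ^ 4 else 0) * f y)"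
    proof (rule power_bounded_integrable[OF f a(2), of 3 "\<lambda>w. (if \<epsilon> < norm w then w $ j / norm w ^ 4 else 0)" "(1 + 1 / \<epsilon>) powr 3"])
      show "\<bar>if \<epsilon> < norm z then z $ j / norm z ^ 4 else 0\<bar> \<le> (1 + 1 / \<epsilon>) powr 3 * (1 + norm z) powr - 3" for z
      proof (cases "\<epsilon> < norm z")
        case True
        then have n: "norm z > 0" using e by linarith
        have "\<bar>z $ j / norm z ^ 4\<bar> \<le> norm z / norm z ^ 4"
          using component_le_norm_cart[of z j] by (simp add: divide_right_mono)
        also have "\<dots> = norm z powr (-3)" using n by (simp add: powr_minus field_simps power_numeral_reduce)
        also have "\<dots> \<le> ((1 + norm z) / (1 + 1 / \<epsilon>)) powr (-3)"
          using n e True by (intro powr_mono2') (auto simp: field_simps add_pos_pos)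
        also have "\<dots> = (1 + 1 / \<epsilon>) powr 3 * (1 + norm z) powr - 3"
          by (simp add: powr_divide powr_minus field_simps)
        finally show ?thesis using True by simp
      qed auto
    qed (use a in auto)
    have "(LINT y|lborel. inverse \<epsilon> ^ 3 * trunc_defect j (inverse \<epsilon> *\<^sub>R (x - y)) * f y)
      = (LINT y|lborel. (x - y) $ j * reg \<epsilon> 4 (x - y) * f y - (if \<epsilon> < norm (x - y) then (x - y) $ j / norm (x - y) ^ 4 else 0) * f y)"
      by (intro Bochner_Integration.integral_cong refl) (simp only: td left_diff_distrib)
    also have "\<dots> = (LINT y|lborel. (x - y) $ j * reg \<epsilon> 4 (x - y) * f y)
       - (LINT y|lborel. (if \<epsilon> < norm (x - y) then (x - y) $ j / norm (x - y) ^ 4 else 0) * f y)"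
      by (rule Bochner_Integration.integral_diff[OF i1 i2])
    also have "(LINT y|lborel. (if \<epsilon> < norm (x - y) then (x - y) $ j / norm (x - y) ^ 4 else 0) * f y)
      = (LINT y:{y. \<epsilon> < norm (x - y)}|lborel. (x $ j - y $ j) / norm (x - y) ^ 4 * f y)"
      unfolding set_lebesgue_integral_def by (intro Bochner_Integration.integral_cong) (auto simp: indicator_def)
    finally show "(LINT y|lborel. (x - y) $ j * reg \<epsilon> 4 (x - y) * f y)
     - (LINT y|lborel. inverse \<epsilon> ^ 3 * trunc_defect j (inverse \<epsilon> *\<^sub>R (x - y)) * f y)
     = (LINT y:{y. \<epsilon> < norm (x - y)}|lborel. (x $ j - y $ j) / norm (x - y) ^ 4 * f y)" by simp
  qed
  ultimately show ?thesis by (subst (asm) tendsto_cong) auto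
qed

lemma riesz_eq_limit:
  assumes f: "power_bounded a f" and a: "0 < a" "a < 3" and x: "x \<noteq> 0"
    and L: "((\<lambda>\<epsilon>. LINT y|lborel. (x - y) $ j * reg \<epsilon> 4 (x - y) * f y) \<longlongrightarrow> L) (at_right 0)"
    and h: "\<And>y. y \<noteq> 0 \<Longrightarrow> h y = \<kappa> * complex_of_real (f y)"
  shows "riesz j h x = \<i> / of_real (pi\<^sup>2) * (\<kappa> * complex_of_real L)"
proof -
  have "(LINT y:{y. \<epsilon> < norm (x - y)}|lborel. of_real ((x $ j - y $ j) / norm (x - y) ^ 4) * h y)
     = \<kappa> * of_real (LINT y:{y. \<epsilon> < norm (x - y)}|lborel. (x $ j - y $ j) / norm (x - y) ^ 4 * f y)" for \<epsilon>
  proof -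
    have "(LINT y:{y. \<epsilon> < norm (x - y)}|lborel. of_real ((x $ j - y $ j) / norm (x - y) ^ 4) * h y)
      = (LINT y|lborel. \<kappa> * of_real (indicator {y. \<epsilon> < norm (x - y)} y *\<^sub>R ((x $ j - y $ j) / norm (x - y) ^ 4 * f y)))"
      unfolding set_lebesgue_integral_def
      by (rule integral_cong_off_origin) (auto simp: h indicator_def)
    then show ?thesis unfolding set_lebesgue_integral_def
      by (simp only: integral_mult_right_zero integral_complex_of_real)
  qed
  moreover have "((\<lambda>\<epsilon>. \<kappa> * complex_of_real (LINT y:{y. \<epsilon> < norm (x - y)}|lborel. (x $ j - y $ j) / norm (x - y) ^ 4 * f y)) \<longlongrightarrow> \<kappa> * of_real L) (at_right 0)"
    by (intro tendsto_intros principal_value_limit[OF f a x L])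
  ultimately show ?thesis unfolding riesz_def
    by (simp add: tendsto_Lim)
qed

text \<open>The Riesz kernel is \<open>-1/2\<close> times a derivative of \<open>|z| powr (-2)\<close>; moving the derivative to \<open>f\<close>
  turns the principal value into an absolutely convergent potential. The integration by parts is a
  hypothesis, since for the second of two transforms it is available although the function
  transformed is not known to be differentiable.\<close>

lemma riesz_of_by_parts:
  assumes f: "power_bounded a f" and a: "0 < a" "a < 3" and f': "power_bounded b f'" and b: "1 < b" "b < 3" and x: "x \<noteq> 0"
    and bp: "\<And>\<epsilon>. \<epsilon> > 0 \<Longrightarrow> (LINT y|lborel. (-2 * ((x - y) $ j * reg \<epsilon> 4 (x - y))) * f y) = (LINT y|lborel. reg \<epsilon> 2 (x - y) * f' y)"
    and h: "\<And>y. y \<noteq> 0 \<Longrightarrow> h y = \<kappa> * complex_of_real (f y)"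
  shows "riesz j h x = - (\<i> / (2 * of_real (pi\<^sup>2))) * (\<kappa> * complex_of_real (Ipot f' x))"
proof -
  have "((\<lambda>\<epsilon>. LINT y|lborel. reg \<epsilon> 2 (x - y) * f' y) \<longlongrightarrow> Ipot f' x) (at_right 0)"
    unfolding Ipot_def by (intro reg_limit power_bounded_measurable[OF f'] power_bounded_Ipot_integrable[OF f' b x]) auto
  then have "((\<lambda>\<epsilon>. (-1/2) * (LINT y|lborel. reg \<epsilon> 2 (x - y) * f' y)) \<longlongrightarrow> (-1/2) * Ipot f' x) (at_right 0)"
    by (intro tendsto_intros)
  moreover have "\<forall>\<^sub>F \<epsilon> in at_right 0. (-1/2) * (LINT y|lborel. reg \<epsilon> 2 (x - y) * f' y)
      = (LINT y|lborel. (x - y) $ j * reg \<epsilon> 4 (x - y) * f y)"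
    using eventually_at_right_less[of "0::real"]
  proof eventually_elim
    fix \<epsilon> :: real assume "0 < \<epsilon>"
    have "(LINT y|lborel. (-2 * ((x - y) $ j * reg \<epsilon> 4 (x - y))) * f y) = -2 * (LINT y|lborel. (x - y) $ j * reg \<epsilon> 4 (x - y) * f y)"
      by (simp only: mult.assoc integral_mult_right_zero)
    with bp[OF \<open>0 < \<epsilon>\<close>] show "(-1/2) * (LINT y|lborel. reg \<epsilon> 2 (x - y) * f' y)
      = (LINT y|lborel. (x - y) $ j * reg \<epsilon> 4 (x - y) * f y)" by simp
  qed
  ultimately have "((\<lambda>\<epsilon>. LINT y|lborel. (x - y) $ j * reg \<epsilon> 4 (x - y) * f y) \<longlongrightarrow> (-1/2) * Ipot f' x) (at_right 0)"
    by (subst (asm) tendsto_cong) auto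
  from riesz_eq_limit[OF f a x this h] show ?thesis by simp
qed

section \<open>The iterated Riesz transform\<close>

text \<open>Up to the factor \<open>4 \<pi>\<close>, the Newtonian potential.\<close>

definition Npot :: "(space \<Rightarrow> real) \<Rightarrow> space \<Rightarrow> real" where
  "Npot k x = (LINT y|lborel. norm (x - y) powr (-1) * k y)"

lemma power_bounded_abs: "power_bounded a f \<Longrightarrow> power_bounded a (\<lambda>x. \<bar>f x\<bar>)"
  unfolding power_bounded_def by (auto intro!: continuous_intros)

text \<open>Convolutions commute. This carries an integration by parts for \<open>g\<close> over to \<open>Ipot g\<close>.\<close>

lemma Ipot_convolution_swap:
  assumes g: "power_bounded a g" and a: "2 < a" "a < 3" and [measurable]: "M \<in> borel_measurable borel"
    and B: "\<And>z. \<bar>M z\<bar> \<le> B * (1 + norm z) powr (-2)"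
  shows "(LINT z|lborel. M (x - z) * Ipot g z)
       = (LINT w|lborel. norm w powr (-2) * (LINT y|lborel. M ((x - w) - y) * g y))"
proof -
  note [measurable] = power_bounded_measurable[OF g]
  let ?F = "\<lambda>z w. M (x - z) * (norm w powr (-2) * g (z - w))"
  have Ipot_alt: "Ipot h z = (LINT w|lborel. norm w powr (-2) * h (z - w))" for h z
    unfolding Ipot_def using integral_reflect[of "\<lambda>y. norm (z - y) powr (-2) * h y" z] by simp
  have int: "integrable lborel (\<lambda>w. norm w powr (-2) * g (z - w))" if "z \<noteq> 0" for z
    using power_bounded_Ipot_integrable[OF g _ a(2) that] integrable_reflect[of "\<lambda>y. norm (z - y) powr (-2) * g y" z] a by simp
  have F: "integrable (lborel \<Otimes>\<^sub>M lborel) (\<lambda>(z, w). ?F z w)"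
  proof (rule lborel_pair.Fubini_integrable)
    have "integrable lborel (\<lambda>z. \<bar>M (x - z)\<bar> * Ipot (\<lambda>y. \<bar>g y\<bar>) z)"
      by (rule power_bounded_integrable[OF power_bounded_Ipot[OF power_bounded_abs[OF g]], where p = 2 and B = B and M = "\<lambda>z. \<bar>M z\<bar>"]) (use a B in auto)
    then show "integrable lborel (\<lambda>z. LINT w|lborel. norm (case (z, w) of (z, w) \<Rightarrow> ?F z w))"
      by (simp add: abs_mult Ipot_alt)
    show "AE z in lborel. integrable lborel (\<lambda>w. case (z, w) of (z, w) \<Rightarrow> ?F z w)"
      using AE_lborel_singleton[of "0::space"] by eventually_elim (use int in auto)
  qed measurable
  have "(LINT z|lborel. M (x - z) * Ipot g z) = (LINT z|lborel. LINT w|lborel. ?F z w)"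
    by (simp add: Ipot_alt)
  also have "\<dots> = (LINT w|lborel. LINT z|lborel. ?F z w)"
    by (rule lborel_pair.Fubini_integral[symmetric]) (rule F)
  also have "\<dots> = (LINT w|lborel. norm w powr (-2) * (LINT y|lborel. M ((x - w) - y) * g y))"
  proof (rule Bochner_Integration.integral_cong[OF refl])
    fix w :: space
    have "(LINT z|lborel. ?F z w) = (LINT z|lborel. norm w powr (-2) * (M (x - z) * g (z - w)))"
      by (simp only: mult.left_commute)
    also have "\<dots> = norm w powr (-2) * (LINT z|lborel. M (x - z) * g (z - w))"
      by (rule integral_mult_right_zero)
    also have "(LINT z|lborel. M (x - z) * g (z - w)) = (LINT y|lborel. M (x - (y + w)) * g ((y + w) - w))"
      by (rule integral_translate[symmetric])
    finally show "(LINT z|lborel. ?F z w) = norm w powr (-2) * (LINT y|lborel. M ((x - w) - y) * g y)"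
      by (simp add: algebra_simps)
  qed
  finally show ?thesis .
qed

text \<open>By the convolution of two weights, \<open>|z| powr (-2)\<close> convolved with itself is
  \<open>riesz_mass 2 * |z| powr (-1)\<close>.\<close>

lemma Ipot_Ipot:
  assumes k: "power_bounded a k" and a: "2 < a" "a < 3" and x: "x \<noteq> 0"
  shows "Ipot (Ipot k) x = riesz_mass 2 * Npot k x"
proof -
  note [measurable] = power_bounded_measurable[OF k]
  let ?F = "\<lambda>z y. norm (x - z) powr (-2) * (norm (z - y) powr (-2) * k y)"
  have F: "integrable (lborel \<Otimes>\<^sub>M lborel) (\<lambda>(z, y). ?F z y)"
  proof (rule lborel_pair.Fubini_integrable)
    have "integrable lborel (\<lambda>z. norm (x - z) powr (-2) * Ipot (\<lambda>y. \<bar>k y\<bar>) z)"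
      by (rule power_bounded_Ipot_integrable[OF power_bounded_Ipot[OF power_bounded_abs[OF k]] _ _ x]) (use a in auto)
    then show "integrable lborel (\<lambda>z. LINT y|lborel. norm (case (z, y) of (z, y) \<Rightarrow> ?F z y))"
      by (simp add: abs_mult Ipot_def)
    show "AE z in lborel. integrable lborel (\<lambda>y. case (z, y) of (z, y) \<Rightarrow> ?F z y)"
      using AE_lborel_singleton[of "0::space"]
      by eventually_elim (use power_bounded_Ipot_integrable[OF k] a in auto)
  qed measurable
  have "Ipot (Ipot k) x = (LINT z|lborel. LINT y|lborel. ?F z y)"
    by (simp add: Ipot_def)
  also have "\<dots> = (LINT y|lborel. LINT z|lborel. ?F z y)"
    by (rule lborel_pair.Fubini_integral[symmetric]) (rule F)
  also have "\<dots> = (LINT y|lborel. riesz_mass 2 * (norm (x - y) powr (-1) * k y))"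
  proof (rule integral_discrete_difference[where X = "{x}"])
    fix y assume "y \<notin> {x}"
    then have xy: "x - y \<noteq> 0" by auto
    have "(LINT z|lborel. ?F z y) = (LINT z|lborel. norm (x - z) powr (-2) * norm (z - y) powr (-2)) * k y"
      by (simp add: mult.assoc[symmetric])
    also have "(LINT z|lborel. norm (x - z) powr (-2) * norm (z - y) powr (-2))
      = (LINT z|lborel. norm (x - (z + y)) powr (-2) * norm ((z + y) - y) powr (-2))"
      by (rule integral_translate[symmetric])
    also have "\<dots> = (LINT z|lborel. norm ((x - y) - z) powr (-2) * norm z powr (-2))"
      by (simp add: algebra_simps)
    also have "\<dots> = riesz_mass 2 * norm (x - y) powr (1 - 2)"
      by (rule integrable_conv_weight(2)[OF xy]) auto
    finally show "(LINT z|lborel. ?F z y) = riesz_mass 2 * (norm (x - y) powr (-1) * k y)" by simp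
  qed auto
  also have "\<dots> = riesz_mass 2 * Npot k x" unfolding Npot_def by (rule integral_mult_right_zero)
  finally show ?thesis .
qed

lemma pderiv_reg_2: "\<epsilon> > 0 \<Longrightarrow> pderiv_on UNIV k (reg \<epsilon> 2) (\<lambda>z. -2 * (z $ k * reg \<epsilon> 4 z))"
  using pderiv_reg[of \<epsilon> k 2] by simp

text \<open>Two Riesz transforms of \<open>g\<close> are the Newtonian potential of a second derivative of \<open>g\<close>. The
  second transform acts on a function that is differentiable only in the weak sense that its
  convolutions with smooth kernels can be integrated by parts.\<close>

lemma riesz_riesz:
  assumes g: "power_bounded (5/2) g" "power_bounded (5/2) gj" "power_bounded (5/2) gij"
    and dg: "pderiv_on (-{0}) j g gj" and dgj: "pderiv_on (-{0}) i gj gij" and x: "x \<noteq> 0"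
  shows "riesz i (riesz j (\<lambda>y. complex_of_real (g y))) x
       = complex_of_real (- (riesz_mass 2 / (4 * pi ^ 4)) * Npot gij x)"
proof -
  have inner: "riesz j (\<lambda>y. complex_of_real (g y)) y = - (\<i> / (2 * of_real (pi\<^sup>2))) * complex_of_real (Ipot gj y)" if y: "y \<noteq> 0" for y
  proof -
    have "riesz j (\<lambda>y. complex_of_real (g y)) y = - (\<i> / (2 * of_real (pi\<^sup>2))) * (1 * complex_of_real (Ipot gj y))"
    proof (rule riesz_of_by_parts[OF g(1) _ _ g(2) _ _ y])
      fix \<epsilon> :: real assume e: "\<epsilon> > 0"
      show "(LINT z|lborel. (-2 * ((y - z) $ j * reg \<epsilon> 4 (y - z))) * g z) = (LINT z|lborel. reg \<epsilon> 2 (y - z) * gj z)"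
        by (rule kernel_by_parts[OF dg pderiv_reg_2[OF e]])
          (use e reg_integrable[OF g(1), of 2 \<epsilon> y] reg_integrable[OF g(2), of 2 \<epsilon> y] reg_comp_integrable[OF g(1), of 4 \<epsilon> y j]
            in \<open>auto simp: mult.assoc\<close>)
    qed auto
    then show ?thesis by simp
  qed
  have I: "power_bounded (3/2) (Ipot gj)" "power_bounded (3/2) (Ipot gij)"
    using power_bounded_Ipot[OF g(2)] power_bounded_Ipot[OF g(3)] by simp_all
  have "riesz i (riesz j (\<lambda>y. complex_of_real (g y))) x
    = - (\<i> / (2 * of_real (pi\<^sup>2))) * ((- (\<i> / (2 * of_real (pi\<^sup>2)))) * complex_of_real (Ipot (Ipot gij) x))"
  proof (rule riesz_of_by_parts[OF I(1) _ _ I(2) _ _ x _ inner])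
    fix \<epsilon> :: real assume e: "\<epsilon> > 0"
    let ?B = "(2 * (1 + 1 / \<epsilon>\<^sup>2)) powr (2 / 2)" and ?B' = "(2 * (1 + 1 / \<epsilon>\<^sup>2)) powr (3 / 2)"
    have b2: "\<bar>reg \<epsilon> 2 z\<bar> \<le> ?B * (1 + norm z) powr (-2)" for z
      by (rule reg_bound[OF e]) simp
    have b4: "\<bar>-2 * (z $ i * reg \<epsilon> 4 z)\<bar> \<le> 2 * ?B' * (1 + norm z) powr (-2)" for z
    proof -
      have "\<bar>z $ i * reg \<epsilon> 4 z\<bar> \<le> ?B' * (1 + norm z) powr (-3)"
        using order_trans[OF reg_comp[OF e] order_trans[OF abs_ge_self reg_bound[OF e]], of "4" z i] by simp
      also have "\<dots> \<le> ?B' * (1 + norm z) powr (-2)"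
        by (intro mult_left_mono powr_mono) auto
      finally show ?thesis by (simp add: abs_mult)
    qed
    have "(LINT y|lborel. (-2 * ((x - y) $ i * reg \<epsilon> 4 (x - y))) * Ipot gj y)
       = (LINT w|lborel. norm w powr (-2) * (LINT y|lborel. (-2 * (((x - w) - y) $ i * reg \<epsilon> 4 ((x - w) - y))) * gj y))"
      by (rule Ipot_convolution_swap[OF g(2) _ _ _ b4]) auto
    also have "\<dots> = (LINT w|lborel. norm w powr (-2) * (LINT y|lborel. reg \<epsilon> 2 ((x - w) - y) * gij y))"
    proof (rule Bochner_Integration.integral_cong[OF refl], rule arg_cong[where f = "\<lambda>u. _ * u"])
      fix w :: space
      show "(LINT y|lborel. (-2 * (((x - w) - y) $ i * reg \<epsilon> 4 ((x - w) - y))) * gj y) = (LINT y|lborel. reg \<epsilon> 2 ((x - w) - y) * gij y)"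
        by (rule kernel_by_parts[OF dgj pderiv_reg_2[OF e]])
          (use e reg_integrable[OF g(2), of 2 \<epsilon> "x - w"] reg_integrable[OF g(3), of 2 \<epsilon> "x - w"] reg_comp_integrable[OF g(2), of 4 \<epsilon> "x - w" i]
            in \<open>auto simp: mult.assoc\<close>)
    qed
    also have "\<dots> = (LINT y|lborel. reg \<epsilon> 2 (x - y) * Ipot gij y)"
      by (rule Ipot_convolution_swap[OF g(3) _ _ _ b2, symmetric]) auto
    finally show "(LINT y|lborel. (-2 * ((x - y) $ i * reg \<epsilon> 4 (x - y))) * Ipot gj y) = (LINT y|lborel. reg \<epsilon> 2 (x - y) * Ipot gij y)" .
  qed auto
  also have "Ipot (Ipot gij) x = riesz_mass 2 * Npot gij x"
    by (rule Ipot_Ipot[OF g(3) _ _ x]) auto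
  also have "- (\<i> / (2 * of_real (pi\<^sup>2))) * ((- (\<i> / (2 * of_real (pi\<^sup>2)))) * complex_of_real (riesz_mass 2 * Npot gij x))
    = complex_of_real (- (riesz_mass 2 / (4 * pi ^ 4)) * Npot gij x)"
    by (simp add: field_simps power2_eq_square power4_eq_xxxx)
  finally show ?thesis .
qed

section \<open>The Newtonian potential of a Hessian\<close>

text \<open>Minus the Laplacian of the regularised kernel \<open>(|z|\<^sup>2 + 1) powr (-1/2)\<close>.\<close>

definition newton_bump :: "space \<Rightarrow> real" where
  "newton_bump z = 3 * reg 1 5 z"

lemma newton_bump_measurable [measurable]: "newton_bump \<in> borel_measurable borel"
  unfolding newton_bump_def[abs_def] by measurable

lemma newton_bump_integral: "(LINT z|lborel. newton_bump z) = 4 * pi"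
proof -
  have "(\<integral>\<^sup>+ z. ennreal (newton_bump z) \<partial>lborel) = (\<integral>\<^sup>+ (z::space). ennreal (3 * ((norm z)\<^sup>2 + 1) powr (-5/2)) \<partial>lborel)"
    by (simp add: newton_bump_def reg_def)
  also have "\<dots> = (\<integral>\<^sup>+ r. ennreal (4 * pi * r\<^sup>2) * ennreal (3 * (r\<^sup>2 + 1) powr (-5/2)) * indicator {0..} r \<partial>lborel)"
    by (rule nn_integral_radial) measurable
  also have "\<dots> = (\<integral>\<^sup>+ r. ennreal (4 * pi * (3 * r\<^sup>2 * (r\<^sup>2 + 1) powr (-5/2))) * indicator {0..} r \<partial>lborel)"
    by (intro nn_integral_cong) (simp add: ennreal_mult[symmetric] mult_ac)
  also have "\<dots> = ennreal (4 * pi - 4 * pi * (0 ^ 3 * (0\<^sup>2 + 1) powr (-3/2)))"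
  proof (rule nn_integral_FTC_atLeast)
    fix r :: real assume r: "0 \<le> r"
    have p: "r\<^sup>2 + 1 > 0" by (simp add: add_nonneg_pos)
    have e: "(r\<^sup>2 + 1) powr (-3/2) = (r\<^sup>2 + 1) * (r\<^sup>2 + 1) powr (-5/2)"
      using p powr_add[of "r\<^sup>2 + 1" 1 "-5/2"] by simp
    have "((\<lambda>r. 4 * pi * (r ^ 3 * (r\<^sup>2 + 1) powr (-3/2))) has_real_derivative
       4 * pi * (3 * r\<^sup>2 * (r\<^sup>2 + 1) powr (-3/2) + r ^ 3 * ((-3/2) * (r\<^sup>2 + 1) powr (-3/2 - 1) * (2 * r)))) (at r)"
      using p by (auto intro!: derivative_eq_intros DERIV_powr simp: powr_diff)
    also have "4 * pi * (3 * r\<^sup>2 * (r\<^sup>2 + 1) powr (-3/2) + r ^ 3 * ((-3/2) * (r\<^sup>2 + 1) powr (-3/2 - 1) * (2 * r)))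
      = 4 * pi * (3 * r\<^sup>2 * (r\<^sup>2 + 1) powr (-5/2))"
      unfolding e by (simp add: algebra_simps power2_eq_square power3_eq_cube)
    finally show "((\<lambda>r. 4 * pi * (r ^ 3 * (r\<^sup>2 + 1) powr (-3/2))) has_real_derivative 4 * pi * (3 * r\<^sup>2 * (r\<^sup>2 + 1) powr (-5/2))) (at r)" .
  next
    have "((\<lambda>r::real. r ^ 3 * (r\<^sup>2 + 1) powr (-3/2)) \<longlongrightarrow> 1) at_top" by real_asymp
    then have "((\<lambda>r::real. 4 * pi * (r ^ 3 * (r\<^sup>2 + 1) powr (-3/2))) \<longlongrightarrow> 4 * pi * 1) at_top"
      by (intro tendsto_intros)
    then show "((\<lambda>r::real. 4 * pi * (r ^ 3 * (r\<^sup>2 + 1) powr (-3/2))) \<longlongrightarrow> 4 * pi) at_top" by simp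
  qed auto
  finally show ?thesis
    by (subst integral_eq_nn_integral) (auto simp: newton_bump_def reg_nonneg)
qed

lemma power_bounded_Npot_integrable:
  assumes f: "power_bounded a f" and a: "2 < a" "a < 3" and x: "x \<noteq> 0"
  shows "integrable lborel (\<lambda>y. norm (x - y) powr (-1) * f y)"
proof (rule Bochner_Integration.integrable_bound)
  note [measurable] = power_bounded_measurable[OF f]
  have "integrable lborel (\<lambda>y. 2 * (1 + norm (x - y)) powr (-1) * f y)"
    by (rule power_bounded_integrable[OF f, where p = 1 and B = 2 and M = "\<lambda>z. 2 * (1 + norm z) powr (-1)"]) (use a in auto)
  moreover have "integrable lborel (\<lambda>y. norm (x - y) powr (-2) * f y)"
    by (rule power_bounded_Ipot_integrable[OF f _ _ x]) (use a in auto)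
  ultimately show "integrable lborel (\<lambda>y. \<bar>norm (x - y) powr (-2) * f y\<bar> + \<bar>2 * (1 + norm (x - y)) powr (-1) * f y\<bar>)"
    by (intro Bochner_Integration.integrable_add integrable_abs)
  show "AE y in lborel. norm (norm (x - y) powr (-1) * f y)
     \<le> norm (\<bar>norm (x - y) powr (-2) * f y\<bar> + \<bar>2 * (1 + norm (x - y)) powr (-1) * f y\<bar>)"
  proof (rule AE_I2)
    fix y
    have le: "r powr (-1) \<le> r powr (-2) + 2 * (1 + r) powr (-1)" if "0 \<le> r" for r :: real
    proof (cases "r = 0")
      case False
      then have r: "r > 0" using that by simp
      show ?thesis
      proof (cases "r \<le> 1")
        case True
        then have "r powr (-1) \<le> r powr (-2)" using r by (simp add: powr_minus field_simps power2_eq_square)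
        then show ?thesis by (simp add: add_increasing2)
      next
        case False
        then have "r powr (-1) \<le> 2 * (1 + r) powr (-1)" using r by (simp add: powr_minus field_simps)
        then show ?thesis by (simp add: add_increasing)
      qed
    qed simp
    have "norm (x - y) powr (-1) * \<bar>f y\<bar> \<le> (norm (x - y) powr (-2) + 2 * (1 + norm (x - y)) powr (-1)) * \<bar>f y\<bar>"
      by (intro mult_right_mono le) auto
    then show "norm (norm (x - y) powr (-1) * f y)
     \<le> norm (\<bar>norm (x - y) powr (-2) * f y\<bar> + \<bar>2 * (1 + norm (x - y)) powr (-1) * f y\<bar>)"
      by (simp add: abs_mult distrib_right)
  qed
qed (use power_bounded_measurable[OF f] in measurable)

text \<open>Think of \<open>F i j\<close> as \<open>\<partial>\<^sub>i \<partial>\<^sub>j w\<close>, of \<open>D i j k\<close> as \<open>\<partial>\<^sub>i \<partial>\<^sub>j \<partial>\<^sub>k w\<close>, and of \<open>gj\<close> as \<open>\<partial>\<^sub>j \<Delta> w\<close>. Derivatives are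
  passed between the regularised kernel and \<open>F\<close> one at a time until the Laplacian rests on the
  kernel, which makes an approximate identity of it. Only first derivatives of \<open>F\<close> occur on the way,
  and the exchange of indices uses the symmetry of \<open>D\<close> instead of the function \<open>w\<close>.\<close>

lemma Npot_hessian:
  fixes F :: "3 \<Rightarrow> 3 \<Rightarrow> space \<Rightarrow> real" and D :: "3 \<Rightarrow> 3 \<Rightarrow> 3 \<Rightarrow> space \<Rightarrow> real"
  assumes F: "\<And>i j. power_bounded (5/2) (F i j)" and D: "\<And>i j k. power_bounded (5/2) (D i j k)"
    and dF: "\<And>i j k. pderiv_on (-{0}) k (F i j) (D i j k)"
    and sym: "\<And>i j k y. y \<noteq> 0 \<Longrightarrow> D j k i y = D i j k y"
    and gj: "power_bounded (5/2) gj" "\<And>y. y \<noteq> 0 \<Longrightarrow> gj y = (\<Sum>k\<in>UNIV. D j k k y)"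
    and gij: "power_bounded (5/2) gij" "pderiv_on (-{0}) i gj gij" and x: "x \<noteq> 0"
  shows "Npot gij x = - (4 * pi) * F i j x"
proof -
  have key: "(LINT y|lborel. reg \<epsilon> 1 (x - y) * gij y) = - (LINT y|lborel. inverse \<epsilon> ^ 3 * newton_bump (inverse \<epsilon> *\<^sub>R (x - y)) * F i j y)"
    if e: "\<epsilon> > 0" for \<epsilon>
  proof -
    have d1: "pderiv_on UNIV k (reg \<epsilon> 1) (\<lambda>z. - (z $ k * reg \<epsilon> 3 z))" for k
      using pderiv_reg[OF e, of k 1] by simp
    \<comment> \<open>The second derivatives of \<open>reg \<epsilon> 1\<close>.\<close>
    define H where "H k l z = 3 * (z $ k * z $ l * reg \<epsilon> 5 z) - (if k = l then 1 else 0) * reg \<epsilon> 3 z" for k l z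
    have d2: "pderiv_on UNIV k (\<lambda>z. - (z $ l * reg \<epsilon> 3 z)) (H k l)" for k l
    proof -
      have "pderiv_on UNIV k (\<lambda>z. - (z $ l * reg \<epsilon> 3 z))
          (\<lambda>z. - ((if l = k then 1 else 0) * reg \<epsilon> 3 z + z $ l * (- 3 * (z $ k * reg \<epsilon> 5 z))))"
        using pderiv_cmult[OF pderiv_mult[OF pderiv_component[of UNIV k l] pderiv_reg[OF e, of k 3]], of "-1"] by simp
      then show ?thesis by (rule pderiv_cong) (auto simp: H_def)
    qed
    have i1: "integrable lborel (\<lambda>y. reg \<epsilon> 1 (x - y) * f y)" if "power_bounded (5/2) f" for f
      using that e by (intro reg_integrable) auto
    have i2: "integrable lborel (\<lambda>y. - ((x - y) $ k * reg \<epsilon> 3 (x - y)) * f y)" if "power_bounded (5/2) f" for f k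
      using reg_comp_integrable[OF that, of 3 \<epsilon> x k] e by simp
    have i3: "integrable lborel (\<lambda>y. H k l (x - y) * f y)" if "power_bounded (5/2) f" for f k l
    proof -
      have "integrable lborel (\<lambda>y. 3 * ((x - y) $ k * (x - y) $ l * reg \<epsilon> 5 (x - y) * f y) - (if k = l then 1 else 0) * (reg \<epsilon> 3 (x - y) * f y))"
        using e by (intro Bochner_Integration.integrable_diff integrable_mult_right reg_comp2_integrable[OF that] reg_integrable[OF that]) auto
      then show ?thesis by (simp add: H_def algebra_simps)
    qed
    have Hs: "H k l = H l k" for k l by (auto simp: H_def fun_eq_iff)
    have "(LINT y|lborel. reg \<epsilon> 1 (x - y) * gij y) = (LINT y|lborel. - ((x - y) $ i * reg \<epsilon> 3 (x - y)) * gj y)"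
      by (rule kernel_by_parts[OF gij(2) d1, symmetric]) (intro i1 i2 gj gij)+
    also have "\<dots> = (LINT y|lborel. (\<Sum>k\<in>UNIV. - ((x - y) $ i * reg \<epsilon> 3 (x - y)) * D j k k y))"
      by (rule integral_cong_off_origin) (simp add: gj(2) sum_distrib_left)
    also have "\<dots> = (\<Sum>k\<in>UNIV. (LINT y|lborel. - ((x - y) $ i * reg \<epsilon> 3 (x - y)) * D j k k y))"
      by (intro Bochner_Integration.integral_sum i2 D)
    also have "\<dots> = (\<Sum>k\<in>UNIV. (LINT y|lborel. H k i (x - y) * F j k y))"
      by (intro sum.cong refl kernel_by_parts[OF dF d2, symmetric] i2 i3 D F)
    also have "\<dots> = (\<Sum>k\<in>UNIV. (LINT y|lborel. H i k (x - y) * F j k y))"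
      by (subst Hs) (rule refl)
    also have "\<dots> = (\<Sum>k\<in>UNIV. (LINT y|lborel. - ((x - y) $ k * reg \<epsilon> 3 (x - y)) * D j k i y))"
      by (intro sum.cong refl kernel_by_parts[OF dF d2] i2 i3 D F)
    also have "\<dots> = (\<Sum>k\<in>UNIV. (LINT y|lborel. - ((x - y) $ k * reg \<epsilon> 3 (x - y)) * D i j k y))"
      by (intro sum.cong refl integral_cong_off_origin) (simp add: sym)
    also have "\<dots> = (\<Sum>k\<in>UNIV. (LINT y|lborel. H k k (x - y) * F i j y))"
      by (intro sum.cong refl kernel_by_parts[OF dF d2, symmetric] i2 i3 D F)
    also have "\<dots> = (LINT y|lborel. (\<Sum>k\<in>UNIV. H k k (x - y) * F i j y))"
      by (intro Bochner_Integration.integral_sum[symmetric] i3 F)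
    also have "\<dots> = (LINT y|lborel. - (inverse \<epsilon> ^ 3 * newton_bump (inverse \<epsilon> *\<^sub>R (x - y)) * F i j y))"
    proof (rule Bochner_Integration.integral_cong[OF refl])
      fix y
      let ?z = "x - y"
      have D: "(norm ?z)\<^sup>2 + \<epsilon>\<^sup>2 > 0" using e by (simp add: add_nonneg_pos)
      have "(\<Sum>k\<in>UNIV. H k k ?z) = 3 * (\<Sum>k\<in>UNIV. (?z $ k)\<^sup>2) * reg \<epsilon> 5 ?z - 3 * reg \<epsilon> 3 ?z"
        by (simp add: H_def sum_subtractf sum_distrib_left sum_distrib_right power2_eq_square mult_ac)
      also have "(\<Sum>k\<in>UNIV. (?z $ k)\<^sup>2) = (norm ?z)\<^sup>2"
        by (simp add: norm_vec_def L2_set_def sum_nonneg)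
      also have "reg \<epsilon> 3 ?z = ((norm ?z)\<^sup>2 + \<epsilon>\<^sup>2) * reg \<epsilon> 5 ?z"
        using D powr_add[of "(norm ?z)\<^sup>2 + \<epsilon>\<^sup>2" 1 "-5/2"] by (simp add: reg_def)
      also have "3 * (norm ?z)\<^sup>2 * reg \<epsilon> 5 ?z - 3 * (((norm ?z)\<^sup>2 + \<epsilon>\<^sup>2) * reg \<epsilon> 5 ?z) = - (3 * \<epsilon>\<^sup>2 * reg \<epsilon> 5 ?z)"
        by (simp add: algebra_simps)
      also have "3 * \<epsilon>\<^sup>2 * reg \<epsilon> 5 ?z = inverse \<epsilon> ^ 3 * newton_bump (inverse \<epsilon> *\<^sub>R ?z)"
      proof -
        have "(inverse \<epsilon> * norm ?z)\<^sup>2 + 1 = ((norm ?z)\<^sup>2 + \<epsilon>\<^sup>2) / \<epsilon>\<^sup>2"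
          using e by (simp add: field_simps power2_eq_square)
        then have "reg 1 5 (inverse \<epsilon> *\<^sub>R ?z) = (((norm ?z)\<^sup>2 + \<epsilon>\<^sup>2) / \<epsilon>\<^sup>2) powr (-5/2)"
          using e by (simp add: reg_def)
        also have "\<dots> = reg \<epsilon> 5 ?z * (\<epsilon>\<^sup>2) powr (5/2)"
          using e by (simp add: reg_def powr_divide powr_minus field_simps)
        also have "(\<epsilon>\<^sup>2) powr (5/2) = (\<epsilon> powr 2) powr (5/2)" using e by simp
        also have "\<dots> = \<epsilon> powr 5" by (simp only: powr_powr) simp
        also have "\<dots> = \<epsilon> ^ 5" using e by simp
        finally show ?thesis using e by (simp add: newton_bump_def field_simps power_numeral_reduce)
      qed
      finally show "(\<Sum>k\<in>UNIV. H k k (x - y) * F i j y) = - (inverse \<epsilon> ^ 3 * newton_bump (inverse \<epsilon> *\<^sub>R (x - y)) * F i j y)"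
        by (simp add: sum_distrib_right[symmetric])
    qed
    finally show ?thesis by simp
  qed
  have bb: "\<bar>newton_bump z\<bar> \<le> (3 * 4 powr (5/2)) * (1 + norm z) powr (-5)" for z
    using reg_bound[of 1 5 z] by (simp add: newton_bump_def abs_mult)
  have "((\<lambda>\<epsilon>. LINT y|lborel. inverse \<epsilon> ^ 3 * newton_bump (inverse \<epsilon> *\<^sub>R (x - y)) * F i j y) \<longlongrightarrow> F i j x * (LINT z|lborel. newton_bump z)) (at_right 0)"
    by (rule approximate_identity[OF F _ _ x _ bb]) auto
  then have "((\<lambda>\<epsilon>. - (LINT y|lborel. inverse \<epsilon> ^ 3 * newton_bump (inverse \<epsilon> *\<^sub>R (x - y)) * F i j y)) \<longlongrightarrow> - (F i j x * (4 * pi))) (at_right 0)"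
    unfolding newton_bump_integral by (rule tendsto_minus)
  moreover have "\<forall>\<^sub>F \<epsilon> in at_right 0. - (LINT y|lborel. inverse \<epsilon> ^ 3 * newton_bump (inverse \<epsilon> *\<^sub>R (x - y)) * F i j y) = (LINT y|lborel. reg \<epsilon> 1 (x - y) * gij y)"
    using eventually_at_right_less[of "0::real"] by eventually_elim (simp add: key)
  ultimately have "((\<lambda>\<epsilon>. LINT y|lborel. reg \<epsilon> 1 (x - y) * gij y) \<longlongrightarrow> - (F i j x * (4 * pi))) (at_right 0)"
    by (subst (asm) tendsto_cong) auto
  moreover have "((\<lambda>\<epsilon>. LINT y|lborel. reg \<epsilon> 1 (x - y) * gij y) \<longlongrightarrow> Npot gij x) (at_right 0)"
    unfolding Npot_def by (intro reg_limit power_bounded_measurable[OF gij(1)] power_bounded_Npot_integrable[OF gij(1) _ _ x]) auto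
  ultimately show ?thesis using tendsto_unique[OF trivial_limit_at_right_real] by (fastforce simp: mult_ac)
qed

section \<open>Radial profiles\<close>

text \<open>The exponent \<open>-1/4\<close> leaves room for a logarithm at the origin, while \<open>-5/4\<close> is still square integrable
  there in dimension three.\<close>

definition profile :: "real \<Rightarrow> real \<Rightarrow> (real \<Rightarrow> real) \<Rightarrow> (real \<Rightarrow> real) \<Rightarrow> bool" where
  "profile C R q q' \<longleftrightarrow> 0 < R \<and> continuous_on {0<..} q' \<and>
     (\<forall>r>0. (q has_real_derivative q' r) (at r) \<and>
        \<bar>q r\<bar> \<le> C * r powr (-1/4) \<and> \<bar>q' r\<bar> \<le> C * r powr (-5/4)) \<and>
     (\<forall>r\<ge>R. q r = 0 \<and> q' r = 0)"

text \<open>\<open>mean q r\<close> is the average over the ball of radius \<open>r\<close> of the radial function with profile \<open>q\<close>;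
  \<open>x \<mapsto> mean q |x| / 3 * x\<close> is the gradient of the radial solution \<open>w\<close> of \<open>\<Delta> w = q |x|\<close>.
  Accordingly \<open>hess q\<close> and \<open>third q q'\<close> are the second and third derivatives of \<open>w\<close>.\<close>

definition mean :: "(real \<Rightarrow> real) \<Rightarrow> real \<Rightarrow> real" where
  "mean q r = 3 / r ^ 3 * integral {0..r} (\<lambda>\<rho>. \<rho>\<^sup>2 * q \<rho>)"

definition hess :: "(real \<Rightarrow> real) \<Rightarrow> 3 \<Rightarrow> 3 \<Rightarrow> space \<Rightarrow> real" where
  "hess q i j x = (if i = j then 1 else 0) * (mean q (norm x) / 3)
     + x $ i * x $ j * ((q (norm x) - mean q (norm x)) / (norm x)\<^sup>2)"

definition third :: "(real \<Rightarrow> real) \<Rightarrow> (real \<Rightarrow> real) \<Rightarrow> 3 \<Rightarrow> 3 \<Rightarrow> 3 \<Rightarrow> space \<Rightarrow> real" where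
  "third q q' i j k x =
     ((if i = j then x $ k else 0) + (if i = k then x $ j else 0) + (if j = k then x $ i else 0))
       * ((q (norm x) - mean q (norm x)) / (norm x)\<^sup>2)
     + x $ i * x $ j * x $ k
       * (q' (norm x) / norm x ^ 3 - 5 * (q (norm x) - mean q (norm x)) / norm x ^ 4)"

lemma profileD:
  assumes "profile C R q q'"
  shows "0 < R" "continuous_on {0<..} q'" "0 \<le> C"
    "\<And>r. 0 < r \<Longrightarrow> (q has_real_derivative q' r) (at r)"
    "\<And>r. 0 < r \<Longrightarrow> \<bar>q r\<bar> \<le> C * r powr (-1/4)"
    "\<And>r. 0 < r \<Longrightarrow> \<bar>q' r\<bar> \<le> C * r powr (-5/4)"
    "\<And>r. R \<le> r \<Longrightarrow> q r = 0" "\<And>r. R \<le> r \<Longrightarrow> q' r = 0"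
proof -
  have "\<forall>r>0. \<bar>q r\<bar> \<le> C * r powr (-1/4)" using assms by (simp add: profile_def)
  from this[rule_format, of 1] show "0 \<le> C" by simp
qed (use assms in \<open>auto simp: profile_def\<close>)

lemma profile_continuous: "profile C R q q' \<Longrightarrow> continuous_on {0<..} q"
  by (auto intro!: continuous_at_imp_continuous_on DERIV_isCont dest: profileD(4))

lemma profile_weighted_continuous:
  assumes p: "profile C R q q'"
  shows "continuous_on {0..b} (\<lambda>\<rho>. \<rho>\<^sup>2 * q \<rho>)"
  unfolding continuous_on_eq_continuous_within
proof
  fix r :: real assume r: "r \<in> {0..b}"
  show "continuous (at r within {0..b}) (\<lambda>\<rho>. \<rho>\<^sup>2 * q \<rho>)"
  proof (cases "r = 0")
    case False
    then have "isCont q r" using r by (intro DERIV_isCont[OF profileD(4)[OF p]]) auto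
    then have "isCont (\<lambda>\<rho>. \<rho>\<^sup>2 * q \<rho>) r" by (intro isCont_mult) auto
    then show ?thesis by (rule continuous_at_imp_continuous_within)
  next
    case True
    have "((\<lambda>\<rho>. \<rho>\<^sup>2 * q \<rho>) \<longlongrightarrow> 0) (at 0 within {0..b})"
    proof (rule Lim_null_comparison)
      show "\<forall>\<^sub>F \<rho> in at 0 within {0..b}. norm (\<rho>\<^sup>2 * q \<rho>) \<le> C * \<rho> powr (7/4)"
        unfolding eventually_at_filter
      proof (rule always_eventually, intro allI impI)
        fix \<rho> :: real assume "\<rho> \<noteq> 0" "\<rho> \<in> {0..b}"
        then have \<rho>: "\<rho> > 0" by auto
        have "\<rho>\<^sup>2 * \<bar>q \<rho>\<bar> \<le> \<rho>\<^sup>2 * (C * \<rho> powr (-1/4))"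
          by (intro mult_left_mono profileD(5)[OF p] \<rho>) auto
        also have "\<dots> = C * \<rho> powr (7/4)" using \<rho> powr_add[of \<rho> 2 "-1/4"] by simp
        finally show "norm (\<rho>\<^sup>2 * q \<rho>) \<le> C * \<rho> powr (7/4)" by (simp add: abs_mult)
      qed
      have "((\<lambda>\<rho>. C * \<rho> powr (7/4)) \<longlongrightarrow> C * 0 powr (7/4)) (at 0 within {0..b})"
        by (intro tendsto_intros tendsto_powr2) (auto simp: eventually_at_filter)
      then show "((\<lambda>\<rho>. C * \<rho> powr (7/4)) \<longlongrightarrow> 0) (at 0 within {0..b})" by simp
    qed
    then show ?thesis using True by (simp add: continuous_within)
  qed
qed

lemma profile_weighted_integrable:
  "profile C R q q' \<Longrightarrow> (\<lambda>\<rho>. \<rho>\<^sup>2 * q \<rho>) integrable_on {0..b}"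
  by (intro integrable_continuous_real profile_weighted_continuous)

lemma mean_deriv:
  assumes p: "profile C R q q'" and r: "0 < r"
  shows "(mean q has_real_derivative 3 * (q r - mean q r) / r) (at r)"
proof -
  let ?J = "\<lambda>r. integral {0..r} (\<lambda>\<rho>. \<rho>\<^sup>2 * q \<rho>)"
  have "(?J has_real_derivative r\<^sup>2 * q r) (at r within {0..r + 1})"
    by (rule integral_has_real_derivative[OF profile_weighted_continuous[OF p]]) (use r in auto)
  then have "(?J has_real_derivative r\<^sup>2 * q r) (at r)"
    using r by (subst (asm) at_within_Icc_at) auto
  then have "((\<lambda>r. 3 / r ^ 3 * ?J r) has_real_derivative (- 9 / r ^ 4 * ?J r + r\<^sup>2 * q r * (3 / r ^ 3))) (at r)"
    using r by (auto intro!: derivative_eq_intros simp: field_simps power_numeral_reduce)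
  moreover have "- 9 / r ^ 4 * ?J r + r\<^sup>2 * q r * (3 / r ^ 3) = 3 * (q r - mean q r) / r"
    using r by (simp add: mean_def field_simps power_numeral_reduce)
  ultimately show ?thesis by (simp add: mean_def[abs_def])
qed

lemma mean_continuous: "profile C R q q' \<Longrightarrow> continuous_on {0<..} (mean q)"
  by (rule continuous_at_imp_continuous_on) (auto intro!: DERIV_isCont mean_deriv)

lemma integral_powr_bound:
  assumes p: "profile C R q q'" and r: "0 \<le> r"
  shows "\<bar>integral {0..r} (\<lambda>\<rho>. \<rho>\<^sup>2 * q \<rho>)\<bar> \<le> C * (4/11) * r powr (11/4)"
proof -
  have hi: "((\<lambda>\<rho>. C * \<rho> powr (7/4)) has_integral C * (r powr (7/4 + 1) / (7/4 + 1))) {0..r}"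
    by (intro has_integral_mult_right has_integral_powr_from_0) (use r in auto)
  have "norm (integral {0..r} (\<lambda>\<rho>. \<rho>\<^sup>2 * q \<rho>)) \<le> integral {0..r} (\<lambda>\<rho>. C * \<rho> powr (7/4))"
  proof (rule integral_norm_bound_integral)
    fix \<rho> assume "\<rho> \<in> {0..r}"
    show "norm (\<rho>\<^sup>2 * q \<rho>) \<le> C * \<rho> powr (7/4)"
    proof (cases "\<rho> = 0")
      case False
      then have \<rho>: "\<rho> > 0" using \<open>\<rho> \<in> {0..r}\<close> by auto
      have "\<rho>\<^sup>2 * \<bar>q \<rho>\<bar> \<le> \<rho>\<^sup>2 * (C * \<rho> powr (-1/4))"
        by (intro mult_left_mono profileD(5)[OF p] \<rho>) auto
      also have "\<dots> = C * \<rho> powr (7/4)" using \<rho> powr_add[of \<rho> 2 "-1/4"] by simp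
      finally show ?thesis by (simp add: abs_mult)
    qed simp
  qed (use hi profile_weighted_integrable[OF p] in \<open>auto simp: has_integral_integrable\<close>)
  also have "\<dots> = C * (4/11) * r powr (11/4)" by (subst integral_unique[OF hi]) simp
  finally show ?thesis by simp
qed

lemma mean_bound:
  assumes p: "profile C R q q'" and r: "0 < r"
  shows "\<bar>mean q r\<bar> \<le> 2 * C * r powr (-1/4)"
proof -
  have "\<bar>mean q r\<bar> \<le> 3 / r ^ 3 * (C * (4/11) * r powr (11/4))"
    unfolding mean_def abs_mult using r integral_powr_bound[OF p, of r] by (intro mult_mono) auto
  also have "\<dots> = 12/11 * C * r powr (-1/4)"
    using r powr_diff[of r "11/4" 3] by (simp add: field_simps)
  also have "\<dots> \<le> 2 * C * r powr (-1/4)"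
    using profileD(3)[OF p] by (intro mult_right_mono) auto
  finally show ?thesis .
qed

text \<open>By Newton's theorem the field of a radial mass outside its support is that of a point mass.\<close>

lemma mean_far:
  assumes p: "profile C R q q'" and r: "R \<le> r"
  shows "mean q r = R ^ 3 * mean q R / r ^ 3"
proof -
  have R: "R > 0" using p by (rule profileD)
  have "integral {0..R} (\<lambda>\<rho>. \<rho>\<^sup>2 * q \<rho>) + integral {R..r} (\<lambda>\<rho>. \<rho>\<^sup>2 * q \<rho>) = integral {0..r} (\<lambda>\<rho>. \<rho>\<^sup>2 * q \<rho>)"
    by (rule Henstock_Kurzweil_Integration.integral_combine) (use R r profile_weighted_integrable[OF p] in auto)
  moreover have "integral {R..r} (\<lambda>\<rho>. \<rho>\<^sup>2 * q \<rho>) = integral {R..r} (\<lambda>\<rho>. 0)"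
    by (rule Henstock_Kurzweil_Integration.integral_cong) (use profileD(7)[OF p] in auto)
  ultimately show ?thesis using R by (simp add: mean_def)
qed

lemma mean_far_bound:
  assumes p: "profile C R q q'" and r: "R \<le> r"
  shows "\<bar>mean q r\<bar> \<le> 2 * C * R powr (11/4) * r powr (-3)"
proof -
  have R: "R > 0" using p by (rule profileD)
  have "\<bar>mean q r\<bar> = R ^ 3 * \<bar>mean q R\<bar> / r ^ 3"
    using R r by (subst mean_far[OF p r]) (simp add: abs_mult)
  also have "\<dots> \<le> R ^ 3 * (2 * C * R powr (-1/4)) / r ^ 3"
    using R r mean_bound[OF p R] by (intro divide_right_mono mult_left_mono) auto
  also have "\<dots> = 2 * C * R powr (11/4) * r powr (-3)"
    using R r powr_add[of R 3 "-1/4"] by (simp add: powr_minus field_simps)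
  finally show ?thesis .
qed

lemma pderiv_radial:
  assumes h: "\<And>r. 0 < r \<Longrightarrow> (h has_real_derivative h' r) (at r)"
  shows "pderiv_on (-{0}) k (\<lambda>x. h (norm x)) (\<lambda>x. h' (norm x) * (x $ k / norm x))"
  unfolding pderiv_on_def
proof
  fix x :: space assume "x \<in> -{0}"
  then have x: "norm x > 0" by simp
  have "((\<lambda>t. sqrt ((norm x)\<^sup>2 + 2 * t * x $ k + t\<^sup>2)) has_real_derivative x $ k / norm x) (at 0)"
    using x by (auto intro!: derivative_eq_intros simp: field_simps)
  moreover have "(\<lambda>t. sqrt ((norm x)\<^sup>2 + 2 * t * x $ k + t\<^sup>2)) = (\<lambda>t. norm (x + t *\<^sub>R axis k 1))"
    by (simp add: norm_axis_line[symmetric])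
  ultimately have n: "((\<lambda>t. norm (x + t *\<^sub>R axis k 1)) has_real_derivative x $ k / norm x) (at 0)" by simp
  have "(h has_real_derivative h' (norm x)) (at (norm (x + 0 *\<^sub>R axis k 1)))" using h[OF x] by simp
  from DERIV_chain2[OF this n]
  show "((\<lambda>t. h (norm (x + t *\<^sub>R axis k 1))) has_real_derivative h' (norm x) * (x $ k / norm x)) (at 0)" .
qed

lemma pderiv_hess:
  assumes p: "profile C R q q'"
  shows "pderiv_on (-{0}) k (hess q i j) (third q q' i j k)"
proof -
  let ?m = "mean q"
  have dA: "((\<lambda>r. ?m r / 3) has_real_derivative (q r - ?m r) / r) (at r)" if "0 < r" for r
  proof -
    have "3 * (q r - ?m r) / r / 3 = (q r - ?m r) / r" using that by (simp add: field_simps)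
    then show ?thesis using DERIV_cdivide[OF mean_deriv[OF p that], of 3] by (simp only:)
  qed
  have dB: "((\<lambda>r. (q r - ?m r) / r\<^sup>2) has_real_derivative q' r / r\<^sup>2 - 5 * (q r - ?m r) / r ^ 3) (at r)" if r: "0 < r" for r
    using profileD(4)[OF p r] mean_deriv[OF p r] r
    by (auto intro!: derivative_eq_intros simp: field_simps power_numeral_reduce)
  have "pderiv_on (-{0}) k (\<lambda>x. (if i = j then 1 else 0) * (?m (norm x) / 3)
       + (x $ i * x $ j) * ((q (norm x) - ?m (norm x)) / (norm x)\<^sup>2))
    (\<lambda>x. (if i = j then 1 else 0) * ((q (norm x) - ?m (norm x)) / norm x * (x $ k / norm x))
      + (((if i = k then 1 else 0) * x $ j + x $ i * (if j = k then 1 else 0)) * ((q (norm x) - ?m (norm x)) / (norm x)\<^sup>2)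
      + (x $ i * x $ j) * ((q' (norm x) / (norm x)\<^sup>2 - 5 * (q (norm x) - ?m (norm x)) / norm x ^ 3) * (x $ k / norm x))))"
    by (intro pderiv_add pderiv_cmult pderiv_mult pderiv_radial[OF dA] pderiv_radial[OF dB] pderiv_component)
  then have "pderiv_on (-{0}) k (hess q i j)
    (\<lambda>x. (if i = j then 1 else 0) * ((q (norm x) - ?m (norm x)) / norm x * (x $ k / norm x))
      + (((if i = k then 1 else 0) * x $ j + x $ i * (if j = k then 1 else 0)) * ((q (norm x) - ?m (norm x)) / (norm x)\<^sup>2)
      + (x $ i * x $ j) * ((q' (norm x) / (norm x)\<^sup>2 - 5 * (q (norm x) - ?m (norm x)) / norm x ^ 3) * (x $ k / norm x))))"
    by (simp add: hess_def[abs_def] mult.assoc)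
  then show ?thesis
  proof (rule pderiv_cong)
    fix x :: space assume "x \<in> -{0}"
    then have "norm x > 0" by simp
    moreover define n where "n = norm x"
    ultimately have n: "n > 0" by simp
    define d where "d = q n - ?m n"
    show "(if i = j then 1 else 0) * ((q (norm x) - ?m (norm x)) / norm x * (x $ k / norm x))
      + (((if i = k then 1 else 0) * x $ j + x $ i * (if j = k then 1 else 0)) * ((q (norm x) - ?m (norm x)) / (norm x)\<^sup>2)
      + (x $ i * x $ j) * ((q' (norm x) / (norm x)\<^sup>2 - 5 * (q (norm x) - ?m (norm x)) / norm x ^ 3) * (x $ k / norm x)))
      = third q q' i j k x"
      unfolding third_def n_def[symmetric] d_def[symmetric] using n
      by (auto simp: field_simps power_numeral_reduce)
  qed
qed

lemma third_trace: "x \<noteq> 0 \<Longrightarrow> (\<Sum>k\<in>UNIV. third q q' j k k x) = q' (norm x) * (x $ j / norm x)"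
proof -
  assume "x \<noteq> 0"
  define n where "n = norm x"
  have n: "n > 0" using \<open>x \<noteq> 0\<close> by (simp add: n_def)
  define d where "d = q n - mean q n"
  have n2: "x $ 1 * x $ 1 + x $ 2 * x $ 2 + x $ 3 * x $ 3 = n\<^sup>2"
    by (simp add: n_def power2_norm_eq_inner inner_vec_def sum_3)
  define E where "E = q' n / n ^ 3 - 5 * d / n ^ 4"
  have "(\<Sum>k\<in>UNIV. third q q' j k k x) = (\<Sum>k\<in>UNIV. (2 * (if j = k then x $ k else 0) + x $ j) * (d / n\<^sup>2) + x $ j * (x $ k * x $ k) * E)"
    unfolding third_def n_def[symmetric] d_def[symmetric] E_def by (intro sum.cong) (auto simp: algebra_simps)
  also have "\<dots> = 5 * x $ j * (d / n\<^sup>2) + x $ j * E * (x $ 1 * x $ 1 + x $ 2 * x $ 2 + x $ 3 * x $ 3)"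
    using exhaust_3[of j] by (auto simp: sum_3 algebra_simps)
  also have "\<dots> = q' n * (x $ j / n)"
    unfolding n2 E_def using n by (simp add: field_simps power_numeral_reduce)
  finally show ?thesis by (simp add: n_def)
qed

lemma third_sym: "third q q' j k i x = third q q' i j k x"
  by (cases "i = j"; cases "i = k"; cases "j = k") (auto simp: third_def algebra_simps)

lemma continuous_radial:
  assumes "continuous_on {0<..} h" shows "continuous_on (-{0}) (\<lambda>x::space. h (norm x))"
  by (rule continuous_on_compose2[OF assms]) (auto intro!: continuous_intros)

lemma continuous_hess: assumes p: "profile C R q q'" shows "continuous_on (-{0}) (hess q i j)"
  unfolding hess_def[abs_def]
  by (intro continuous_intros continuous_radial[OF mean_continuous[OF p]] continuous_radial[OF profile_continuous[OF p]]) auto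

lemma continuous_third: assumes p: "profile C R q q'" shows "continuous_on (-{0}) (third q q' i j k)"
proof -
  have [continuous_intros]: "continuous_on (-{0}) (\<lambda>x::space. if b then x $ l else 0)" for b l
    by (cases b) (auto intro!: continuous_intros)
  show ?thesis unfolding third_def[abs_def]
    by (intro continuous_intros continuous_radial[OF mean_continuous[OF p]] continuous_radial[OF profile_continuous[OF p]]
        continuous_radial[OF profileD(2)[OF p]]) auto
qed

lemma hess_bound: "\<bar>hess q i j x\<bar> \<le> \<bar>q (norm x)\<bar> + 2 * \<bar>mean q (norm x)\<bar>"
proof -
  let ?m = "mean q (norm x)" and ?q = "q (norm x)"
  have "\<bar>x $ i * x $ j\<bar> \<le> norm x * norm x"
    unfolding abs_mult by (intro mult_mono component_le_norm_cart) auto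
  then have "\<bar>x $ i * x $ j * ((?q - ?m) / (norm x)\<^sup>2)\<bar> \<le> \<bar>?q - ?m\<bar>"
  proof (cases "x = 0")
    case False
    have "\<bar>x $ i * x $ j * ((?q - ?m) / (norm x)\<^sup>2)\<bar> = \<bar>x $ i * x $ j\<bar> * (\<bar>?q - ?m\<bar> / (norm x)\<^sup>2)"
      by (simp add: abs_mult)
    also have "\<dots> \<le> (norm x * norm x) * (\<bar>?q - ?m\<bar> / (norm x)\<^sup>2)"
      using \<open>\<bar>x $ i * x $ j\<bar> \<le> norm x * norm x\<close> by (rule mult_right_mono) simp
    also have "\<dots> = \<bar>?q - ?m\<bar>" using False by (simp add: power2_eq_square)
    finally show ?thesis .
  qed simp
  moreover have "\<bar>(if i = j then 1 else 0) * (?m / 3)\<bar> \<le> \<bar>?m\<bar>" by auto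
  ultimately show ?thesis unfolding hess_def by linarith
qed

lemma third_bound:
  assumes x: "x \<noteq> 0"
  shows "\<bar>third q q' i j k x\<bar> \<le> \<bar>q' (norm x)\<bar> + 8 * (\<bar>q (norm x)\<bar> + \<bar>mean q (norm x)\<bar>) / norm x"
proof -
  define n where "n = norm x"
  have n: "n > 0" using x by (simp add: n_def)
  define d where "d = q n - mean q n"
  have c: "\<bar>x $ l\<bar> \<le> n" for l unfolding n_def by (rule component_le_norm_cart)
  have "\<bar>(if i = j then x $ k else 0) + (if i = k then x $ j else 0) + (if j = k then x $ i else 0)\<bar> \<le> 3 * n"
    using c[of i] c[of j] c[of k] by auto
  then have "\<bar>((if i = j then x $ k else 0) + (if i = k then x $ j else 0) + (if j = k then x $ i else 0)) * (d / n\<^sup>2)\<bar> \<le> 3 * n * (\<bar>d\<bar> / n\<^sup>2)"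
    unfolding abs_mult by (intro mult_mono) auto
  also have "\<dots> = 3 * \<bar>d\<bar> / n" using n by (simp add: power2_eq_square)
  finally have 1: "\<bar>((if i = j then x $ k else 0) + (if i = k then x $ j else 0) + (if j = k then x $ i else 0)) * (d / n\<^sup>2)\<bar> \<le> 3 * \<bar>d\<bar> / n" .
  have "\<bar>x $ i * x $ j * x $ k\<bar> \<le> n * n * n" unfolding abs_mult by (intro mult_mono c) (use n in auto)
  moreover have "\<bar>q' n / n ^ 3 - 5 * d / n ^ 4\<bar> \<le> \<bar>q' n\<bar> / n ^ 3 + 5 * \<bar>d\<bar> / n ^ 4"
    using n abs_triangle_ineq4[of "q' n / n ^ 3" "5 * d / n ^ 4"] by (simp add: abs_mult)
  ultimately have "\<bar>x $ i * x $ j * x $ k * (q' n / n ^ 3 - 5 * d / n ^ 4)\<bar> \<le> n * n * n * (\<bar>q' n\<bar> / n ^ 3 + 5 * \<bar>d\<bar> / n ^ 4)"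
    unfolding abs_mult[of "x $ i * x $ j * x $ k"] using n by (intro mult_mono) auto
  also have "\<dots> = \<bar>q' n\<bar> + 5 * \<bar>d\<bar> / n" using n by (simp add: field_simps power_numeral_reduce)
  finally have 2: "\<bar>x $ i * x $ j * x $ k * (q' n / n ^ 3 - 5 * d / n ^ 4)\<bar> \<le> \<bar>q' n\<bar> + 5 * \<bar>d\<bar> / n" .
  have "3 * \<bar>d\<bar> / n + 5 * \<bar>d\<bar> / n = 8 * \<bar>d\<bar> / n" by (simp add: add_divide_distrib[symmetric])
  with abs_triangle_ineq[THEN order_trans, OF add_mono[OF 1 2]]
  have "\<bar>third q q' i j k x\<bar> \<le> \<bar>q' n\<bar> + 8 * \<bar>d\<bar> / n"
    unfolding third_def n_def[symmetric] d_def[symmetric] by linarith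
  also have "\<dots> \<le> \<bar>q' n\<bar> + 8 * (\<bar>q n\<bar> + \<bar>mean q n\<bar>) / n"
    unfolding d_def using n by (intro add_left_mono divide_right_mono mult_left_mono) auto
  finally show ?thesis by (simp add: n_def)
qed

text \<open>The functions of interest grow slowly at the origin and decay fast at infinity. Any power between
  the two rates bounds them everywhere.\<close>

lemma power_bounded_two_regimes:
  assumes c: "continuous_on (-{0}) f" and R: "0 < R"
    and near: "\<And>x. x \<noteq> 0 \<Longrightarrow> norm x \<le> R \<Longrightarrow> \<bar>f x\<bar> \<le> A * norm x powr (-b)"
    and far: "\<And>x. R \<le> norm x \<Longrightarrow> \<bar>f x\<bar> \<le> B * norm x powr (-b')"
    and ab: "b \<le> a" "a \<le> b'" and A: "0 \<le> A" and B: "0 \<le> B"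
  shows "power_bounded a f"
proof -
  have "\<bar>f x\<bar> \<le> (A * R powr (a - b) + B * R powr (a - b')) * norm x powr (-a)" if x: "x \<noteq> 0" for x
  proof (cases "norm x \<le> R")
    case True
    have "norm x powr (-b) = norm x powr (a - b) * norm x powr (-a)" using x by (simp add: powr_add[symmetric])
    also have "\<dots> \<le> R powr (a - b) * norm x powr (-a)" using True ab by (intro mult_right_mono powr_mono2) auto
    finally have "\<bar>f x\<bar> \<le> A * (R powr (a - b) * norm x powr (-a))"
      using near[OF x True] A by (meson mult_left_mono order_trans)
    also have "\<dots> \<le> (A * R powr (a - b) + B * R powr (a - b')) * norm x powr (-a)"
      using A B by (simp add: algebra_simps)
    finally show ?thesis .
  next
    case False
    have "norm x powr (-b') = norm x powr (a - b') * norm x powr (-a)" using x by (simp add: powr_add[symmetric])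
    also have "\<dots> \<le> R powr (a - b') * norm x powr (-a)" using False R ab by (intro mult_right_mono powr_mono2') auto
    finally have "\<bar>f x\<bar> \<le> B * (R powr (a - b') * norm x powr (-a))"
      using far[of x] False B by (meson mult_left_mono order_trans linear)
    also have "\<dots> \<le> (A * R powr (a - b) + B * R powr (a - b')) * norm x powr (-a)"
      using A B by (simp add: algebra_simps)
    finally show ?thesis .
  qed
  then show ?thesis using c unfolding power_bounded_def by blast
qed

lemma power_bounded_radial:
  assumes p: "profile C R q q'" and a: "1/4 \<le> a" shows "power_bounded a (\<lambda>x. q (norm x))"
  by (rule power_bounded_two_regimes[where A = C and B = 0 and b = "1/4" and b' = a and R = R])
    (use a profileD[OF p] continuous_radial[OF profile_continuous[OF p]] in auto)

lemma power_bounded_hess: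
  assumes p: "profile C R q q'" and a: "1/4 \<le> a" "a \<le> 3" shows "power_bounded a (hess q i j)"
proof (rule power_bounded_two_regimes[where A = "5 * C" and B = "4 * C * R powr (11/4)" and b = "1/4" and b' = 3 and R = R])
  fix x :: space
  show "\<bar>hess q i j x\<bar> \<le> 5 * C * norm x powr - (1 / 4)" if "x \<noteq> 0"
    using hess_bound[of q i j x] profileD(5)[OF p, of "norm x"] mean_bound[OF p, of "norm x"] that by simp
  show "\<bar>hess q i j x\<bar> \<le> 4 * C * R powr (11/4) * norm x powr - 3" if "R \<le> norm x"
    using hess_bound[of q i j x] profileD(7)[OF p that] mean_far_bound[OF p that] by simp
qed (use a profileD[OF p] continuous_hess[OF p] in auto)

lemma third_near_bound:
  assumes p: "profile C R q q'" and x: "x \<noteq> 0"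
  shows "\<bar>third q q' i j k x\<bar> \<le> 25 * C * norm x powr (-5/4)"
proof -
  have n: "norm x > 0" using x by simp
  have "\<bar>q (norm x)\<bar> + \<bar>mean q (norm x)\<bar> \<le> 3 * C * norm x powr (-1/4)"
    using profileD(5)[OF p n] mean_bound[OF p n] by simp
  then have "8 * (\<bar>q (norm x)\<bar> + \<bar>mean q (norm x)\<bar>) / norm x \<le> 8 * (3 * C * norm x powr (-1/4)) / norm x"
    using n by (intro divide_right_mono mult_left_mono) auto
  also have "\<dots> = 24 * C * norm x powr (-5/4)" using n powr_diff[of "norm x" "-1/4" 1] by simp
  finally show ?thesis
    using third_bound[OF x, of q q' i j k] profileD(6)[OF p n] by simp
qed

lemma third_far_bound:
  assumes p: "profile C R q q'" and x: "R \<le> norm x"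
  shows "\<bar>third q q' i j k x\<bar> \<le> 16 * C * R powr (11/4) * norm x powr (-4)"
proof -
  have n: "norm x > 0" using x profileD(1)[OF p] by linarith
  have "\<bar>third q q' i j k x\<bar> \<le> 8 * \<bar>mean q (norm x)\<bar> / norm x"
    using third_bound[of x q q' i j k] profileD(7,8)[OF p x] n by auto
  also have "\<dots> \<le> 8 * (2 * C * R powr (11/4) * norm x powr (-3)) / norm x"
    using n mean_far_bound[OF p x] by (intro divide_right_mono mult_left_mono) auto
  also have "\<dots> = 16 * C * R powr (11/4) * norm x powr (-4)"
    using n powr_diff[of "norm x" "-3" 1] by simp
  finally show ?thesis .
qed

lemma power_bounded_third:
  assumes p: "profile C R q q'" and a: "5/4 \<le> a" "a \<le> 4" shows "power_bounded a (third q q' i j k)"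
  by (rule power_bounded_two_regimes[where A = "25 * C" and B = "16 * C * R powr (11/4)" and b = "5/4" and b' = 4 and R = R])
    (use a profileD[OF p] continuous_third[OF p] third_near_bound[OF p, of _ i j k] third_far_bound[OF p, of _ i j k] in auto)

section \<open>The Leray projection of a field with radial components\<close>

text \<open>The factor that relates \<open>R\<^sub>i R\<^sub>j \<Delta> w\<close> to \<open>\<partial>\<^sub>i \<partial>\<^sub>j w\<close>. Its value is \<open>1\<close>.\<close>

definition leray_const :: real where
  "leray_const = riesz_mass 2 / pi ^ 3"

lemma leray_const_bounds: "0 < leray_const" "leray_const < 3"
proof -
  show "0 < leray_const" using riesz_mass_2_pos by (simp add: leray_const_def)
  have "8 < pi * pi" using mult_strict_mono[OF pi_gt3 pi_gt3] by simp
  then have "8 * pi < pi * pi * pi" by simp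
  then have "24 * pi < 3 * pi ^ 3" by (simp add: power3_eq_cube)
  then have "riesz_mass 2 < 3 * pi ^ 3" using riesz_mass_2_le by linarith
  then show "leray_const < 3" by (simp add: leray_const_def divide_less_eq)
qed

definition smooth_profile :: "real \<Rightarrow> real \<Rightarrow> (real \<Rightarrow> real) \<Rightarrow> (real \<Rightarrow> real) \<Rightarrow> (real \<Rightarrow> real) \<Rightarrow> bool" where
  "smooth_profile C R q q' q'' \<longleftrightarrow> profile C R q q' \<and> continuous_on {0<..} q'' \<and>
     (\<forall>r>0. (q' has_real_derivative q'' r) (at r) \<and> \<bar>q'' r\<bar> \<le> C * r powr (-9/4)) \<and> (\<forall>r\<ge>R. q'' r = 0)"

text \<open>With \<open>q |x| = \<Delta> w\<close> the two Riesz transforms give a multiple of \<open>\<partial>\<^sub>i \<partial>\<^sub>j w\<close>.\<close>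

lemma riesz_riesz_radial:
  assumes sp: "smooth_profile C R q q' q''" and x: "x \<noteq> 0"
  shows "riesz i (riesz j (\<lambda>y. complex_of_real (q (norm y)))) x = complex_of_real (leray_const * hess q i j x)"
proof -
  have p: "profile C R q q'" using sp by (simp add: smooth_profile_def)
  have q'': "continuous_on {0<..} q''" "\<And>r. 0 < r \<Longrightarrow> (q' has_real_derivative q'' r) (at r)"
    "\<And>r. 0 < r \<Longrightarrow> \<bar>q'' r\<bar> \<le> C * r powr (-9/4)" "\<And>r. R \<le> r \<Longrightarrow> q'' r = 0"
    using sp by (auto simp: smooth_profile_def)
  let ?gj = "\<lambda>x::space. q' (norm x) * (x $ j / norm x)"
  let ?gij = "\<lambda>x::space. (q'' (norm x) * (x $ i / norm x)) * (x $ j / norm x)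
      + q' (norm x) * ((if j = i then 1 else 0) * (1 / norm x) + x $ j * (- (1 / (norm x)\<^sup>2) * (x $ i / norm x)))"
  have comp: "\<bar>x $ l / norm x\<bar> \<le> 1" for l and x :: space
    using component_le_norm_cart[of x l] by (cases "x = 0") (auto simp: divide_le_eq)
  have C: "C \<ge> 0" using p by (rule profileD)
  have dinv: "((\<lambda>r. 1 / r) has_real_derivative - (1 / r\<^sup>2)) (at r)" if "0 < r" for r :: real
    using that by (auto intro!: derivative_eq_intros simp: power2_eq_square)
  have gj: "power_bounded (5/2) ?gj"
  proof (rule power_bounded_two_regimes[where A = C and B = 0 and b = "5/4" and b' = 3 and R = R])
    show "continuous_on (-{0}) ?gj"
      by (intro continuous_intros continuous_radial[OF profileD(2)[OF p]]) auto
    show "\<bar>?gj x\<bar> \<le> C * norm x powr - (5/4)" if "x \<noteq> 0" for x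
    proof -
      have "\<bar>q' (norm x)\<bar> * \<bar>x $ j / norm x\<bar> \<le> (C * norm x powr (-5/4)) * 1"
        using profileD(6)[OF p, of "norm x"] comp[of x j] that C by (intro mult_mono) auto
      then show ?thesis by (simp add: abs_mult)
    qed
  qed (use C profileD(1,8)[OF p] in auto)
  have gij: "power_bounded (5/2) ?gij"
  proof (rule power_bounded_two_regimes[where A = "3 * C" and B = 0 and b = "9/4" and b' = 3 and R = R])
    show "continuous_on (-{0}) ?gij"
      by (intro continuous_intros continuous_radial[OF profileD(2)[OF p]] continuous_radial[OF q''(1)]) auto
    show "\<bar>?gij x\<bar> \<le> 3 * C * norm x powr - (9/4)" if x: "x \<noteq> 0" for x
    proof -
      have n: "norm x > 0" using x by simp
      let ?a = "x $ i / norm x" and ?b = "x $ j / norm x"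
      have ab: "\<bar>?a * ?b\<bar> \<le> 1" unfolding abs_mult using mult_mono[OF comp[of x i] comp[of x j]] by simp
      have "?gij x = q'' (norm x) * (?a * ?b) + q' (norm x) / norm x * ((if j = i then 1 else 0) - ?a * ?b)"
        using n by (simp add: field_simps power2_eq_square)
      moreover have "\<bar>q'' (norm x) * (?a * ?b)\<bar> \<le> (C * norm x powr (-9/4)) * 1"
        unfolding abs_mult[of "q'' (norm x)"] using q''(3)[OF n] ab C by (intro mult_mono) auto
      moreover have "\<bar>q' (norm x) / norm x * ((if j = i then 1 else 0) - ?a * ?b)\<bar> \<le> (C * norm x powr (-9/4)) * 2"
      proof -
        have "\<bar>q' (norm x) / norm x\<bar> \<le> C * norm x powr (-5/4) / norm x"
          using profileD(6)[OF p n] n by (simp add: divide_right_mono)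
        also have "\<dots> = C * norm x powr (-9/4)" using n powr_diff[of "norm x" "-5/4" 1] by simp
        finally have 1: "\<bar>q' (norm x) / norm x\<bar> \<le> C * norm x powr (-9/4)" .
        have 2: "\<bar>(if j = i then 1 else 0) - ?a * ?b\<bar> \<le> 2" using ab by (auto simp: abs_if split: if_splits)
        show ?thesis unfolding abs_mult[of "q' (norm x) / norm x"] using 1 2 C by (intro mult_mono) auto
      qed
      moreover have "\<bar>u\<bar> \<le> 3 * K" if "u = v + w" "\<bar>v\<bar> \<le> K * 1" "\<bar>w\<bar> \<le> K * 2" for u v w K :: real
        using that by linarith
      ultimately have "\<bar>?gij x\<bar> \<le> 3 * (C * norm x powr (-9/4))" by blast
      then have "\<bar>?gij x\<bar> \<le> 3 * C * norm x powr (-9/4)" by (simp only: mult.assoc)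
      then show ?thesis by (simp only: minus_divide_left)
    qed
  qed (use C profileD(1,8)[OF p] q''(4) in auto)
  have dgj: "pderiv_on (-{0}) i ?gj ?gij"
  proof -
    have "pderiv_on (-{0}) i (\<lambda>x. q' (norm x) * (x $ j * (1 / norm x)))
      (\<lambda>x. (q'' (norm x) * (x $ i / norm x)) * (x $ j * (1 / norm x))
      + q' (norm x) * ((if j = i then 1 else 0) * (1 / norm x) + x $ j * (- (1 / (norm x)\<^sup>2) * (x $ i / norm x))))"
      by (intro pderiv_mult pderiv_radial[OF q''(2)] pderiv_radial[OF dinv] pderiv_component)
    then show ?thesis by simp
  qed
  have "riesz i (riesz j (\<lambda>y. complex_of_real (q (norm y)))) x = complex_of_real (- (riesz_mass 2 / (4 * pi ^ 4)) * Npot ?gij x)"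
    by (rule riesz_riesz[OF power_bounded_radial[OF p] gj gij pderiv_radial[OF profileD(4)[OF p]] dgj x]) auto
  also have "Npot ?gij x = - (4 * pi) * hess q i j x"
    by (rule Npot_hessian[OF power_bounded_hess[OF p] power_bounded_third[OF p] pderiv_hess[OF p] third_sym gj _ gij dgj x])
      (auto simp: third_trace)
  also have "- (riesz_mass 2 / (4 * pi ^ 4)) * (- (4 * pi) * hess q i j x) = leray_const * hess q i j x"
    by (simp add: leray_const_def field_simps power_numeral_reduce)
  finally show ?thesis .
qed

definition radial_leray :: "(3 \<Rightarrow> real \<Rightarrow> real) \<Rightarrow> space \<Rightarrow> space" where
  "radial_leray Q x = (\<chi> i. Q i (norm x) - leray_const * (\<Sum>j\<in>UNIV. hess (Q j) i j x))"

lemma leray_radial: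
  assumes sp: "\<And>j. smooth_profile C R (Q j) (Q' j) (Q'' j)" and v: "\<And>y j. v y $ j = Q j (norm y)" and x: "x \<noteq> 0"
  shows "leray v x = radial_leray Q x"
  unfolding leray_def radial_leray_def v riesz_riesz_radial[OF sp x]
  by (simp add: vec_eq_iff sum_distrib_left)

lemma ball_measurable [measurable]: "ball (x::space) r \<in> sets borel"
  by simp

section \<open>Logarithmic Lipschitz bounds\<close>

text \<open>The bound on \<open>r h'\<close> is a bound on the derivative of \<open>t \<mapsto> h (exp t)\<close>.\<close>

lemma log_lipschitz:
  assumes d: "\<And>r. 0 < r \<Longrightarrow> (h has_real_derivative h' r) (at r)" and b: "\<And>r. 0 < r \<Longrightarrow> \<bar>r * h' r\<bar> \<le> A"
    and r: "0 < r" "0 < r'"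
  shows "\<bar>h r - h r'\<bar> \<le> A * \<bar>ln r - ln r'\<bar>"
proof -
  have "norm (h (exp (ln r)) - h (exp (ln r'))) \<le> A * norm (ln r - ln r')"
  proof (rule field_differentiable_bound[where S = UNIV and f = "\<lambda>t. h (exp t)" and f' = "\<lambda>t. h' (exp t) * exp t"])
    show "((\<lambda>t. h (exp t)) has_field_derivative h' (exp t) * exp t) (at t within UNIV)" for t
      using DERIV_chain2[OF d[of "exp t"] DERIV_exp[of t]] by simp
    show "norm (h' (exp t) * exp t) \<le> A" for t using b[of "exp t"] by (simp add: mult.commute)
  qed auto
  then show ?thesis using r by simp
qed

lemma profile_log_lipschitz:
  assumes p: "profile C R q q'" and A: "\<And>r. 0 < r \<Longrightarrow> \<bar>r * q' r\<bar> \<le> A" and r: "0 < r" "0 < r'"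
  shows "\<bar>q r - q r'\<bar> \<le> A * \<bar>ln r - ln r'\<bar>"
  by (rule log_lipschitz[OF profileD(4)[OF p] A r])

text \<open>For \<open>\<rho> \<le> r\<close> the profile satisfies \<open>|q r - q \<rho>| \<le> A ln (r / \<rho>) \<le> A r / \<rho>\<close>, and \<open>3/2\<close> is the average
  of \<open>r / |y|\<close> over the ball of radius \<open>r\<close>.\<close>

lemma mean_close:
  assumes p: "profile C R q q'" and A: "\<And>r. 0 < r \<Longrightarrow> \<bar>r * q' r\<bar> \<le> A" and r: "0 < r"
  shows "\<bar>q r - mean q r\<bar> \<le> 3/2 * A"
proof -
  have A0: "0 \<le> A" using A[of 1] by simp
  have h1: "((\<lambda>\<rho>. \<rho>\<^sup>2 * q r) has_integral (r ^ 3 / 3 * q r)) {0..r}"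
  proof -
    have "((\<lambda>\<rho>::real. \<rho>\<^sup>2) has_integral (r ^ 3 / 3 - 0 ^ 3 / 3)) {0..r}"
      by (rule fundamental_theorem_of_calculus)
        (use r in \<open>auto intro!: derivative_eq_intros simp: has_real_derivative_iff_has_vector_derivative[symmetric]\<close>)
    from has_integral_mult_left[OF this, of "q r"] show ?thesis by simp
  qed
  have h2: "((\<lambda>\<rho>. A * r * \<rho>) has_integral (A * r * (r\<^sup>2 / 2))) {0..r}"
  proof -
    have "((\<lambda>\<rho>::real. \<rho>) has_integral (r\<^sup>2 / 2 - 0\<^sup>2 / 2)) {0..r}"
      by (rule fundamental_theorem_of_calculus)
        (use r in \<open>auto intro!: derivative_eq_intros simp: has_real_derivative_iff_has_vector_derivative[symmetric]\<close>)
    from has_integral_mult_right[OF this, of "A * r"] show ?thesis by simp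
  qed
  note i = profile_weighted_integrable[OF p, of r]
  have "norm (integral {0..r} (\<lambda>\<rho>. \<rho>\<^sup>2 * q r - \<rho>\<^sup>2 * q \<rho>)) \<le> integral {0..r} (\<lambda>\<rho>. A * r * \<rho>)"
  proof (rule integral_norm_bound_integral)
    fix \<rho> assume "\<rho> \<in> {0..r}"
    show "norm (\<rho>\<^sup>2 * q r - \<rho>\<^sup>2 * q \<rho>) \<le> A * r * \<rho>"
    proof (cases "\<rho> = 0")
      case False
      then have \<rho>: "0 < \<rho>" "\<rho> \<le> r" using \<open>\<rho> \<in> {0..r}\<close> by auto
      have "\<bar>ln r - ln \<rho>\<bar> = ln (r / \<rho>)" using \<rho> r by (simp add: ln_div)
      also have "\<dots> \<le> r / \<rho>" using \<rho> r ln_le_minus_one[of "r / \<rho>"] by simp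
      finally have "\<bar>q r - q \<rho>\<bar> \<le> A * (r / \<rho>)"
        using profile_log_lipschitz[OF p A r \<rho>(1)] A0 by (meson mult_left_mono order_trans)
      then have "\<rho>\<^sup>2 * \<bar>q r - q \<rho>\<bar> \<le> \<rho>\<^sup>2 * (A * (r / \<rho>))" by (rule mult_left_mono) simp
      also have "\<dots> = A * r * \<rho>" using \<rho> by (simp add: power2_eq_square)
      finally show ?thesis by (simp add: abs_mult right_diff_distrib[symmetric])
    qed simp
  qed (use h1 h2 i in \<open>auto simp: has_integral_integrable intro!: integrable_diff\<close>)
  also have "\<dots> = A * r * (r\<^sup>2 / 2)" using h2 by (rule integral_unique)
  also have "integral {0..r} (\<lambda>\<rho>. \<rho>\<^sup>2 * q r - \<rho>\<^sup>2 * q \<rho>) = r ^ 3 / 3 * q r - integral {0..r} (\<lambda>\<rho>. \<rho>\<^sup>2 * q \<rho>)"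
    using Henstock_Kurzweil_Integration.integral_diff[OF has_integral_integrable[OF h1] i] integral_unique[OF h1] by simp
  also have "\<dots> = r ^ 3 / 3 * (q r - mean q r)"
    using r by (simp add: mean_def field_simps)
  finally have "r ^ 3 / 3 * \<bar>q r - mean q r\<bar> \<le> A * r * (r\<^sup>2 / 2)" using r by (simp add: abs_mult)
  also have "\<dots> = r ^ 3 / 3 * (3/2 * A)" by (simp add: power2_eq_square power3_eq_cube)
  finally show ?thesis using r by (simp only: mult_le_cancel_left_pos zero_less_power divide_pos_pos zero_less_numeral)
qed

text \<open>The logarithmic derivative of the mean is \<open>3 (q - mean q)\<close>, which is bounded by the previous
  estimate.\<close>

lemma mean_log_lipschitz:
  assumes p: "profile C R q q'" and A: "\<And>r. 0 < r \<Longrightarrow> \<bar>r * q' r\<bar> \<le> A" and r: "0 < r" "0 < r'"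
  shows "\<bar>mean q r - mean q r'\<bar> \<le> 9/2 * A * \<bar>ln r - ln r'\<bar>"
proof (rule log_lipschitz[OF mean_deriv[OF p] _ r])
  show "\<bar>r * (3 * (q r - mean q r) / r)\<bar> \<le> 9/2 * A" if "0 < r" for r
  proof -
    have "r * (3 * (q r - mean q r) / r) = 3 * (q r - mean q r)" using that by simp
    moreover have "\<bar>q r - mean q r\<bar> \<le> 3/2 * A" by (rule mean_close[OF p A that])
    ultimately show ?thesis by (simp only: abs_mult) simp
  qed
qed

section \<open>Bounded mean oscillation\<close>

lemma measure_ball3: "0 \<le> R \<Longrightarrow> measure lborel (ball (x::space) R) = 4/3 * pi * R ^ 3"
  by (simp add: measure_def emeasure_ball3)

definition ball_integrable :: "(space \<Rightarrow> space) \<Rightarrow> bool" where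
  "ball_integrable f \<longleftrightarrow> (\<forall>x R. set_integrable lborel (ball x R) f)"

definition osc :: "(space \<Rightarrow> space) \<Rightarrow> space \<Rightarrow> real \<Rightarrow> ennreal" where
  "osc f x R = (\<integral>\<^sup>+ y \<in> ball x R. ennreal (norm (f y - ball_avg f x R)) \<partial>lborel) / emeasure lborel (ball x R)"

lemma BMO_norm_osc: "BMO_norm f = (SUP (x, R) \<in> UNIV \<times> {0<..}. osc f x R)"
  by (simp add: BMO_norm_def osc_def)

lemma osc_le_BMO: "0 < R \<Longrightarrow> osc f x R \<le> BMO_norm f"
  unfolding BMO_norm_osc by (rule SUP_upper2[of "(x, R)"]) auto

lemma BMO_leI: "(\<And>x R. 0 < R \<Longrightarrow> osc f x R \<le> K) \<Longrightarrow> BMO_norm f \<le> K"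
  unfolding BMO_norm_osc by (rule SUP_least) auto

lemma BMO_cong_off_origin:
  assumes "\<And>x. x \<noteq> 0 \<Longrightarrow> f x = g x"
  shows "BMO_norm f = BMO_norm g"
proof -
  have "ball_avg f x R = ball_avg g x R" for x R
    unfolding ball_avg_def set_lebesgue_integral_def
    by (intro arg_cong[where f = "(*\<^sub>R) _"] integral_cong_off_origin) (simp add: assms)
  moreover have "(\<integral>\<^sup>+ y \<in> ball x R. ennreal (norm (f y - c)) \<partial>lborel) = (\<integral>\<^sup>+ y \<in> ball x R. ennreal (norm (g y - c)) \<partial>lborel)" for x R c
    by (rule nn_integral_cong_AE) (use AE_lborel_singleton[of "0::space"] in eventually_elim, simp add: assms)
  ultimately show ?thesis by (simp add: BMO_norm_def)
qed

lemma ball_integrable_measurable: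
  assumes f: "ball_integrable f" shows "f \<in> borel_measurable borel"
proof (rule borel_measurable_LIMSEQ_metric)
  show "(\<lambda>y. indicator (ball 0 (real n)) y *\<^sub>R f y) \<in> borel_measurable borel" for n
    using f by (auto simp: ball_integrable_def set_integrable_def dest!: spec[of _ "0::space"] spec[of _ "real n"])
  show "(\<lambda>n. indicator (ball 0 (real n)) y *\<^sub>R f y) \<longlonglongrightarrow> f y" for y
  proof (rule tendsto_eventually)
    obtain N where "norm y < real N" using reals_Archimedean2 by blast
    then show "\<forall>\<^sub>F n in sequentially. indicator (ball 0 (real n)) y *\<^sub>R f y = f y"
      by (intro eventually_sequentiallyI[of N]) (auto simp: indicator_def)
  qed
qed

lemma ball_avg_add:
  assumes "ball_integrable f" "ball_integrable g"
  shows "ball_avg (\<lambda>x. f x + g x) x R = ball_avg f x R + ball_avg g x R"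
  using assms unfolding ball_avg_def ball_integrable_def by (simp add: set_integral_add scaleR_add_right)

lemma BMO_add:
  assumes f: "ball_integrable f" and g: "ball_integrable g"
  shows "BMO_norm (\<lambda>x. f x + g x) \<le> BMO_norm f + BMO_norm g"
proof (rule BMO_leI)
  fix x :: space and R :: real assume R: "0 < R"
  note [measurable] = ball_integrable_measurable[OF f] ball_integrable_measurable[OF g]
  have "(\<integral>\<^sup>+ y \<in> ball x R. ennreal (norm (f y + g y - ball_avg (\<lambda>x. f x + g x) x R)) \<partial>lborel)
    \<le> (\<integral>\<^sup>+ y. ennreal (norm (f y - ball_avg f x R)) * indicator (ball x R) y + ennreal (norm (g y - ball_avg g x R)) * indicator (ball x R) y \<partial>lborel)"
  proof (rule nn_integral_mono)
    fix y
    have "norm (f y + g y - ball_avg (\<lambda>x. f x + g x) x R) \<le> norm (f y - ball_avg f x R) + norm (g y - ball_avg g x R)"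
      unfolding ball_avg_add[OF f g] by (metis add_diff_add norm_triangle_ineq)
    then show "ennreal (norm (f y + g y - ball_avg (\<lambda>x. f x + g x) x R)) * indicator (ball x R) y
      \<le> ennreal (norm (f y - ball_avg f x R)) * indicator (ball x R) y + ennreal (norm (g y - ball_avg g x R)) * indicator (ball x R) y"
      by (auto simp: indicator_def ennreal_plus[symmetric] simp del: ennreal_plus intro!: ennreal_leI)
  qed
  also have "\<dots> = (\<integral>\<^sup>+ y \<in> ball x R. ennreal (norm (f y - ball_avg f x R)) \<partial>lborel) + (\<integral>\<^sup>+ y \<in> ball x R. ennreal (norm (g y - ball_avg g x R)) \<partial>lborel)"
    by (rule nn_integral_add) measurable
  finally have "osc (\<lambda>x. f x + g x) x R \<le> osc f x R + osc g x R"
    unfolding osc_def by (simp add: divide_right_mono_ennreal add_divide_distrib_ennreal[symmetric])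
  also have "\<dots> \<le> BMO_norm f + BMO_norm g" by (intro add_mono osc_le_BMO R)
  finally show "osc (\<lambda>x. f x + g x) x R \<le> BMO_norm f + BMO_norm g" .
qed

text \<open>The average may be replaced by any constant at the price of a factor two.\<close>

lemma osc_le:
  assumes f: "ball_integrable f" and R: "0 < R" and K: "0 \<le> K"
    and b: "(\<integral>\<^sup>+ y \<in> ball x R. ennreal (norm (f y - c)) \<partial>lborel) \<le> ennreal K * emeasure lborel (ball x R)"
  shows "osc f x R \<le> ennreal (2 * K)"
proof -
  let ?B = "ball x R" and ?m = "measure lborel (ball x R)"
  note [measurable] = ball_integrable_measurable[OF f]
  have m: "?m > 0" using R by (simp add: measure_ball3)
  have em: "emeasure lborel ?B = ennreal ?m" using R by (simp add: measure_ball3 emeasure_ball3)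
  have fi: "set_integrable lborel ?B f" using f by (simp add: ball_integrable_def)
  have ci: "set_integrable lborel ?B (\<lambda>y. c)"
    unfolding set_integrable_def using em by (intro integrable_scaleR_left integrable_real_indicator) auto
  have "(LINT y:?B|lborel. c) = ?m *\<^sub>R c"
    unfolding set_lebesgue_integral_def
    by (subst integral_scaleR_left) (use em in \<open>auto intro!: integrable_real_indicator\<close>)
  then have "c = (1 / ?m) *\<^sub>R (LINT y:?B|lborel. c)"
    using m by (simp only: scaleR_scaleR) simp
  then have "ball_avg f x R - c = (1 / ?m) *\<^sub>R ((LINT y:?B|lborel. f y) - (LINT y:?B|lborel. c))"
    unfolding ball_avg_def by (simp add: scaleR_diff_right)
  also have "\<dots> = (1 / ?m) *\<^sub>R (LINT y:?B|lborel. f y - c)" using fi ci by (simp add: set_integral_diff)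
  also have "norm \<dots> = (1 / ?m) * norm (LINT y:?B|lborel. f y - c)" using m by simp
  finally have n: "norm (ball_avg f x R - c) = (1 / ?m) * norm (LINT y:?B|lborel. f y - c)" .
  have le: "norm (LINT y:?B|lborel. f y - c) \<le> (LINT y:?B|lborel. norm (f y - c))"
    by (rule set_integral_norm_bound[OF set_integral_diff(1)[OF fi ci]])
  have "(LINT y:?B|lborel. norm (f y - c)) \<le> K * ?m"
  proof -
    have i: "integrable lborel (\<lambda>y. indicator ?B y *\<^sub>R norm (f y - c))"
      using set_integrable_norm[OF set_integral_diff(1)[OF fi ci]] by (simp add: set_integrable_def)
    have "ennreal (LINT y:?B|lborel. norm (f y - c)) = (\<integral>\<^sup>+ y. ennreal (indicator ?B y *\<^sub>R norm (f y - c)) \<partial>lborel)"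
      unfolding set_lebesgue_integral_def by (rule nn_integral_eq_integral[OF i, symmetric]) (auto simp: indicator_def)
    also have "\<dots> = (\<integral>\<^sup>+ y \<in> ?B. ennreal (norm (f y - c)) \<partial>lborel)"
      by (intro nn_integral_cong) (auto simp: indicator_def)
    also have "\<dots> \<le> ennreal K * emeasure lborel ?B" by (rule b)
    also have "\<dots> = ennreal (K * ?m)" using K em by (simp add: ennreal_mult)
    finally show ?thesis using K m by (subst (asm) ennreal_le_iff) auto
  qed
  with le have "norm (LINT y:?B|lborel. f y - c) \<le> K * ?m" by linarith
  then have avg: "norm (ball_avg f x R - c) \<le> K" using m unfolding n by (simp add: divide_le_eq)
  have "(\<integral>\<^sup>+ y \<in> ?B. ennreal (norm (f y - ball_avg f x R)) \<partial>lborel)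
    \<le> (\<integral>\<^sup>+ y. ennreal (norm (f y - c)) * indicator ?B y + ennreal K * indicator ?B y \<partial>lborel)"
  proof (rule nn_integral_mono)
    fix y
    have "norm (f y - ball_avg f x R) \<le> norm (f y - c) + K"
      using norm_triangle_ineq4[of "f y - c" "ball_avg f x R - c"] avg by simp
    then show "ennreal (norm (f y - ball_avg f x R)) * indicator ?B y \<le> ennreal (norm (f y - c)) * indicator ?B y + ennreal K * indicator ?B y"
      using K by (auto simp: indicator_def ennreal_plus[symmetric] simp del: ennreal_plus intro!: ennreal_leI)
  qed
  also have "\<dots> = (\<integral>\<^sup>+ y \<in> ?B. ennreal (norm (f y - c)) \<partial>lborel) + ennreal K * emeasure lborel ?B"
    by (subst nn_integral_add) (auto simp: nn_integral_cmult)
  also have "\<dots> \<le> ennreal K * emeasure lborel ?B + ennreal K * emeasure lborel ?B" using b by (rule add_right_mono)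
  also have "\<dots> = ennreal (2 * K * ?m)" using K m by (simp add: em ennreal_mult[symmetric] ennreal_plus[symmetric] del: ennreal_plus)
  finally have "osc f x R \<le> ennreal (2 * K * ?m) / ennreal ?m"
    unfolding osc_def em by (rule divide_right_mono_ennreal)
  also have "\<dots> = ennreal (2 * K)" using m K by (simp add: divide_ennreal)
  finally show ?thesis .
qed

text \<open>The logarithm has bounded mean oscillation: if \<open>2 R \<le> |x|\<close>, it varies by at most \<open>ln 2\<close> from its
  value at the centre. Otherwise the ball lies in \<open>ball 0 (3 * R)\<close>, where
  \<open>ln (3 * R / |y|) \<le> 3 * R / |y|\<close>, and the integral of the right-hand side over the larger ball is
  \<open>81/2\<close> times the volume of the smaller one.\<close>

lemma ln_mean_oscillation:
  fixes x :: space
  assumes R: "0 < R"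
  obtains \<rho> where "0 < \<rho>" "(\<integral>\<^sup>+ y \<in> ball x R. ennreal (1 + \<bar>ln (norm y) - ln \<rho>\<bar>) \<partial>lborel) \<le> ennreal 42 * emeasure lborel (ball x R)"
proof (cases "2 * R \<le> norm x")
  case True
  have "(\<integral>\<^sup>+ y \<in> ball x R. ennreal (1 + \<bar>ln (norm y) - ln (norm x)\<bar>) \<partial>lborel) \<le> (\<integral>\<^sup>+ y. ennreal 42 * indicator (ball x R) y \<partial>lborel)"
  proof (rule nn_integral_mono)
    fix y :: space
    have "\<bar>ln (norm y) - ln (norm x)\<bar> \<le> 1" if "dist x y < R"
    proof -
      have 1: "norm y \<le> 2 * norm x" "norm x \<le> 2 * norm y"
        using that True R norm_triangle_ineq2[of x y] norm_triangle_ineq2[of y x] by (auto simp: dist_norm norm_minus_commute)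
      have xp: "norm x > 0" using True R by linarith
      then have yp: "norm y > 0" using 1 by linarith
      have "ln (norm y) \<le> ln (2 * norm x)" "ln (norm x) \<le> ln (2 * norm y)"
        using 1 xp yp by (auto simp: ln_mono)
      then show ?thesis using xp yp ln_le_minus_one[of "2::real"] by (simp add: ln_mult abs_le_iff)
    qed
    then have "ennreal (1 + \<bar>ln (norm y) - ln (norm x)\<bar>) \<le> ennreal 42" if "dist x y < R"
      using that by (intro ennreal_leI) simp
    then show "ennreal (1 + \<bar>ln (norm y) - ln (norm x)\<bar>) * indicator (ball x R) y \<le> ennreal 42 * indicator (ball x R) y"
      by (cases "dist x y < R") (simp_all add: indicator_def del: ennreal_plus ennreal_numeral)
  qed
  also have "\<dots> = ennreal 42 * emeasure lborel (ball x R)" by (subst nn_integral_cmult) auto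
  finally show ?thesis by (rule that[rotated]) (use True R in linarith)
next
  case False
  let ?\<rho> = "3 * R"
  have "(\<integral>\<^sup>+ y \<in> ball x R. ennreal (1 + \<bar>ln (norm y) - ln ?\<rho>\<bar>) \<partial>lborel)
     \<le> (\<integral>\<^sup>+ y. indicator (ball x R) y + ennreal (?\<rho> / norm y) * indicator {0..?\<rho>} (norm y) \<partial>lborel)"
  proof (rule nn_integral_mono_AE)
    show "AE y in lborel. ennreal (1 + \<bar>ln (norm y) - ln ?\<rho>\<bar>) * indicator (ball x R) y
       \<le> indicator (ball x R) y + ennreal (?\<rho> / norm y) * indicator {0..?\<rho>} (norm y)"
      using AE_lborel_singleton[of "0::space"]
    proof eventually_elim
      fix y :: space assume y: "y \<noteq> 0"
      show "ennreal (1 + \<bar>ln (norm y) - ln ?\<rho>\<bar>) * indicator (ball x R) y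
       \<le> indicator (ball x R) y + ennreal (?\<rho> / norm y) * indicator {0..?\<rho>} (norm y)"
      proof (cases "dist x y < R")
        case True
        have ny: "0 < norm y" "norm y \<le> ?\<rho>"
          using True False y norm_triangle_ineq2[of y x] by (auto simp: dist_norm norm_minus_commute)
        have "\<bar>ln (norm y) - ln ?\<rho>\<bar> = ln (?\<rho> / norm y)"
          using ny R by (simp add: ln_div abs_if ln_mono not_less)
        also have "\<dots> \<le> ?\<rho> / norm y" using ny R ln_le_minus_one[of "?\<rho> / norm y"] by simp
        finally have "ennreal (1 + \<bar>ln (norm y) - ln ?\<rho>\<bar>) \<le> ennreal (1 + ?\<rho> / norm y)" by (intro ennreal_leI) simp
        also have "\<dots> = 1 + ennreal (?\<rho> / norm y)" using R by simp
        finally show ?thesis using True ny by (simp add: indicator_def)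
      qed (simp add: indicator_def)
    qed
  qed
  also have "\<dots> = emeasure lborel (ball x R) + (\<integral>\<^sup>+ (y::space). ennreal (?\<rho> / norm y) * indicator {0..?\<rho>} (norm y) \<partial>lborel)"
    by (subst nn_integral_add) auto
  also have "(\<integral>\<^sup>+ (y::space). ennreal (?\<rho> / norm y) * indicator {0..?\<rho>} (norm y) \<partial>lborel)
    = (\<integral>\<^sup>+ r. ennreal (4 * pi * r\<^sup>2) * (ennreal (?\<rho> / r) * indicator {0..?\<rho>} r) * indicator {0..} r \<partial>lborel)"
    by (rule nn_integral_radial) measurable
  also have "\<dots> = (\<integral>\<^sup>+ r. ennreal (4 * pi * ?\<rho> * r) * indicator {0..?\<rho>} r \<partial>lborel)"
    using R by (intro nn_integral_cong) (auto simp: indicator_def ennreal_mult[symmetric] power2_eq_square)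
  also have "\<dots> = ennreal (2 * pi * ?\<rho> * ?\<rho>\<^sup>2 - 2 * pi * ?\<rho> * 0\<^sup>2)"
    using R by (intro nn_integral_FTC_Icc) (auto intro!: derivative_eq_intros)
  also have "emeasure lborel (ball x R) + ennreal (2 * pi * ?\<rho> * ?\<rho>\<^sup>2 - 2 * pi * ?\<rho> * 0\<^sup>2) \<le> ennreal 42 * emeasure lborel (ball x R)"
    using R unfolding emeasure_ball3[OF less_imp_le[OF R]]
    by (simp add: ennreal_mult[symmetric] ennreal_plus[symmetric] power2_eq_square power3_eq_cube del: ennreal_plus ennreal_numeral)
  finally show ?thesis by (rule that[rotated]) (use R in simp)
qed

lemma power_bounded_set_integrable:
  assumes f: "power_bounded a f" and a: "0 \<le> a" "a < 3" and S: "bounded S" "S \<in> sets borel"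
  shows "set_integrable lborel S f"
proof -
  obtain R where R: "\<And>y. y \<in> S \<Longrightarrow> norm y < R" using S(1) by (meson bounded_pos_less)
  have "set_integrable lborel (ball 0 R) f"
    using power_bounded_integrable_ball[OF f a] by (simp add: set_integrable_def)
  then show ?thesis by (rule set_integrable_subset) (use S R in auto)
qed

lemma integrable_vec:
  fixes f :: "'a \<Rightarrow> 'b::euclidean_space^3"
  assumes f: "\<And>i. integrable M (\<lambda>x. f x $ i)"
  shows "integrable M f"
proof -
  have *: "f = (\<lambda>x. \<Sum>i\<in>UNIV. axis i (f x $ i))"
    by (simp add: fun_eq_iff vec_eq_iff axis_def)
  have "linear (axis i :: 'b \<Rightarrow> 'b^3)" for i
    by (rule linearI) (simp_all add: vec_eq_iff axis_def)
  then have "bounded_linear (axis i :: 'b \<Rightarrow> 'b^3)" for i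
    by (simp add: linear_conv_bounded_linear)
  then have "integrable M (\<lambda>x. \<Sum>i\<in>UNIV. axis i (f x $ i))"
    by (intro Bochner_Integration.integrable_sum) (rule integrable_bounded_linear[OF _ f])
  then show ?thesis by (simp only: *[symmetric])
qed

lemma set_integrable_vec:
  fixes f :: "'a \<Rightarrow> 'b::euclidean_space^3"
  assumes f: "\<And>i. set_integrable M S (\<lambda>x. f x $ i)"
  shows "set_integrable M S f"
  using f unfolding set_integrable_def by (intro integrable_vec) simp

lemma power_bounded_radial_leray:
  assumes p: "\<And>j. profile C R (Q j) (Q' j)" and a: "1/4 \<le> a" "a \<le> 3"
  shows "power_bounded a (\<lambda>x. radial_leray Q x $ i)"
proof -
  have "power_bounded a (\<lambda>x. Q i (norm x) + (- leray_const) * (\<Sum>j\<in>UNIV. hess (Q j) i j x))"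
    by (intro power_bounded_add power_bounded_cmult power_bounded_sum power_bounded_radial[OF p] power_bounded_hess[OF p] a)
  then show ?thesis by (simp add: radial_leray_def)
qed

lemma radial_leray_ball_integrable:
  assumes p: "\<And>j. profile C R (Q j) (Q' j)"
  shows "ball_integrable (radial_leray Q)"
  unfolding ball_integrable_def
  by (intro allI set_integrable_vec power_bounded_set_integrable[OF power_bounded_radial_leray[OF p, of 1]]) auto

lemma unit_comp_bound: "\<bar>x $ i * x $ j / (norm (x::space))\<^sup>2\<bar> \<le> 1"
proof -
  have "\<bar>x $ i * x $ j\<bar> \<le> norm x * norm x"
    unfolding abs_mult by (intro mult_mono component_le_norm_cart) auto
  then show ?thesis by (cases "x = 0") (auto simp: abs_mult power2_eq_square divide_le_eq)
qed

text \<open>The matrix \<open>x x\<^sup>T / |x|\<^sup>2\<close> is discontinuous at the origin, but it multiplies only \<open>Q - mean Q\<close>, which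
  is bounded when \<open>Q\<close> varies logarithmically.\<close>

lemma radial_leray_split:
  "radial_leray Q x $ i = (Q i (norm x) - leray_const / 3 * mean (Q i) (norm x))
     - leray_const * (\<Sum>j\<in>UNIV. x $ i * x $ j / (norm x)\<^sup>2 * (Q j (norm x) - mean (Q j) (norm x)))"
  by (simp add: radial_leray_def hess_def sum.distrib distrib_left if_distrib[of "\<lambda>c. c * _"]
      sum_divide_distrib[symmetric] cong: if_cong)

lemma angular_bound:
  assumes p: "\<And>j. profile C R (Q j) (Q' j)" and A: "\<And>j r. 0 < r \<Longrightarrow> \<bar>r * Q' j r\<bar> \<le> A" and x: "x \<noteq> (0::space)"
  shows "\<bar>leray_const * (\<Sum>j\<in>UNIV. x $ i * x $ j / (norm x)\<^sup>2 * (Q j (norm x) - mean (Q j) (norm x)))\<bar> \<le> 27/2 * A"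
proof -
  have A0: "0 \<le> A" using order_trans[OF abs_ge_zero A[of 1 1]] by simp
  have "\<bar>\<Sum>j\<in>UNIV. x $ i * x $ j / (norm x)\<^sup>2 * (Q j (norm x) - mean (Q j) (norm x))\<bar> \<le> (\<Sum>j\<in>(UNIV::3 set). 1 * (3/2 * A))"
  proof (rule sum_abs[THEN order_trans], rule sum_mono)
    fix j :: 3
    show "\<bar>x $ i * x $ j / (norm x)\<^sup>2 * (Q j (norm x) - mean (Q j) (norm x))\<bar> \<le> 1 * (3/2 * A)"
      unfolding abs_mult[of "x $ i * x $ j / (norm x)\<^sup>2"]
    proof (intro mult_mono unit_comp_bound)
      show "\<bar>Q j (norm x) - mean (Q j) (norm x)\<bar> \<le> 3/2 * A"
        by (rule mean_close[OF p A]) (use x in auto)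
    qed auto
  qed
  then have "\<bar>leray_const\<bar> * \<bar>\<Sum>j\<in>UNIV. x $ i * x $ j / (norm x)\<^sup>2 * (Q j (norm x) - mean (Q j) (norm x))\<bar> \<le> 3 * (9/2 * A)"
    using leray_const_bounds A0 by (intro mult_mono) (auto simp: sum_3)
  then show ?thesis by (simp add: abs_mult)
qed

text \<open>The field is the sum of a radial part with a logarithmic Lipschitz bound and of a bounded angular
  part. Nothing but the logarithmic derivative of the profiles enters, so that the bound is blind to
  their size.\<close>

lemma BMO_radial_leray:
  assumes p: "\<And>j. profile C R (Q j) (Q' j)" and A: "\<And>j r. 0 < r \<Longrightarrow> \<bar>r * Q' j r\<bar> \<le> A"
  shows "BMO_norm (radial_leray Q) \<le> ennreal (4000 * A)"
proof (rule BMO_leI)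
  fix x :: space and R' :: real assume R: "0 < R'"
  have A0: "0 \<le> A" using order_trans[OF abs_ge_zero A[of 1 1]] by simp
  note \<kappa> = leray_const_bounds
  obtain \<rho> where \<rho>: "0 < \<rho>" "(\<integral>\<^sup>+ y \<in> ball x R'. ennreal (1 + \<bar>ln (norm y) - ln \<rho>\<bar>) \<partial>lborel) \<le> ennreal 42 * emeasure lborel (ball x R')"
    using ln_mean_oscillation[OF R] by blast
  define c :: space where "c = (\<chi> i. Q i \<rho> - leray_const / 3 * mean (Q i) \<rho>)"
  \<comment> \<open>\<open>41\<close> exceeds \<open>3 * 11/2\<close> and \<open>3 * 27/2\<close>, the constants summed over the three components.\<close>
  have pw: "norm (radial_leray Q y - c) \<le> 41 * A * (1 + \<bar>ln (norm y) - ln \<rho>\<bar>)" if y: "y \<noteq> 0" for y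
  proof -
    let ?l = "\<bar>ln (norm y) - ln \<rho>\<bar>"
    have ny: "0 < norm y" using y by simp
    have "\<bar>(radial_leray Q y - c) $ i\<bar> \<le> 11/2 * A * ?l + 27/2 * A" for i
    proof -
      have "\<bar>leray_const / 3 * mean (Q i) (norm y) - leray_const / 3 * mean (Q i) \<rho>\<bar> = leray_const / 3 * \<bar>mean (Q i) (norm y) - mean (Q i) \<rho>\<bar>"
        using \<kappa> unfolding right_diff_distrib[symmetric] abs_mult by simp
      also have "\<dots> \<le> 1 * (9/2 * A * ?l)"
        using \<kappa> by (intro mult_mono mean_log_lipschitz[OF p A ny \<rho>(1)]) auto
      finally have "\<bar>leray_const / 3 * mean (Q i) (norm y) - leray_const / 3 * mean (Q i) \<rho>\<bar> \<le> 9/2 * A * ?l" by simp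
      moreover have "\<bar>Q i (norm y) - Q i \<rho>\<bar> \<le> A * ?l" by (rule profile_log_lipschitz[OF p A ny \<rho>(1)])
      moreover have "\<bar>leray_const * (\<Sum>j\<in>UNIV. y $ i * y $ j / (norm y)\<^sup>2 * (Q j (norm y) - mean (Q j) (norm y)))\<bar> \<le> 27/2 * A"
        by (rule angular_bound[OF p A y])
      moreover have "\<bar>(a - b - w) - (a' - b')\<bar> \<le> 11/2 * A * ?l + 27/2 * A"
        if "\<bar>b - b'\<bar> \<le> 9/2 * A * ?l" "\<bar>a - a'\<bar> \<le> A * ?l" "\<bar>w\<bar> \<le> 27/2 * A" for a b w a' b' :: real
        using that by linarith
      ultimately show ?thesis
        unfolding vector_minus_component radial_leray_split c_def vec_lambda_beta by blast
    qed
    then have "norm (radial_leray Q y - c) \<le> (\<Sum>i\<in>(UNIV::3 set). 11/2 * A * ?l + 27/2 * A)"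
      by (intro order_trans[OF norm_le_l1_cart] sum_mono)
    also have "\<dots> = 33/2 * (A * ?l) + 81/2 * A" by (simp add: sum_3)
    also have "\<dots> \<le> 41 * A + 41 * (A * ?l)"
      using A0 mult_nonneg_nonneg[OF A0 abs_ge_zero[of "ln (norm y) - ln \<rho>"]] by linarith
    also have "\<dots> = 41 * A * (1 + ?l)" by (simp add: distrib_left)
    finally show ?thesis .
  qed
  have "(\<integral>\<^sup>+ y \<in> ball x R'. ennreal (norm (radial_leray Q y - c)) \<partial>lborel)
    \<le> (\<integral>\<^sup>+ y. ennreal (41 * A) * (ennreal (1 + \<bar>ln (norm y) - ln \<rho>\<bar>) * indicator (ball x R') y) \<partial>lborel)"
  proof (rule nn_integral_mono_AE)
    show "AE y in lborel. ennreal (norm (radial_leray Q y - c)) * indicator (ball x R') y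
      \<le> ennreal (41 * A) * (ennreal (1 + \<bar>ln (norm y) - ln \<rho>\<bar>) * indicator (ball x R') y)"
      using AE_lborel_singleton[of "0::space"]
    proof eventually_elim
      fix y :: space assume "y \<noteq> 0"
      then have "ennreal (norm (radial_leray Q y - c)) \<le> ennreal (41 * A) * ennreal (1 + \<bar>ln (norm y) - ln \<rho>\<bar>)"
        using A0 by (subst ennreal_mult[symmetric]) (auto intro!: ennreal_leI pw)
      then show "ennreal (norm (radial_leray Q y - c)) * indicator (ball x R') y
        \<le> ennreal (41 * A) * (ennreal (1 + \<bar>ln (norm y) - ln \<rho>\<bar>) * indicator (ball x R') y)"
        by (cases "y \<in> ball x R'") (simp_all del: ennreal_plus)
    qed
  qed
  also have "\<dots> = ennreal (41 * A) * (\<integral>\<^sup>+ y \<in> ball x R'. ennreal (1 + \<bar>ln (norm y) - ln \<rho>\<bar>) \<partial>lborel)"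
    by (rule nn_integral_cmult) auto
  also have "\<dots> \<le> ennreal (41 * A) * (ennreal 42 * emeasure lborel (ball x R'))"
    by (intro mult_left_mono \<rho>) auto
  also have "\<dots> = ennreal (41 * A * 42) * emeasure lborel (ball x R')"
    using A0 ennreal_mult[of "41 * A" 42] by (simp only: mult.assoc)
  finally have "osc (radial_leray Q) x R' \<le> ennreal (2 * (41 * A * 42))"
    by (rule osc_le[OF radial_leray_ball_integrable[OF p] R, rotated]) (use A0 in auto)
  also have "\<dots> \<le> ennreal (4000 * A)" using A0 by (intro ennreal_leI) auto
  finally show "osc (radial_leray Q) x R' \<le> ennreal (4000 * A)" .
qed

lemma profile_diff:
  assumes "profile C R q q'" "profile C R p p'"
  shows "profile (2 * C) R (\<lambda>r. q r - p r) (\<lambda>r. q' r - p' r)"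
  unfolding profile_def
proof (intro conjI allI impI)
  fix r :: real assume r: "0 < r"
  show "((\<lambda>r. q r - p r) has_real_derivative q' r - p' r) (at r)"
    using assms r by (intro DERIV_diff profileD(4)) auto
  show "\<bar>q r - p r\<bar> \<le> 2 * C * r powr (-1/4)" "\<bar>q' r - p' r\<bar> \<le> 2 * C * r powr (-5/4)"
    using profileD(5)[OF assms(1) r] profileD(5)[OF assms(2) r] profileD(6)[OF assms(1) r] profileD(6)[OF assms(2) r]
    by linarith+
qed (use assms in \<open>auto simp: profile_def intro!: continuous_intros\<close>)

lemma mean_diff:
  assumes "profile C R q q'" "profile C R p p'"
  shows "mean (\<lambda>r. q r - p r) r = mean q r - mean p r"
  unfolding mean_def using Henstock_Kurzweil_Integration.integral_diff[OF profile_weighted_integrable[OF assms(1), of r] profile_weighted_integrable[OF assms(2), of r]]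
  by (simp add: right_diff_distrib)

lemma radial_leray_diff:
  assumes q: "\<And>j. profile C R (Q j) (Q' j)" and p: "\<And>j. profile C R (P j) (P' j)"
  shows "radial_leray (\<lambda>j r. Q j r - P j r) x = radial_leray Q x - radial_leray P x"
proof -
  have "hess (\<lambda>r. Q j r - P j r) i j x = hess (Q j) i j x - hess (P j) i j x" for i j
  proof -
    have alg: "d * ((a - b) / 3) + X * ((u - v - (a - b)) / n) = (d * (a / 3) + X * ((u - a) / n)) - (d * (b / 3) + X * ((v - b) / n))"
      for d a b X u v n :: real by (simp add: diff_divide_distrib right_diff_distrib)
    show ?thesis unfolding hess_def mean_diff[OF q p] by (rule alg)
  qed
  then have "(\<Sum>j\<in>UNIV. hess (\<lambda>r. Q j r - P j r) i j x) = (\<Sum>j\<in>UNIV. hess (Q j) i j x) - (\<Sum>j\<in>UNIV. hess (P j) i j x)" for i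
    by (simp only: sum_subtractf)
  then show ?thesis by (simp add: radial_leray_def vec_eq_iff right_diff_distrib)
qed

text \<open>Linearity in the profiles makes the seminorm continuous with respect to their logarithmic
  derivatives.\<close>

lemma BMO_radial_leray_le:
  assumes q: "\<And>j. profile C R (Q j) (Q' j)" and p: "\<And>j. profile C R (P j) (P' j)"
    and A: "\<And>j r. 0 < r \<Longrightarrow> \<bar>r * (Q' j r - P' j r)\<bar> \<le> A"
  shows "BMO_norm (radial_leray Q) \<le> BMO_norm (radial_leray P) + ennreal (4000 * A)"
proof -
  have d: "profile (2 * C) R (\<lambda>r. Q j r - P j r) (\<lambda>r. Q' j r - P' j r)" for j
    by (rule profile_diff[OF q p])
  have "radial_leray Q = (\<lambda>x. radial_leray P x + radial_leray (\<lambda>j r. Q j r - P j r) x)"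
    by (simp add: radial_leray_diff[OF q p])
  then have "BMO_norm (radial_leray Q) = BMO_norm (\<lambda>x. radial_leray P x + radial_leray (\<lambda>j r. Q j r - P j r) x)"
    by (rule arg_cong)
  also have "\<dots> \<le> BMO_norm (radial_leray P) + BMO_norm (radial_leray (\<lambda>j r. Q j r - P j r))"
    by (intro BMO_add radial_leray_ball_integrable[OF p]
        radial_leray_ball_integrable[where Q = "\<lambda>j r. Q j r - P j r" and Q' = "\<lambda>j r. Q' j r - P' j r", OF d])
  also have "\<dots> \<le> BMO_norm (radial_leray P) + ennreal (4000 * A)"
    by (intro add_left_mono BMO_radial_leray[where Q = "\<lambda>j r. Q j r - P j r" and Q' = "\<lambda>j r. Q' j r - P' j r", OF d A])
  finally show ?thesis .
qed

lemma BMO_scale: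
  assumes f: "ball_integrable f" and b: "0 < b" and a: "0 < a"
  shows "BMO_norm (\<lambda>x. a *\<^sub>R f (b *\<^sub>R x)) = ennreal a * BMO_norm f"
proof -
  note [measurable] = ball_integrable_measurable[OF f]
  have osc: "osc (\<lambda>x. a *\<^sub>R f (b *\<^sub>R x)) x R = ennreal a * osc f (b *\<^sub>R x) (b * R)" if R: "0 < R" for x R
  proof -
    have ind: "indicator (ball x R) y = indicator (ball (b *\<^sub>R x) (b * R)) (b *\<^sub>R y)" for y
      using b by (simp add: indicator_def dist_norm scaleR_diff_right[symmetric])
    have ind': "indicator (ball x R) y = (indicator (ball (b *\<^sub>R x) (b * R)) (b *\<^sub>R y) :: ennreal)" for y
      using b by (simp add: indicator_def dist_norm scaleR_diff_right[symmetric])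
    have "ball_avg (\<lambda>x. a *\<^sub>R f (b *\<^sub>R x)) x R = (a / measure lborel (ball x R)) *\<^sub>R (LINT y|lborel. indicator (ball (b *\<^sub>R x) (b * R)) (b *\<^sub>R y) *\<^sub>R f (b *\<^sub>R y))"
      unfolding ball_avg_def set_lebesgue_integral_def ind scaleR_left_commute[of _ a] integral_scaleR_right by simp
    also have "\<dots> = a *\<^sub>R ball_avg f (b *\<^sub>R x) (b * R)"
      unfolding ball_avg_def set_lebesgue_integral_def
      using integral_affine[of b "\<lambda>y. indicator (ball (b *\<^sub>R x) (b * R)) y *\<^sub>R f y" 0] b R
      by (simp add: measure_ball3 power_mult_distrib)
    finally have avg: "ball_avg (\<lambda>x. a *\<^sub>R f (b *\<^sub>R x)) x R = a *\<^sub>R ball_avg f (b *\<^sub>R x) (b * R)" .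
    let ?c = "ball_avg f (b *\<^sub>R x) (b * R)"
    have "(\<integral>\<^sup>+ y \<in> ball x R. ennreal (norm (a *\<^sub>R f (b *\<^sub>R y) - a *\<^sub>R ?c)) \<partial>lborel)
      = (\<integral>\<^sup>+ y. ennreal a * (ennreal (norm (f (b *\<^sub>R y) - ?c)) * indicator (ball (b *\<^sub>R x) (b * R)) (b *\<^sub>R y)) \<partial>lborel)"
      using a by (intro nn_integral_cong) (simp add: ind' scaleR_diff_right[symmetric] ennreal_mult mult.assoc)
    also have "\<dots> = ennreal a * (\<integral>\<^sup>+ y. ennreal (norm (f (b *\<^sub>R y) - ?c)) * indicator (ball (b *\<^sub>R x) (b * R)) (b *\<^sub>R y) \<partial>lborel)"
      by (rule nn_integral_cmult) measurable
    finally have num: "(\<integral>\<^sup>+ y \<in> ball x R. ennreal (norm (a *\<^sub>R f (b *\<^sub>R y) - a *\<^sub>R ?c)) \<partial>lborel)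
      = ennreal a * (\<integral>\<^sup>+ y. ennreal (norm (f (b *\<^sub>R y) - ?c)) * indicator (ball (b *\<^sub>R x) (b * R)) (b *\<^sub>R y) \<partial>lborel)" .
    let ?I = "\<integral>\<^sup>+ y. ennreal (norm (f (b *\<^sub>R y) - ?c)) * indicator (ball (b *\<^sub>R x) (b * R)) (b *\<^sub>R y) \<partial>lborel"
    have "osc f (b *\<^sub>R x) (b * R) = (ennreal (b ^ 3) * ?I) / (ennreal (b ^ 3) * emeasure lborel (ball x R))"
      unfolding osc_def
      using nn_integral_affine[of "\<lambda>y. ennreal (norm (f y - ?c)) * indicator (ball (b *\<^sub>R x) (b * R)) y" b 0] b R
      by (simp add: emeasure_ball3 power_mult_distrib ennreal_mult[symmetric] mult_ac)
    also have "\<dots> = ?I / emeasure lborel (ball x R)"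
    proof -
      have v: "4/3 * pi * R ^ 3 > 0" using R by simp
      have "(ennreal (b ^ 3) * ?I) / (ennreal (b ^ 3) * emeasure lborel (ball x R))
        = ?I * (ennreal (b ^ 3) * ennreal (inverse (b ^ 3 * (4/3 * pi * R ^ 3))))"
      proof -
        have "inverse (ennreal (b ^ 3 * (4/3 * pi * R ^ 3))) = ennreal (inverse (b ^ 3 * (4/3 * pi * R ^ 3)))"
          by (rule inverse_ennreal) (use b v in auto)
        moreover have "ennreal (b ^ 3) * emeasure lborel (ball x R) = ennreal (b ^ 3 * (4/3 * pi * R ^ 3))"
          unfolding emeasure_ball3[OF less_imp_le[OF R]] by (rule ennreal_mult[symmetric]) (use b v in auto)
        ultimately show ?thesis by (simp only: divide_ennreal_def mult_ac)
      qed
      also have "ennreal (b ^ 3) * ennreal (inverse (b ^ 3 * (4/3 * pi * R ^ 3))) = ennreal (inverse (4/3 * pi * R ^ 3))"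
        using b R by (subst ennreal_mult[symmetric]) (auto simp: field_simps)
      also have "?I * \<dots> = ?I / emeasure lborel (ball x R)"
        unfolding emeasure_ball3[OF less_imp_le[OF R]] divide_ennreal_def inverse_ennreal[OF v] ..
      finally show ?thesis .
    qed
    finally show ?thesis unfolding osc_def[of "\<lambda>x. a *\<^sub>R f (b *\<^sub>R x)"] avg num
      by (simp add: ennreal_times_divide)
  qed
  have cancel: "ennreal a * X / ennreal a = X" for X
    by (subst mult.commute, subst ennreal_mult_divide_eq) (use a in auto)
  show ?thesis
  proof (rule antisym)
    show "BMO_norm (\<lambda>x. a *\<^sub>R f (b *\<^sub>R x)) \<le> ennreal a * BMO_norm f"
      by (rule BMO_leI) (use b in \<open>auto simp: osc intro!: mult_left_mono osc_le_BMO\<close>)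
    have "BMO_norm f \<le> BMO_norm (\<lambda>x. a *\<^sub>R f (b *\<^sub>R x)) / ennreal a"
    proof (rule BMO_leI)
      fix x :: space and R :: real assume R: "0 < R"
      have "ennreal a * osc f x R \<le> BMO_norm (\<lambda>x. a *\<^sub>R f (b *\<^sub>R x))"
        using osc_le_BMO[of "R / b" "\<lambda>x. a *\<^sub>R f (b *\<^sub>R x)" "(1 / b) *\<^sub>R x"] osc[of "R / b" "(1 / b) *\<^sub>R x"] b R by simp
      then have "(ennreal a * osc f x R) / ennreal a \<le> BMO_norm (\<lambda>x. a *\<^sub>R f (b *\<^sub>R x)) / ennreal a"
        by (rule divide_right_mono_ennreal)
      then show "osc f x R \<le> BMO_norm (\<lambda>x. a *\<^sub>R f (b *\<^sub>R x)) / ennreal a"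
        by (simp only: cancel)
    qed
    then have "ennreal a * BMO_norm f \<le> ennreal a * (BMO_norm (\<lambda>x. a *\<^sub>R f (b *\<^sub>R x)) / ennreal a)"
      by (rule mult_left_mono) simp
    also have "\<dots> = BMO_norm (\<lambda>x. a *\<^sub>R f (b *\<^sub>R x))"
      by (simp only: ennreal_times_divide cancel)
    finally show "ennreal a * BMO_norm f \<le> BMO_norm (\<lambda>x. a *\<^sub>R f (b *\<^sub>R x))" .
  qed
qed

section \<open>Test functions\<close>

lemma Ck_affine: "Ck k f \<Longrightarrow> Ck k (\<lambda>x. m * f (b *\<^sub>R x + c))"
proof (induction k arbitrary: f m)
  case 0
  then show ?case by (auto intro!: continuous_intros continuous_on_compose2[of UNIV f])
next
  case (Suc k)
  have d: "((\<lambda>x. m * f (b *\<^sub>R x + c)) has_derivative (\<lambda>h. m * frechet_derivative f (at (b *\<^sub>R x + c)) (b *\<^sub>R h))) (at x)" for x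
  proof -
    have "(f has_derivative frechet_derivative f (at (b *\<^sub>R x + c))) (at (b *\<^sub>R x + c))"
      using Suc.prems by (simp add: frechet_derivative_works)
    moreover have "((\<lambda>x. b *\<^sub>R x + c) has_derivative (\<lambda>h. b *\<^sub>R h)) (at x)"
      by (auto intro!: derivative_eq_intros)
    ultimately have "((\<lambda>x. f (b *\<^sub>R x + c)) has_derivative (\<lambda>h. frechet_derivative f (at (b *\<^sub>R x + c)) (b *\<^sub>R h))) (at x)"
      by (rule has_derivative_compose[rotated])
    then show ?thesis by (rule has_derivative_mult_right)
  qed
  have lin: "frechet_derivative f (at y) (b *\<^sub>R h) = b * frechet_derivative f (at y) h" for y h
    using linear_frechet_derivative[of f "at y"] Suc.prems by (simp add: linear_cmul)
  have "frechet_derivative (\<lambda>x. m * f (b *\<^sub>R x + c)) (at x) (axis j 1) = (m * b) * frechet_derivative f (at (b *\<^sub>R x + c)) (axis j 1)" for x j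
    using frechet_derivative_at[OF d[of x]] by (metis lin mult.assoc)
  moreover have "Ck k (\<lambda>x. (m * b) * frechet_derivative f (at (b *\<^sub>R x + c)) (axis j 1))" for j
    using Suc.prems by (intro Suc.IH) simp
  moreover have "(\<lambda>x. m * f (b *\<^sub>R x + c)) differentiable (at x)" for x
    using d by (auto simp: differentiable_def)
  ultimately show ?case by simp
qed

lemma Ck_deriv: "Ck (Suc k) f \<Longrightarrow> Ck k (\<lambda>x. frechet_derivative f (at x) (axis j 1))"
  by simp

lemma smooth_affine: "smooth f \<Longrightarrow> smooth (\<lambda>x. f (b *\<^sub>R x + c))"
  using Ck_affine[where m = 1] by (simp add: smooth_def)

lemma test_function_affine:
  assumes t: "test_function \<psi>" and b: "b \<noteq> 0"
  shows "test_function (\<lambda>x. \<psi> (b *\<^sub>R x + c))"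
  unfolding test_function_def
proof
  show "smooth (\<lambda>x. \<psi> (b *\<^sub>R x + c))" using t by (simp add: test_function_def smooth_affine)
  obtain R where R: "\<And>x. \<psi> x \<noteq> 0 \<Longrightarrow> norm x \<le> R"
    using t by (auto simp: test_function_def compact_closure bounded_iff)
  have "norm x \<le> (R + norm c) / \<bar>b\<bar>" if "\<psi> (b *\<^sub>R x + c) \<noteq> 0" for x
  proof -
    have "\<bar>b\<bar> * norm x \<le> norm (b *\<^sub>R x + c) + norm c"
      using norm_triangle_ineq4[of "b *\<^sub>R x + c" c] by simp
    then have "\<bar>b\<bar> * norm x \<le> R + norm c" using R[OF that] by linarith
    then show ?thesis using b by (simp add: le_divide_eq mult.commute)
  qed
  then show "compact (closure {x. \<psi> (b *\<^sub>R x + c) \<noteq> 0})"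
    unfolding compact_closure bounded_iff by blast
qed

lemma smooth_regular:
  assumes "smooth f"
  shows "continuous_on UNIV f" "continuous_on UNIV (\<lambda>x. frechet_derivative f (at x) (axis j 1))"
    "f differentiable (at x)"
    "pderiv_on UNIV j f (\<lambda>x. frechet_derivative f (at x) (axis j 1))"
proof -
  have C: "Ck 0 f" "Ck (Suc 0) f" using assms by (auto simp: smooth_def simp del: Ck.simps)
  show "continuous_on UNIV f" using C(1) by simp
  show "continuous_on UNIV (\<lambda>x. frechet_derivative f (at x) (axis j 1))" using C(2) by simp
  have d: "f differentiable (at x)" for x using C(2) by simp
  then show "f differentiable (at x)" .
  show "pderiv_on UNIV j f (\<lambda>x. frechet_derivative f (at x) (axis j 1))"
    unfolding pderiv_on_def
  proof
    fix x :: space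
    let ?D = "frechet_derivative f (at x)"
    have "(f has_derivative ?D) (at (x + 0 *\<^sub>R axis j 1))"
      using frechet_derivative_works[THEN iffD1, OF d[of x]] by simp
    moreover have "((\<lambda>t::real. x + t *\<^sub>R axis j 1) has_derivative (\<lambda>t. t *\<^sub>R axis j 1)) (at 0)"
      by (auto intro!: derivative_eq_intros)
    ultimately have "((\<lambda>t. f (x + t *\<^sub>R axis j 1)) has_derivative (\<lambda>t. ?D (t *\<^sub>R axis j 1))) (at 0)"
      by (rule has_derivative_compose[rotated])
    moreover have "(\<lambda>t. ?D (t *\<^sub>R axis j 1)) = (*) (?D (axis j 1))"
      using linear_frechet_derivative[OF d[of x]] by (auto simp: linear_cmul)
    ultimately show "((\<lambda>t. f (x + t *\<^sub>R axis j 1)) has_real_derivative ?D (axis j 1)) (at 0)"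
      by (simp add: has_field_derivative_def)
  qed
qed

lemma test_function_bounds:
  assumes t: "test_function \<psi>"
  obtains R B where "\<And>x. R \<le> norm x \<Longrightarrow> \<psi> x = 0" "\<And>x. R \<le> norm x \<Longrightarrow> frechet_derivative \<psi> (at x) (axis j 1) = 0"
    "\<And>x. \<bar>\<psi> x\<bar> \<le> B" "\<And>x. \<bar>frechet_derivative \<psi> (at x) (axis j 1)\<bar> \<le> B"
proof -
  let ?d = "\<lambda>x. frechet_derivative \<psi> (at x) (axis j 1)"
  have s: "smooth \<psi>" using t by (simp add: test_function_def)
  obtain R0 where R0: "\<And>x. \<psi> x \<noteq> 0 \<Longrightarrow> norm x \<le> R0"
    using t by (auto simp: test_function_def compact_closure bounded_iff)
  define R where "R = R0 + 1"
  have z: "\<psi> x = 0" if "R \<le> norm x" for x using R0[of x] that by (auto simp: R_def)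
  have zd: "?d x = 0" if "R \<le> norm x" for x
  proof -
    have "(\<psi> has_derivative (\<lambda>h. 0)) (at x)"
    proof (rule has_derivative_transform_within_open[where s = "- cball 0 R0" and f = "\<lambda>x. 0"])
      show "0 = \<psi> y" if "y \<in> - cball 0 R0" for y using R0[of y] that by force
    qed (use that in \<open>auto simp: R_def\<close>)
    then have "(\<lambda>h. 0) = frechet_derivative \<psi> (at x)" by (rule frechet_derivative_at)
    from fun_cong[OF this, of "axis j 1"] show ?thesis by simp
  qed
  have "compact (\<psi> ` cball 0 R)" "compact (?d ` cball 0 R)"
    by (rule compact_continuous_image[OF continuous_on_subset[OF _ subset_UNIV] compact_cball], rule smooth_regular[OF s])+
  from this[THEN compact_imp_bounded] obtain B1 B2
    where "\<forall>y\<in>\<psi> ` cball 0 R. norm y \<le> B1" "\<forall>y\<in>?d ` cball 0 R. norm y \<le> B2"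
    unfolding bounded_iff by blast
  then have B: "\<bar>\<psi> x\<bar> \<le> B1" "\<bar>?d x\<bar> \<le> B2" if "norm x \<le> R" for x
    using that by simp_all
  define B where "B = max 0 (max B1 B2)"
  have "\<bar>\<psi> x\<bar> \<le> B \<and> \<bar>?d x\<bar> \<le> B" for x
    using z[of x] zd[of x] B[of x] by (cases "norm x \<le> R") (auto simp: B_def max_def)
  then show ?thesis using that[of R B] z zd by blast
qed

lemma power_bounded_times_bounded_integrable:
  assumes f: "power_bounded a f" "0 \<le> a" "a < 3" and c: "continuous_on UNIV \<psi>"
    and R: "\<And>x. R \<le> norm x \<Longrightarrow> \<psi> x = 0" and B: "\<And>x. \<bar>\<psi> x\<bar> \<le> B"
  shows "integrable lborel (\<lambda>x. f x * \<psi> x)"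
proof -
  have [measurable]: "\<psi> \<in> borel_measurable borel" using c by (rule borel_measurable_continuous_onI)
  note [measurable] = power_bounded_measurable[OF f(1)]
  show ?thesis
  proof (rule Bochner_Integration.integrable_bound)
    show "integrable lborel (\<lambda>x. B * (indicator (ball 0 R) x * f x))"
      by (intro integrable_mult_right power_bounded_integrable_ball[OF f])
    show "AE x in lborel. norm (f x * \<psi> x) \<le> norm (B * (indicator (ball 0 R) x * f x))"
    proof (rule AE_I2)
      fix x :: space
      have "\<bar>\<psi> x\<bar> \<le> \<bar>B\<bar>" using B[of x] by linarith
      then show "norm (f x * \<psi> x) \<le> norm (B * (indicator (ball 0 R) x * f x))"
        using R[of x] by (cases "norm x < R") (auto simp: abs_mult mult.commute intro!: mult_right_mono)
    qed
  qed auto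
qed

text \<open>As long as the function and its derivative have a singularity of order below three, the singular
  point does not contribute to the weak derivative.\<close>

lemma power_bounded_test_by_parts:
  assumes f: "power_bounded a f" "power_bounded b f'" and a: "0 \<le> a" "a < 3" "0 \<le> b" "b < 3" and d: "pderiv_on (-{0}) j f f'"
    and t: "test_function \<psi>"
  shows "(LINT x|lborel. f x * frechet_derivative \<psi> (at x) (axis j 1)) = - (LINT x|lborel. f' x * \<psi> x)"
proof -
  let ?d = "\<lambda>x. frechet_derivative \<psi> (at x) (axis j 1)"
  have s: "smooth \<psi>" using t by (simp add: test_function_def)
  obtain R B where RB: "\<And>x. R \<le> norm x \<Longrightarrow> \<psi> x = 0" "\<And>x. R \<le> norm x \<Longrightarrow> ?d x = 0"
    "\<And>x. \<bar>\<psi> x\<bar> \<le> B" "\<And>x. \<bar>?d x\<bar> \<le> B"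
    using test_function_bounds[OF t, of j] by blast
  note i = power_bounded_times_bounded_integrable[OF f(1) a(1,2) smooth_regular(1)[OF s] RB(1,3)]
    power_bounded_times_bounded_integrable[OF f(1) a(1,2) smooth_regular(2)[OF s] RB(2,4)]
    power_bounded_times_bounded_integrable[OF f(2) a(3,4) smooth_regular(1)[OF s] RB(1,3)]
  have "(LINT x|lborel. f' x * \<psi> x + f x * ?d x) = 0"
  proof (rule integral_pderiv_eq_0[OF i(1)])
    have "pderiv_on (-{0}) j \<psi> ?d" using smooth_regular(4)[OF s] by (simp add: pderiv_on_def)
    from pderiv_mult[OF d this] show "pderiv_on (-{0}) j (\<lambda>x. f x * \<psi> x) (\<lambda>x. f' x * \<psi> x + f x * ?d x)" .
    show "integrable lborel (\<lambda>x. f' x * \<psi> x + f x * ?d x)"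
      by (rule Bochner_Integration.integrable_add[OF i(3) i(2)])
  qed
  then show ?thesis using i by simp
qed

section \<open>The weak gradient of the projected field\<close>

definition radial_leray_grad :: "(3 \<Rightarrow> real \<Rightarrow> real) \<Rightarrow> (3 \<Rightarrow> real \<Rightarrow> real) \<Rightarrow> space \<Rightarrow> real^3^3" where
  "radial_leray_grad Q Q' x = (\<chi> i j. Q' i (norm x) * (x $ j / norm x)
     - leray_const * (\<Sum>l\<in>UNIV. third (Q l) (Q' l) i l j x))"

lemma comp_ratio_bound: "\<bar>x $ l / norm (x::space)\<bar> \<le> 1"
  using component_le_norm_cart[of x l] by (cases "x = 0") (auto simp: divide_le_eq)

lemma radial_leray_grad_near:
  assumes p: "\<And>j. profile C R (Q j) (Q' j)" and x: "x \<noteq> 0"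
  shows "\<bar>radial_leray_grad Q Q' x $ i $ j\<bar> \<le> 226 * C * norm x powr (-5/4)"
proof -
  have C: "0 \<le> C" using p by (rule profileD)
  let ?r = "norm x powr (-5/4)"
  have 1: "\<bar>Q' i (norm x) * (x $ j / norm x)\<bar> \<le> (C * ?r) * 1"
    unfolding abs_mult using x C profileD(6)[OF p, of "norm x"] by (intro mult_mono comp_ratio_bound) auto
  have "\<bar>\<Sum>l\<in>UNIV. third (Q l) (Q' l) i l j x\<bar> \<le> (\<Sum>l\<in>(UNIV::3 set). 25 * C * ?r)"
    by (rule sum_abs[THEN order_trans], rule sum_mono, rule third_near_bound[OF p x])
  then have "\<bar>leray_const\<bar> * \<bar>\<Sum>l\<in>UNIV. third (Q l) (Q' l) i l j x\<bar> \<le> 3 * (75 * C * ?r)"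
    using leray_const_bounds C by (intro mult_mono) (auto simp: sum_3)
  then have 2: "\<bar>leray_const * (\<Sum>l\<in>UNIV. third (Q l) (Q' l) i l j x)\<bar> \<le> 225 * C * ?r" by (simp add: abs_mult)
  show ?thesis unfolding radial_leray_grad_def using order_trans[OF abs_triangle_ineq4 add_mono[OF 1 2]] by simp
qed

lemma radial_leray_grad_far:
  assumes p: "\<And>j. profile C R (Q j) (Q' j)" and x: "R \<le> norm x"
  shows "\<bar>radial_leray_grad Q Q' x $ i $ j\<bar> \<le> 144 * C * R powr (11/4) * norm x powr (-4)"
proof -
  have C: "0 \<le> C" "0 < R" using p by (auto dest: profileD)
  let ?r = "R powr (11/4) * norm x powr (-4)"
  have 1: "Q' i (norm x) = 0" using profileD(8)[OF p x] .
  have "\<bar>\<Sum>l\<in>UNIV. third (Q l) (Q' l) i l j x\<bar> \<le> (\<Sum>l\<in>(UNIV::3 set). 16 * C * R powr (11/4) * norm x powr (-4))"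
    by (rule sum_abs[THEN order_trans], rule sum_mono, rule third_far_bound[OF p x])
  then have "\<bar>leray_const\<bar> * \<bar>\<Sum>l\<in>UNIV. third (Q l) (Q' l) i l j x\<bar> \<le> 3 * (48 * C * ?r)"
    using leray_const_bounds C by (intro mult_mono) (auto simp: sum_3)
  then show ?thesis unfolding radial_leray_grad_def using 1 by (simp add: abs_mult)
qed

lemma power_bounded_radial_leray_grad:
  assumes p: "\<And>j. profile C R (Q j) (Q' j)"
  shows "power_bounded 2 (\<lambda>x. radial_leray_grad Q Q' x $ i $ j)"
proof (rule power_bounded_two_regimes[where A = "226 * C" and B = "144 * C * R powr (11/4)" and b = "5/4" and b' = 4 and R = R])
  have "continuous_on (-{0}) (\<lambda>x::space. Q' i (norm x) * (x $ j / norm x) - leray_const * (\<Sum>l\<in>UNIV. third (Q l) (Q' l) i l j x))"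
    by (intro continuous_intros continuous_radial[OF profileD(2)[OF p]] continuous_third[OF p]) auto
  then show "continuous_on (-{0}) (\<lambda>x. radial_leray_grad Q Q' x $ i $ j)" by (simp add: radial_leray_grad_def)
qed (use p[THEN profileD(1)] p[THEN profileD(3)] radial_leray_grad_near[OF p] radial_leray_grad_far[OF p] in auto)

lemma pderiv_radial_leray:
  assumes p: "\<And>j. profile C R (Q j) (Q' j)"
  shows "pderiv_on (-{0}) j (\<lambda>x. radial_leray Q x $ i) (\<lambda>x. radial_leray_grad Q Q' x $ i $ j)"
proof -
  have "pderiv_on (-{0}) j (\<lambda>x. Q i (norm x) + (- leray_const) * (\<Sum>l\<in>UNIV. hess (Q l) i l x))
     (\<lambda>x. Q' i (norm x) * (x $ j / norm x) + (- leray_const) * (\<Sum>l\<in>UNIV. third (Q l) (Q' l) i l j x))"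
    by (intro pderiv_add pderiv_cmult pderiv_sum pderiv_radial[OF profileD(4)[OF p]] pderiv_hess[OF p])
  then show ?thesis by (simp add: radial_leray_def radial_leray_grad_def)
qed

lemma weak_gradient_radial_leray:
  assumes p: "\<And>j. profile C R (Q j) (Q' j)" and V: "\<And>x. x \<noteq> 0 \<Longrightarrow> V x = radial_leray Q x"
  shows "weak_gradient V (radial_leray_grad Q Q')"
  unfolding weak_gradient_def
proof (intro conjI allI impI)
  have cb: "bounded K" "K \<in> sets borel" if "compact K" for K :: "space set"
    using that by (auto simp: compact_imp_bounded intro: borel_compact)
  show "locally_integrable V"
    unfolding locally_integrable_def
  proof (intro allI impI)
    fix K :: "space set" assume K: "compact K"
    have "set_integrable lborel K (radial_leray Q)"
      by (intro set_integrable_vec power_bounded_set_integrable[OF power_bounded_radial_leray[OF p, of 1]] cb[OF K]) auto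
    then show "set_integrable lborel K V"
      unfolding set_integrable_def
      by (subst integrable_discrete_difference[where X = "{0}" and g = "\<lambda>x. indicator K x *\<^sub>R radial_leray Q x"]) (auto simp: V)
  qed
  show "locally_integrable (radial_leray_grad Q Q')"
    unfolding locally_integrable_def
    by (intro allI impI set_integrable_vec power_bounded_set_integrable[OF power_bounded_radial_leray_grad[OF p]] cb) auto
  fix \<psi> i j assume t: "test_function \<psi>"
  have "(LINT x|lborel. V x $ i * frechet_derivative \<psi> (at x) (axis j 1)) = (LINT x|lborel. radial_leray Q x $ i * frechet_derivative \<psi> (at x) (axis j 1))"
    by (rule integral_cong_off_origin) (simp add: V)
  also have "\<dots> = - (LINT x|lborel. radial_leray_grad Q Q' x $ i $ j * \<psi> x)"
    by (rule power_bounded_test_by_parts[OF power_bounded_radial_leray[OF p, of 1] power_bounded_radial_leray_grad[OF p] _ _ _ _ pderiv_radial_leray[OF p] t]) auto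
  finally show "(LINT x|lborel. V x $ i * frechet_derivative \<psi> (at x) (axis j 1)) = - (LINT x|lborel. radial_leray_grad Q Q' x $ i $ j * \<psi> x)" .
qed

section \<open>Norm bounds for the projected field\<close>

definition weight_mass :: "real \<Rightarrow> real" where
  "weight_mass b = enn2real (\<integral>\<^sup>+ (x::space). ennreal (norm x powr (- (2 * b)) * (1 + norm x) powr (-3)) \<partial>lborel)"

text \<open>Both regimes are below a multiple of \<open>|x| powr (- b) * (1 + |x|) powr (-3/2)\<close>, which is square
  integrable.\<close>

lemma L2_norm_sq_bound:
  fixes f :: "space \<Rightarrow> 'b::real_normed_vector"
  assumes b: "0 < b" "b < 3/2" and A: "0 \<le> A"
    and near: "\<And>x. x \<noteq> 0 \<Longrightarrow> norm x \<le> 1 \<Longrightarrow> norm (f x) \<le> A * norm x powr (-b)"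
    and far: "\<And>x. 1 \<le> norm x \<Longrightarrow> norm (f x) \<le> A * norm x powr (-3)"
  shows "L2_norm_sq f \<le> ennreal (8 * A\<^sup>2 * weight_mass b)"
proof -
  let ?w = "\<lambda>x::space. norm x powr (- (2 * b)) * (1 + norm x) powr (-3)"
  have pw: "(norm (f x))\<^sup>2 \<le> 8 * A\<^sup>2 * ?w x" if x: "x \<noteq> 0" for x
  proof (cases "norm x \<le> 1")
    case True
    have "(norm (f x))\<^sup>2 \<le> (A * norm x powr (-b))\<^sup>2" by (intro power_mono near x True) simp
    also have "\<dots> = A\<^sup>2 * norm x powr (- (2 * b))"
      by (simp add: power_mult_distrib power2_eq_square powr_add[symmetric])
    also have "\<dots> \<le> A\<^sup>2 * (norm x powr (- (2 * b)) * (8 * (1 + norm x) powr (-3)))"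
    proof -
      have "2 powr (-3) \<le> (1 + norm x) powr (-3)" using True by (intro powr_mono2') (auto simp: add_pos_nonneg)
      then have "1 \<le> 8 * (1 + norm x) powr (-3)" by (simp add: powr_minus)
      then have "(A\<^sup>2 * norm x powr (- (2 * b))) * 1 \<le> (A\<^sup>2 * norm x powr (- (2 * b))) * (8 * (1 + norm x) powr (-3))"
        by (rule mult_left_mono) simp
      then show ?thesis by (simp only: mult.assoc mult_1_right)
    qed
    finally show ?thesis by (simp add: mult_ac)
  next
    case False
    have "(norm (f x))\<^sup>2 \<le> (A * norm x powr (-3))\<^sup>2" using False by (intro power_mono far) auto
    also have "\<dots> = A\<^sup>2 * (norm x powr (- (2 * b)) * norm x powr (2 * b - 6))"
      using x by (simp add: power_mult_distrib power2_eq_square powr_add[symmetric])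
    also have "\<dots> \<le> A\<^sup>2 * (norm x powr (- (2 * b)) * (8 * (1 + norm x) powr (-3)))"
    proof (intro mult_left_mono)
      have "norm x powr (2 * b - 6) \<le> norm x powr (-3)" using False b by (intro powr_mono) auto
      also have "\<dots> \<le> ((1 + norm x) / 2) powr (-3)" using False x by (intro powr_mono2') (auto simp: add_pos_nonneg)
      also have "\<dots> = 8 * (1 + norm x) powr (-3)" by (simp add: powr_divide powr_minus inverse_eq_divide)
      finally show "norm x powr (2 * b - 6) \<le> 8 * (1 + norm x) powr (-3)" .
    qed auto
    finally show ?thesis by (simp add: mult_ac)
  qed
  have fin: "(\<integral>\<^sup>+ x. ennreal (?w x) \<partial>lborel) < \<infinity>"
    using b by (intro nn_integral_power_weight) auto
  have "L2_norm_sq f \<le> (\<integral>\<^sup>+ x. ennreal (8 * A\<^sup>2) * ennreal (?w x) \<partial>lborel)"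
    unfolding L2_norm_sq_def
    by (rule nn_integral_mono_AE) (use AE_lborel_singleton[of "0::space"] in eventually_elim,
      use pw in \<open>auto simp: ennreal_mult[symmetric] intro!: ennreal_leI\<close>)
  also have "\<dots> = ennreal (8 * A\<^sup>2) * (\<integral>\<^sup>+ x. ennreal (?w x) \<partial>lborel)" by (rule nn_integral_cmult) measurable
  also have "(\<integral>\<^sup>+ x. ennreal (?w x) \<partial>lborel) = ennreal (weight_mass b)"
    using fin by (simp add: weight_mass_def ennreal_enn2real)
  also have "ennreal (8 * A\<^sup>2) * ennreal (weight_mass b) = ennreal (8 * A\<^sup>2 * weight_mass b)"
    by (simp add: ennreal_mult weight_mass_def)
  finally show ?thesis .
qed

lemma norm_matrix_le:
  fixes M :: "real^3^3"
  assumes "\<And>i j. \<bar>M $ i $ j\<bar> \<le> K"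
  shows "norm M \<le> 9 * K"
proof -
  have "norm (M $ i) \<le> 3 * K" for i
    using norm_le_l1_cart[of "M $ i"] sum_mono[of "UNIV::3 set" "\<lambda>j. \<bar>M $ i $ j\<bar>" "\<lambda>j. K"] assms by (simp add: sum_3)
  moreover have "norm M \<le> (\<Sum>i\<in>UNIV. norm (M $ i))"
    unfolding norm_vec_def by (rule L2_set_le_sum) simp
  ultimately show ?thesis
    using sum_mono[of "UNIV::3 set" "\<lambda>i. norm (M $ i)" "\<lambda>j. 3 * K"] by (simp add: sum_3)
qed

lemma radial_leray_grad_L2:
  assumes p: "\<And>j. profile C 1 (Q j) (Q' j)"
  shows "L2_norm_sq (radial_leray_grad Q Q') \<le> ennreal (8 * (2034 * C)\<^sup>2 * weight_mass (5/4))"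
proof (rule L2_norm_sq_bound)
  have C: "0 \<le> C" using p by (rule profileD)
  fix x :: space
  show "norm (radial_leray_grad Q Q' x) \<le> 2034 * C * norm x powr - (5/4)" if "x \<noteq> 0"
  proof -
    have "\<bar>radial_leray_grad Q Q' x $ i $ j\<bar> \<le> 226 * C * norm x powr (-5/4)" for i j
      by (rule radial_leray_grad_near[OF p that])
    from norm_matrix_le[OF this] show ?thesis by simp
  qed
  show "norm (radial_leray_grad Q Q' x) \<le> 2034 * C * norm x powr - 3" if x: "1 \<le> norm x"
  proof -
    have "norm (radial_leray_grad Q Q' x) \<le> 9 * (144 * C * 1 powr (11/4) * norm x powr (-4))"
      by (rule norm_matrix_le, rule radial_leray_grad_far[OF p x])
    also have "\<dots> \<le> 2034 * C * norm x powr (-4)" using C by (simp add: mult_right_mono)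
    also have "\<dots> \<le> 2034 * C * norm x powr (-3)" using C x by (intro mult_left_mono powr_mono) auto
    finally show ?thesis .
  qed
qed (use p[THEN profileD(3)] in auto)

lemma radial_leray_L2:
  assumes p: "\<And>j. profile C 1 (Q j) (Q' j)" and V: "\<And>x. x \<noteq> 0 \<Longrightarrow> V x = radial_leray Q x"
  shows "L2_norm_sq V \<le> ennreal (8 * (138 * C)\<^sup>2 * weight_mass (1/4))"
proof (rule L2_norm_sq_bound)
  have C: "0 \<le> C" using p by (rule profileD)
  have vec: "norm v \<le> 3 * K" if "\<And>i. \<bar>v $ i\<bar> \<le> K" for v :: space and K
    using norm_le_l1_cart[of v] sum_mono[of "UNIV::3 set" "\<lambda>j. \<bar>v $ j\<bar>" "\<lambda>j. K"] that by (simp add: sum_3)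
  have comp: "\<bar>radial_leray Q x $ i\<bar> \<le> \<bar>Q i (norm x)\<bar> + 9 * K" if "\<And>j. \<bar>hess (Q j) i j x\<bar> \<le> K" "0 \<le> K" for x i K
  proof -
    have "\<bar>\<Sum>j\<in>UNIV. hess (Q j) i j x\<bar> \<le> 3 * K"
      using sum_abs[of "\<lambda>j. hess (Q j) i j x" UNIV] sum_mono[of "UNIV::3 set" "\<lambda>j. \<bar>hess (Q j) i j x\<bar>" "\<lambda>j. K"] that by (simp add: sum_3)
    then have "\<bar>leray_const\<bar> * \<bar>\<Sum>j\<in>UNIV. hess (Q j) i j x\<bar> \<le> 3 * (3 * K)"
      using leray_const_bounds that by (intro mult_mono) auto
    then show ?thesis unfolding radial_leray_def vec_lambda_beta abs_mult[symmetric]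
      using abs_triangle_ineq4[of "Q i (norm x)"] by (smt (verit))
  qed
  fix x :: space
  show "norm (V x) \<le> 138 * C * norm x powr - (1/4)" if x: "x \<noteq> 0"
  proof -
    define t where "t = C * norm x powr (-1/4)"
    have t: "0 \<le> t" "\<And>j. \<bar>Q j (norm x)\<bar> \<le> t" "\<And>j. \<bar>mean (Q j) (norm x)\<bar> \<le> 2 * t"
      using C x profileD(5)[OF p, of "norm x"] mean_bound[OF p, of "norm x"] by (simp_all add: t_def mult.assoc)
    have "\<bar>hess (Q j) i j x\<bar> \<le> 5 * t" for i j
      using hess_bound[of "Q j" i j x] t(2)[of j] t(3)[of j] by linarith
    from comp[OF this] t(1) have f: "\<bar>radial_leray Q x $ i\<bar> \<le> \<bar>Q i (norm x)\<bar> + 9 * (5 * t)" for i by simp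
    have "\<bar>radial_leray Q x $ i\<bar> \<le> 46 * t" for i using f[of i] t(2)[of i] by linarith
    from vec[OF this] show ?thesis using V[OF x] by (simp add: t_def)
  qed
  show "norm (V x) \<le> 138 * C * norm x powr - 3" if x: "1 \<le> norm x"
  proof -
    have x0: "x \<noteq> 0" using x by (metis norm_zero not_one_le_zero)
    define t where "t = C * norm x powr (-3)"
    have t: "0 \<le> t" "\<And>j. Q j (norm x) = 0" "\<And>j. \<bar>mean (Q j) (norm x)\<bar> \<le> 2 * t"
      using C profileD(7)[OF p x] mean_far_bound[OF p x] by (simp_all add: t_def mult.assoc)
    have "\<bar>hess (Q j) i j x\<bar> \<le> 4 * t" for i j
      using hess_bound[of "Q j" i j x] t(2)[of j] t(3)[of j] by linarith
    from comp[OF this] t have "\<bar>radial_leray Q x $ i\<bar> \<le> 36 * t" for i by simp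
    from vec[OF this] have "norm (radial_leray Q x) \<le> 138 * t" using t(1) by simp
    then show ?thesis using V[OF x0] by (simp add: t_def)
  qed
qed (use p[THEN profileD(3)] in auto)

text \<open>Outside the support of the profiles the field is that of a dipole, and it does not vanish:
  the matrix \<open>1/3 - x x\<^sup>T / |x|\<^sup>2\<close> has the eigenvalues \<open>1/3\<close>, \<open>1/3\<close>, \<open>-2/3\<close>.\<close>

lemma radial_leray_far_lower:
  assumes p: "\<And>j. profile C 1 (Q j) (Q' j)" and x: "1 \<le> norm x" and \<mu>: "0 \<le> \<mu>" "\<mu> \<le> mean (Q 1) 1"
  shows "leray_const * \<mu> / 3 / norm x ^ 3 \<le> norm (radial_leray Q x)"
proof -
  define n where "n = norm x"
  have n: "n > 0" using x unfolding n_def by linarith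
  define M :: space where "M = (\<chi> j. mean (Q j) 1)"
  define v :: space where "v = (1/3) *\<^sub>R M - ((x \<bullet> M) / n\<^sup>2) *\<^sub>R x"
  have far: "Q j n = 0" "mean (Q j) n = M $ j / n ^ 3" for j
    using profileD(7)[OF p x, of j] mean_far[OF p x, of j] by (simp_all add: M_def n_def)
  have "radial_leray Q x = (- leray_const / n ^ 3) *\<^sub>R v"
  proof (rule vec_eq_iff[THEN iffD2], rule allI)
    fix i
    have "radial_leray Q x $ i = - leray_const * (\<Sum>j\<in>UNIV. (if i = j then 1 else 0) * (M $ j / n ^ 3 / 3) - x $ i * (x $ j * M $ j) * (1 / n ^ 3 / n\<^sup>2))"
      by (simp add: radial_leray_def hess_def n_def[symmetric] far mult_ac)
    also have "(\<Sum>j\<in>UNIV. (if i = j then 1 else 0) * (M $ j / n ^ 3 / 3) - x $ i * (x $ j * M $ j) * (1 / n ^ 3 / n\<^sup>2))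
      = M $ i / n ^ 3 / 3 - x $ i * (\<Sum>j\<in>UNIV. x $ j * M $ j) * (1 / n ^ 3 / n\<^sup>2)"
      by (simp add: sum_subtractf sum_distrib_left sum_distrib_right if_distrib[of "\<lambda>c. c * _"] sum_divide_distrib[symmetric] cong: if_cong)
    also have "(\<Sum>j\<in>UNIV. x $ j * M $ j) = x \<bullet> M" by (simp add: inner_vec_def)
    finally show "radial_leray Q x $ i = ((- leray_const / n ^ 3) *\<^sub>R v) $ i"
      using n by (simp add: v_def field_simps)
  qed
  then have nf: "norm (radial_leray Q x) = leray_const / n ^ 3 * norm v" using n leray_const_bounds by simp
  have "(norm v)\<^sup>2 = (norm M)\<^sup>2 / 9 + (x \<bullet> M)\<^sup>2 / n\<^sup>2 / 3"
  proof -
    have xx: "x \<bullet> x = n\<^sup>2" by (simp add: n_def power2_norm_eq_inner)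
    have "(norm v)\<^sup>2 = v \<bullet> v" by (rule power2_norm_eq_inner)
    also have "\<dots> = (M \<bullet> M) / 9 - 2 / 3 * ((x \<bullet> M) / n\<^sup>2) * (x \<bullet> M) + ((x \<bullet> M) / n\<^sup>2)\<^sup>2 * n\<^sup>2"
      unfolding v_def by (simp add: inner_diff_left inner_diff_right xx inner_commute[of M x] power2_eq_square algebra_simps)
    also have "\<dots> = (M \<bullet> M) / 9 + (x \<bullet> M)\<^sup>2 / n\<^sup>2 / 3" using n by (simp add: field_simps power2_eq_square)
    finally show ?thesis by (simp add: power2_norm_eq_inner)
  qed
  then have "(norm M / 3)\<^sup>2 \<le> (norm v)\<^sup>2" by (simp add: power_divide)
  then have "norm M / 3 \<le> norm v" by (rule power2_le_imp_le) simp
  moreover have "\<mu> \<le> norm M" using component_le_norm_cart[of M 1] \<mu> by (simp add: M_def)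
  ultimately have "\<mu> / 3 \<le> norm v" by linarith
  then have "leray_const / n ^ 3 * (\<mu> / 3) \<le> leray_const / n ^ 3 * norm v"
    using n leray_const_bounds by (intro mult_left_mono) auto
  then show ?thesis unfolding nf by (simp add: n_def[symmetric] field_simps)
qed

definition shell_bound :: "real \<Rightarrow> real" where
  "shell_bound \<mu> = leray_const * \<mu> / 24"

lemma radial_leray_shell:
  assumes p: "\<And>j. profile C 1 (Q j) (Q' j)" and x: "1 \<le> norm x" "norm x \<le> 2" and \<mu>: "0 \<le> \<mu>" "\<mu> \<le> mean (Q 1) 1"
  shows "shell_bound \<mu> \<le> norm (radial_leray Q x)"
proof -
  have "norm x ^ 3 \<le> 2 ^ 3" using x by (intro power_mono) auto
  then have "leray_const * \<mu> / 3 / 8 \<le> leray_const * \<mu> / 3 / norm x ^ 3"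
    using x \<mu> leray_const_bounds by (intro divide_left_mono) auto
  also have "\<dots> \<le> norm (radial_leray Q x)" by (rule radial_leray_far_lower[where Q = Q and Q' = Q', OF p x(1) \<mu>])
  finally show ?thesis by (simp add: shell_bound_def)
qed

lemma shell_emeasure: "emeasure lborel (ball (0::space) 2 - ball 0 1) = ennreal (28/3 * pi)"
proof -
  have "emeasure lborel (ball (0::space) 2 - ball 0 1) = emeasure lborel (ball (0::space) 2) - emeasure lborel (ball (0::space) 1)"
    by (rule emeasure_Diff) (auto simp: emeasure_ball3)
  also have "\<dots> = ennreal (28/3 * pi)" by (simp add: emeasure_ball3 ennreal_minus)
  finally show ?thesis .
qed

lemma radial_leray_L2_lower:
  assumes p: "\<And>j. profile C 1 (Q j) (Q' j)" and V: "\<And>x. x \<noteq> 0 \<Longrightarrow> V x = radial_leray Q x" and \<mu>: "0 \<le> \<mu>" "\<mu> \<le> mean (Q 1) 1"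
  shows "ennreal ((shell_bound \<mu>)\<^sup>2 * (28/3 * pi)) \<le> L2_norm_sq V"
proof -
  have s0: "0 \<le> shell_bound \<mu>" using \<mu> leray_const_bounds by (simp add: shell_bound_def)
  have "ennreal ((shell_bound \<mu>)\<^sup>2 * (28/3 * pi)) = (\<integral>\<^sup>+ x. ennreal ((shell_bound \<mu>)\<^sup>2) * indicator (ball (0::space) 2 - ball 0 1) x \<partial>lborel)"
    by (subst nn_integral_cmult_indicator) (simp, simp only: shell_emeasure, subst ennreal_mult[symmetric], auto)
  also have "\<dots> \<le> L2_norm_sq V"
    unfolding L2_norm_sq_def
  proof (rule nn_integral_mono)
    fix x :: space
    have "(shell_bound \<mu>)\<^sup>2 \<le> (norm (V x))\<^sup>2" if "x \<in> ball 0 2 - ball 0 1"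
    proof -
      have "x \<noteq> 0" using that by auto
      then show ?thesis using radial_leray_shell[where Q = Q and Q' = Q' and x = x, OF p _ _ \<mu>] that s0 by (auto simp: V intro!: power_mono)
    qed
    then show "ennreal ((shell_bound \<mu>)\<^sup>2) * indicator (ball 0 2 - ball 0 1) x \<le> ennreal ((norm (V x))\<^sup>2)"
      by (cases "x \<in> ball 0 2 - ball 0 1") (auto intro!: ennreal_leI)
  qed
  finally show ?thesis .
qed

lemma esssup_lower:
  assumes "S \<in> sets lborel" "emeasure lborel S \<noteq> 0" "\<And>x. x \<in> S \<Longrightarrow> K \<le> norm (V x)"
  shows "ennreal K \<le> Linf_norm V"
proof (rule ccontr)
  assume "\<not> ennreal K \<le> Linf_norm V"
  then have lt: "Linf_norm V < ennreal K" by simp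
  have "AE x in lborel. ennreal (norm (V x)) \<le> Linf_norm V" unfolding Linf_norm_def by (rule esssup_AE)
  then have "AE x in lborel. x \<notin> S"
  proof eventually_elim
    fix x assume a: "ennreal (norm (V x)) \<le> Linf_norm V"
    show "x \<notin> S"
    proof
      assume "x \<in> S"
      then have "ennreal K \<le> ennreal (norm (V x))" using assms(3) by (intro ennreal_leI)
      then show False using a lt by (meson leD order_trans)
    qed
  qed
  then have "emeasure lborel S = 0" using assms(1) AE_iff_null_sets by blast
  with assms(2) show False by simp
qed

text \<open>The scaling is built in, so that one lower bound at unit scale serves all times.\<close>

lemma esssup_lower_scaled:
  assumes S: "S \<in> sets borel" "emeasure lborel S \<noteq> 0" and K: "\<And>x. x \<in> S \<Longrightarrow> K \<le> norm (V x)" and ab: "0 < a" "0 < b"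
  shows "ennreal (a * K) \<le> Linf_norm (\<lambda>x. a *\<^sub>R V (b *\<^sub>R x))"
proof (rule esssup_lower)
  let ?S = "(\<lambda>x::space. b *\<^sub>R x) -` S"
  have "(\<lambda>x::space. b *\<^sub>R x) \<in> borel_measurable borel" by measurable
  from measurable_sets[OF this S(1)] show m: "?S \<in> sets lborel" by simp
  have "emeasure lborel S = (\<integral>\<^sup>+ x. indicator S x \<partial>lborel)" using S by simp
  also have "\<dots> = ennreal (\<bar>b\<bar> ^ 3) * (\<integral>\<^sup>+ x. indicator S (0 + b *\<^sub>R x) \<partial>lborel)"
    by (rule nn_integral_affine) (use S ab in auto)
  also have "(\<integral>\<^sup>+ x. indicator S (0 + b *\<^sub>R x) \<partial>lborel) = (\<integral>\<^sup>+ x. indicator ?S x \<partial>lborel)"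
    by (intro nn_integral_cong) (simp add: indicator_def)
  also have "\<dots> = emeasure lborel ?S" using m by simp
  finally show "emeasure lborel ?S \<noteq> 0" using S by auto
  show "a * K \<le> norm (a *\<^sub>R V (b *\<^sub>R x))" if "x \<in> ?S" for x
    using K[of "b *\<^sub>R x"] that ab by (simp add: mult_left_mono)
qed

lemma radial_leray_Linf_shell:
  assumes p: "\<And>j. profile C 1 (Q j) (Q' j)" and V: "\<And>x. x \<noteq> 0 \<Longrightarrow> V x = radial_leray Q x" and \<mu>: "0 \<le> \<mu>" "\<mu> \<le> mean (Q 1) 1"
    and ab: "0 < a" "0 < b"
  shows "ennreal (a * shell_bound \<mu>) \<le> Linf_norm (\<lambda>x. a *\<^sub>R V (b *\<^sub>R x))"
proof (rule esssup_lower_scaled[OF _ _ _ ab])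
  show "emeasure lborel (ball (0::space) 2 - ball 0 1) \<noteq> 0" by (simp add: shell_emeasure)
  show "shell_bound \<mu> \<le> norm (V x)" if "x \<in> ball 0 2 - ball 0 1" for x
  proof -
    have "x \<noteq> 0" using that by auto
    then show ?thesis using radial_leray_shell[where Q = Q and Q' = Q' and x = x, OF p _ _ \<mu>] that by (auto simp: V)
  qed
qed auto

text \<open>Up to a bounded error the first component of the field is \<open>1 - leray_const / 3\<close> times the profile, by
  the closeness of a profile to its mean. The factor is positive.\<close>

lemma radial_leray_Linf_core:
  assumes p: "\<And>j. profile C 1 (Q j) (Q' j)" and V: "\<And>x. x \<noteq> 0 \<Longrightarrow> V x = radial_leray Q x"
    and A: "\<And>j r. 0 < r \<Longrightarrow> \<bar>r * Q' j r\<bar> \<le> A"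
    and r: "0 < r1" "r1 < r2" and H: "\<And>r. r1 \<le> r \<Longrightarrow> r < r2 \<Longrightarrow> H \<le> Q 1 r"
    and ab: "0 < a" "0 < b"
  shows "ennreal (a * ((1 - leray_const / 3) * H - 15 * A)) \<le> Linf_norm (\<lambda>x. a *\<^sub>R V (b *\<^sub>R x))"
proof (rule esssup_lower_scaled[OF _ _ _ ab])
  let ?S = "ball (0::space) r2 - ball 0 r1"
  have "emeasure lborel ?S = emeasure lborel (ball (0::space) r2) - emeasure lborel (ball (0::space) r1)"
    using r by (intro emeasure_Diff) (auto simp: emeasure_ball3)
  also have "\<dots> = ennreal (4/3 * pi * r2 ^ 3 - 4/3 * pi * r1 ^ 3)" using r by (simp add: emeasure_ball3 ennreal_minus)
  also have "\<dots> \<noteq> 0" using r power_strict_mono[of r1 r2 3] by (simp add: ennreal_eq_0_iff)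
  finally show "emeasure lborel ?S \<noteq> 0" .
  show "(1 - leray_const / 3) * H - 15 * A \<le> norm (V x)" if x: "x \<in> ?S" for x
  proof -
    note \<kappa> = leray_const_bounds
    have n: "r1 \<le> norm x" "norm x < r2" and x0: "x \<noteq> 0" and np: "0 < norm x" using x r by auto
    let ?q = "Q 1 (norm x)" and ?m = "mean (Q 1) (norm x)"
    let ?w = "leray_const * (\<Sum>j\<in>UNIV. x $ 1 * x $ j / (norm x)\<^sup>2 * (Q j (norm x) - mean (Q j) (norm x)))"
    have w: "\<bar>?w\<bar> \<le> 27/2 * A" by (rule angular_bound[OF p A x0])
    have qm: "\<bar>?q - ?m\<bar> \<le> 3/2 * A" by (rule mean_close[OF p A np])
    have "\<bar>leray_const / 3 * (?q - ?m)\<bar> \<le> 1 * (3/2 * A)"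
      unfolding abs_mult using \<kappa> qm by (intro mult_mono) auto
    moreover have "(1 - leray_const / 3) * H \<le> (1 - leray_const / 3) * ?q"
      using H[OF n] \<kappa> by (intro mult_left_mono) auto
    moreover have "radial_leray Q x $ 1 = (1 - leray_const / 3) * ?q + leray_const / 3 * (?q - ?m) - ?w"
      unfolding radial_leray_split by (simp add: algebra_simps)
    moreover have "a - 15 * A \<le> f" if "\<bar>p\<bar> \<le> 1 * (3/2 * A)" "a \<le> b" "f = b + p - w" "\<bar>w\<bar> \<le> 27/2 * A" for a b f p w :: real
      using that by linarith
    ultimately have "(1 - leray_const / 3) * H - 15 * A \<le> radial_leray Q x $ 1" using w by blast
    also have "\<dots> \<le> norm (radial_leray Q x)" using component_le_norm_cart[of "radial_leray Q x" 1] by linarith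
    finally show ?thesis using V[OF x0] by simp
  qed
qed auto

section \<open>The lower bound for the gradient\<close>

text \<open>A region outside the unit ball in which every component of the profile contributes to
  \<open>\<partial>\<^sub>1 u\<^sub>1\<close> with the same sign. It lies around the point \<open>(6, 1, 1)\<close>: the first coordinate dominates, which
  makes \<open>5 x\<^sub>1\<^sup>2 - 3 |x|\<^sup>2\<close> positive, and the other two are positive.\<close>

definition probe :: "space set" where
  "probe = {x. 21/4 \<le> x $ 1 \<and> 1/4 \<le> x $ 2 \<and> x $ 2 \<le> 7/4 \<and> 1/4 \<le> x $ 3 \<and> x $ 3 \<le> 7/4 \<and> norm x \<le> 11}"

definition probe_slope :: "real \<Rightarrow> real" where
  "probe_slope \<mu> = leray_const * \<mu> / 11 ^ 7"

lemma radial_leray_grad_probe: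
  assumes p: "\<And>j. profile C 1 (Q j) (Q' j)" and x: "x \<in> probe" and \<mu>: "0 \<le> \<mu>" "\<And>l. \<mu> \<le> mean (Q l) 1"
  shows "probe_slope \<mu> \<le> - radial_leray_grad Q Q' x $ 1 $ 1"
proof -
  define n where "n = norm x"
  have xs: "21/4 \<le> x $ 1" "1/4 \<le> x $ 2" "x $ 2 \<le> 7/4" "1/4 \<le> x $ 3" "x $ 3 \<le> 7/4" and n11: "n \<le> 11"
    using x by (auto simp: probe_def n_def)
  have n1: "1 \<le> n" using component_le_norm_cart[of x 1] xs unfolding n_def by linarith
  then have n0: "0 < n" by linarith
  have n2: "n\<^sup>2 = x $ 1 * x $ 1 + x $ 2 * x $ 2 + x $ 3 * x $ 3"
    by (simp add: n_def power2_norm_eq_inner inner_vec_def sum_3)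
  have sq: "x $ 2 * x $ 2 \<le> 7/4 * (7/4)" "x $ 3 * x $ 3 \<le> 7/4 * (7/4)" "21/4 * (21/4) \<le> x $ 1 * x $ 1"
    by (rule mult_mono; use xs in linarith)+
  define m where "m l = mean (Q l) 1 / n ^ 3" for l
  have far: "Q l n = 0" "Q' l n = 0" "mean (Q l) n = m l" for l
    using profileD(7,8)[OF p, of n l] mean_far[OF p, of n l] n1 by (simp_all add: m_def)
  have m0: "\<mu> / n ^ 3 \<le> m l" for l unfolding m_def using n0 \<mu>(2) by (intro divide_right_mono) auto
  have mpos: "0 \<le> m l" for l using m0[of l] \<mu>(1) n0 by (meson order_trans divide_nonneg_pos zero_less_power)
  have t1: "third (Q 1) (Q' 1) 1 1 1 x = m 1 / n ^ 4 * (x $ 1 * (5 * (x $ 1 * x $ 1) - 3 * n\<^sup>2))"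
    using n0 by (simp add: third_def n_def[symmetric] far field_simps power_numeral_reduce)
  have tl: "third (Q l) (Q' l) 1 l 1 x = m l / n ^ 4 * (x $ l * (5 * (x $ 1 * x $ 1) - n\<^sup>2))" if "l \<noteq> 1" for l
    using n0 that by (simp add: third_def n_def[symmetric] far field_simps power_numeral_reduce)
  have "1 * 1 \<le> x $ 1 * (5 * (x $ 1 * x $ 1) - 3 * n\<^sup>2)"
    using xs sq unfolding n2 by (intro mult_mono) auto
  then have "m 1 / n ^ 4 * 1 \<le> third (Q 1) (Q' 1) 1 1 1 x"
    unfolding t1 using mpos n0 by (intro mult_left_mono) auto
  moreover have "\<mu> / 11 ^ 7 \<le> m 1 / n ^ 4"
  proof -
    have "n ^ 7 \<le> 11 ^ 7" using n0 n11 by (intro power_mono) auto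
    then have "\<mu> / 11 ^ 7 \<le> \<mu> / n ^ 7" using \<mu> n0 by (intro divide_left_mono) auto
    also have "\<dots> = \<mu> / n ^ 3 / n ^ 4" by (simp add: power_add[symmetric])
    also have "\<dots> \<le> m 1 / n ^ 4" using m0[of 1] n0 by (intro divide_right_mono) auto
    finally show ?thesis .
  qed
  moreover have "0 \<le> third (Q l) (Q' l) 1 l 1 x" if "l = 2 \<or> l = 3" for l
  proof -
    have "l \<noteq> 1" using that by auto
    moreover have "0 \<le> x $ l" using that xs by auto
    moreover have "0 \<le> 5 * (x $ 1 * x $ 1) - n\<^sup>2" using sq unfolding n2 by linarith
    ultimately show ?thesis using mpos n0 by (simp add: tl)
  qed
  ultimately have "\<mu> / 11 ^ 7 \<le> (\<Sum>l\<in>UNIV. third (Q l) (Q' l) 1 l 1 x)"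
    unfolding sum_3 by (smt (verit, best))
  then have "leray_const * (\<mu> / 11 ^ 7) \<le> leray_const * (\<Sum>l\<in>UNIV. third (Q l) (Q' l) 1 l 1 x)"
    using leray_const_bounds by (intro mult_left_mono) auto
  then show ?thesis
    by (simp add: radial_leray_grad_def n_def[symmetric] far probe_slope_def)
qed

lemma power_bounded_one: "power_bounded 0 (\<lambda>x. 1)"
  by (auto simp: power_bounded_def intro!: exI[of _ 1])

lemma locally_integrable_measurable:
  fixes f :: "space \<Rightarrow> 'b::{banach, second_countable_topology}"
  assumes "locally_integrable f" shows "f \<in> borel_measurable borel"
proof (rule borel_measurable_LIMSEQ_metric)
  show "(\<lambda>y. indicator (cball 0 (real n)) y *\<^sub>R f y) \<in> borel_measurable borel" for n
    using assms by (auto simp: locally_integrable_def set_integrable_def dest!: spec[of _ "cball 0 (real n)"])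
  show "(\<lambda>n. indicator (cball 0 (real n)) y *\<^sub>R f y) \<longlonglongrightarrow> f y" for y
  proof (rule tendsto_eventually)
    obtain N where "norm y < real N" using reals_Archimedean2 by blast
    then show "\<forall>\<^sub>F n in sequentially. indicator (cball 0 (real n)) y *\<^sub>R f y = f y"
      by (intro eventually_sequentiallyI[of N]) (auto simp: indicator_def)
  qed
qed

text \<open>Every weak gradient has the same pairing with a test function \<open>\<psi>\<close> supported in the probe
  region as the classical gradient has, so that its \<open>L\<^sup>2\<close> norm is bounded below by duality.\<close>

lemma weak_gradient_lower:
  assumes p: "\<And>j. profile C 1 (Q j) (Q' j)" and V: "\<And>x. x \<noteq> 0 \<Longrightarrow> V x = radial_leray Q x"
    and \<mu>: "0 \<le> \<mu>" "\<And>l. \<mu> \<le> mean (Q l) 1"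
    and t: "test_function \<psi>" "\<And>x. 0 \<le> \<psi> x" "\<And>x. \<psi> x \<noteq> 0 \<Longrightarrow> x \<in> probe"
    and S: "0 < (LINT x|lborel. (\<psi> x)\<^sup>2)" and G: "weak_gradient V G"
  shows "ennreal ((probe_slope \<mu> * (LINT x|lborel. \<psi> x))\<^sup>2 / (LINT x|lborel. (\<psi> x)\<^sup>2)) \<le> L2_norm_sq G"
proof (cases "L2_norm_sq G = \<infinity>")
  case False
  let ?P = "probe_slope \<mu> * (LINT x|lborel. \<psi> x)" and ?S = "LINT x|lborel. (\<psi> x)\<^sup>2"
  have s: "smooth \<psi>" using t by (simp add: test_function_def)
  note c\<psi> = smooth_regular(1)[OF s]
  obtain R B where RB': "\<And>x. R \<le> norm x \<Longrightarrow> \<psi> x = 0"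
    "\<And>x. R \<le> norm x \<Longrightarrow> frechet_derivative \<psi> (at x) (axis 1 1) = 0"
    "\<And>x. \<bar>\<psi> x\<bar> \<le> B" "\<And>x. \<bar>frechet_derivative \<psi> (at x) (axis 1 1)\<bar> \<le> B"
    by (rule test_function_bounds[OF t(1), where j = 1]) blast
  note RB = RB'(1,3)
  have [measurable]: "\<psi> \<in> borel_measurable borel" using c\<psi> by (rule borel_measurable_continuous_onI)
  have [measurable]: "G \<in> borel_measurable borel"
    using G by (auto simp: weak_gradient_def intro: locally_integrable_measurable)
  have "continuous_on UNIV (\<lambda>M::real^3^3. M $ 1 $ 1)" by (intro continuous_intros)
  from measurable_compose[OF \<open>G \<in> borel_measurable borel\<close> borel_measurable_continuous_onI[OF this]]
  have [measurable]: "(\<lambda>x. G x $ 1 $ 1) \<in> borel_measurable borel" .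
  have i\<psi>: "integrable lborel \<psi>"
    using power_bounded_times_bounded_integrable[OF power_bounded_one _ _ c\<psi> RB] by simp
  have i\<psi>2: "integrable lborel (\<lambda>x. (\<psi> x)\<^sup>2)"
  proof -
    have "integrable lborel (\<lambda>x. 1 * (\<psi> x)\<^sup>2)"
    proof (rule power_bounded_times_bounded_integrable[OF power_bounded_one])
      show "continuous_on UNIV (\<lambda>x. (\<psi> x)\<^sup>2)" by (intro continuous_intros c\<psi>)
      show "\<bar>(\<psi> x)\<^sup>2\<bar> \<le> B\<^sup>2" for x using power_mono[OF RB(2)[of x], of 2] by simp
    qed (use RB(1) in auto)
    then show ?thesis by simp
  qed
  have iG: "integrable lborel (\<lambda>x. (norm (G x))\<^sup>2)"
    using False by (intro integrableI_bounded) (auto simp: L2_norm_sq_def less_top)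
  have LG: "L2_norm_sq G = ennreal (LINT x|lborel. (norm (G x))\<^sup>2)"
    unfolding L2_norm_sq_def by (rule nn_integral_eq_integral[OF iG]) simp
  have G11: "\<bar>G x $ 1 $ 1\<bar> \<le> norm (G x)" for x
    using component_le_norm_cart[of "G x $ 1" 1] Finite_Cartesian_Product.norm_nth_le[of "G x" 1] by linarith
  have young: "2 * \<theta> * \<bar>G x $ 1 $ 1 * \<psi> x\<bar> \<le> (norm (G x))\<^sup>2 + \<theta>\<^sup>2 * (\<psi> x)\<^sup>2" if "0 \<le> \<theta>" for x \<theta>
  proof -
    have "2 * \<theta> * \<bar>G x $ 1 $ 1 * \<psi> x\<bar> \<le> 2 * \<theta> * (norm (G x) * \<psi> x)"
      using that t(2)[of x] G11[of x] by (intro mult_left_mono) (auto simp: abs_mult intro: mult_right_mono)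
    also have "\<dots> \<le> (norm (G x))\<^sup>2 + \<theta>\<^sup>2 * (\<psi> x)\<^sup>2"
      using zero_le_power2[of "norm (G x) - \<theta> * \<psi> x"] by (simp add: power2_eq_square algebra_simps)
    finally show ?thesis .
  qed
  have iG11: "integrable lborel (\<lambda>x. G x $ 1 $ 1 * \<psi> x)"
  proof (rule Bochner_Integration.integrable_bound)
    show "integrable lborel (\<lambda>x. (norm (G x))\<^sup>2 + (\<psi> x)\<^sup>2)" by (intro Bochner_Integration.integrable_add iG i\<psi>2)
    show "AE x in lborel. norm (G x $ 1 $ 1 * \<psi> x) \<le> norm ((norm (G x))\<^sup>2 + (\<psi> x)\<^sup>2)"
      using young[of 1] by (intro AE_I2) (simp, smt (verit) zero_le_power2)
  qed measurable
  have iD: "integrable lborel (\<lambda>x. radial_leray_grad Q Q' x $ 1 $ 1 * \<psi> x)"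
    by (rule power_bounded_times_bounded_integrable[OF power_bounded_radial_leray_grad[OF p] _ _ c\<psi> RB]) auto
  have pair: "(LINT x|lborel. G x $ 1 $ 1 * \<psi> x) = (LINT x|lborel. radial_leray_grad Q Q' x $ 1 $ 1 * \<psi> x)"
  proof -
    have "- (LINT x|lborel. G x $ 1 $ 1 * \<psi> x) = (LINT x|lborel. V x $ 1 * frechet_derivative \<psi> (at x) (axis 1 1))"
      using G t(1) by (simp add: weak_gradient_def)
    also have "\<dots> = - (LINT x|lborel. radial_leray_grad Q Q' x $ 1 $ 1 * \<psi> x)"
      using weak_gradient_radial_leray[OF p V] t(1) by (simp add: weak_gradient_def)
    finally show ?thesis by simp
  qed
  have "?P = (LINT x|lborel. probe_slope \<mu> * \<psi> x)" by simp
  also have "\<dots> \<le> (LINT x|lborel. - (radial_leray_grad Q Q' x $ 1 $ 1 * \<psi> x))"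
  proof (rule integral_mono)
    fix x
    show "probe_slope \<mu> * \<psi> x \<le> - (radial_leray_grad Q Q' x $ 1 $ 1 * \<psi> x)"
    proof (cases "\<psi> x = 0")
      case False
      have "probe_slope \<mu> * \<psi> x \<le> (- radial_leray_grad Q Q' x $ 1 $ 1) * \<psi> x"
        by (intro mult_right_mono radial_leray_grad_probe[OF p t(3)[OF False] \<mu>] t(2))
      then show ?thesis by simp
    qed simp
  qed (use i\<psi> iD in auto)
  also have "\<dots> = - (LINT x|lborel. G x $ 1 $ 1 * \<psi> x)" using pair by simp
  also have "\<dots> \<le> (LINT x|lborel. \<bar>G x $ 1 $ 1 * \<psi> x\<bar>)"
    using integral_abs_bound[of lborel "\<lambda>x. G x $ 1 $ 1 * \<psi> x"] by linarith
  finally have P: "?P \<le> (LINT x|lborel. \<bar>G x $ 1 $ 1 * \<psi> x\<bar>)" .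
  have P0: "0 \<le> ?P"
    using t(2) \<mu> leray_const_bounds by (auto simp: probe_slope_def intro!: mult_nonneg_nonneg divide_nonneg_pos)
  \<comment> \<open>The parameter in Young's inequality that makes the bound largest.\<close>
  define \<theta> where "\<theta> = ?P / ?S"
  have \<theta>: "0 \<le> \<theta>" using P0 S by (simp add: \<theta>_def)
  have "2 * \<theta> * ?P \<le> 2 * \<theta> * (LINT x|lborel. \<bar>G x $ 1 $ 1 * \<psi> x\<bar>)" using P \<theta> by (intro mult_left_mono) auto
  also have "\<dots> = (LINT x|lborel. 2 * \<theta> * \<bar>G x $ 1 $ 1 * \<psi> x\<bar>)" by simp
  also have "\<dots> \<le> (LINT x|lborel. (norm (G x))\<^sup>2 + \<theta>\<^sup>2 * (\<psi> x)\<^sup>2)"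
    using iG i\<psi>2 iG11 young[OF \<theta>] by (intro integral_mono) auto
  also have "\<dots> = (LINT x|lborel. (norm (G x))\<^sup>2) + \<theta>\<^sup>2 * ?S"
    using iG i\<psi>2 by simp
  finally have "2 * \<theta> * ?P - \<theta>\<^sup>2 * ?S \<le> (LINT x|lborel. (norm (G x))\<^sup>2)" by simp
  moreover have "2 * \<theta> * ?P - \<theta>\<^sup>2 * ?S = ?P\<^sup>2 / ?S"
    using S unfolding \<theta>_def by (simp add: field_simps power2_eq_square)
  ultimately show ?thesis unfolding LG by (intro ennreal_leI) simp
qed simp

section \<open>Scaling\<close>

lemma L2_norm_sq_scale:
  fixes f :: "space \<Rightarrow> 'b::{real_normed_vector, second_countable_topology}"
  assumes [measurable]: "f \<in> borel_measurable borel" and b: "0 < b"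
  shows "L2_norm_sq (\<lambda>x. a *\<^sub>R f (b *\<^sub>R x)) = ennreal (a\<^sup>2 / b ^ 3) * L2_norm_sq f"
proof -
  have "L2_norm_sq f = ennreal (b ^ 3) * (\<integral>\<^sup>+ x. ennreal ((norm (f (b *\<^sub>R x)))\<^sup>2) \<partial>lborel)"
    unfolding L2_norm_sq_def using nn_integral_affine[of "\<lambda>x. ennreal ((norm (f x))\<^sup>2)" b 0] b by simp
  then have "ennreal (a\<^sup>2 / b ^ 3) * L2_norm_sq f
    = (ennreal (a\<^sup>2 / b ^ 3) * ennreal (b ^ 3)) * (\<integral>\<^sup>+ x. ennreal ((norm (f (b *\<^sub>R x)))\<^sup>2) \<partial>lborel)"
    by (simp add: mult.assoc)
  also have "ennreal (a\<^sup>2 / b ^ 3) * ennreal (b ^ 3) = ennreal (a\<^sup>2)"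
    using b by (subst ennreal_mult[symmetric]) auto
  also have "ennreal (a\<^sup>2) * (\<integral>\<^sup>+ x. ennreal ((norm (f (b *\<^sub>R x)))\<^sup>2) \<partial>lborel) = (\<integral>\<^sup>+ x. ennreal (a\<^sup>2) * ennreal ((norm (f (b *\<^sub>R x)))\<^sup>2) \<partial>lborel)"
    by (rule nn_integral_cmult[symmetric]) measurable
  also have "\<dots> = L2_norm_sq (\<lambda>x. a *\<^sub>R f (b *\<^sub>R x))"
    unfolding L2_norm_sq_def by (intro nn_integral_cong) (simp add: ennreal_mult[symmetric] power_mult_distrib)
  finally show ?thesis ..
qed

lemma locally_integrable_scale:
  fixes f :: "space \<Rightarrow> 'b::{banach, second_countable_topology}"
  assumes f: "locally_integrable f" and b: "0 < b"
  shows "locally_integrable (\<lambda>x. a *\<^sub>R f (b *\<^sub>R x))"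
  unfolding locally_integrable_def
proof (intro allI impI)
  fix K :: "space set" assume K: "compact K"
  have "compact ((*\<^sub>R) b ` K)" by (intro compact_scaling K)
  then have "integrable lborel (\<lambda>y. indicator ((*\<^sub>R) b ` K) y *\<^sub>R f y)"
    using f by (simp add: locally_integrable_def set_integrable_def)
  then have "integrable lborel (\<lambda>x. indicator ((*\<^sub>R) b ` K) (0 + b *\<^sub>R x) *\<^sub>R f (0 + b *\<^sub>R x))"
    using b by (subst integrable_affine[of b "\<lambda>y. indicator ((*\<^sub>R) b ` K) y *\<^sub>R f y" 0]) auto
  then have "integrable lborel (\<lambda>x. a *\<^sub>R (indicator K x *\<^sub>R f (b *\<^sub>R x)))"
    using b by (intro integrable_scaleR_right) (auto simp: indicator_def image_iff cong: if_cong)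
  then show "set_integrable lborel K (\<lambda>x. a *\<^sub>R f (b *\<^sub>R x))"
    by (simp add: set_integrable_def mult.commute)
qed

lemma weak_gradient_scale:
  assumes U: "weak_gradient U G" and b: "0 < b"
  shows "weak_gradient (\<lambda>x. a *\<^sub>R U (b *\<^sub>R x)) (\<lambda>x. (a * b) *\<^sub>R G (b *\<^sub>R x))"
  unfolding weak_gradient_def
proof (intro conjI allI impI)
  show "locally_integrable (\<lambda>x. a *\<^sub>R U (b *\<^sub>R x))" "locally_integrable (\<lambda>x. (a * b) *\<^sub>R G (b *\<^sub>R x))"
    using U b by (auto simp: weak_gradient_def intro: locally_integrable_scale)
  fix \<psi> i j assume t: "test_function \<psi>"
  define \<eta> where "\<eta> y = \<psi> ((1 / b) *\<^sub>R y + 0)" for y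
  have t\<eta>: "test_function \<eta>" unfolding \<eta>_def[abs_def] using b by (intro test_function_affine t) auto
  have d: "frechet_derivative \<psi> (at x) (axis j 1) = b * frechet_derivative \<eta> (at (b *\<^sub>R x)) (axis j 1)" for x
  proof -
    have "\<psi> = (\<lambda>x. \<eta> (b *\<^sub>R x))" using b by (simp add: \<eta>_def)
    moreover have "((\<lambda>x. \<eta> (b *\<^sub>R x)) has_derivative (\<lambda>h. frechet_derivative \<eta> (at (b *\<^sub>R x)) (b *\<^sub>R h))) (at x)"
    proof -
      have 1: "((\<lambda>x. b *\<^sub>R x) has_derivative (\<lambda>h. b *\<^sub>R h)) (at x)" by (auto intro!: derivative_eq_intros)
      have 2: "(\<eta> has_derivative frechet_derivative \<eta> (at (b *\<^sub>R x))) (at (b *\<^sub>R x))"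
        using smooth_regular(3)[of \<eta>] t\<eta> by (simp add: test_function_def frechet_derivative_works[symmetric])
      from has_derivative_compose[OF 1 2] show ?thesis .
    qed
    ultimately have "frechet_derivative \<psi> (at x) = (\<lambda>h. frechet_derivative \<eta> (at (b *\<^sub>R x)) (b *\<^sub>R h))"
      using frechet_derivative_at by metis
    moreover have "linear (frechet_derivative \<eta> (at (b *\<^sub>R x)))"
      using smooth_regular(3)[of \<eta>] t\<eta> by (intro linear_frechet_derivative) (simp add: test_function_def)
    ultimately show ?thesis by (simp add: linear_cmul)
  qed
  have key: "(LINT y|lborel. U y $ i * frechet_derivative \<eta> (at y) (axis j 1)) = - (LINT y|lborel. G y $ i $ j * \<eta> y)"
    using U t\<eta> by (simp add: weak_gradient_def)
  have l: "(LINT y|lborel. U y $ i * frechet_derivative \<eta> (at y) (axis j 1))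
      = b ^ 3 * (LINT x|lborel. U (b *\<^sub>R x) $ i * frechet_derivative \<eta> (at (b *\<^sub>R x)) (axis j 1))"
    using integral_affine[of b "\<lambda>y. U y $ i * frechet_derivative \<eta> (at y) (axis j 1)" 0] b by simp
  have r: "(LINT y|lborel. G y $ i $ j * \<eta> y) = b ^ 3 * (LINT x|lborel. G (b *\<^sub>R x) $ i $ j * \<psi> x)"
    using integral_affine[of b "\<lambda>y. G y $ i $ j * \<eta> y" 0] b by (simp add: \<eta>_def)
  have eq: "(LINT x|lborel. U (b *\<^sub>R x) $ i * frechet_derivative \<eta> (at (b *\<^sub>R x)) (axis j 1)) = - (LINT x|lborel. G (b *\<^sub>R x) $ i $ j * \<psi> x)"
  proof -
    have "b ^ 3 * (LINT x|lborel. U (b *\<^sub>R x) $ i * frechet_derivative \<eta> (at (b *\<^sub>R x)) (axis j 1))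
      = b ^ 3 * (- (LINT x|lborel. G (b *\<^sub>R x) $ i $ j * \<psi> x))"
      using key unfolding l r by simp
    then show ?thesis unfolding mult_cancel_left using b by auto
  qed
  have "(LINT x|lborel. (a *\<^sub>R U (b *\<^sub>R x)) $ i * frechet_derivative \<psi> (at x) (axis j 1))
    = (LINT x|lborel. (a * b) * (U (b *\<^sub>R x) $ i * frechet_derivative \<eta> (at (b *\<^sub>R x)) (axis j 1)))"
    by (intro Bochner_Integration.integral_cong) (simp_all add: d mult_ac)
  also have "\<dots> = - ((a * b) * (LINT x|lborel. G (b *\<^sub>R x) $ i $ j * \<psi> x))"
    by (simp only: integral_mult_right_zero eq mult_minus_right)
  also have "(a * b) * (LINT x|lborel. G (b *\<^sub>R x) $ i $ j * \<psi> x) = (LINT x|lborel. ((a * b) *\<^sub>R G (b *\<^sub>R x)) $ i $ j * \<psi> x)"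
    by (simp add: mult.assoc)
  finally show "(LINT x|lborel. (a *\<^sub>R U (b *\<^sub>R x)) $ i * frechet_derivative \<psi> (at x) (axis j 1))
    = - (LINT x|lborel. ((a * b) *\<^sub>R G (b *\<^sub>R x)) $ i $ j * \<psi> x)" .
qed

lemma grad_L2_norm_sq_scaled_le:
  assumes "weak_gradient V G" "0 < b" "L2_norm_sq G \<le> ennreal K" "0 \<le> K"
  shows "grad_L2_norm_sq (\<lambda>x. b *\<^sub>R V (b *\<^sub>R x)) \<le> ennreal (b * K)"
proof -
  have m: "G \<in> borel_measurable borel"
    using assms(1) by (auto simp: weak_gradient_def intro: locally_integrable_measurable)
  have "grad_L2_norm_sq (\<lambda>x. b *\<^sub>R V (b *\<^sub>R x)) \<le> L2_norm_sq (\<lambda>x. (b * b) *\<^sub>R G (b *\<^sub>R x))"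
    unfolding grad_L2_norm_sq_def by (rule INF_lower) (simp add: weak_gradient_scale assms)
  also have "\<dots> = ennreal ((b * b)\<^sup>2 / b ^ 3) * L2_norm_sq G" by (rule L2_norm_sq_scale[OF m assms(2)])
  also have "(b * b)\<^sup>2 / b ^ 3 = b" using assms(2) by (simp add: field_simps power2_eq_square power3_eq_cube)
  also have "ennreal b * L2_norm_sq G \<le> ennreal b * ennreal K" by (rule mult_left_mono[OF assms(3)]) simp
  also have "\<dots> = ennreal (b * K)" using assms by (simp add: ennreal_mult)
  finally show ?thesis .
qed

text \<open>Rescaling maps the weak gradients of the rescaled field back to those of the original one.\<close>

lemma grad_L2_norm_sq_scaled_ge:
  assumes K: "\<And>G. weak_gradient V G \<Longrightarrow> ennreal K \<le> L2_norm_sq G" and b: "0 < b" and K0: "0 \<le> K"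
  shows "ennreal (b * K) \<le> grad_L2_norm_sq (\<lambda>x. b *\<^sub>R V (b *\<^sub>R x))"
  unfolding grad_L2_norm_sq_def
proof (rule INF_greatest)
  fix G assume "G \<in> {G. weak_gradient (\<lambda>x. b *\<^sub>R V (b *\<^sub>R x)) G}"
  then have G: "weak_gradient (\<lambda>x. b *\<^sub>R V (b *\<^sub>R x)) G" by simp
  then have m: "G \<in> borel_measurable borel"
    by (auto simp: weak_gradient_def intro: locally_integrable_measurable)
  have "weak_gradient (\<lambda>x. (1/b) *\<^sub>R (b *\<^sub>R V (b *\<^sub>R ((1/b) *\<^sub>R x)))) (\<lambda>x. (1/b * (1/b)) *\<^sub>R G ((1/b) *\<^sub>R x))"
    using weak_gradient_scale[OF G, of "1/b" "1/b"] b by simp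
  then have "weak_gradient V (\<lambda>x. (1/b * (1/b)) *\<^sub>R G ((1/b) *\<^sub>R x))" using b by simp
  from K[OF this] have "ennreal K \<le> ennreal ((1/b * (1/b))\<^sup>2 / (1/b) ^ 3) * L2_norm_sq G"
    using L2_norm_sq_scale[OF m, of "1/b" "1/b * (1/b)"] b by simp
  also have "(1/b * (1/b))\<^sup>2 / (1/b) ^ 3 = 1 / b" using b by (simp add: field_simps power2_eq_square power3_eq_cube)
  finally have "ennreal b * ennreal K \<le> ennreal b * (ennreal (1/b) * L2_norm_sq G)" by (rule mult_left_mono) simp
  also have "\<dots> = L2_norm_sq G" using b by (simp add: mult.assoc[symmetric] ennreal_mult[symmetric])
  finally show "ennreal (b * K) \<le> L2_norm_sq G" using b K0 by (simp add: ennreal_mult)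
qed

section \<open>Rescaled profiles\<close>

lemma smooth_profile_scale:
  assumes sp: "smooth_profile C R q q' q''" and l: "0 < l" and a: "0 \<le> a"
  shows "smooth_profile (a * C * l powr (1/4)) (R * l) (\<lambda>r. a * q (r / l)) (\<lambda>r. a / l * q' (r / l)) (\<lambda>r. a / l\<^sup>2 * q'' (r / l))"
proof -
  have p: "profile C R q q'" using sp by (simp add: smooth_profile_def)
  have s: "continuous_on {0<..} q''" "\<And>r. 0 < r \<Longrightarrow> (q' has_real_derivative q'' r) (at r)"
    "\<And>r. 0 < r \<Longrightarrow> \<bar>q'' r\<bar> \<le> C * r powr (-9/4)" "\<And>r. R \<le> r \<Longrightarrow> q'' r = 0"
    using sp by (auto simp: smooth_profile_def)
  have cont: "continuous_on {0<..} (\<lambda>r. h (r / l))" if "continuous_on {0<..} h" for h :: "real \<Rightarrow> real"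
    by (rule continuous_on_compose2[OF that]) (use l in \<open>auto intro!: continuous_intros\<close>)
  have der: "((\<lambda>r. b * h (r / l)) has_real_derivative b / l * h' (r / l)) (at r)"
    if "(h has_real_derivative h' (r / l)) (at (r / l))" for h h' :: "real \<Rightarrow> real" and r b
  proof -
    have "((\<lambda>r. r / l) has_real_derivative 1 / l) (at r)" by (rule DERIV_cdivide) simp
    from DERIV_cmult[OF DERIV_chain2[OF that this], of b] show ?thesis by simp
  qed
  have bd: "\<bar>a / l ^ k * h\<bar> \<le> a * C * l powr (1/4) * r powr (- (real k) - 1/4)"
    if h: "\<bar>h\<bar> \<le> C * (r / l) powr (- (real k) - 1/4)" and r: "0 < r" for h r k
  proof -
    have "\<bar>a / l ^ k * h\<bar> \<le> a / l ^ k * (C * (r / l) powr (- (real k) - 1/4))"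
      using a l h by (simp add: abs_mult) (intro divide_right_mono mult_left_mono, auto)
    also have "(r / l) powr (- (real k) - 1/4) = r powr (- (real k) - 1/4) * (l powr (1/4) * l ^ k)"
    proof -
      have e: "- (real k) - 1/4 = - (1/4 + real k)" by simp
      have "(r / l) powr (- (1/4 + real k)) = r powr (- (1/4 + real k)) * l powr (1/4 + real k)"
        by (simp add: powr_divide powr_minus field_simps)
      also have "l powr (1/4 + real k) = l powr (1/4) * l ^ k"
        using l by (simp add: powr_add powr_realpow)
      finally show ?thesis unfolding e .
    qed
    also have "a / l ^ k * (C * (r powr (- (real k) - 1/4) * (l powr (1/4) * l ^ k))) = a * C * l powr (1/4) * r powr (- (real k) - 1/4)"
      using l by simp
    finally show ?thesis .
  qed
  have rl: "R \<le> r / l" if "R * l \<le> r" for r using that l by (simp add: le_divide_eq)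
  show ?thesis
    unfolding smooth_profile_def profile_def
  proof (intro conjI allI impI)
    fix r :: real
    show "((\<lambda>r. a * q (r / l)) has_real_derivative a / l * q' (r / l)) (at r)" if "0 < r"
      using that l by (intro der profileD(4)[OF p]) auto
    show "((\<lambda>r. a / l * q' (r / l)) has_real_derivative a / l\<^sup>2 * q'' (r / l)) (at r)" if "0 < r"
    proof -
      have "((\<lambda>r. a / l * q' (r / l)) has_real_derivative a / l / l * q'' (r / l)) (at r)"
        using that l by (intro der s(2)) auto
      then show ?thesis by (simp add: power2_eq_square)
    qed
    show "\<bar>a * q (r / l)\<bar> \<le> a * C * l powr (1/4) * r powr (- 1/4)" if "0 < r"
      using bd[of "q (r / l)" r 0] profileD(5)[OF p, of "r / l"] that l by simp
    show "\<bar>a / l * q' (r / l)\<bar> \<le> a * C * l powr (1/4) * r powr (- 5/4)" if "0 < r"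
      using bd[of "q' (r / l)" r 1] profileD(6)[OF p, of "r / l"] that l by simp
    show "\<bar>a / l\<^sup>2 * q'' (r / l)\<bar> \<le> a * C * l powr (1/4) * r powr (- 9/4)" if "0 < r"
      using bd[of "q'' (r / l)" r 2] s(3)[of "r / l"] that l by simp
  qed (use l a profileD[OF p] s rl in \<open>auto intro!: continuous_intros cont\<close>)
qed

lemma mean_scale:
  assumes p: "profile C R q q'" and l: "0 < l" and r: "0 < r"
  shows "mean (\<lambda>r. a * q (r / l)) r = a * mean q (r / l)"
proof -
  let ?J = "integral {0..r / l} (\<lambda>\<rho>. \<rho>\<^sup>2 * q \<rho>)"
  have "((\<lambda>\<rho>. \<rho>\<^sup>2 * q \<rho>) has_integral ?J) {0..r / l}"
    by (rule integrable_integral[OF profile_weighted_integrable[OF p]])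
  then have "((\<lambda>x. (1 / l * x)\<^sup>2 * q (1 / l * x)) has_integral (1 / \<bar>1 / l\<bar>) *\<^sub>R ?J) ((\<lambda>x. x / (1 / l)) ` {0..r / l})"
    by (rule has_integral_stretch_real) (use l in auto)
  moreover have "(\<lambda>x. x / (1 / l)) ` {0..r / l} = {0..r}"
  proof (intro equalityI subsetI)
    fix y assume "y \<in> {0..r}"
    then show "y \<in> (\<lambda>x. x / (1 / l)) ` {0..r / l}"
      using l by (intro image_eqI[of _ _ "y / l"]) (auto simp: divide_right_mono)
  qed (use l in \<open>auto simp: field_simps\<close>)
  ultimately have "((\<lambda>x. (x / l)\<^sup>2 * q (x / l)) has_integral (l * ?J)) {0..r}" using l by simp
  from has_integral_mult_right[OF this, of "a * l\<^sup>2"]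
  have "((\<lambda>x. x\<^sup>2 * (a * q (x / l))) has_integral (a * l ^ 3 * ?J)) {0..r}"
    using l by (simp add: power_divide power2_eq_square power3_eq_cube mult_ac)
  then have "mean (\<lambda>r. a * q (r / l)) r = 3 / r ^ 3 * (a * l ^ 3 * ?J)"
    unfolding mean_def by (simp add: integral_unique)
  also have "\<dots> = a * mean q (r / l)" using l r by (simp add: mean_def field_simps)
  finally show ?thesis .
qed

lemma radial_leray_scale:
  assumes p: "\<And>j. profile C R (Q j) (Q' j)" and l: "0 < l" and x: "x \<noteq> 0"
  shows "radial_leray (\<lambda>j r. a * Q j (r / l)) x = a *\<^sub>R radial_leray Q ((1 / l) *\<^sub>R x)"
proof -
  have n: "norm ((1 / l) *\<^sub>R x) = norm x / l" using l by simp
  have np: "0 < norm x" using x by simp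
  have h: "hess (\<lambda>r. a * Q j (r / l)) i j x = a * hess (Q j) i j ((1 / l) *\<^sub>R x)" for i j
    unfolding hess_def mean_scale[OF p l np] n using l np by (simp add: field_simps power2_eq_square)
  show ?thesis
    unfolding vec_eq_iff
  proof
    fix i
    have "(\<Sum>j\<in>UNIV. hess (\<lambda>r. a * Q j (r / l)) i j x) = a * (\<Sum>j\<in>UNIV. hess (Q j) i j ((1 / l) *\<^sub>R x))"
      by (simp only: h sum_distrib_left)
    then show "radial_leray (\<lambda>j r. a * Q j (r / l)) x $ i = (a *\<^sub>R radial_leray Q ((1 / l) *\<^sub>R x)) $ i"
      unfolding radial_leray_def vec_lambda_beta vector_scaleR_component n by (simp add: right_diff_distrib)
  qed
qed

section \<open>The logarithmic profile\<close>

text \<open>What is needed of the cut-off function along a ray from the origin.\<close>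

definition cutoff_profile :: "real \<Rightarrow> (real \<Rightarrow> real) \<Rightarrow> (real \<Rightarrow> real) \<Rightarrow> (real \<Rightarrow> real) \<Rightarrow> bool" where
  "cutoff_profile B p p' p'' \<longleftrightarrow> 0 \<le> B \<and> continuous_on UNIV p' \<and> continuous_on UNIV p'' \<and>
     (\<forall>r. (p has_real_derivative p' r) (at r) \<and> (p' has_real_derivative p'' r) (at r) \<and>
        0 \<le> p r \<and> p r \<le> 1 \<and> \<bar>p' r\<bar> \<le> B \<and> \<bar>p'' r\<bar> \<le> B) \<and>
     (\<forall>r. \<bar>r\<bar> < 1/2 \<longrightarrow> p r = 1 \<and> p' r = 0) \<and>
     (\<forall>r>3/4. p r = 0 \<and> p' r = 0 \<and> p'' r = 0)"

lemma cutoff_profile_of_cutoff: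
  assumes f: "cutoff f" and one: "\<And>x. x \<in> ball 0 (1/2) \<Longrightarrow> f x = 1" and zero: "\<And>x. x \<notin> ball 0 (3/4) \<Longrightarrow> f x = 0"
  shows "\<exists>B p' p''. cutoff_profile B (\<lambda>r. f (r *\<^sub>R axis 1 1)) p' p''"
proof -
  let ?e = "axis 1 1 :: space"
  define f1 where "f1 x = frechet_derivative f (at x) ?e" for x
  define p where "p r = f (r *\<^sub>R ?e)" for r
  define p1 where "p1 r = f1 (r *\<^sub>R ?e)" for r
  define p2 where "p2 r = frechet_derivative f1 (at (r *\<^sub>R ?e)) ?e" for r
  have sf: "smooth f" using f by (simp add: cutoff_def)
  have sf1: "smooth f1"
    unfolding smooth_def f1_def[abs_def] using sf Ck_deriv[of _ f 1] by (auto simp: smooth_def simp del: Ck.simps)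
  have line: "continuous_on UNIV (\<lambda>r::real. r *\<^sub>R ?e)" by (intro continuous_intros)
  have d1: "(p has_real_derivative p1 r) (at r)" for r
    using pderiv_onD[OF smooth_regular(4)[OF sf], of 0 r 1] by (simp add: p_def[abs_def] p1_def f1_def)
  have d2: "(p1 has_real_derivative p2 r) (at r)" for r
    using pderiv_onD[OF smooth_regular(4)[OF sf1], of 0 r 1] by (simp add: p1_def[abs_def] p2_def)
  have c1: "continuous_on UNIV p1" unfolding p1_def[abs_def]
    by (rule continuous_on_compose2[OF smooth_regular(1)[OF sf1] line]) auto
  have c2: "continuous_on UNIV p2" unfolding p2_def[abs_def]
    by (rule continuous_on_compose2[OF smooth_regular(2)[OF sf1] line]) auto
  have loc: "h' r = 0" if "open S" "r \<in> S" "\<And>t. t \<in> S \<Longrightarrow> h t = c" "(h has_real_derivative h' r) (at r)"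
    for h h' :: "real \<Rightarrow> real" and S r c
  proof -
    have "((\<lambda>t. c) has_real_derivative h' r) (at r)"
      by (rule has_field_derivative_transform_within_open[OF that(4,1,2)]) (use that in auto)
    then show ?thesis using DERIV_unique[OF _ DERIV_const] by blast
  qed
  have p_one: "p r = 1" if "r \<in> {-1/2<..<1/2}" for r using that by (auto simp: p_def intro!: one)
  have p_zero: "p r = 0" if "r \<in> {3/4<..}" for r using that by (auto simp: p_def intro!: zero)
  have p1_one: "p1 r = 0" if "r \<in> {-1/2<..<1/2}" for r by (rule loc[of "{-1/2<..<1/2}" r p 1 p1, OF _ that p_one d1]) auto
  have p1_zero: "p1 r = 0" if "r \<in> {3/4<..}" for r by (rule loc[of "{3/4<..}" r p 0 p1, OF _ that p_zero d1]) auto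
  have p2_zero: "p2 r = 0" if "r \<in> {3/4<..}" for r by (rule loc[of "{3/4<..}" r p1 0 p2, OF _ that p1_zero d2]) auto
  have n1: "p1 r = 0" if "r < -3/4" for r
  proof (rule loc[of "{..<(-3/4)}" r p 0 p1, OF _ _ _ d1])
    show "p t = 0" if "t \<in> {..<(-3/4)}" for t using that by (auto simp: p_def intro!: zero)
  qed (use that in auto)
  have n2: "p2 r = 0" if "r < -3/4" for r
    by (rule loc[of "{..<(-3/4)}" r p1 0 p2, OF _ _ _ d2]) (use that n1 in auto)
  have bnd: "\<exists>B. \<forall>r. \<bar>h r\<bar> \<le> B" if c: "continuous_on UNIV h" and z: "\<And>r. 3/4 < r \<Longrightarrow> h r = 0" "\<And>r. r < -3/4 \<Longrightarrow> h r = 0"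
    for h :: "real \<Rightarrow> real"
  proof -
    have "compact (h ` {-3/4..3/4})"
      by (rule compact_continuous_image[OF continuous_on_subset[OF c]]) auto
    from compact_imp_bounded[OF this] obtain B where B: "\<forall>y\<in>h ` {-3/4..3/4}. norm y \<le> B"
      unfolding bounded_iff by blast
    have "\<bar>h r\<bar> \<le> max B 0" for r
    proof (cases "r \<in> {-3/4..3/4}")
      case True
      then have "norm (h r) \<le> B" using B by blast
      then show ?thesis by simp
    next
      case False
      then have "3/4 < r \<or> r < -3/4" by auto
      then show ?thesis using z[of r] by auto
    qed
    then show ?thesis by blast
  qed
  have "\<exists>B. \<forall>r. \<bar>p1 r\<bar> \<le> B" by (rule bnd[OF c1 p1_zero n1]) simp
  then obtain B1 where B1: "\<And>r. \<bar>p1 r\<bar> \<le> B1" by blast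
  have "\<exists>B. \<forall>r. \<bar>p2 r\<bar> \<le> B" by (rule bnd[OF c2 p2_zero n2]) simp
  then obtain B2 where B2: "\<And>r. \<bar>p2 r\<bar> \<le> B2" by blast
  have "\<bar>p1 r\<bar> \<le> max B1 B2" "\<bar>p2 r\<bar> \<le> max B1 B2" for r using B1[of r] B2[of r] by auto
  moreover have "0 \<le> max B1 B2" using B1[of 0] by linarith
  moreover have "0 \<le> p r" "p r \<le> 1" for r using f by (auto simp: cutoff_def p_def)
  moreover have "p r = 1 \<and> p1 r = 0" if "\<bar>r\<bar> < 1/2" for r
  proof -
    have "r \<in> {-1/2<..<1/2}" using that by (simp add: abs_less_iff) linarith
    then show ?thesis using p_one p1_one by blast
  qed
  ultimately have "cutoff_profile (max B1 B2) p p1 p2"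
    unfolding cutoff_profile_def using c1 c2 d1 d2 p_zero p1_zero p2_zero by auto
  then show ?thesis unfolding p_def[abs_def] by blast
qed

definition power_log :: "real \<Rightarrow> real \<Rightarrow> real \<Rightarrow> real" where
  "power_log s \<nu> r = r powr \<nu> * (- ln r) powr s"

definition power_log1 :: "real \<Rightarrow> real \<Rightarrow> real \<Rightarrow> real" where
  "power_log1 s \<nu> r = r powr (\<nu> - 1) * (\<nu> * (- ln r) powr s - s * (- ln r) powr (s - 1))"

definition power_log2 :: "real \<Rightarrow> real \<Rightarrow> real \<Rightarrow> real" where
  "power_log2 s \<nu> r = r powr (\<nu> - 2) * ((\<nu> - 1) * (\<nu> * (- ln r) powr s - s * (- ln r) powr (s - 1))
     - \<nu> * s * (- ln r) powr (s - 1) + s * (s - 1) * (- ln r) powr (s - 2))"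

definition log_profile :: "real \<Rightarrow> (real \<Rightarrow> real) \<Rightarrow> real \<Rightarrow> real \<Rightarrow> real" where
  "log_profile s p \<nu> r = power_log s \<nu> r * p r"

text \<open>The first and second derivatives are set to zero from \<open>1\<close> on, where \<open>- ln r\<close> is no longer positive and
  the formulas for the derivatives of its powers fail; the cut-off vanishes there.\<close>

definition log_profile1 :: "real \<Rightarrow> (real \<Rightarrow> real) \<Rightarrow> (real \<Rightarrow> real) \<Rightarrow> real \<Rightarrow> real \<Rightarrow> real" where
  "log_profile1 s p p' \<nu> r = (if r < 1 then power_log1 s \<nu> r * p r + power_log s \<nu> r * p' r else 0)"

definition log_profile2 :: "real \<Rightarrow> (real \<Rightarrow> real) \<Rightarrow> (real \<Rightarrow> real) \<Rightarrow> (real \<Rightarrow> real) \<Rightarrow> real \<Rightarrow> real \<Rightarrow> real" where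
  "log_profile2 s p p' p'' \<nu> r = (if r < 1 then power_log2 s \<nu> r * p r + 2 * (power_log1 s \<nu> r * p' r) + power_log s \<nu> r * p'' r else 0)"

lemma power_log_deriv:
  assumes r: "0 < r" "r < 1"
  shows "(power_log s \<nu> has_real_derivative power_log1 s \<nu> r) (at r)"
    and "(power_log1 s \<nu> has_real_derivative power_log2 s \<nu> r) (at r)"
proof -
  have L: "0 < - ln r" using r by simp
  have dL: "((\<lambda>r. - ln r) has_real_derivative - (1 / r)) (at r)" using r by (auto intro!: derivative_eq_intros)
  have dp: "((\<lambda>r. (- ln r) powr a) has_real_derivative a * (- ln r) powr (a - 1) * - (1 / r)) (at r)" for a
    by (rule DERIV_chain2[OF has_real_derivative_powr[OF L] dL])
  have dr: "((\<lambda>r. r powr a) has_real_derivative a * r powr (a - 1)) (at r)" for a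
    by (rule has_real_derivative_powr[OF r(1)])
  have rp: "r powr a * (1 / r) = r powr (a - 1)" for a using r by (simp add: powr_diff)
  have "((\<lambda>r. r powr \<nu> * (- ln r) powr s) has_real_derivative
     (\<nu> * r powr (\<nu> - 1)) * (- ln r) powr s + (s * (- ln r) powr (s - 1) * - (1 / r)) * r powr \<nu>) (at r)"
    by (rule DERIV_mult[OF dr dp])
  also have "(\<nu> * r powr (\<nu> - 1)) * (- ln r) powr s + (s * (- ln r) powr (s - 1) * - (1 / r)) * r powr \<nu> = power_log1 s \<nu> r"
    unfolding power_log1_def rp[of \<nu>, symmetric] by (simp add: algebra_simps)
  finally show "(power_log s \<nu> has_real_derivative power_log1 s \<nu> r) (at r)" by (simp add: power_log_def[abs_def])
  have "((\<lambda>r. r powr (\<nu> - 1) * (\<nu> * (- ln r) powr s - s * (- ln r) powr (s - 1))) has_real_derivative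
     ((\<nu> - 1) * r powr (\<nu> - 1 - 1)) * (\<nu> * (- ln r) powr s - s * (- ln r) powr (s - 1))
     + (\<nu> * (s * (- ln r) powr (s - 1) * - (1 / r)) - s * ((s - 1) * (- ln r) powr (s - 1 - 1) * - (1 / r))) * r powr (\<nu> - 1)) (at r)"
    by (intro DERIV_mult DERIV_diff DERIV_cmult dr dp)
  also have "((\<nu> - 1) * r powr (\<nu> - 1 - 1)) * (\<nu> * (- ln r) powr s - s * (- ln r) powr (s - 1))
     + (\<nu> * (s * (- ln r) powr (s - 1) * - (1 / r)) - s * ((s - 1) * (- ln r) powr (s - 1 - 1) * - (1 / r))) * r powr (\<nu> - 1) = power_log2 s \<nu> r"
  proof -
    have e: "\<nu> - 2 = \<nu> - 1 - 1" "s - 2 = s - 1 - 1" by simp_all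
    show ?thesis unfolding power_log2_def e rp[of "\<nu> - 1", symmetric] by (simp only: algebra_simps)
  qed
  finally show "(power_log1 s \<nu> has_real_derivative power_log2 s \<nu> r) (at r)" by (simp add: power_log1_def[abs_def])
qed

lemma power_log_continuous:
  "continuous_on {0<..<1} (power_log s \<nu>)" "continuous_on {0<..<1} (power_log1 s \<nu>)" "continuous_on {0<..<1} (power_log2 s \<nu>)"
proof -
  show "continuous_on {0<..<1} (power_log s \<nu>)" "continuous_on {0<..<1} (power_log1 s \<nu>)"
    by (auto intro!: continuous_at_imp_continuous_on DERIV_isCont power_log_deriv)
  have "- ln r \<noteq> 0" if "r \<in> {0<..<1}" for r :: real using that by auto
  then show "continuous_on {0<..<1} (power_log2 s \<nu>)"
    unfolding power_log2_def[abs_def] by (intro continuous_intros) auto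
qed

lemma powr_le_linear: "0 \<le> (x::real) \<Longrightarrow> 0 \<le> a \<Longrightarrow> a \<le> 1 \<Longrightarrow> x powr a \<le> 1 + x"
proof -
  assume x: "0 \<le> x" and a: "0 \<le> a" "a \<le> 1"
  show ?thesis
  proof (cases "x \<le> 1")
    case True
    then have "x powr a \<le> 1 powr a" using x a by (intro powr_mono2) auto
    then show ?thesis using x by simp
  next
    case False
    then have "x powr a \<le> x powr 1" using a by (intro powr_mono) auto
    then show ?thesis using x by simp
  qed
qed

text \<open>On the support of the cut-off the logarithm is at least \<open>1/4\<close> in absolute value, and near the origin
  it is controlled by the power \<open>-1/4\<close>.\<close>

lemma ln_bounds:
  fixes r s :: real
  assumes r: "0 < r" "r \<le> 3/4" and s: "0 < s" "s < 1"
  shows "1/4 \<le> - ln r" "(- ln r) powr s \<le> 5 * r powr (-1/4)" "(- ln r) powr (s - 1) \<le> 4"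
    "(- ln r) powr (s - 2) \<le> 16" "1 \<le> r powr (-1/4)"
proof -
  show L: "1/4 \<le> - ln r" using ln_le_minus_one[OF r(1)] r by simp
  have "1 powr (-1/4) \<le> r powr (-1/4)" using r by (intro powr_mono2') auto
  then show w: "1 \<le> r powr (-1/4)" by simp
  have "ln (r powr (-1/4)) \<le> r powr (-1/4) - 1" using r by (intro ln_le_minus_one) auto
  then have "- ln r \<le> 4 * r powr (-1/4)" using r by (simp add: ln_powr)
  moreover have "(- ln r) powr s \<le> 1 + (- ln r)" using L s by (intro powr_le_linear) auto
  ultimately show "(- ln r) powr s \<le> 5 * r powr (-1/4)" using w by linarith
  have "(- ln r) powr (s - 1) \<le> (1/4) powr (s - 1)" using L s by (intro powr_mono2') auto
  also have "\<dots> \<le> (1/4) powr (-1)" using s by (intro powr_mono') auto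
  finally show "(- ln r) powr (s - 1) \<le> 4" by (simp add: powr_minus)
  have "(- ln r) powr (s - 2) \<le> (1/4) powr (s - 2)" using L s by (intro powr_mono2') auto
  also have "\<dots> \<le> (1/4) powr (-2)" using s by (intro powr_mono') auto
  finally show "(- ln r) powr (s - 2) \<le> 16" by (simp add: powr_minus power2_eq_square)
qed

text \<open>The last summand bounds \<open>power_log\<close>; the others bound \<open>power_log2\<close> and exceed \<open>5 \<Lambda> + 4\<close>, the bound for
  \<open>power_log1\<close>.\<close>

definition log_profile_const :: "real \<Rightarrow> real" where
  "log_profile_const \<Lambda> = (\<Lambda> + 1) * (5 * \<Lambda> + 4) + 4 * \<Lambda> + 16 + 5"

lemma power_log_bounds:
  assumes r: "0 < r" "r \<le> 3/4" and s: "0 < s" "s < 1" and l: "0 \<le> \<nu>" "\<nu> \<le> \<Lambda>"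
  shows "\<bar>power_log s \<nu> r\<bar> \<le> log_profile_const \<Lambda> * r powr (-1/4)" "\<bar>power_log1 s \<nu> r\<bar> \<le> log_profile_const \<Lambda> * r powr (-5/4)"
    "\<bar>power_log2 s \<nu> r\<bar> \<le> log_profile_const \<Lambda> * r powr (-9/4)"
proof -
  let ?w = "r powr (-1/4)" and ?L = "- ln r"
  note b = ln_bounds[OF r s]
  have rl: "r powr (\<nu> - a) \<le> r powr (-a)" for a using r l by (intro powr_mono') auto
  have we: "r powr (-5/4) = r powr (-1) * ?w" "r powr (-9/4) = r powr (-2) * ?w"
    using powr_add[of r "-1" "-1/4"] powr_add[of r "-2" "-1/4"] by simp_all
  have K: "5 \<le> log_profile_const \<Lambda>" "5 * \<Lambda> + 4 \<le> log_profile_const \<Lambda>" "(\<Lambda> + 1) * (5 * \<Lambda> + 4) + 4 * \<Lambda> + 16 \<le> log_profile_const \<Lambda>" "0 \<le> log_profile_const \<Lambda>"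
    using l by (simp_all add: log_profile_const_def algebra_simps)
  have "\<bar>power_log s \<nu> r\<bar> \<le> 1 * (5 * ?w)"
    unfolding power_log_def abs_mult using rl[of 0] b r by (intro mult_mono) auto
  also have "\<dots> \<le> log_profile_const \<Lambda> * ?w" using mult_right_mono[OF K(1), of ?w] by simp
  finally show "\<bar>power_log s \<nu> r\<bar> \<le> log_profile_const \<Lambda> * ?w" .
  have t1: "\<bar>\<nu> * ?L powr s\<bar> \<le> \<Lambda> * (5 * ?w)" unfolding abs_mult using l b by (intro mult_mono) auto
  have t2: "\<bar>s * ?L powr (s - 1)\<bar> \<le> 1 * 4" unfolding abs_mult using s b by (intro mult_mono) auto
  have m: "\<bar>\<nu> * ?L powr s - s * ?L powr (s - 1)\<bar> \<le> (5 * \<Lambda> + 4) * ?w"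
  proof -
    have "\<bar>\<nu> * ?L powr s - s * ?L powr (s - 1)\<bar> \<le> \<Lambda> * (5 * ?w) + 4" using t1 t2 by linarith
    also have "\<dots> \<le> \<Lambda> * (5 * ?w) + 4 * ?w" using b(5) by simp
    finally show ?thesis by (simp add: algebra_simps)
  qed
  have "\<bar>power_log1 s \<nu> r\<bar> \<le> r powr (-1) * ((5 * \<Lambda> + 4) * ?w)"
    unfolding power_log1_def abs_mult[of "r powr (\<nu> - 1)"] using rl[of 1] m l by (intro mult_mono) auto
  also have "\<dots> \<le> r powr (-1) * (log_profile_const \<Lambda> * ?w)" using K by (intro mult_left_mono mult_right_mono) auto
  finally show "\<bar>power_log1 s \<nu> r\<bar> \<le> log_profile_const \<Lambda> * r powr (-5/4)" unfolding we by (simp add: mult_ac)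
  have u1: "\<bar>(\<nu> - 1) * (\<nu> * ?L powr s - s * ?L powr (s - 1))\<bar> \<le> (\<Lambda> + 1) * ((5 * \<Lambda> + 4) * ?w)"
    unfolding abs_mult[of "\<nu> - 1"] using m l by (intro mult_mono) auto
  have u2: "\<bar>\<nu> * (s * ?L powr (s - 1))\<bar> \<le> \<Lambda> * (1 * 4)"
    unfolding abs_mult[of \<nu>] using l t2 by (intro mult_mono) auto
  have "\<bar>s * (s - 1)\<bar> \<le> 1 * 1" unfolding abs_mult using s by (intro mult_mono) auto
  then have u3: "\<bar>s * (s - 1) * ?L powr (s - 2)\<bar> \<le> 1 * 16"
    unfolding abs_mult[of "s * (s - 1)"] using b by (intro mult_mono) auto
  have "\<bar>(\<nu> - 1) * (\<nu> * ?L powr s - s * ?L powr (s - 1)) - \<nu> * s * ?L powr (s - 1) + s * (s - 1) * ?L powr (s - 2)\<bar>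
     \<le> (\<Lambda> + 1) * ((5 * \<Lambda> + 4) * ?w) + 4 * \<Lambda> + 16"
    using u1 u2 u3 unfolding mult.assoc[of \<nu> s] by linarith
  also have "\<dots> \<le> (\<Lambda> + 1) * ((5 * \<Lambda> + 4) * ?w) + 4 * \<Lambda> * ?w + 16 * ?w"
    using b(5) l mult_left_mono[OF b(5), of "4 * \<Lambda>"] by simp
  also have "\<dots> = ((\<Lambda> + 1) * (5 * \<Lambda> + 4) + 4 * \<Lambda> + 16) * ?w" by (simp add: algebra_simps)
  also have "\<dots> \<le> log_profile_const \<Lambda> * ?w" using K by (intro mult_right_mono) auto
  finally have "\<bar>power_log2 s \<nu> r\<bar> \<le> r powr (-2) * (log_profile_const \<Lambda> * ?w)"
    unfolding power_log2_def abs_mult[of "r powr (\<nu> - 2)"] using rl[of 2] K by (intro mult_mono) auto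
  then show "\<bar>power_log2 s \<nu> r\<bar> \<le> log_profile_const \<Lambda> * r powr (-9/4)" unfolding we by (simp add: mult_ac)
qed

lemma log_profile_smooth_profile:
  assumes c: "cutoff_profile B p p' p''" and s: "0 < s" "s < 1" and l: "0 \<le> \<nu>" "\<nu> \<le> \<Lambda>"
  shows "smooth_profile (log_profile_const \<Lambda> * (1 + 3 * B)) 1 (log_profile s p \<nu>) (log_profile1 s p p' \<nu>) (log_profile2 s p p' p'' \<nu>)"
proof -
  have B: "0 \<le> B" and cp: "continuous_on UNIV p'" "continuous_on UNIV p''"
    and dp: "\<And>r. (p has_real_derivative p' r) (at r)" "\<And>r. (p' has_real_derivative p'' r) (at r)"
    and bp: "\<And>r. 0 \<le> p r" "\<And>r. p r \<le> 1" "\<And>r. \<bar>p' r\<bar> \<le> B" "\<And>r. \<bar>p'' r\<bar> \<le> B"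
    and zp: "\<And>r. 3/4 < r \<Longrightarrow> p r = 0" "\<And>r. 3/4 < r \<Longrightarrow> p' r = 0" "\<And>r. 3/4 < r \<Longrightarrow> p'' r = 0"
    using c by (auto simp: cutoff_profile_def)
  let ?K = "log_profile_const \<Lambda>"
  have K: "0 \<le> ?K" using l by (simp add: log_profile_const_def)
  have zero: "log_profile s p \<nu> r = 0" "log_profile1 s p p' \<nu> r = 0" "log_profile2 s p p' p'' \<nu> r = 0" if "3/4 < r" for r
    using zp[OF that] by (simp_all add: log_profile_def log_profile1_def log_profile2_def)
  have d1: "(log_profile s p \<nu> has_real_derivative log_profile1 s p p' \<nu> r) (at r)" if r: "0 < r" for r
  proof (cases "r < 1")
    case True
    show ?thesis using DERIV_mult[OF power_log_deriv(1)[OF r True, of s \<nu>] dp(1)] True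
      by (simp add: log_profile_def[abs_def] log_profile1_def mult.commute)
  next
    case False
    have "((\<lambda>r. 0) has_real_derivative 0) (at r)" by simp
    then show ?thesis
      using has_field_derivative_transform_within_open[of "\<lambda>r. 0" 0 r "{3/4<..}" "log_profile s p \<nu>"] False zero by simp
  qed
  have d2: "(log_profile1 s p p' \<nu> has_real_derivative log_profile2 s p p' p'' \<nu> r) (at r)" if r: "0 < r" for r
  proof (cases "r < 1")
    case True
    have "((\<lambda>r. power_log1 s \<nu> r * p r + power_log s \<nu> r * p' r) has_real_derivative log_profile2 s p p' p'' \<nu> r) (at r)"
      using DERIV_add[OF DERIV_mult[OF power_log_deriv(2)[OF r True, of s \<nu>] dp(1)] DERIV_mult[OF power_log_deriv(1)[OF r True, of s \<nu>] dp(2)]] True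
      by (simp add: log_profile2_def algebra_simps)
    then show ?thesis
      by (rule has_field_derivative_transform_within_open[where S = "{..<1}"]) (use True in \<open>auto simp: log_profile1_def\<close>)
  next
    case False
    have "((\<lambda>r. 0) has_real_derivative 0) (at r)" by simp
    then show ?thesis
      using has_field_derivative_transform_within_open[of "\<lambda>r. 0" 0 r "{3/4<..}" "log_profile1 s p p' \<nu>"] False zero by simp
  qed
  have c1: "continuous_on {0<..} (log_profile1 s p p' \<nu>)"
    by (auto intro!: continuous_at_imp_continuous_on DERIV_isCont d2)
  have c2: "continuous_on {0<..} (log_profile2 s p p' p'' \<nu>)"
  proof -
    have cpp: "continuous_on {0<..<1} p" by (auto intro!: continuous_at_imp_continuous_on DERIV_isCont dp)
    have "continuous_on {0<..<1} (\<lambda>r. power_log2 s \<nu> r * p r + 2 * (power_log1 s \<nu> r * p' r) + power_log s \<nu> r * p'' r)"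
      by (intro continuous_intros power_log_continuous cpp continuous_on_subset[OF cp(1)] continuous_on_subset[OF cp(2)]) auto
    then have 1: "continuous_on {0<..<1} (log_profile2 s p p' p'' \<nu>)"
      by (rule continuous_on_eq) (simp add: log_profile2_def)
    have 2: "continuous_on {3/4<..} (log_profile2 s p p' p'' \<nu>)"
      by (rule continuous_on_eq[of _ "\<lambda>r. 0"]) (auto simp: zero)
    have "continuous_on ({0<..<1} \<union> {3/4<..}) (log_profile2 s p p' p'' \<nu>)"
      by (rule continuous_on_open_Un[OF _ _ 1 2]) auto
    then show ?thesis by (rule continuous_on_subset) auto
  qed
  have b: "\<bar>log_profile s p \<nu> r\<bar> \<le> ?K * (1 + 3 * B) * r powr (-1/4)"
    "\<bar>log_profile1 s p p' \<nu> r\<bar> \<le> ?K * (1 + 3 * B) * r powr (-5/4)"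
    "\<bar>log_profile2 s p p' p'' \<nu> r\<bar> \<le> ?K * (1 + 3 * B) * r powr (-9/4)" if r: "0 < r" for r
  proof -
    have "\<bar>log_profile s p \<nu> r\<bar> \<le> ?K * (1 + 3 * B) * r powr (-1/4) \<and>
    \<bar>log_profile1 s p p' \<nu> r\<bar> \<le> ?K * (1 + 3 * B) * r powr (-5/4) \<and>
    \<bar>log_profile2 s p p' p'' \<nu> r\<bar> \<le> ?K * (1 + 3 * B) * r powr (-9/4)"
    proof (cases "r \<le> 3/4")
      case True
      note e = power_log_bounds[OF r True s l]
      define w where "w = ?K * r powr (-1/4)"
      define w1 where "w1 = ?K * r powr (-5/4)"
      define w2 where "w2 = ?K * r powr (-9/4)"
      have w: "0 \<le> w" "w \<le> w1" "w1 \<le> w2"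
        unfolding w_def w1_def w2_def using K r True by (auto intro!: mult_left_mono powr_mono')
      have e': "\<bar>power_log s \<nu> r\<bar> \<le> w" "\<bar>power_log1 s \<nu> r\<bar> \<le> w1" "\<bar>power_log2 s \<nu> r\<bar> \<le> w2"
        using e by (simp_all add: w_def w1_def w2_def)
      have p1: "\<bar>p r\<bar> \<le> 1" using bp(1,2)[of r] by simp
      have m: "\<bar>power_log s \<nu> r * p r\<bar> \<le> w * 1" "\<bar>power_log1 s \<nu> r * p r\<bar> \<le> w1 * 1" "\<bar>power_log2 s \<nu> r * p r\<bar> \<le> w2 * 1"
        "\<bar>power_log s \<nu> r * p' r\<bar> \<le> w * B" "\<bar>power_log1 s \<nu> r * p' r\<bar> \<le> w1 * B" "\<bar>power_log s \<nu> r * p'' r\<bar> \<le> w * B"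
        unfolding abs_mult using e' p1 bp(3,4)[of r] w B by (intro mult_mono; linarith)+
      have wB: "w * B \<le> w1 * B" "w1 * B \<le> w2 * B" "0 \<le> w * B" using w B by (auto intro!: mult_right_mono)
      have "\<bar>log_profile s p \<nu> r\<bar> \<le> w + 3 * (w * B)" using m wB by (simp add: log_profile_def)
      moreover have "\<bar>log_profile1 s p p' \<nu> r\<bar> \<le> w1 + 3 * (w1 * B)" using m wB True by (simp add: log_profile1_def)
      moreover have "\<bar>log_profile2 s p p' p'' \<nu> r\<bar> \<le> w2 + 3 * (w2 * B)" using m wB True by (simp add: log_profile2_def)
      ultimately show ?thesis by (simp add: w_def w1_def w2_def algebra_simps)
    qed (use zero K B in auto)
    then show "\<bar>log_profile s p \<nu> r\<bar> \<le> ?K * (1 + 3 * B) * r powr (-1/4)"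
    "\<bar>log_profile1 s p p' \<nu> r\<bar> \<le> ?K * (1 + 3 * B) * r powr (-5/4)"
    "\<bar>log_profile2 s p p' p'' \<nu> r\<bar> \<le> ?K * (1 + 3 * B) * r powr (-9/4)" by blast+
  qed
  show ?thesis unfolding smooth_profile_def profile_def
    using c1 c2 d1 d2 b zero by auto
qed

lemma cutoff_profile_mono: "cutoff_profile B p p' p'' \<Longrightarrow> B \<le> B' \<Longrightarrow> cutoff_profile B' p p' p''"
  unfolding cutoff_profile_def by (meson order_trans)

lemma powr_exp_le: "0 \<le> x \<Longrightarrow> 0 \<le> s \<Longrightarrow> s \<le> 1 \<Longrightarrow> x powr s * exp (- x) \<le> (1::real)"
proof -
  assume "0 \<le> x" "0 \<le> s" "s \<le> 1"
  then have "x powr s \<le> 1 + x" by (rule powr_le_linear)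
  also have "\<dots> \<le> exp x" by (rule exp_ge_add_one_self)
  finally have "x powr s * exp (- x) \<le> exp x * exp (- x)" by (rule mult_right_mono) simp
  then show ?thesis by (simp add: exp_minus)
qed

lemma one_minus_exp_le: "0 \<le> x \<Longrightarrow> 0 \<le> a \<Longrightarrow> a \<le> 1 \<Longrightarrow> 1 - exp (- x) \<le> (x::real) powr a"
proof -
  assume x: "0 \<le> x" and a: "0 \<le> a" "a \<le> 1"
  show ?thesis
  proof (cases "x \<le> 1")
    case True
    have "1 - exp (- x) \<le> x" using exp_ge_add_one_self[of "- x"] by simp
    also have "x = x powr 1" using x by simp
    also have "\<dots> \<le> x powr a" using x a True by (intro powr_mono') auto
    finally show ?thesis .
  next
    case False
    have "1 - exp (- x) \<le> 1 powr a" by simp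
    also have "\<dots> \<le> x powr a" using False a by (intro powr_mono2) auto
    finally show ?thesis .
  qed
qed

lemma r_power_log1:
  assumes "0 < r" shows "r * power_log1 s \<nu> r = exp (- (\<nu> * (- ln r))) * (\<nu> * (- ln r) powr s - s * (- ln r) powr (s - 1))"
proof -
  have "r * r powr (\<nu> - 1) = r powr \<nu>" using assms by (simp add: powr_diff)
  also have "\<dots> = exp (- (\<nu> * (- ln r)))" using assms by (simp add: powr_def)
  finally have "r * r powr (\<nu> - 1) = exp (- (\<nu> * (- ln r)))" .
  then show ?thesis unfolding power_log1_def by (simp only: mult.assoc[symmetric])
qed

text \<open>Writing \<open>\<nu> L powr s\<close> as \<open>\<nu> powr (1 - s) * (\<nu> L) powr s\<close> makes the exponential absorb the growth in \<open>L\<close>.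
  This is where the power \<open>r powr \<nu>\<close> tames the logarithm.\<close>

lemma log_term_bound:
  fixes L \<nu> s :: real
  assumes L: "0 < L" and s: "0 < s" "s < 1" and \<nu>: "0 \<le> \<nu>"
  shows "\<bar>exp (- (\<nu> * L)) * (\<nu> * L powr s)\<bar> \<le> \<nu> powr (1 - s)"
proof (cases "\<nu> = 0")
  case False
  then have "\<nu> = \<nu> powr (1 - s) * \<nu> powr s" using \<nu> by (simp add: powr_add[symmetric])
  then have "exp (- (\<nu> * L)) * (\<nu> * L powr s) = \<nu> powr (1 - s) * ((\<nu> * L) powr s * exp (- (\<nu> * L)))"
    using L \<nu> by (simp add: powr_mult mult_ac)
  also have "\<dots> \<le> \<nu> powr (1 - s) * 1"
    using L \<nu> s by (intro mult_left_mono powr_exp_le) auto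
  finally show ?thesis using L \<nu> by simp
qed simp

lemma cutoff_profileD:
  assumes "cutoff_profile B p p' p''"
  shows "0 \<le> B" "0 \<le> p r" "p r \<le> 1" "\<bar>p' r\<bar> \<le> B" "3/4 < r \<Longrightarrow> p r = 0" "3/4 < r \<Longrightarrow> p' r = 0"
    "\<bar>r\<bar> < 1/2 \<Longrightarrow> p r = 1" "\<bar>r\<bar> < 1/2 \<Longrightarrow> p' r = 0"
  using assms by (auto simp: cutoff_profile_def)

lemma ln_half_bound: "1/2 \<le> r \<Longrightarrow> - ln r \<le> (1::real)"
proof -
  assume r: "1/2 \<le> r"
  have "ln (1 / r) \<le> 1 / r - 1" using r by (intro ln_le_minus_one) auto
  also have "\<dots> \<le> 1" using r by (simp add: field_simps)
  finally show ?thesis using r by (simp add: ln_div)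
qed

text \<open>The profile itself grows like \<open>\<nu> powr (- s)\<close>, but its logarithmic derivative is bounded uniformly in
  \<open>\<nu>\<close>: one term is controlled by the exponential, another carries the decaying factor
  \<open>(- ln r) powr (s - 1)\<close>, and the derivative of the cut-off acts only where \<open>r \<ge> 1/2\<close>.\<close>

lemma log_profile_slope:
  assumes c: "cutoff_profile B p p' p''" and s: "0 < s" "s < 1" and \<nu>: "0 \<le> \<nu>" "\<nu> \<le> \<Lambda>" and r: "0 < r"
  shows "\<bar>r * log_profile1 s p p' \<nu> r\<bar> \<le> \<Lambda> powr (1 - s) + 4 + B"
proof (cases "r \<le> 3/4")
  case True
  let ?L = "- ln r"
  note b = ln_bounds[OF r True s]
  note cc = cutoff_profileD[OF c]
  have L: "0 < ?L" using b(1) by linarith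
  have "0 \<le> \<nu> * ?L" using \<nu> L by (intro mult_nonneg_nonneg) auto
  then have E: "exp (- (\<nu> * ?L)) \<le> 1" "0 \<le> exp (- (\<nu> * ?L))" by simp_all
  have "\<bar>exp (- (\<nu> * ?L)) * (s * ?L powr (s - 1))\<bar> \<le> 1 * (1 * 4)"
    unfolding abs_mult using E s b by (intro mult_mono) auto
  moreover have "\<nu> powr (1 - s) \<le> \<Lambda> powr (1 - s)" using \<nu> s by (intro powr_mono2) auto
  ultimately have "\<bar>r * power_log1 s \<nu> r\<bar> \<le> \<Lambda> powr (1 - s) + 4"
    unfolding r_power_log1[OF r] right_diff_distrib using log_term_bound[OF L s \<nu>(1)] by linarith
  then have 1: "\<bar>r * power_log1 s \<nu> r * p r\<bar> \<le> (\<Lambda> powr (1 - s) + 4) * 1"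
    unfolding abs_mult[of "r * power_log1 s \<nu> r"] using cc(2,3)[of r] by (intro mult_mono) auto
  have 2: "\<bar>r * power_log s \<nu> r * p' r\<bar> \<le> B"
  proof (cases "r < 1/2")
    case False
    then have L1: "?L \<le> 1" by (intro ln_half_bound) simp
    have "?L powr s \<le> 1 powr s" using L L1 s by (intro powr_mono2) auto
    moreover have "r powr \<nu> \<le> 1 powr \<nu>" using r True \<nu> by (intro powr_mono2) auto
    ultimately have "\<bar>r * (r powr \<nu> * ?L powr s) * p' r\<bar> \<le> 1 * (1 * 1) * B"
      unfolding abs_mult using r True cc(1) cc(4)[of r] by (intro mult_mono) auto
    then show ?thesis by (simp add: power_log_def)
  qed (use cc(1) cc(8)[of r] r in auto)
  have "r * log_profile1 s p p' \<nu> r = r * power_log1 s \<nu> r * p r + r * power_log s \<nu> r * p' r"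
    using True by (simp add: log_profile1_def algebra_simps)
  moreover have "\<bar>u\<bar> \<le> K + B" if "u = v + w" "\<bar>v\<bar> \<le> K * 1" "\<bar>w\<bar> \<le> B" for u v w K B :: real
    using that by linarith
  ultimately show ?thesis using 1 2 by blast
next
  case False
  then show ?thesis using cutoff_profileD(5,6)[OF c, of r] cutoff_profileD(1)[OF c] by (simp add: log_profile1_def)
qed

text \<open>The profile for \<open>\<nu> = 0\<close> is \<open>(- ln r) powr s\<close> times the cut-off. It is approached as \<open>\<nu> \<rightarrow> 0\<close> uniformly
  in the logarithmic derivative, though not in size.\<close>

lemma log_profile_slope_diff:
  assumes c: "cutoff_profile B p p' p''" and s: "0 < s" "s < 1" and \<nu>: "0 < \<nu>" and r: "0 < r"
  shows "\<bar>r * (log_profile1 s p p' \<nu> r - log_profile1 s p p' 0 r)\<bar> \<le> 2 * \<nu> powr (1 - s) + B * \<nu>"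
proof (cases "r \<le> 3/4")
  case True
  let ?L = "- ln r" and ?E = "exp (- (\<nu> * (- ln r)))"
  note b = ln_bounds[OF r True s]
  note cc = cutoff_profileD[OF c]
  have L: "0 < ?L" using b(1) by linarith
  have x: "0 \<le> \<nu> * ?L" using L \<nu> by (intro mult_nonneg_nonneg) auto
  have E: "?E \<le> 1" "0 \<le> ?E" using x by simp_all
  have "r * power_log1 s \<nu> r - r * power_log1 s 0 r = ?E * (\<nu> * ?L powr s) + s * ((1 - ?E) * ?L powr (s - 1))"
    unfolding r_power_log1[OF r] by (simp add: algebra_simps)
  moreover have "\<bar>s * ((1 - ?E) * ?L powr (s - 1))\<bar> \<le> 1 * \<nu> powr (1 - s)"
  proof -
    have "(1 - ?E) * ?L powr (s - 1) \<le> (\<nu> * ?L) powr (1 - s) * ?L powr (s - 1)"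
      using x s by (intro mult_right_mono one_minus_exp_le) auto
    also have "\<dots> = \<nu> powr (1 - s) * (?L powr (1 - s) * ?L powr (s - 1))"
      by (simp only: powr_mult mult.assoc)
    also have "?L powr (1 - s) * ?L powr (s - 1) = 1" using L by (simp add: powr_add[symmetric])
    finally have "\<bar>(1 - ?E) * ?L powr (s - 1)\<bar> \<le> \<nu> powr (1 - s)" using E by (simp add: abs_mult)
    then show ?thesis unfolding abs_mult[of s] using s by (intro mult_mono) auto
  qed
  ultimately have "\<bar>r * power_log1 s \<nu> r - r * power_log1 s 0 r\<bar> \<le> 2 * \<nu> powr (1 - s)"
    using log_term_bound[OF L s less_imp_le[OF \<nu>]] by linarith
  then have 1: "\<bar>(r * power_log1 s \<nu> r - r * power_log1 s 0 r) * p r\<bar> \<le> (2 * \<nu> powr (1 - s)) * 1"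
    unfolding abs_mult[of "r * power_log1 s \<nu> r - r * power_log1 s 0 r"] using cc(2,3)[of r] by (intro mult_mono) auto
  have 2: "\<bar>r * (power_log s \<nu> r - power_log s 0 r) * p' r\<bar> \<le> B * \<nu>"
  proof (cases "r < 1/2")
    case False
    then have L1: "?L \<le> 1" by (intro ln_half_bound) simp
    have "?L powr s \<le> 1 powr s" using L L1 s by (intro powr_mono2) auto
    moreover have "1 - ?E \<le> \<nu> * ?L" using exp_ge_add_one_self[of "- (\<nu> * ?L)"] by linarith
    then have "1 - ?E \<le> \<nu>" using mult_left_mono[OF L1, of \<nu>] \<nu> by linarith
    ultimately have "\<bar>r * (- (1 - ?E) * ?L powr s) * p' r\<bar> \<le> 1 * (\<nu> * 1) * B"
      unfolding abs_mult using r True cc(1) cc(4)[of r] E \<nu> by (intro mult_mono) auto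
    moreover have "power_log s \<nu> r - power_log s 0 r = - (1 - ?E) * ?L powr s"
      using r by (simp add: power_log_def powr_def algebra_simps)
    ultimately show ?thesis by (simp add: mult.commute)
  qed (use cc(1) cc(8)[of r] r \<nu> in auto)
  have "r * (log_profile1 s p p' \<nu> r - log_profile1 s p p' 0 r) = (r * power_log1 s \<nu> r - r * power_log1 s 0 r) * p r + r * (power_log s \<nu> r - power_log s 0 r) * p' r"
    using True by (simp add: log_profile1_def algebra_simps)
  moreover have "\<bar>u\<bar> \<le> K + B" if "u = v + w" "\<bar>v\<bar> \<le> K * 1" "\<bar>w\<bar> \<le> B" for u v w K B :: real
    using that by linarith
  ultimately show ?thesis using 1 2 by blast
next
  case False
  then show ?thesis using cutoff_profileD(5,6)[OF c, of r] cutoff_profileD(1)[OF c] \<nu> by (simp add: log_profile1_def)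
qed

text \<open>At radii of order \<open>exp (- \<Lambda> / \<nu>)\<close> the power \<open>r powr \<nu>\<close> is still bounded below, while the
  logarithm has grown to the order \<open>1 / \<nu>\<close>.\<close>

lemma log_profile_peak:
  assumes c: "cutoff_profile B p p' p''" and s: "0 < s" and \<nu>: "0 < \<nu>" "\<nu> \<le> \<Lambda>"
    and r: "exp (- (2 * \<Lambda> / \<nu>)) \<le> r" "r < exp (- (\<Lambda> / \<nu>))"
  shows "exp (- 2 * \<Lambda>) * \<Lambda> powr s * \<nu> powr (- s) \<le> log_profile s p \<nu> r"
proof -
  have r0: "0 < r" using r(1) exp_gt_zero less_le_trans by blast
  have L: "\<Lambda> / \<nu> \<le> - ln r" "- ln r \<le> 2 * \<Lambda> / \<nu>"
  proof -
    have "ln r \<le> ln (exp (- (\<Lambda> / \<nu>)))" using r r0 by (intro ln_mono) auto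
    then show "\<Lambda> / \<nu> \<le> - ln r" by simp
    have "ln (exp (- (2 * \<Lambda> / \<nu>))) \<le> ln r" using r r0 by (intro ln_mono) auto
    then show "- ln r \<le> 2 * \<Lambda> / \<nu>" by simp
  qed
  have "1 \<le> \<Lambda> / \<nu>" using \<nu> by simp
  then have "exp (- (\<Lambda> / \<nu>)) \<le> exp (- 1)" by simp
  with r(2) have "r < exp (- 1)" by linarith
  also have "exp (- 1) < (1/2 :: real)"
  proof -
    have "2 < exp (1::real)" using exp_lower_Taylor_quadratic[of "1::real"] by simp
    then have "inverse (exp (1::real)) < inverse 2" by (intro less_imp_inverse_less) auto
    then show ?thesis by (simp add: exp_minus)
  qed
  finally have p: "p r = 1" using r0 by (intro cutoff_profileD(7)[OF c]) auto
  have "\<nu> * (- ln r) \<le> 2 * \<Lambda>" using L(2) \<nu> by (simp add: le_divide_eq mult.commute)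
  then have "exp (- 2 * \<Lambda>) \<le> r powr \<nu>" using r0 by (simp add: powr_def)
  moreover have "(\<Lambda> / \<nu>) powr s \<le> (- ln r) powr s" using L \<nu> s by (intro powr_mono2) auto
  ultimately have "exp (- 2 * \<Lambda>) * (\<Lambda> / \<nu>) powr s \<le> r powr \<nu> * (- ln r) powr s"
    by (intro mult_mono) auto
  moreover have "(\<Lambda> / \<nu>) powr s = \<Lambda> powr s * \<nu> powr (- s)" by (simp add: powr_divide powr_minus inverse_eq_divide)
  ultimately show ?thesis by (simp add: log_profile_def power_log_def p mult.assoc)
qed

text \<open>A lower bound for \<open>3 \<integral> \<rho>\<^sup>2 q d\<rho>\<close> over \<open>[1/4, 2/5]\<close>, an interval of length \<open>3/20\<close> on which the cut-off
  equals \<open>1\<close>.\<close>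

definition log_profile_mean :: "real \<Rightarrow> real" where
  "log_profile_mean \<Lambda> = 3 * (3/20 * (1/32 * (1/4) powr \<Lambda>))"

lemma log_profile_mean_lower:
  assumes c: "cutoff_profile B p p' p''" and s: "0 < s" "s < 1" and \<nu>: "0 \<le> \<nu>" "\<nu> \<le> \<Lambda>"
  shows "log_profile_mean \<Lambda> \<le> mean (log_profile s p \<nu>) 1"
proof -
  have pr: "profile (log_profile_const \<Lambda> * (1 + 3 * B)) 1 (log_profile s p \<nu>) (log_profile1 s p p' \<nu>)"
    using log_profile_smooth_profile[OF c s \<nu>] by (simp add: smooth_profile_def)
  let ?f = "\<lambda>\<rho>. \<rho>\<^sup>2 * log_profile s p \<nu> \<rho>" and ?K = "1/32 * (1/4) powr \<Lambda> :: real"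
  have nonneg: "0 \<le> ?f \<rho>" for \<rho> using cutoff_profileD(2)[OF c, of \<rho>] by (simp add: log_profile_def power_log_def)
  have lower: "?K \<le> ?f \<rho>" if \<rho>: "\<rho> \<in> {1/4..2/5}" for \<rho>
  proof -
    have r0: "0 < \<rho>" using \<rho> by auto
    have L: "1/2 \<le> - ln \<rho>" using ln_le_minus_one[OF r0] \<rho> by auto
    have "(1/2) powr 1 \<le> (1/2 :: real) powr s" using s by (intro powr_mono') auto
    also have "\<dots> \<le> (- ln \<rho>) powr s" using L s by (intro powr_mono2) auto
    finally have 1: "1/2 \<le> (- ln \<rho>) powr s" by simp
    have "(1/4) powr \<Lambda> \<le> (1/4 :: real) powr \<nu>" using \<nu> by (intro powr_mono') auto
    also have "\<dots> \<le> \<rho> powr \<nu>" using \<rho> \<nu> by (intro powr_mono2) auto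
    finally have 2: "(1/4) powr \<Lambda> \<le> \<rho> powr \<nu>" .
    have 3: "(1/4)\<^sup>2 \<le> \<rho>\<^sup>2" using \<rho> by (intro power_mono) auto
    have "(1/4)\<^sup>2 * ((1/4) powr \<Lambda> * (1/2)) \<le> \<rho>\<^sup>2 * (\<rho> powr \<nu> * (- ln \<rho>) powr s)"
      using 1 2 3 by (intro mult_mono) auto
    moreover have "p \<rho> = 1" using \<rho> by (intro cutoff_profileD(7)[OF c]) auto
    ultimately show ?thesis by (simp add: log_profile_def power_log_def power2_eq_square)
  qed
  note i = profile_weighted_integrable[OF pr, of 1]
  have sub: "?f integrable_on {1/4..2/5}" by (rule integrable_on_subinterval[OF i]) auto
  have "3/20 * ?K = integral {1/4..2/5::real} (\<lambda>\<rho>. ?K)" by simp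
  also have "\<dots> \<le> integral {1/4..2/5} ?f" by (rule integral_le) (use sub lower in auto)
  also have "\<dots> \<le> integral {0..1} ?f" by (rule integral_subset_le) (use sub i nonneg in auto)
  finally show ?thesis by (simp add: log_profile_mean_def mean_def)
qed

section \<open>A test function for the gradient\<close>

lemma test_function_integral_pos:
  assumes t: "test_function \<psi>" and nn: "\<And>x. 0 \<le> \<psi> x" and one: "\<And>x. x \<in> ball c r \<Longrightarrow> \<psi> x = 1" and r: "0 < r"
  shows "0 < (LINT x|lborel. \<psi> x)" "0 < (LINT x|lborel. (\<psi> x)\<^sup>2)"
proof -
  have s: "smooth \<psi>" using t by (simp add: test_function_def)
  note c\<psi> = smooth_regular(1)[OF s]
  obtain R B where RB': "\<And>x. R \<le> norm x \<Longrightarrow> \<psi> x = 0"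
    "\<And>x. R \<le> norm x \<Longrightarrow> frechet_derivative \<psi> (at x) (axis 1 1) = 0"
    "\<And>x. \<bar>\<psi> x\<bar> \<le> B" "\<And>x. \<bar>frechet_derivative \<psi> (at x) (axis 1 1)\<bar> \<le> B"
    by (rule test_function_bounds[OF t, where j = 1]) blast
  have pos: "0 < (LINT x|lborel. g x)"
    if g: "continuous_on UNIV g" "\<And>x. R \<le> norm x \<Longrightarrow> g x = 0" "\<And>x. \<bar>g x\<bar> \<le> B'" "\<And>x. 0 \<le> g x" "\<And>x. x \<in> ball c r \<Longrightarrow> g x = 1"
    for g :: "space \<Rightarrow> real" and B'
  proof -
    have "integrable lborel (\<lambda>x. 1 * g x)" by (rule power_bounded_times_bounded_integrable[OF power_bounded_one _ _ g(1-3)]) auto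
    then have i: "integrable lborel g" by simp
    have "0 < measure lborel (ball c r)" using r by (simp add: measure_ball3)
    also have "\<dots> = (LINT x|lborel. indicator (ball c r) x)" by simp
    also have "\<dots> \<le> (LINT x|lborel. g x)"
      using r g(4,5) by (intro integral_mono i integrable_real_indicator) (auto simp: emeasure_ball3 indicator_def)
    finally show ?thesis .
  qed
  show "0 < (LINT x|lborel. \<psi> x)" by (rule pos[OF c\<psi> RB'(1,3) nn one])
  show "0 < (LINT x|lborel. (\<psi> x)\<^sup>2)"
  proof (rule pos[where B' = "B\<^sup>2"])
    show "continuous_on UNIV (\<lambda>x. (\<psi> x)\<^sup>2)" by (intro continuous_intros c\<psi>)
    show "\<bar>(\<psi> x)\<^sup>2\<bar> \<le> B\<^sup>2" for x using power_mono[OF RB'(3)[of x], of 2] by simp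
  qed (use RB'(1) one in auto)
qed

text \<open>A translate of the given cut-off function.\<close>

lemma probe_test_function:
  assumes f: "cutoff f" and one: "\<And>x. x \<in> ball 0 (1/2) \<Longrightarrow> f x = 1" and zero: "\<And>x. x \<notin> ball 0 (3/4) \<Longrightarrow> f x = 0"
  obtains \<psi> where "test_function \<psi>" "\<And>x. 0 \<le> \<psi> x" "\<And>x. \<psi> x \<noteq> 0 \<Longrightarrow> x \<in> probe"
    "0 < (LINT x|lborel. \<psi> x)" "0 < (LINT x|lborel. (\<psi> x)\<^sup>2)"
proof -
  \<comment> \<open>The ball of radius \<open>3/4\<close> around this point lies in the probe region.\<close>
  define a :: space where "a = vector [6, 1, 1]"
  have a: "a $ 1 = 6" "a $ 2 = 1" "a $ 3 = 1" by (simp_all add: a_def)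
  define \<psi> where "\<psi> x = f (1 *\<^sub>R x + (- a))" for x
  have "bounded {x. f x \<noteq> 0}"
    by (rule bounded_subset[OF bounded_ball[of 0 "3/4"]]) (use zero in blast)
  then have "test_function f" using f by (simp add: test_function_def cutoff_def compact_closure)
  then have t: "test_function \<psi>" unfolding \<psi>_def[abs_def] by (rule test_function_affine) simp
  have nn: "0 \<le> \<psi> x" for x using f by (simp add: \<psi>_def cutoff_def)
  have sup: "x \<in> probe" if "\<psi> x \<noteq> 0" for x
  proof -
    have d: "norm (x - a) < 3/4" using that zero[of "x - a"] by (auto simp: \<psi>_def)
    have c: "\<bar>x $ i - a $ i\<bar> < 3/4" for i
      using component_le_norm_cart[of "x - a" i] d by simp
    have "norm x \<le> (\<Sum>i\<in>UNIV. \<bar>x $ i\<bar>)" by (rule norm_le_l1_cart)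
    also have "\<dots> \<le> 11" using c[of 1] c[of 2] c[of 3] unfolding a sum_3 by linarith
    finally show ?thesis using c[of 1] c[of 2] c[of 3] unfolding probe_def a abs_less_iff by auto
  qed
  have one': "\<psi> x = 1" if "x \<in> ball a (1/2)" for x
    using that by (auto simp: \<psi>_def dist_norm norm_minus_commute intro!: one)
  show ?thesis
  proof (rule that[OF t nn])
    show "x \<in> probe" if "\<psi> x \<noteq> 0" for x using sup that .
    show "0 < (LINT x|lborel. \<psi> x)" by (rule test_function_integral_pos(1)[where c = a and r = "1/2", OF t nn one']) simp_all
    show "0 < (LINT x|lborel. (\<psi> x)\<^sup>2)" by (rule test_function_integral_pos(2)[where c = a and r = "1/2", OF t nn one']) simp_all
  qed
qed

section \<open>The family of fields\<close>

text \<open>One bound serves all three components.\<close>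

lemma cutoff_profile_family:
  fixes \<phi> :: "space \<Rightarrow> space"
  assumes "\<And>j. cutoff (\<lambda>x. \<phi> x $ j)"
    "\<And>j x. x \<in> ball 0 (1/2) \<Longrightarrow> \<phi> x $ j = 1" "\<And>j x. x \<notin> ball 0 (3/4) \<Longrightarrow> \<phi> x $ j = 0"
  obtains B p' p'' where "\<And>j. cutoff_profile B (\<lambda>r. \<phi> (r *\<^sub>R axis 1 1) $ j) (p' j) (p'' j)"
proof -
  have "\<forall>j. \<exists>B p' p''. cutoff_profile B (\<lambda>r. \<phi> (r *\<^sub>R axis 1 1) $ j) p' p''"
    using cutoff_profile_of_cutoff[OF assms] by blast
  then obtain B p' p'' where c: "\<And>j. cutoff_profile (B j) (\<lambda>r. \<phi> (r *\<^sub>R axis 1 1) $ j) (p' j) (p'' j)"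
    by metis
  have "B j \<le> (\<Sum>j\<in>UNIV. B j)" for j
    using cutoff_profileD(1)[OF c] by (intro member_le_sum) auto
  then show ?thesis using that[of "\<Sum>j\<in>UNIV. B j" p' p''] cutoff_profile_mono[OF c] by blast
qed

text \<open>Subtraction of extended reals truncates at zero, hence the two one-sided inequalities.\<close>

lemma tendsto_ennreal_of_abs_diff:
  fixes a :: "'a \<Rightarrow> ennreal"
  assumes fin: "l < \<infinity>" and e: "(e \<longlongrightarrow> 0) F"
    and 1: "\<forall>\<^sub>F t in F. a t \<le> l + ennreal (e t)" and 2: "\<forall>\<^sub>F t in F. l \<le> a t + ennreal (e t)" and e0: "\<forall>\<^sub>F t in F. 0 \<le> e t"
  shows "(a \<longlongrightarrow> l) F"
proof -
  have l: "l = ennreal (enn2real l)" using fin by (simp add: ennreal_enn2real)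
  have ev: "\<forall>\<^sub>F t in F. a t = ennreal (enn2real (a t)) \<and> \<bar>enn2real (a t) - enn2real l\<bar> \<le> e t"
    using 1 2 e0
  proof eventually_elim
    fix t assume t: "a t \<le> l + ennreal (e t)" "l \<le> a t + ennreal (e t)" "0 \<le> e t"
    have "l + ennreal (e t) < \<infinity>" using fin by simp
    then have "a t < \<infinity>" using t(1) by (rule le_less_trans[rotated])
    then have at: "a t = ennreal (enn2real (a t))" by (simp add: ennreal_enn2real)
    have le: "l + ennreal (e t) = ennreal (enn2real l + e t)" "a t + ennreal (e t) = ennreal (enn2real (a t) + e t)"
      using l at t(3) by (metis ennreal_plus enn2real_nonneg)+
    have "ennreal (enn2real (a t)) \<le> ennreal (enn2real l + e t)"
      using t(1) at le by simp
    then have "enn2real (a t) \<le> enn2real l + e t" using t by (subst (asm) ennreal_le_iff) auto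
    moreover have "ennreal (enn2real l) \<le> ennreal (enn2real (a t) + e t)"
      using t(2) l le by simp
    then have "enn2real l \<le> enn2real (a t) + e t" using t by (subst (asm) ennreal_le_iff) auto
    ultimately show "a t = ennreal (enn2real (a t)) \<and> \<bar>enn2real (a t) - enn2real l\<bar> \<le> e t"
      using at by simp
  qed
  have "((\<lambda>t. enn2real (a t) - enn2real l) \<longlongrightarrow> 0) F"
    by (rule Lim_null_comparison[OF _ e]) (use ev in eventually_elim, simp)
  then have "((\<lambda>t. enn2real (a t)) \<longlongrightarrow> enn2real l) F" by (simp add: LIM_zero_iff)
  then have "((\<lambda>t. ennreal (enn2real (a t))) \<longlongrightarrow> ennreal (enn2real l)) F" by (rule tendsto_ennrealI)
  moreover have "\<forall>\<^sub>F t in F. ennreal (enn2real (a t)) = a t" using ev by eventually_elim simp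
  ultimately have "(a \<longlongrightarrow> ennreal (enn2real l)) F" by (rule Lim_transform_eventually)
  then show ?thesis by (simp only: l[symmetric])
qed

(* The exponent (1 + s) / 2 in the L-infinity bound is the one the field actually satisfies;
   the printed exponent 1 + s/2 is a misprint and makes the bound false as t tends to T. *)
theorem proposition1p1:
  fixes T s :: real
    and \<phi> :: "real^3 \<Rightarrow> real^3"
    and u :: "real \<Rightarrow> real^3 \<Rightarrow> real^3"
  assumes T: "0 < T"
    and s: "0 < s" "s < 2 / 3"
    and phi: "\<And>j. cutoff (\<lambda>x. \<phi> x $ j)"
      "\<And>j. radial (\<lambda>x. \<phi> x $ j)"
      "\<And>j x. x \<in> ball 0 (1/2) \<Longrightarrow> \<phi> x $ j = 1"
      "\<And>j x. x \<notin> ball 0 (3/4) \<Longrightarrow> \<phi> x $ j = 0"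
    and u: "\<And>t. t \<in> {0..<T} \<Longrightarrow>
      u t = leray (\<lambda>x. let y = (1 / sqrt (T - t)) *\<^sub>R x in
        ((1 / sqrt (T - t)) * norm y powr sqrt (T - t) * (- ln (norm y)) powr s) *\<^sub>R \<phi> y)"
  shows "comparable_on {0..<T} (\<lambda>t. L2_norm_sq (u t)) (\<lambda>t. sqrt (T - t)) \<and>
    comparable_on {0..<T} (\<lambda>t. grad_L2_norm_sq (u t)) (\<lambda>t. 1 / sqrt (T - t)) \<and>
    (\<exists>c>0. \<forall>t\<in>{0..<T}. ennreal (c / (T - t) powr ((1 + s) / 2)) \<le> Linf_norm (u t)) \<and>
    (\<exists>C>0. \<forall>t\<in>{0..<T}. BMO_norm (u t) \<le> ennreal (C / sqrt (T - t))) \<and>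
    (\<exists>l<\<infinity>. ((\<lambda>t. ennreal (sqrt (T - t)) * BMO_norm (u t)) \<longlongrightarrow> l) (at_left T)) \<and>
    ((\<lambda>t. ennreal (sqrt (T - t)) * Linf_norm (u t)) \<longlongrightarrow> \<infinity>) (at_left T)"
proof -
  have s1: "s < 1" using s by simp
  define \<Lambda> where "\<Lambda> = sqrt T"
  define \<nu> where "\<nu> t = sqrt (T - t)" for t
  have \<Lambda>: "0 < \<Lambda>" using T by (simp add: \<Lambda>_def)
  have \<nu>: "0 < \<nu> t" "\<nu> t \<le> \<Lambda>" if "t \<in> {0..<T}" for t
    using that by (auto simp: \<nu>_def \<Lambda>_def)
  \<comment> \<open>By radial symmetry the values along the first axis determine the cut-off.\<close>
  define p where "p j r = \<phi> (r *\<^sub>R axis 1 1) $ j" for j r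
  obtain B p' p'' where "\<And>j. cutoff_profile B (\<lambda>r. \<phi> (r *\<^sub>R axis 1 1) $ j) (p' j) (p'' j)"
    using cutoff_profile_family[OF phi(1,3,4)] by blast
  then have c: "cutoff_profile B (p j) (p' j) (p'' j)" for j by (simp add: p_def[abs_def])
  have B: "0 \<le> B" using cutoff_profileD(1)[OF c] .
  have \<phi>p: "\<phi> x $ j = p j (norm x)" for x j
  proof -
    have "norm x = norm (norm x *\<^sub>R (axis 1 1 :: space))" by simp
    then show ?thesis using phi(2)[of j] unfolding radial_def p_def by blast
  qed
  define Q where "Q l j = log_profile s (p j) l" for l j
  define Q' where "Q' l j = log_profile1 s (p j) (p' j) l" for l j
  define C where "C = log_profile_const \<Lambda> * (1 + 3 * B)"
  have sp: "smooth_profile C 1 (Q l j) (Q' l j) (log_profile2 s (p j) (p' j) (p'' j) l)" if "0 \<le> l" "l \<le> \<Lambda>" for l j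
    unfolding Q_def Q'_def C_def by (rule log_profile_smooth_profile[OF c s(1) s1 that])
  then have pr: "profile C 1 (Q l j) (Q' l j)" if "0 \<le> l" "l \<le> \<Lambda>" for l j
    using that by (simp add: smooth_profile_def)
  define A where "A = \<Lambda> powr (1 - s) + 4 + B"
  have A: "0 < A" using B powr_ge_zero[of \<Lambda> "1 - s"] unfolding A_def by linarith
  have slope: "\<bar>r * Q' l j r\<bar> \<le> A" if "0 \<le> l" "l \<le> \<Lambda>" "0 < r" for l j r
    unfolding Q'_def A_def by (rule log_profile_slope[OF c s(1) s1 that])
  define \<mu> where "\<mu> = log_profile_mean \<Lambda>"
  have \<mu>: "0 < \<mu>" "\<And>l j. 0 \<le> l \<Longrightarrow> l \<le> \<Lambda> \<Longrightarrow> \<mu> \<le> mean (Q l j) 1"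
    unfolding \<mu>_def Q_def using log_profile_mean_lower[OF c s(1) s1] by (auto simp: log_profile_mean_def)
  \<comment> \<open>The field at time \<open>t\<close>, rescaled to unit length. It agrees with the explicit field only off the
    origin, so norms are compared up to that point.\<close>
  define V where "V t y = \<nu> t *\<^sub>R u t (\<nu> t *\<^sub>R y)" for t y
  have uV: "u t = (\<lambda>x. (1 / \<nu> t) *\<^sub>R V t ((1 / \<nu> t) *\<^sub>R x))" if "t \<in> {0..<T}" for t
    using \<nu>[OF that] by (simp add: V_def)
  have V: "V t y = radial_leray (Q (\<nu> t)) y" if t: "t \<in> {0..<T}" and y: "y \<noteq> 0" for t y
  proof -
    note n = \<nu>[OF t]
    have "u t (\<nu> t *\<^sub>R y) = radial_leray (\<lambda>j r. (1 / \<nu> t) * Q (\<nu> t) j (r / \<nu> t)) (\<nu> t *\<^sub>R y)"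
      unfolding u[OF t]
    proof (rule leray_radial)
      show "smooth_profile ((1 / \<nu> t) * C * \<nu> t powr (1/4)) (1 * \<nu> t) (\<lambda>r. (1 / \<nu> t) * Q (\<nu> t) j (r / \<nu> t))
        (\<lambda>r. (1 / \<nu> t) / \<nu> t * Q' (\<nu> t) j (r / \<nu> t)) (\<lambda>r. (1 / \<nu> t) / (\<nu> t)\<^sup>2 * log_profile2 s (p j) (p' j) (p'' j) (\<nu> t) (r / \<nu> t))" for j
        by (rule smooth_profile_scale[OF sp]) (use n in auto)
      show "(let y = (1 / sqrt (T - t)) *\<^sub>R x in ((1 / sqrt (T - t)) * norm y powr sqrt (T - t) * (- ln (norm y)) powr s) *\<^sub>R \<phi> y) $ j
        = (1 / \<nu> t) * Q (\<nu> t) j (norm x / \<nu> t)" for x j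
        using n unfolding \<nu>_def[symmetric] Let_def vector_scaleR_component \<phi>p norm_scaleR Q_def log_profile_def power_log_def
        by (simp add: mult.assoc)
    qed (use n y in auto)
    also have "\<dots> = (1 / \<nu> t) *\<^sub>R radial_leray (Q (\<nu> t)) ((1 / \<nu> t) *\<^sub>R (\<nu> t *\<^sub>R y))"
      by (rule radial_leray_scale[OF pr]) (use n y in auto)
    finally show ?thesis using n by (simp add: V_def)
  qed
  have Vw: "weak_gradient (V t) (radial_leray_grad (Q (\<nu> t)) (Q' (\<nu> t)))" if t: "t \<in> {0..<T}" for t
    using \<nu>[OF t] by (intro weak_gradient_radial_leray[OF pr] V[OF t]) auto
  have Vm: "V t \<in> borel_measurable borel" if t: "t \<in> {0..<T}" for t
    using Vw[OF t] by (intro locally_integrable_measurable) (simp add: weak_gradient_def)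
  have L2: "L2_norm_sq (u t) = ennreal (\<nu> t) * L2_norm_sq (V t)" if t: "t \<in> {0..<T}" for t
  proof -
    have "L2_norm_sq (u t) = ennreal ((1 / \<nu> t)\<^sup>2 / (1 / \<nu> t) ^ 3) * L2_norm_sq (V t)"
      by (subst uV[OF t], rule L2_norm_sq_scale[OF Vm[OF t]]) (use \<nu>[OF t] in auto)
    also have "(1 / \<nu> t)\<^sup>2 / (1 / \<nu> t) ^ 3 = \<nu> t"
      using \<nu>[OF t] by (simp add: field_simps power2_eq_square power3_eq_cube)
    finally show ?thesis .
  qed
  have BMO: "BMO_norm (u t) = ennreal (1 / \<nu> t) * BMO_norm (radial_leray (Q (\<nu> t)))" if t: "t \<in> {0..<T}" for t
  proof -
    have n: "0 < \<nu> t" "\<nu> t \<le> \<Lambda>" using \<nu>[OF t] by auto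
    have "BMO_norm (u t) = BMO_norm (\<lambda>x. (1 / \<nu> t) *\<^sub>R radial_leray (Q (\<nu> t)) ((1 / \<nu> t) *\<^sub>R x))"
    proof (rule BMO_cong_off_origin)
      fix x :: space assume "x \<noteq> 0"
      then show "u t x = (1 / \<nu> t) *\<^sub>R radial_leray (Q (\<nu> t)) ((1 / \<nu> t) *\<^sub>R x)"
        using n V[OF t, of "(1 / \<nu> t) *\<^sub>R x"] by (subst uV[OF t]) simp
    qed
    also have "\<dots> = ennreal (1 / \<nu> t) * BMO_norm (radial_leray (Q (\<nu> t)))"
      by (rule BMO_scale[OF radial_leray_ball_integrable[OF pr]]) (use n in auto)
    finally show ?thesis .
  qed

  have L2_comparable: "comparable_on {0..<T} (\<lambda>t. L2_norm_sq (u t)) (\<lambda>t. sqrt (T - t))"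
  proof -
    let ?c = "(shell_bound \<mu>)\<^sup>2 * (28/3 * pi)" and ?C = "8 * (138 * C)\<^sup>2 * weight_mass (1/4) + 1"
    have c0: "0 < ?c" using \<mu> leray_const_bounds by (simp add: shell_bound_def)
    have C0: "0 < ?C" by (intro add_nonneg_pos mult_nonneg_nonneg) (auto simp: weight_mass_def)
    have "ennreal (?c * sqrt (T - t)) \<le> L2_norm_sq (u t) \<and> L2_norm_sq (u t) \<le> ennreal (?C * sqrt (T - t))" if t: "t \<in> {0..<T}" for t
    proof
      have n: "0 \<le> \<nu> t" "\<nu> t \<le> \<Lambda>" using \<nu>[OF t] by auto
      have "ennreal ?c \<le> L2_norm_sq (V t)"
        by (rule radial_leray_L2_lower[where Q = "Q (\<nu> t)" and Q' = "Q' (\<nu> t)", OF pr[OF n] V[OF t]]) (use \<mu> n in auto)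
      then have "ennreal (\<nu> t) * ennreal ?c \<le> L2_norm_sq (u t)" unfolding L2[OF t] by (rule mult_left_mono) simp
      then show "ennreal (?c * sqrt (T - t)) \<le> L2_norm_sq (u t)"
        using n c0 by (simp add: \<nu>_def ennreal_mult[symmetric] mult.commute)
      have "L2_norm_sq (V t) \<le> ennreal (8 * (138 * C)\<^sup>2 * weight_mass (1/4))"
        by (rule radial_leray_L2[where Q = "Q (\<nu> t)" and Q' = "Q' (\<nu> t)", OF pr[OF n] V[OF t]])
      also have "\<dots> \<le> ennreal ?C" by (rule ennreal_leI) simp
      finally have "L2_norm_sq (u t) \<le> ennreal (\<nu> t) * ennreal ?C" unfolding L2[OF t] by (rule mult_left_mono) simp
      then show "L2_norm_sq (u t) \<le> ennreal (?C * sqrt (T - t))"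
        using n C0 ennreal_mult[of "\<nu> t" ?C] by (simp only: \<nu>_def mult.commute less_imp_le)
    qed
    then show ?thesis unfolding comparable_on_def using c0 C0 by blast
  qed

  have grad_comparable: "comparable_on {0..<T} (\<lambda>t. grad_L2_norm_sq (u t)) (\<lambda>t. 1 / sqrt (T - t))"
  proof -
    obtain \<psi> where \<psi>: "test_function \<psi>" "\<And>x. 0 \<le> \<psi> x" "\<And>x. \<psi> x \<noteq> 0 \<Longrightarrow> x \<in> probe"
      "0 < (LINT x|lborel. \<psi> x)" "0 < (LINT x|lborel. (\<psi> x)\<^sup>2)"
      by (rule probe_test_function[OF phi(1)[where j = 1] phi(3)[where j = 1] phi(4)[where j = 1]]) blast+
    let ?c = "(probe_slope \<mu> * (LINT x|lborel. \<psi> x))\<^sup>2 / (LINT x|lborel. (\<psi> x)\<^sup>2)"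
    let ?C = "8 * (2034 * C)\<^sup>2 * weight_mass (5/4) + 1"
    have c0: "0 < ?c" using \<mu> \<psi>(4,5) leray_const_bounds by (simp add: probe_slope_def)
    have C0: "0 < ?C" by (intro add_nonneg_pos mult_nonneg_nonneg) (auto simp: weight_mass_def)
    have "ennreal (?c * (1 / sqrt (T - t))) \<le> grad_L2_norm_sq (u t) \<and> grad_L2_norm_sq (u t) \<le> ennreal (?C * (1 / sqrt (T - t)))"
      if t: "t \<in> {0..<T}" for t
    proof
      have n: "0 \<le> \<nu> t" "\<nu> t \<le> \<Lambda>" "0 < \<nu> t" using \<nu>[OF t] by auto
      have "ennreal (1 / \<nu> t * ?c) \<le> grad_L2_norm_sq (u t)"
        unfolding uV[OF t]
      proof (rule grad_L2_norm_sq_scaled_ge)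
        show "ennreal ?c \<le> L2_norm_sq G" if "weak_gradient (V t) G" for G
          by (rule weak_gradient_lower[where Q = "Q (\<nu> t)" and Q' = "Q' (\<nu> t)", OF pr[OF n(1,2)] V[OF t] _ _ \<psi>(1,2,3,5) that])
            (use \<mu> n in auto)
      qed (use n c0 in auto)
      then show "ennreal (?c * (1 / sqrt (T - t))) \<le> grad_L2_norm_sq (u t)" by (simp only: \<nu>_def mult.commute)
      have "grad_L2_norm_sq (u t) \<le> ennreal (1 / \<nu> t * ?C)"
        unfolding uV[OF t]
      proof (rule grad_L2_norm_sq_scaled_le[OF Vw[OF t]])
        have "L2_norm_sq (radial_leray_grad (Q (\<nu> t)) (Q' (\<nu> t))) \<le> ennreal (8 * (2034 * C)\<^sup>2 * weight_mass (5/4))"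
          by (rule radial_leray_grad_L2[OF pr[OF n(1,2)]])
        also have "\<dots> \<le> ennreal ?C" by (rule ennreal_leI) simp
        finally show "L2_norm_sq (radial_leray_grad (Q (\<nu> t)) (Q' (\<nu> t))) \<le> ennreal ?C" .
      qed (use n C0 in auto)
      then show "grad_L2_norm_sq (u t) \<le> ennreal (?C * (1 / sqrt (T - t)))" by (simp only: \<nu>_def mult.commute)
    qed
    then show ?thesis unfolding comparable_on_def using c0 C0 by blast
  qed

  have BMO_upper_at: "BMO_norm (u t) \<le> ennreal (4000 * A / \<nu> t)" if t: "t \<in> {0..<T}" for t
  proof -
    have n: "0 \<le> \<nu> t" "\<nu> t \<le> \<Lambda>" using \<nu>[OF t] by auto
    have "BMO_norm (u t) \<le> ennreal (1 / \<nu> t) * ennreal (4000 * A)"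
      unfolding BMO[OF t]
      by (intro mult_left_mono BMO_radial_leray[where Q = "Q (\<nu> t)" and Q' = "Q' (\<nu> t)", OF pr[OF n] slope[OF n]]) auto
    also have "\<dots> = ennreal (4000 * A / \<nu> t)" using n A by (simp add: ennreal_mult[symmetric])
    finally show ?thesis .
  qed
  then have BMO_upper: "\<exists>C>0. \<forall>t\<in>{0..<T}. BMO_norm (u t) \<le> ennreal (C / sqrt (T - t))"
    using A by (intro exI[of _ "4000 * A"]) (simp add: \<nu>_def)

  define h where "h = (1 - leray_const / 3) * (exp (- 2 * \<Lambda>) * \<Lambda> powr s)"
  define S where "S = shell_bound \<mu>"
  have h: "0 < h" using leray_const_bounds \<Lambda> by (simp add: h_def)
  have S: "0 < S" using \<mu> leray_const_bounds by (simp add: S_def shell_bound_def)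
  \<comment> \<open>The core gives \<open>h w - 15 A\<close> with \<open>w = \<nu> powr (- s)\<close>, which is at least \<open>h w / 2\<close> once \<open>h w \<ge> 30 A\<close>;
    otherwise \<open>w\<close> is bounded and the value \<open>S\<close> on the shell suffices.\<close>
  define c3 where "c3 = min (h / 2) (S * h / (30 * A))"
  have c3: "0 < c3" using h S A by (simp add: c3_def)
  have Linf: "ennreal (1 / \<nu> t * (c3 * \<nu> t powr (- s))) \<le> Linf_norm (u t)" if t: "t \<in> {0..<T}" for t
  proof -
    have n: "0 \<le> \<nu> t" "\<nu> t \<le> \<Lambda>" "0 < \<nu> t" using \<nu>[OF t] by auto
    define w where "w = \<nu> t powr (- s)"
    have w: "0 < w" using n by (simp add: w_def)
    have 1: "ennreal (1 / \<nu> t * S) \<le> Linf_norm (u t)"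
      unfolding uV[OF t] S_def
      by (rule radial_leray_Linf_shell[where Q = "Q (\<nu> t)" and Q' = "Q' (\<nu> t)", OF pr[OF n(1,2)] V[OF t]]) (use \<mu> n in auto)
    have 2: "ennreal (1 / \<nu> t * ((1 - leray_const / 3) * (exp (- 2 * \<Lambda>) * \<Lambda> powr s * w) - 15 * A)) \<le> Linf_norm (u t)"
      unfolding uV[OF t]
    proof (rule radial_leray_Linf_core[where Q = "Q (\<nu> t)" and Q' = "Q' (\<nu> t)", OF pr[OF n(1,2)] V[OF t] slope[OF n(1,2)]])
      show "exp (- (2 * \<Lambda> / \<nu> t)) < exp (- (\<Lambda> / \<nu> t))" using n \<Lambda> by (simp add: divide_strict_right_mono)
      show "exp (- 2 * \<Lambda>) * \<Lambda> powr s * w \<le> Q (\<nu> t) 1 r" if "exp (- (2 * \<Lambda> / \<nu> t)) \<le> r" "r < exp (- (\<Lambda> / \<nu> t))" for r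
        unfolding Q_def w_def by (rule log_profile_peak[OF c s(1) n(3,2) that])
    qed (use n in auto)
    have "c3 * w \<le> S \<or> c3 * w \<le> h * w - 15 * A"
    proof (cases "h * w \<le> 30 * A")
      case True
      have "c3 * w \<le> S * h / (30 * A) * w" using w by (intro mult_right_mono) (auto simp: c3_def)
      also have "\<dots> = S * ((h * w) / (30 * A))" by simp
      also have "\<dots> \<le> S * 1" using True A S by (intro mult_left_mono) (auto simp: divide_le_eq)
      finally show ?thesis by simp
    next
      case False
      have "c3 * w \<le> h / 2 * w" using w by (intro mult_right_mono) (auto simp: c3_def)
      then show ?thesis using False by simp
    qed
    then show ?thesis
    proof
      assume "c3 * w \<le> S"
      then have "ennreal (1 / \<nu> t * (c3 * w)) \<le> ennreal (1 / \<nu> t * S)"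
        using n by (intro ennreal_leI mult_left_mono) auto
      then show ?thesis using 1 unfolding w_def by (rule order_trans)
    next
      assume "c3 * w \<le> h * w - 15 * A"
      then have "c3 * w \<le> (1 - leray_const / 3) * (exp (- 2 * \<Lambda>) * \<Lambda> powr s * w) - 15 * A"
        by (simp add: h_def mult.assoc)
      then have "ennreal (1 / \<nu> t * (c3 * w)) \<le> ennreal (1 / \<nu> t * ((1 - leray_const / 3) * (exp (- 2 * \<Lambda>) * \<Lambda> powr s * w) - 15 * A))"
        using n by (intro ennreal_leI mult_left_mono) auto
      then show ?thesis using 2 unfolding w_def by (rule order_trans)
    qed
  qed
  have Linf_lower: "\<exists>c>0. \<forall>t\<in>{0..<T}. ennreal (c / (T - t) powr ((1 + s) / 2)) \<le> Linf_norm (u t)"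
  proof (intro exI[of _ c3] conjI ballI c3)
    fix t assume t: "t \<in> {0..<T}"
    have Tt: "0 < T - t" using t by simp
    have "1 / \<nu> t * (c3 * \<nu> t powr (- s)) = c3 * (\<nu> t powr (-1) * \<nu> t powr (- s))"
      using \<nu>[OF t] by (simp add: powr_minus field_simps)
    also have "\<nu> t powr (-1) * \<nu> t powr (- s) = \<nu> t powr (- (1 + s))"
      by (simp only: powr_add[symmetric]) simp
    also have "\<nu> t powr (- (1 + s)) = (T - t) powr (- ((1 + s) / 2))"
    proof -
      have "\<nu> t = (T - t) powr (1/2)" using Tt by (simp add: \<nu>_def powr_half_sqrt)
      moreover have "1/2 * (- (1 + s)) = - ((1 + s) / 2)" by (simp add: field_simps)
      ultimately show ?thesis by (simp only: powr_powr)
    qed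
    finally have "1 / \<nu> t * (c3 * \<nu> t powr (- s)) = c3 / (T - t) powr ((1 + s) / 2)"
      by (simp add: powr_minus inverse_eq_divide)
    then show "ennreal (c3 / (T - t) powr ((1 + s) / 2)) \<le> Linf_norm (u t)" using Linf[OF t] by simp
  qed

  have left: "\<forall>\<^sub>F t in at_left T. t \<in> {0..<T}"
    using eventually_at_left_real[OF T] by eventually_elim auto
  have \<nu>0: "(\<nu> \<longlongrightarrow> 0) (at_left T)"
  proof -
    have "((\<lambda>t. sqrt (T - t)) \<longlongrightarrow> sqrt (T - T)) (at_left T)" by (intro tendsto_intros)
    then show ?thesis by (simp add: \<nu>_def[abs_def])
  qed

  have BMO_limit: "\<exists>l<\<infinity>. ((\<lambda>t. ennreal (sqrt (T - t)) * BMO_norm (u t)) \<longlongrightarrow> l) (at_left T)"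
  proof (intro exI conjI)
    \<comment> \<open>The limit is the seminorm for the profile with \<open>\<nu> = 0\<close>; \<open>e\<close> is the rate at which it is approached.\<close>
    have z: "(0::real) \<le> 0" "0 \<le> \<Lambda>" using \<Lambda> by auto
    have "BMO_norm (radial_leray (Q 0)) \<le> ennreal (4000 * A)"
      by (rule BMO_radial_leray[where Q = "Q 0" and Q' = "Q' 0", OF pr[OF z] slope[OF z]])
    then show fin: "BMO_norm (radial_leray (Q 0)) < \<infinity>" using ennreal_less_top le_less_trans by (metis infinity_ennreal_def)
    define e where "e t = 4000 * (2 * \<nu> t powr (1 - s) + B * \<nu> t)" for t
    have pw: "((\<lambda>t. \<nu> t powr (1 - s)) \<longlongrightarrow> 0 powr (1 - s)) (at_left T)"
    proof (rule tendsto_powr2[OF \<nu>0 tendsto_const])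
      show "\<forall>\<^sub>F t in at_left T. 0 \<le> \<nu> t" using left by eventually_elim (auto simp: \<nu>_def)
    qed (use s1 in auto)
    have e: "(e \<longlongrightarrow> 4000 * (2 * 0 powr (1 - s) + B * 0)) (at_left T)"
      unfolding e_def[abs_def] by (intro tendsto_mult tendsto_add tendsto_const \<nu>0 pw)
    have eq: "\<forall>\<^sub>F t in at_left T. ennreal (sqrt (T - t)) * BMO_norm (u t) = BMO_norm (radial_leray (Q (\<nu> t)))"
      using left
    proof eventually_elim
      fix t assume t: "t \<in> {0..<T}"
      have "ennreal (\<nu> t) * (ennreal (1 / \<nu> t) * BMO_norm (radial_leray (Q (\<nu> t)))) = BMO_norm (radial_leray (Q (\<nu> t)))"
        using \<nu>[OF t] by (simp add: mult.assoc[symmetric] ennreal_mult[symmetric])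
      then show "ennreal (sqrt (T - t)) * BMO_norm (u t) = BMO_norm (radial_leray (Q (\<nu> t)))"
        unfolding BMO[OF t] by (simp add: \<nu>_def)
    qed
    have sl: "\<bar>r * (Q' (\<nu> t) j r - Q' 0 j r)\<bar> \<le> 2 * \<nu> t powr (1 - s) + B * \<nu> t"
      if t: "t \<in> {0..<T}" and r: "0 < r" for t j r
      unfolding Q'_def by (rule log_profile_slope_diff[OF c s(1) s1 \<nu>(1)[OF t] r])
    have "((\<lambda>t. BMO_norm (radial_leray (Q (\<nu> t)))) \<longlongrightarrow> BMO_norm (radial_leray (Q 0))) (at_left T)"
    proof (rule tendsto_ennreal_of_abs_diff[OF fin])
      show "(e \<longlongrightarrow> 0) (at_left T)" using e by simp
      show "\<forall>\<^sub>F t in at_left T. 0 \<le> e t"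
        using left by eventually_elim (use B in \<open>auto simp: e_def \<nu>_def\<close>)
      show "\<forall>\<^sub>F t in at_left T. BMO_norm (radial_leray (Q (\<nu> t))) \<le> BMO_norm (radial_leray (Q 0)) + ennreal (e t)"
        using left
      proof eventually_elim
        fix t assume t: "t \<in> {0..<T}"
        have n: "0 \<le> \<nu> t" "\<nu> t \<le> \<Lambda>" using \<nu>[OF t] by auto
        show "BMO_norm (radial_leray (Q (\<nu> t))) \<le> BMO_norm (radial_leray (Q 0)) + ennreal (e t)"
          unfolding e_def
          by (rule BMO_radial_leray_le[where Q = "Q (\<nu> t)" and Q' = "Q' (\<nu> t)" and P = "Q 0" and P' = "Q' 0", OF pr[OF n] pr[OF z] sl[OF t]])
      qed
      show "\<forall>\<^sub>F t in at_left T. BMO_norm (radial_leray (Q 0)) \<le> BMO_norm (radial_leray (Q (\<nu> t))) + ennreal (e t)"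
        using left
      proof eventually_elim
        fix t assume t: "t \<in> {0..<T}"
        have n: "0 \<le> \<nu> t" "\<nu> t \<le> \<Lambda>" using \<nu>[OF t] by auto
        have sl': "\<bar>r * (Q' 0 j r - Q' (\<nu> t) j r)\<bar> \<le> 2 * \<nu> t powr (1 - s) + B * \<nu> t" if "0 < r" for j r
          using sl[OF t that, of j] by (simp add: abs_mult abs_minus_commute)
        show "BMO_norm (radial_leray (Q 0)) \<le> BMO_norm (radial_leray (Q (\<nu> t))) + ennreal (e t)"
          unfolding e_def
          by (rule BMO_radial_leray_le[where P = "Q (\<nu> t)" and P' = "Q' (\<nu> t)" and Q = "Q 0" and Q' = "Q' 0", OF pr[OF z] pr[OF n] sl'])
      qed
    qed
    then show "((\<lambda>t. ennreal (sqrt (T - t)) * BMO_norm (u t)) \<longlongrightarrow> BMO_norm (radial_leray (Q 0))) (at_left T)"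
      using tendsto_cong[OF eq] by simp
  qed

  have Linf_blowup: "((\<lambda>t. ennreal (sqrt (T - t)) * Linf_norm (u t)) \<longlongrightarrow> \<infinity>) (at_left T)"
  proof (rule tendsto_sandwich)
    show "\<forall>\<^sub>F t in at_left T. ennreal (c3 * \<nu> t powr (- s)) \<le> ennreal (sqrt (T - t)) * Linf_norm (u t)"
      using left
    proof eventually_elim
      fix t assume t: "t \<in> {0..<T}"
      have "ennreal (c3 * \<nu> t powr (- s)) = ennreal (\<nu> t) * ennreal (1 / \<nu> t * (c3 * \<nu> t powr (- s)))"
        using \<nu>[OF t] c3 by (subst ennreal_mult[symmetric]) auto
      also have "\<dots> \<le> ennreal (\<nu> t) * Linf_norm (u t)" by (rule mult_left_mono[OF Linf[OF t]]) simp
      finally show "ennreal (c3 * \<nu> t powr (- s)) \<le> ennreal (sqrt (T - t)) * Linf_norm (u t)" by (simp add: \<nu>_def)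
    qed
    show "\<forall>\<^sub>F t in at_left T. ennreal (sqrt (T - t)) * Linf_norm (u t) \<le> \<infinity>" by simp
    have "filterlim \<nu> (at_right 0) (at_left T)"
      unfolding filterlim_at using \<nu>0 left by (auto elim!: eventually_mono simp: \<nu>_def)
    moreover have "filterlim (\<lambda>x. c3 * x powr (- s)) at_top (at_right 0)"
    proof (rule filterlim_tendsto_pos_mult_at_top[OF tendsto_const c3])
      show "filterlim (\<lambda>x::real. x powr (- s)) at_top (at_right 0)" using s by real_asymp
    qed
    ultimately have "filterlim (\<lambda>t. c3 * \<nu> t powr (- s)) at_top (at_left T)" by (rule filterlim_compose[rotated])
    then show "((\<lambda>t. ennreal (c3 * \<nu> t powr (- s))) \<longlongrightarrow> \<infinity>) (at_left T)"
      by (simp add: ennreal_tendsto_top_eq_at_top)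
  qed simp
  from L2_comparable grad_comparable Linf_lower BMO_upper BMO_limit Linf_blowup show ?thesis by blast
qed

end
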